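(* Let $\Omega_1\subset\mathbb{R}^{d_1}$, $\Omega_2\subset\mathbb{R}^{d_2}$ be open sets, $\Gamma_1\subset\dot T^*\Omega_1$, $\Gamma_2\subset\dot T^*\Omega_2$ closed cones and $$\Gamma=(\Gamma_1\times\Gamma_2)\cup\big((\Omega_1\times\{0\})\times\Gamma_2\big)\cup\big(\Gamma_1\times(\Omega_2\times\{0\})\big)\subset\dot T^*(\Omega_1\times\Omega_2).$$ Then the tensor product $(u,v)\mapsto u\otimes v$ is hypocontinuous from $\mathcal{D}'_{\Gamma_1}(\Omega_1)\times\mathcal{D}'_{\Gamma_2}(\Omega_2)$ to $\mathcal{D}'_\Gamma(\Omega_1\times\Omega_2)$, all spaces carrying the normal topology.
   Context: For an open set $\Omega\subset\mathbb{R}^n$ write $\mathcal{D}(\Omega)=C_c^\infty(\Omega)$, $T^*\Omega=\Omega\times\mathbb{R}^n$, $\dot T^*\Omega=\{(x;\xi)\in T^*\Omega : \xi\neq 0\}$; $T^*\Omega_1\times T^*\Omega_2$ is identified with $T^*(\Omega_1\times\Omega_2)$ via $((x;\xi),(y;\eta))\mapsto(x,y;\xi,\eta)$. A cone in $\dot T^*\Omega$ is a subset $\Gamma$ such that $(x;\xi)\in\Gamma$ and $\lambda>0$ imply $(x;\lambda\xi)\in\Gamma$; closed means closed in $\dot T^*\Omega$. For a closed cone $\Gamma$, $\mathcal{D}'_\Gamma(\Omega)=\{u\in\mathcal{D}'(\Omega) : \mathrm{WF}(u)\subset\Gamma\}$. The normal topology on $\mathcal{D}'_\Gamma(\Omega)$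 is the locally convex topology defined by the seminorms $p_B(u)=\sup_{\phi\in B}|\langle u,\phi\rangle|$, $B$ running over the bounded subsets of $\mathcal{D}(\Omega)$, and $\|u\|_{N,V,\chi}=\sup_{k\in V}(1+|k|)^N|\widehat{u\chi}(k)|$, where $N\ge 0$, $\chi\in\mathcal{D}(\Omega)$ and $V\subset\mathbb{R}^n$ is a closed cone with $(\operatorname{supp}\chi\times V)\cap\Gamma=\emptyset$; here $\widehat{w}(k)=\langle w,e^{-ik\cdot x}\rangle$. A bilinear map $f:E\times F\to G$ of topological vector spaces is hypocontinuous if for every neighborhood $W$ of zero in $G$: (i) for every bounded $A\subset E$ there is a neighborhood $V$ of zero in $F$ with $f(A\times V)\subset W$; and (ii) for every bounded $B\subset F$ there is a neighborhood $U$ of zero in $E$ with $f(U\times B)\subset W$. *)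

theory Defs
  imports "HOL-Analysis.Analysis"
begin

section \<open>Locally convex spaces of complex-valued functions\<close>

text \<open>
  All spaces below (test functions, and distributions as functionals on test functions) are
  complex vector spaces of functions \<open>'s \<Rightarrow> complex\<close> with pointwise operations. A locally convex
  space is a topology whose \<^const>\<open>topspace\<close> is the carrier of the vector space.

  The generating seminorms are valued in \<^typ>\<open>ennreal\<close>, so that a supremum over the empty set is 0
  and no boundedness is presupposed when a seminorm is written as a supremum.
\<close>

definition seminorm_topology ::
    "('s \<Rightarrow> complex) set \<Rightarrow> (('s \<Rightarrow> complex) \<Rightarrow> ennreal) set \<Rightarrow> ('s \<Rightarrow> complex) topology" where
  "seminorm_topology E P = topology (\<lambda>U. U \<subseteq> E \<and>
     (\<forall>f\<in>U. \<exists>F \<epsilon>. finite F \<and> F \<subseteq> P \<and> 0 < \<epsilon> \<and>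
        {g \<in> E. \<forall>p\<in>F. p (\<lambda>s. g s - f s) < ennreal \<epsilon>} \<subseteq> U))"

lemma openin_seminorm_topology:
  "openin (seminorm_topology E P) U \<longleftrightarrow> U \<subseteq> E \<and>
     (\<forall>f\<in>U. \<exists>F \<epsilon>. finite F \<and> F \<subseteq> P \<and> 0 < \<epsilon> \<and>
        {g \<in> E. \<forall>p\<in>F. p (\<lambda>s. g s - f s) < ennreal \<epsilon>} \<subseteq> U)"
proof -
  let ?N = "\<lambda>f F \<epsilon>. {g \<in> E. \<forall>p\<in>F. p (\<lambda>s. g s - f s) < ennreal \<epsilon>}"
  let ?L = "\<lambda>U. U \<subseteq> E \<and> (\<forall>f\<in>U. \<exists>F \<epsilon>. finite F \<and> F \<subseteq> P \<and> 0 < \<epsilon> \<and> ?N f F \<epsilon> \<subseteq> U)"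
  have "istopology ?L"
    unfolding istopology_def
  proof (intro conjI allI impI)
    fix S T assume S: "?L S" and T: "?L T"
    show "S \<inter> T \<subseteq> E" using S by blast
    show "\<forall>f\<in>S \<inter> T. \<exists>F \<epsilon>. finite F \<and> F \<subseteq> P \<and> 0 < \<epsilon> \<and> ?N f F \<epsilon> \<subseteq> S \<inter> T"
    proof
      fix f assume f: "f \<in> S \<inter> T"
      obtain F d where 1: "finite F" "F \<subseteq> P" "0 < d" "?N f F d \<subseteq> S" using S f by blast
      obtain G e where 2: "finite G" "G \<subseteq> P" "0 < e" "?N f G e \<subseteq> T" using T f by blast
      have le: "ennreal (min d e) \<le> ennreal d" "ennreal (min d e) \<le> ennreal e"
        by (simp_all add: ennreal_leI)
      have "?N f (F \<union> G) (min d e) \<subseteq> ?N f F d \<inter> ?N f G e"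
        using less_le_trans[OF _ le(1)] less_le_trans[OF _ le(2)] by blast
      hence "?N f (F \<union> G) (min d e) \<subseteq> S \<inter> T" using 1(4) 2(4) by blast
      hence "finite (F \<union> G) \<and> F \<union> G \<subseteq> P \<and> 0 < min d e \<and> ?N f (F \<union> G) (min d e) \<subseteq> S \<inter> T"
        using 1(1-3) 2(1-3) by (intro conjI) simp_all
      thus "\<exists>F \<epsilon>. finite F \<and> F \<subseteq> P \<and> 0 < \<epsilon> \<and> ?N f F \<epsilon> \<subseteq> S \<inter> T"
        by (intro exI)
    qed
  next
    fix \<K> assume K: "\<forall>K\<in>\<K>. ?L K"
    show "\<Union>\<K> \<subseteq> E" using K by blast
    show "\<forall>f\<in>\<Union>\<K>. \<exists>F \<epsilon>. finite F \<and> F \<subseteq> P \<and> 0 < \<epsilon> \<and> ?N f F \<epsilon> \<subseteq> \<Union>\<K>"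
    proof
      fix f assume "f \<in> \<Union>\<K>"
      then obtain K where "K \<in> \<K>" "f \<in> K" by blast
      moreover obtain F d where "finite F" "F \<subseteq> P" "0 < d" "?N f F d \<subseteq> K"
        using bspec[OF conjunct2[OF bspec[OF K \<open>K \<in> \<K>\<close>]] \<open>f \<in> K\<close>] by (elim exE conjE) rule
      moreover have "K \<subseteq> \<Union>\<K>" using \<open>K \<in> \<K>\<close> by blast
      ultimately have "finite F \<and> F \<subseteq> P \<and> 0 < d \<and> ?N f F d \<subseteq> \<Union>\<K>"
        by (meson subset_trans)
      thus "\<exists>F \<epsilon>. finite F \<and> F \<subseteq> P \<and> 0 < \<epsilon> \<and> ?N f F \<epsilon> \<subseteq> \<Union>\<K>"
        by (intro exI)
    qed
  qed
  thus ?thesis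
    by (simp add: seminorm_topology_def topology_inverse')
qed

lemma topspace_seminorm_topology [simp]: "topspace (seminorm_topology E P) = E"
proof
  have "openin (seminorm_topology E P) E"
    unfolding openin_seminorm_topology
  proof (intro conjI ballI)
    fix f assume "f \<in> E"
    show "\<exists>F \<epsilon>. finite F \<and> F \<subseteq> P \<and> 0 < \<epsilon> \<and> {g \<in> E. \<forall>p\<in>F. p (\<lambda>s. g s - f s) < ennreal \<epsilon>} \<subseteq> E"
      by (rule exI[of _ "{}"], rule exI[of _ 1]) simp
  qed simp
  thus "E \<subseteq> topspace (seminorm_topology E P)" by (rule openin_subset)
  have "openin (seminorm_topology E P) (topspace (seminorm_topology E P))" by simp
  thus "topspace (seminorm_topology E P) \<subseteq> E" unfolding openin_seminorm_topology by blast
qed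

definition seminorm_on :: "('s \<Rightarrow> complex) set \<Rightarrow> (('s \<Rightarrow> complex) \<Rightarrow> real) \<Rightarrow> bool" where
  "seminorm_on E p \<longleftrightarrow>
     (\<forall>f\<in>E. \<forall>g\<in>E. p (\<lambda>s. f s + g s) \<le> p f + p g) \<and>
     (\<forall>c. \<forall>f\<in>E. p (\<lambda>s. c * f s) = cmod c * p f)"

definition linear_on_functions ::
    "('s \<Rightarrow> complex) set \<Rightarrow> (('s \<Rightarrow> complex) \<Rightarrow> complex) \<Rightarrow> bool" where
  "linear_on_functions E u \<longleftrightarrow>
     (\<forall>f\<in>E. \<forall>g\<in>E. \<forall>a b. u (\<lambda>s. a * f s + b * g s) = a * u f + b * u g)"

definition zero_neighborhood :: "('s \<Rightarrow> complex) topology \<Rightarrow> ('s \<Rightarrow> complex) set \<Rightarrow> bool" where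
  "zero_neighborhood T V \<longleftrightarrow> V \<subseteq> topspace T \<and> (\<exists>U. openin T U \<and> (\<lambda>s. 0) \<in> U \<and> U \<subseteq> V)"

definition tvs_bounded :: "('s \<Rightarrow> complex) topology \<Rightarrow> ('s \<Rightarrow> complex) set \<Rightarrow> bool" where
  "tvs_bounded T A \<longleftrightarrow> A \<subseteq> topspace T \<and>
     (\<forall>V. zero_neighborhood T V \<longrightarrow> (\<exists>r>0. A \<subseteq> (\<lambda>f s. complex_of_real r * f s) ` V))"

definition bilinear_on ::
    "('s \<Rightarrow> complex) set \<Rightarrow> ('t \<Rightarrow> complex) set \<Rightarrow> ('w \<Rightarrow> complex) set \<Rightarrow>
     (('s \<Rightarrow> complex) \<Rightarrow> ('t \<Rightarrow> complex) \<Rightarrow> ('w \<Rightarrow> complex)) \<Rightarrow> bool" where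
  "bilinear_on E F G f \<longleftrightarrow>
     (\<forall>u\<in>E. \<forall>v\<in>F. f u v \<in> G) \<and>
     (\<forall>u\<in>E. \<forall>u'\<in>E. \<forall>v\<in>F. \<forall>a b.
        f (\<lambda>s. a * u s + b * u' s) v = (\<lambda>w. a * f u v w + b * f u' v w)) \<and>
     (\<forall>u\<in>E. \<forall>v\<in>F. \<forall>v'\<in>F. \<forall>a b.
        f u (\<lambda>t. a * v t + b * v' t) = (\<lambda>w. a * f u v w + b * f u v' w))"

definition hypocontinuous ::
    "('s \<Rightarrow> complex) topology \<Rightarrow> ('t \<Rightarrow> complex) topology \<Rightarrow> ('w \<Rightarrow> complex) topology \<Rightarrow>
     (('s \<Rightarrow> complex) \<Rightarrow> ('t \<Rightarrow> complex) \<Rightarrow> ('w \<Rightarrow> complex)) \<Rightarrow> bool" where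
  "hypocontinuous E F G f \<longleftrightarrow>
     bilinear_on (topspace E) (topspace F) (topspace G) f \<and>
     (\<forall>W. zero_neighborhood G W \<longrightarrow>
        (\<forall>A. tvs_bounded E A \<longrightarrow> (\<exists>V. zero_neighborhood F V \<and> (\<forall>u\<in>A. \<forall>v\<in>V. f u v \<in> W))) \<and>
        (\<forall>B. tvs_bounded F B \<longrightarrow> (\<exists>U. zero_neighborhood E U \<and> (\<forall>u\<in>U. \<forall>v\<in>B. f u v \<in> W))))"


section \<open>Test functions and distributions\<close>

text \<open>
  \<open>\<real>\<^sup>n\<close> is an arbitrary type of class \<^class>\<open>euclidean_space\<close>. Partial derivatives of order \<open>m\<close> are
  indexed by lists of \<open>m\<close> basis vectors. A function is \<open>C\<^sup>\<infinity>\<close> if all its iterated partial derivatives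
  exist and are (Frechet) differentiable everywhere.
\<close>

primrec iterated_partial ::
    "'a::euclidean_space list \<Rightarrow> ('a \<Rightarrow> complex) \<Rightarrow> 'a \<Rightarrow> complex" where
  "iterated_partial [] f = f"
| "iterated_partial (b # bs) f = (\<lambda>x. frechet_derivative (iterated_partial bs f) (at x) b)"

definition smooth :: "('a::euclidean_space \<Rightarrow> complex) \<Rightarrow> bool" where
  "smooth f \<longleftrightarrow> (\<forall>bs. set bs \<subseteq> Basis \<longrightarrow> (\<forall>x. iterated_partial bs f differentiable (at x)))"

definition supp :: "('a::euclidean_space \<Rightarrow> complex) \<Rightarrow> 'a set" where
  "supp f = closure (support_on UNIV f)"

text \<open>
  Elements of \<open>\<D>(\<Omega>)\<close> are extended by zero to the whole space.
\<close>

definition test_functions :: "'a::euclidean_space set \<Rightarrow> ('a \<Rightarrow> complex) set" where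
  "test_functions \<Omega> = {\<phi>. smooth \<phi> \<and> compact (supp \<phi>) \<and> supp \<phi> \<subseteq> \<Omega>}"

text \<open>
  The Frechet space of test functions supported in a compact set \<open>K\<close>, with the seminorms
  \<open>\<phi> \<mapsto> sup \<bar>\<partial>\<^sup>\<alpha>\<phi>\<bar>\<close>.
\<close>

definition fixed_support_topology :: "'a::euclidean_space set \<Rightarrow> ('a \<Rightarrow> complex) topology" where
  "fixed_support_topology K = seminorm_topology {\<phi>. smooth \<phi> \<and> supp \<phi> \<subseteq> K}
     {(\<lambda>\<phi>. SUP x. ennreal (cmod (iterated_partial bs \<phi> x))) | bs. set bs \<subseteq> Basis}"

text \<open>
  The usual inductive limit topology on \<open>\<D>(\<Omega>)\<close>: the finest locally convex topology for which the
  inclusions of the spaces above, for \<open>K\<close> compact in \<open>\<Omega>\<close>, are continuous. It is generated by all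
  seminorms whose restrictions to these spaces are continuous.
\<close>

definition test_topology :: "'a::euclidean_space set \<Rightarrow> ('a \<Rightarrow> complex) topology" where
  "test_topology \<Omega> = seminorm_topology (test_functions \<Omega>)
     {(\<lambda>\<phi>. ennreal (p \<phi>)) | p. seminorm_on (test_functions \<Omega>) p \<and>
        (\<forall>K. compact K \<and> K \<subseteq> \<Omega> \<longrightarrow> continuous_map (fixed_support_topology K) euclideanreal p)}"

text \<open>
  Distributions take the value 0 outside \<open>\<D>(\<Omega>)\<close>, so that equality of distributions is equality of
  functions.
\<close>

definition distributions :: "'a::euclidean_space set \<Rightarrow> (('a \<Rightarrow> complex) \<Rightarrow> complex) set" where
  "distributions \<Omega> = {u. (\<forall>\<phi>. \<phi> \<notin> test_functions \<Omega> \<longrightarrow> u \<phi> = 0) \<and>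
     linear_on_functions (test_functions \<Omega>) u \<and> continuous_map (test_topology \<Omega>) euclidean u}"

definition tensor_distribution ::
    "'a::euclidean_space set \<Rightarrow> 'b::euclidean_space set \<Rightarrow> (('a \<Rightarrow> complex) \<Rightarrow> complex) \<Rightarrow>
     (('b \<Rightarrow> complex) \<Rightarrow> complex) \<Rightarrow> (('a \<times> 'b \<Rightarrow> complex) \<Rightarrow> complex)" where
  "tensor_distribution \<Omega>1 \<Omega>2 u v =
     (\<lambda>\<phi>. if \<phi> \<in> test_functions (\<Omega>1 \<times> \<Omega>2) then u (\<lambda>x. v (\<lambda>y. \<phi> (x, y))) else 0)"

lemma tensor_distribution_simple_tensor:
  assumes "u \<in> distributions \<Omega>1" "v \<in> distributions \<Omega>2"
    and "\<phi> \<in> test_functions \<Omega>1" "\<psi> \<in> test_functions \<Omega>2"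
    and "(\<lambda>(x, y). \<phi> x * \<psi> y) \<in> test_functions (\<Omega>1 \<times> \<Omega>2)"
  shows "tensor_distribution \<Omega>1 \<Omega>2 u v (\<lambda>(x, y). \<phi> x * \<psi> y) = u \<phi> * v \<psi>"
proof -
  have scale: "w (\<lambda>x. \<theta> x * c) = w \<theta> * c"
    if "w \<in> distributions \<Omega>" "\<theta> \<in> test_functions \<Omega>"
    for w :: "('c::euclidean_space \<Rightarrow> complex) \<Rightarrow> complex" and \<Omega> \<theta> c
  proof -
    have "w (\<lambda>x. c * \<theta> x + 0 * \<theta> x) = c * w \<theta> + 0 * w \<theta>"
      using that unfolding distributions_def linear_on_functions_def by blast
    thus ?thesis by (simp add: mult.commute)
  qed
  have "v (\<lambda>y. \<phi> x * \<psi> y) = \<phi> x * v \<psi>" for x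
    using scale[OF assms(2,4), of "\<phi> x"] by (simp add: mult.commute)
  thus ?thesis
    using assms(5) scale[OF assms(1,3), of "v \<psi>"] by (simp add: tensor_distribution_def)
qed


section \<open>Cones, wave front sets and the normal topology\<close>

definition punctured_cotangent :: "'a::euclidean_space set \<Rightarrow> ('a \<times> 'a) set" where
  "punctured_cotangent \<Omega> = {(x, \<xi>). x \<in> \<Omega> \<and> \<xi> \<noteq> 0}"

definition closed_cone_in :: "'a::euclidean_space set \<Rightarrow> ('a \<times> 'a) set \<Rightarrow> bool" where
  "closed_cone_in \<Omega> \<Gamma> \<longleftrightarrow>
     closedin (top_of_set (punctured_cotangent \<Omega>)) \<Gamma> \<and>
     (\<forall>x \<xi> l. (x, \<xi>) \<in> \<Gamma> \<and> 0 < l \<longrightarrow> (x, l *\<^sub>R \<xi>) \<in> \<Gamma>)"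

text \<open>
  The library's \<^const>\<open>cone\<close> and \<^const>\<open>conic\<close> also require invariance under multiplication by 0,
  which is inappropriate for open cones.
\<close>

definition positive_cone :: "'a::real_vector set \<Rightarrow> bool" where
  "positive_cone V \<longleftrightarrow> (\<forall>k\<in>V. \<forall>l>0. l *\<^sub>R k \<in> V)"

text \<open>
  The Fourier transform of \<open>u\<theta>\<close> at \<open>k\<close>: the compactly supported distribution \<open>u\<theta>\<close> is evaluated at
  the function \<open>e\<^sup>-\<^sup>i\<^sup>k\<^sup>\<cdot>\<^sup>x\<close> as \<open>\<langle>u, \<theta>e\<^sup>-\<^sup>i\<^sup>k\<^sup>\<cdot>\<^sup>x\<rangle>\<close>.
\<close>

definition localized_fourier ::
    "('a::euclidean_space \<Rightarrow> complex) \<Rightarrow> (('a \<Rightarrow> complex) \<Rightarrow> complex) \<Rightarrow> 'a \<Rightarrow> complex" where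
  "localized_fourier \<theta> u k = u (\<lambda>x. \<theta> x * exp (- (\<i> * complex_of_real (k \<bullet> x))))"

definition fourier_seminorm ::
    "nat \<Rightarrow> 'a::euclidean_space set \<Rightarrow> ('a \<Rightarrow> complex) \<Rightarrow> (('a \<Rightarrow> complex) \<Rightarrow> complex) \<Rightarrow> ennreal" where
  "fourier_seminorm N V \<theta> u = (SUP k\<in>V. ennreal ((1 + norm k) ^ N * cmod (localized_fourier \<theta> u k)))"

definition wave_front_set ::
    "'a::euclidean_space set \<Rightarrow> (('a \<Rightarrow> complex) \<Rightarrow> complex) \<Rightarrow> ('a \<times> 'a) set" where
  "wave_front_set \<Omega> u = {(x, \<xi>) \<in> punctured_cotangent \<Omega>.
     \<not> (\<exists>\<theta>\<in>test_functions \<Omega>. \<theta> x \<noteq> 0 \<and>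
          (\<exists>V. open V \<and> positive_cone V \<and> \<xi> \<in> V \<and> (\<forall>N. fourier_seminorm N V \<theta> u < \<infinity>)))}"

definition distributions_WF ::
    "'a::euclidean_space set \<Rightarrow> ('a \<times> 'a) set \<Rightarrow> (('a \<Rightarrow> complex) \<Rightarrow> complex) set" where
  "distributions_WF \<Omega> \<Gamma> = {u \<in> distributions \<Omega>. wave_front_set \<Omega> u \<subseteq> \<Gamma>}"

definition normal_topology ::
    "'a::euclidean_space set \<Rightarrow> ('a \<times> 'a) set \<Rightarrow> (('a \<Rightarrow> complex) \<Rightarrow> complex) topology" where
  "normal_topology \<Omega> \<Gamma> = seminorm_topology (distributions_WF \<Omega> \<Gamma>)
     ({(\<lambda>u. SUP \<phi>\<in>B. ennreal (cmod (u \<phi>))) | B. tvs_bounded (test_topology \<Omega>) B} \<union>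
      {fourier_seminorm N V \<theta> | N V \<theta>.
         \<theta> \<in> test_functions \<Omega> \<and> closed V \<and> positive_cone V \<and> (supp \<theta> \<times> V) \<inter> \<Gamma> = {}})"

definition cotangent_product ::
    "('a::euclidean_space \<times> 'a) set \<Rightarrow> ('b::euclidean_space \<times> 'b) set \<Rightarrow>
     (('a \<times> 'b) \<times> ('a \<times> 'b)) set" where
  "cotangent_product A B = (\<lambda>((x, \<xi>), (y, \<eta>)). ((x, y), (\<xi>, \<eta>))) ` (A \<times> B)"

end

theory Submission
  imports Defs
begin

text \<open>
  By Fubini, \<open>\<langle>u \<otimes> v, \<phi>\<rangle>\<close> is \<open>u\<close> applied to \<open>x \<mapsto> \<langle>v, \<phi>(x, \<cdot>)\<rangle>\<close> as well as \<open>v\<close> applied to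
  \<open>y \<mapsto> \<langle>u, \<phi>(\<cdot>, y)\<rangle>\<close>. If one factor and \<open>\<phi>\<close> run through bounded sets, so do these partial pairings,
  because a bounded set of distributions has a uniform finite order on compact sets. This settles the
  seminorms \<open>p\<^sub>B\<close>.

  For the seminorm given by \<open>N\<close>, \<open>V\<close> and \<open>\<theta>\<close>, a partition of unity and the compactness of the directions
  in \<open>V\<close> reduce to \<open>\<theta>\<close> supported near \<open>(x\<^sub>0, y\<^sub>0)\<close> and to a small conic neighbourhood of a direction
  \<open>(\<xi>, \<eta>)\<close> with \<open>(x\<^sub>0, y\<^sub>0; \<xi>, \<eta>) \<notin> \<Gamma>\<close>. By symmetry one may assume \<open>\<eta> \<noteq> 0\<close> and
  \<open>(y\<^sub>0; \<eta>) \<notin> \<Gamma>\<^sub>2\<close>. There \<open>\<bar>k\<bar> \<le> c\<bar>l\<bar>\<close>, so the decay of \<open>v\<close> in the direction \<open>l\<close> compensates both the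
  weight \<open>(1 + \<bar>(k, l)\<bar>)\<^sup>N\<close> and the \<open>x\<close>-derivatives of \<open>e\<^sup>-\<^sup>i\<^sup>k\<^sup>\<cdot>\<^sup>x\<close>: pairing the weighted \<open>\<theta>e\<^sup>-\<^sup>i\<^sup>(\<^sup>k\<^sup>\<cdot>\<^sup>x\<^sup>+\<^sup>l\<^sup>\<cdot>\<^sup>y\<^sup>)\<close>
  with \<open>v\<close> gives test functions in \<open>x\<close> that are bounded uniformly in \<open>(k, l)\<close>, and no decay of \<open>u\<close> is
  needed. The same estimate shows that the wave front set of \<open>u \<otimes> v\<close> lies in \<open>\<Gamma>\<close>.
\<close>

section \<open>Partial derivatives of smooth functions\<close>

text \<open>The decay given by a wave front set, or by one admissible seminorm, belongs to a single
  cutoff, whereas pairing with \<open>v\<close> alone produces an infinite family of cutoffs, the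
  slices of \<open>\<theta>\<close> and of its x-derivatives. The core is therefore a transfer of
  decay from one cutoff to all cutoffs supported near the same point, uniformly over bounded
  families and at the price of a smaller cone. Its constants do not depend on \<open>v\<close>, and
  its bound is linear in two seminorm bounds for \<open>v\<close>; so one estimate serves small
  \<open>v\<close>, bounded sets of \<open>v\<close> and a single \<open>v\<close>. Fourier series
  on a large cube carry the analysis: besides the transfer they give Fubini and the symmetry of
  mixed derivatives. Finite partial sums approximate together with finitely many derivatives, which
  is all that a functional of finite order sees. Hypocontinuity is handled through scalar quantities
  \<open>q u v\<close> (\<open>hypo_small\<close>), a notion stable under sums, domination and
  exchange of arguments; this permits cutting \<open>\<theta>\<close> and \<open>V\<close> into
  pieces and arguing by symmetry.\<close>

definition partial_deriv :: "'a::euclidean_space \<Rightarrow> ('a \<Rightarrow> complex) \<Rightarrow> 'a \<Rightarrow> complex" where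
  "partial_deriv b f = (\<lambda>x. frechet_derivative f (at x) b)"

lemma iterated_partial_Cons: "iterated_partial (b # bs) f = partial_deriv b (iterated_partial bs f)"
  by (simp add: partial_deriv_def)

lemma iterated_partial_append:
  "iterated_partial (as @ bs) f = iterated_partial as (iterated_partial bs f)"
  by (induction as) (simp_all add: iterated_partial_Cons del: iterated_partial.simps(2))

lemma iterated_partial_snoc: "iterated_partial (bs @ [b]) f = iterated_partial bs (partial_deriv b f)"
  by (simp add: iterated_partial_append partial_deriv_def)

lemma partial_deriv_eqI: "(f has_derivative D) (at x) \<Longrightarrow> partial_deriv b f x = D b"
  by (simp add: partial_deriv_def frechet_derivative_at[symmetric])

lemma has_derivative_partial_deriv:
  fixes f :: "'a::euclidean_space \<Rightarrow> complex"
  assumes "f differentiable (at x)"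
  shows "(f has_derivative (\<lambda>h. \<Sum>b\<in>Basis. (h \<bullet> b) *\<^sub>R partial_deriv b f x)) (at x)"
proof -
  have D: "(f has_derivative frechet_derivative f (at x)) (at x)"
    using assms frechet_derivative_works by blast
  interpret linear "frechet_derivative f (at x)"
    by (rule has_derivative_linear[OF D])
  have "frechet_derivative f (at x) h = (\<Sum>b\<in>Basis. (h \<bullet> b) *\<^sub>R partial_deriv b f x)" for h
    by (subst euclidean_representation[of h, symmetric])
       (simp add: sum scale partial_deriv_def del: euclidean_representation)
  with D show ?thesis by (metis (no_types, lifting) ext)
qed

lemma partial_deriv_cong_open:
  assumes "open U" "x \<in> U" "\<And>y. y \<in> U \<Longrightarrow> f y = g y" "f differentiable (at x)"
  shows "partial_deriv b f x = partial_deriv b g x"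
  using frechet_derivative_transform_within_open[OF assms(4,1,2,3)]
  by (simp add: partial_deriv_def)

text \<open>\<open>iterated_partial\<close> conses the derivative taken last, while proofs about
  products and compositions differentiate \<open>f\<close> once and induct on the result. This
  recursion splits off the derivative taken first. The count starts at differentiability:
  \<open>n_smooth n\<close> means that all partial derivatives of order at most \<open>n\<close> are
  differentiable.\<close>

primrec n_smooth :: "nat \<Rightarrow> ('a::euclidean_space \<Rightarrow> complex) \<Rightarrow> bool" where
  "n_smooth 0 f \<longleftrightarrow> (\<forall>x. f differentiable (at x))"
| "n_smooth (Suc n) f \<longleftrightarrow>
     (\<forall>x. f differentiable (at x)) \<and> (\<forall>b\<in>Basis. n_smooth n (partial_deriv b f))"

lemma n_smooth_differentiable: "n_smooth n f \<Longrightarrow> f differentiable (at x)"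
  by (cases n) auto

text \<open>The last entry of a list is the derivative taken first, so lists are split at their
  end.\<close>

lemma n_smooth_iff:
  "n_smooth n f \<longleftrightarrow>
     (\<forall>bs. set bs \<subseteq> Basis \<and> length bs \<le> n \<longrightarrow> (\<forall>x. iterated_partial bs f differentiable (at x)))"
proof (induction n arbitrary: f)
  case (Suc n)
  have "(\<forall>bs. set bs \<subseteq> Basis \<and> length bs \<le> Suc n \<longrightarrow> (\<forall>x. iterated_partial bs f differentiable (at x)))
    \<longleftrightarrow> (\<forall>x. f differentiable (at x)) \<and> (\<forall>b\<in>Basis. \<forall>bs. set bs \<subseteq> Basis \<and> length bs \<le> n \<longrightarrow>
           (\<forall>x. iterated_partial bs (partial_deriv b f) differentiable (at x)))" (is "?L \<longleftrightarrow> ?R")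
  proof
    assume L: ?L
    show ?R
    proof (intro conjI ballI allI impI)
      show "f differentiable (at x)" for x using L[rule_format, of "[]"] by simp
      fix b :: 'a and bs x assume "b \<in> Basis" "set bs \<subseteq> (Basis::'a set) \<and> length bs \<le> n"
      thus "iterated_partial bs (partial_deriv b f) differentiable (at x)"
        using L[rule_format, of "bs @ [b]"] by (simp add: iterated_partial_snoc)
    qed
  next
    assume R: ?R
    show ?L
    proof (intro allI impI)
      fix bs and x :: 'a assume bs: "set bs \<subseteq> (Basis::'a set) \<and> length bs \<le> Suc n"
      show "iterated_partial bs f differentiable (at x)"
      proof (cases bs rule: rev_cases)
        case Nil thus ?thesis using R by simp
      next
        case (snoc cs c)
        thus ?thesis using R bs by (auto simp: iterated_partial_snoc)
      qed
    qed
  qed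
  thus ?case using Suc.IH by simp
qed simp

lemma smooth_iff_n_smooth: "smooth f \<longleftrightarrow> (\<forall>n. n_smooth n f)"
  unfolding smooth_def n_smooth_iff by blast

lemma smooth_partial_deriv: "smooth f \<Longrightarrow> b \<in> Basis \<Longrightarrow> smooth (partial_deriv b f)"
  unfolding smooth_iff_n_smooth by (metis n_smooth.simps(2))

lemma smooth_iterated_partial: "smooth f \<Longrightarrow> set bs \<subseteq> Basis \<Longrightarrow> smooth (iterated_partial bs f)"
  by (induction bs) (auto simp: iterated_partial_Cons smooth_partial_deriv simp del: iterated_partial.simps(2))

lemma smooth_differentiable: "smooth f \<Longrightarrow> f differentiable (at x)"
  unfolding smooth_iff_n_smooth by (metis n_smooth_differentiable)

lemma smooth_continuous_on: "smooth f \<Longrightarrow> continuous_on S f"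
  by (meson continuous_at_imp_continuous_on differentiable_imp_continuous_within smooth_differentiable)

section \<open>Algebraic closure properties of smooth functions\<close>

lemma partial_deriv_const: "partial_deriv b (\<lambda>x. c) = (\<lambda>x. 0)"
  by (simp add: partial_deriv_def)

lemma partial_deriv_add:
  assumes "\<And>x. f differentiable (at x)" "\<And>x. g differentiable (at x)"
  shows "partial_deriv b (\<lambda>x. f x + g x) = (\<lambda>x. partial_deriv b f x + partial_deriv b g x)"
proof
  fix x
  show "partial_deriv b (\<lambda>x. f x + g x) x = partial_deriv b f x + partial_deriv b g x"
    using has_derivative_add[OF assms(1)[unfolded frechet_derivative_works] assms(2)[unfolded frechet_derivative_works]]
    by (subst partial_deriv_eqI) (auto simp: partial_deriv_def)
qed

lemma partial_deriv_mult:
  assumes "\<And>x. f differentiable (at x)" "\<And>x. g differentiable (at x)"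
  shows "partial_deriv b (\<lambda>x. f x * g x) = (\<lambda>x. partial_deriv b f x * g x + f x * partial_deriv b g x)"
proof
  fix x
  show "partial_deriv b (\<lambda>x. f x * g x) x = partial_deriv b f x * g x + f x * partial_deriv b g x"
    using has_derivative_mult[OF assms(1)[unfolded frechet_derivative_works] assms(2)[unfolded frechet_derivative_works]]
    by (subst partial_deriv_eqI) (auto simp: partial_deriv_def add.commute)
qed

lemma n_smooth_const: "n_smooth n (\<lambda>x. c)"
  by (induction n arbitrary: c) (auto simp: partial_deriv_const)

lemma n_smooth_add: "n_smooth n f \<Longrightarrow> n_smooth n g \<Longrightarrow> n_smooth n (\<lambda>x. f x + g x)"
  by (induction n arbitrary: f g) (auto simp: partial_deriv_add)

lemma n_smooth_Suc_imp: "n_smooth (Suc n) f \<Longrightarrow> n_smooth n f"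
  unfolding n_smooth_iff by auto

text \<open>The product rule leaves one factor undifferentiated in each term, so the induction step
  also needs both factors at the lower level.\<close>

lemma n_smooth_mult: "n_smooth n f \<Longrightarrow> n_smooth n g \<Longrightarrow> n_smooth n (\<lambda>x. f x * g x)"
proof (induction n arbitrary: f g)
  case (Suc n)
  have "n_smooth n f" "n_smooth n g" using Suc.prems n_smooth_Suc_imp by blast+
  with Suc show ?case
    by (auto simp: partial_deriv_mult intro!: n_smooth_add)
qed auto

lemma n_smooth_sum:
  "finite I \<Longrightarrow> (\<And>i. i \<in> I \<Longrightarrow> n_smooth n (f i)) \<Longrightarrow> n_smooth n (\<lambda>x. \<Sum>i\<in>I. f i x)"
  by (induction I rule: finite_induct) (auto simp: n_smooth_const intro: n_smooth_add)

lemma smooth_const [simp, intro]: "smooth (\<lambda>x. c)"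
  by (simp add: smooth_iff_n_smooth n_smooth_const)

lemma smooth_add: "smooth f \<Longrightarrow> smooth g \<Longrightarrow> smooth (\<lambda>x. f x + g x)"
  by (simp add: smooth_iff_n_smooth n_smooth_add)

lemma smooth_mult: "smooth f \<Longrightarrow> smooth g \<Longrightarrow> smooth (\<lambda>x. f x * g x)"
  by (simp add: smooth_iff_n_smooth n_smooth_mult)

lemma smooth_cmult: "smooth f \<Longrightarrow> smooth (\<lambda>x. c * f x)"
  by (intro smooth_mult smooth_const)

lemma smooth_diff: "smooth f \<Longrightarrow> smooth g \<Longrightarrow> smooth (\<lambda>x. f x - g x)"
  using smooth_add[OF _ smooth_cmult[of g "-1"], of f] by simp

lemma smooth_sum:
  "(\<And>i. i \<in> I \<Longrightarrow> smooth (f i)) \<Longrightarrow> smooth (\<lambda>x. \<Sum>i\<in>I. f i x)"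
  by (cases "finite I") (auto simp: smooth_iff_n_smooth intro: n_smooth_sum n_smooth_const)

lemma smooth_prod:
  "(\<And>i. i \<in> I \<Longrightarrow> smooth (f i)) \<Longrightarrow> smooth (\<lambda>x. \<Prod>i\<in>I. f i x)"
  by (induction I rule: infinite_finite_induct) (auto intro: smooth_mult)

lemma partial_deriv_cmult:
  "(\<And>x. f differentiable (at x)) \<Longrightarrow> partial_deriv b (\<lambda>x. c * f x) = (\<lambda>x. c * partial_deriv b f x)"
  by (subst partial_deriv_mult) (auto simp: partial_deriv_const)

lemma iterated_partial_add:
  assumes "smooth f" "smooth g" "set bs \<subseteq> Basis"
  shows "iterated_partial bs (\<lambda>x. f x + g x) = (\<lambda>x. iterated_partial bs f x + iterated_partial bs g x)"
  using assms(3)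
proof (induction bs)
  case (Cons b bs)
  show ?case unfolding iterated_partial_Cons using Cons
    by (simp add: partial_deriv_add smooth_differentiable[OF smooth_iterated_partial] assms)
qed simp

lemma iterated_partial_cmult:
  assumes "smooth f" "set bs \<subseteq> Basis"
  shows "iterated_partial bs (\<lambda>x. c * f x) = (\<lambda>x. c * iterated_partial bs f x)"
  using assms(2)
proof (induction bs)
  case (Cons b bs)
  show ?case unfolding iterated_partial_Cons using Cons
    by (simp add: partial_deriv_cmult smooth_differentiable[OF smooth_iterated_partial] assms)
qed simp

lemma iterated_partial_zero: "iterated_partial bs (\<lambda>x. 0) = (\<lambda>x. 0)"
  by (induction bs) (auto simp: iterated_partial_Cons partial_deriv_const simp del: iterated_partial.simps(2))

lemma iterated_partial_sum:
  assumes "\<And>i. i \<in> I \<Longrightarrow> smooth (f i)" "set bs \<subseteq> Basis"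
  shows "iterated_partial bs (\<lambda>x. \<Sum>i\<in>I. f i x) = (\<lambda>x. \<Sum>i\<in>I. iterated_partial bs (f i) x)"
  using assms(1)
  by (induction I rule: infinite_finite_induct)
     (auto simp: iterated_partial_zero iterated_partial_add assms(2) smooth_sum)

lemma iterated_partial_diff:
  assumes "smooth f" "smooth g" "set bs \<subseteq> Basis"
  shows "iterated_partial bs (\<lambda>x. f x - g x) = (\<lambda>x. iterated_partial bs f x - iterated_partial bs g x)"
  using iterated_partial_add[OF assms(1) smooth_cmult[OF assms(2), of "-1"] assms(3)]
    iterated_partial_cmult[OF assms(2,3), of "-1"]
  by simp

text \<open>A bound on the C^n norm over \<open>S\<close>, kept as a relation with explicit order
  and constant instead of a supremum: nothing has to be known finite, and constants can be shared by
  whole families of functions.\<close>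

definition derivs_bounded :: "'a::euclidean_space set \<Rightarrow> nat \<Rightarrow> real \<Rightarrow> ('a \<Rightarrow> complex) \<Rightarrow> bool" where
  "derivs_bounded S n C f \<longleftrightarrow>
     (\<forall>bs. set bs \<subseteq> Basis \<and> length bs \<le> n \<longrightarrow> (\<forall>x\<in>S. cmod (iterated_partial bs f x) \<le> C))"

lemma derivs_boundedD:
  "derivs_bounded S n C f \<Longrightarrow> set bs \<subseteq> Basis \<Longrightarrow> length bs \<le> n \<Longrightarrow> x \<in> S \<Longrightarrow>
    cmod (iterated_partial bs f x) \<le> C"
  by (simp add: derivs_bounded_def)

lemma derivs_bounded_0D: "derivs_bounded S n C f \<Longrightarrow> x \<in> S \<Longrightarrow> cmod (f x) \<le> C"
  using derivs_boundedD[of S n C f "[]"] by simp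

lemma derivs_bounded_mono:
  "derivs_bounded S n C f \<Longrightarrow> T \<subseteq> S \<Longrightarrow> m \<le> n \<Longrightarrow> C \<le> D \<Longrightarrow> derivs_bounded T m D f"
  unfolding derivs_bounded_def by (meson order_trans subset_eq)

text \<open>The recursion behind estimates by induction on the order; again it splits off the
  derivative taken first.\<close>

lemma derivs_bounded_Suc:
  "derivs_bounded S (Suc n) C f \<longleftrightarrow>
    (\<forall>x\<in>S. cmod (f x) \<le> C) \<and> (\<forall>b\<in>Basis. derivs_bounded S n C (partial_deriv b f))"
proof
  assume L: "derivs_bounded S (Suc n) C f"
  have "derivs_bounded S n C (partial_deriv b f)" if "b \<in> Basis" for b
    unfolding derivs_bounded_def
  proof (intro allI impI ballI)
    fix bs x assume "set bs \<subseteq> (Basis::'a set) \<and> length bs \<le> n" "x \<in> S"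
    thus "cmod (iterated_partial bs (partial_deriv b f) x) \<le> C"
      using derivs_boundedD[OF L, of "bs @ [b]" x] that by (simp add: iterated_partial_snoc)
  qed
  thus "(\<forall>x\<in>S. cmod (f x) \<le> C) \<and> (\<forall>b\<in>Basis. derivs_bounded S n C (partial_deriv b f))"
    using derivs_bounded_0D[OF L] by blast
next
  assume R: "(\<forall>x\<in>S. cmod (f x) \<le> C) \<and> (\<forall>b\<in>Basis. derivs_bounded S n C (partial_deriv b f))"
  show "derivs_bounded S (Suc n) C f"
    unfolding derivs_bounded_def
  proof (intro allI impI ballI)
    fix bs x assume bs: "set bs \<subseteq> (Basis::'a set) \<and> length bs \<le> Suc n" and x: "x \<in> S"
    show "cmod (iterated_partial bs f x) \<le> C"
    proof (cases bs rule: rev_cases)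
      case Nil thus ?thesis using R x by simp
    next
      case (snoc cs c)
      thus ?thesis using R bs x by (auto simp: iterated_partial_snoc intro: derivs_boundedD)
    qed
  qed
qed

lemma derivs_bounded_0: "derivs_bounded S 0 C f \<longleftrightarrow> (\<forall>x\<in>S. cmod (f x) \<le> C)"
  by (auto simp: derivs_bounded_def)

lemma derivs_bounded_partial_deriv:
  "derivs_bounded S (Suc n) C f \<Longrightarrow> b \<in> Basis \<Longrightarrow> derivs_bounded S n C (partial_deriv b f)"
  by (simp add: derivs_bounded_Suc)

lemma derivs_bounded_iterated_partial:
  assumes "derivs_bounded S (n + length cs) C f" "set cs \<subseteq> Basis"
  shows "derivs_bounded S n C (iterated_partial cs f)"
  using assms unfolding derivs_bounded_def
  by (metis (no_types, lifting) Un_least add.commute add_le_mono1 iterated_partial_append length_append set_append add.commute)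

lemma derivs_bounded_add:
  assumes "smooth f" "smooth g" "derivs_bounded S n C f" "derivs_bounded S n D g"
  shows "derivs_bounded S n (C + D) (\<lambda>x. f x + g x)"
  unfolding derivs_bounded_def
  using assms by (auto simp: iterated_partial_add intro!: norm_triangle_mono derivs_boundedD)

lemma derivs_bounded_cmult:
  assumes "smooth f" "derivs_bounded S n C f"
  shows "derivs_bounded S n (cmod c * C) (\<lambda>x. c * f x)"
  unfolding derivs_bounded_def
  using assms by (auto simp: iterated_partial_cmult norm_mult intro!: mult_left_mono derivs_boundedD)

lemma derivs_bounded_sum:
  assumes "finite I" "\<And>i. i \<in> I \<Longrightarrow> smooth (f i)" "\<And>i. i \<in> I \<Longrightarrow> derivs_bounded S n (C i) (f i)"
  shows "derivs_bounded S n (\<Sum>i\<in>I. C i) (\<lambda>x. \<Sum>i\<in>I. f i x)"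
  unfolding derivs_bounded_def
  using assms by (auto simp: iterated_partial_sum intro!: order_trans[OF norm_sum] sum_mono derivs_boundedD)

text \<open>Each differentiation turns a product into two products of the same kind, so the constant
  doubles with every order. This crude Leibniz formula is the origin of
  \<open>2 ^ n\<close>.\<close>

lemma derivs_bounded_mult:
  assumes "smooth f" "smooth g" "derivs_bounded S n C f" "derivs_bounded S n D g" "C \<ge> 0" "D \<ge> 0"
  shows "derivs_bounded S n (2 ^ n * C * D) (\<lambda>x. f x * g x)"
  using assms
proof (induction n arbitrary: f g)
  case 0
  thus ?case by (auto simp: derivs_bounded_0 norm_mult intro!: mult_mono)
next
  case (Suc n)
  have *: "derivs_bounded S n C f" "derivs_bounded S n D g"
    using Suc.prems by (auto elim: derivs_bounded_mono)
  show ?case unfolding derivs_bounded_Suc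
  proof (intro conjI ballI)
    fix x assume "x \<in> S"
    hence "cmod (f x * g x) \<le> C * D"
      using Suc.prems \<open>x \<in> S\<close> by (auto simp: norm_mult intro!: mult_mono dest: derivs_bounded_0D)
    also have "\<dots> \<le> 2 ^ Suc n * C * D"
      using mult_right_mono[of 1 "2 ^ Suc n" "C * D"] Suc.prems(5,6) by (simp add: mult.assoc del: power_Suc)
    finally show "cmod (f x * g x) \<le> 2 ^ Suc n * C * D" .
  next
    fix b :: 'a assume b: "b \<in> Basis"
    have "derivs_bounded S n (2 ^ n * C * D + 2 ^ n * C * D)
            (\<lambda>x. partial_deriv b f x * g x + f x * partial_deriv b g x)"
      by (intro derivs_bounded_add Suc.IH smooth_mult smooth_partial_deriv Suc.prems b
            derivs_bounded_partial_deriv *)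
    moreover have "2 ^ n * C * D + 2 ^ n * C * D = 2 ^ Suc n * C * D" by simp
    ultimately show "derivs_bounded S n (2 ^ Suc n * C * D) (partial_deriv b (\<lambda>x. f x * g x))"
      using Suc.prems by (simp only: partial_deriv_mult smooth_differentiable)
  qed
qed

section \<open>Plane waves and their derivatives\<close>

definition wave :: "'a::euclidean_space \<Rightarrow> 'a \<Rightarrow> complex" where
  "wave k x = exp (- (\<i> * complex_of_real (k \<bullet> x)))"

lemma has_derivative_wave:
  "(wave k has_derivative (\<lambda>h. - (\<i> * complex_of_real (k \<bullet> h)) * wave k x)) (at x)"
proof -
  have "((\<lambda>x. exp (- (\<i> * complex_of_real (k \<bullet> x)))) has_derivative
      (\<lambda>h. exp (- (\<i> * complex_of_real (k \<bullet> x))) * - (\<i> * complex_of_real (k \<bullet> h)))) (at x)"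
    by (rule has_derivative_compose[OF _ DERIV_exp[unfolded has_field_derivative_def]])
       (auto intro!: derivative_eq_intros)
  thus ?thesis unfolding wave_def by (simp add: mult.commute)
qed

lemma partial_deriv_wave: "partial_deriv b (wave k) = (\<lambda>x. - (\<i> * complex_of_real (k \<bullet> b)) * wave k x)"
  by (rule ext, rule partial_deriv_eqI, rule has_derivative_wave)

lemma wave_differentiable: "wave k differentiable (at x)"
  using has_derivative_wave differentiable_def by blast

lemma smooth_wave [simp, intro]: "smooth (wave k)"
proof -
  have "n_smooth n (wave k)" for n
  proof (induction n)
    case (Suc n)
    thus ?case
      unfolding n_smooth.simps(2) partial_deriv_wave
      by (intro conjI ballI allI n_smooth_mult n_smooth_const wave_differentiable)
  qed (simp add: wave_differentiable)
  thus ?thesis by (simp add: smooth_iff_n_smooth)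
qed

lemma norm_wave [simp]: "cmod (wave k x) = 1"
  by (simp add: wave_def)

lemma wave_add: "wave (k + l) x = wave k x * wave l x"
  by (simp add: wave_def inner_add_left ring_distribs exp_add[symmetric])

lemma wave_add_right: "wave k (x + y) = wave k x * wave k y"
  by (simp add: wave_def inner_add_right ring_distribs exp_add[symmetric])

lemma wave_0 [simp]: "wave 0 x = 1"
  by (simp add: wave_def)

lemma wave_Pair: "wave (k, l) (x, y) = wave k x * wave l y"
  by (simp add: wave_def ring_distribs exp_add[symmetric])

text \<open>A derivative costs a factor of at most \<open>norm k\<close>; with the base
  \<open>1 + norm k\<close> the bound increases with the order and hence covers the lower orders
  too.\<close>

lemma derivs_bounded_wave: "derivs_bounded S n ((1 + norm k) ^ n) (wave k)"
proof (induction n)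
  case (Suc n)
  have le: "norm (k \<bullet> b) * (1 + norm k) ^ n \<le> (1 + norm k) ^ Suc n" if "b \<in> Basis" for b
    using Basis_le_norm[OF that, of k] by (auto intro!: mult_mono simp: that)
  show ?case unfolding derivs_bounded_Suc
  proof (intro conjI ballI)
    fix b :: 'a assume b: "b \<in> Basis"
    show "derivs_bounded S n ((1 + norm k) ^ Suc n) (partial_deriv b (wave k))"
      unfolding partial_deriv_wave
      by (rule derivs_bounded_mono[OF derivs_bounded_cmult[OF smooth_wave Suc.IH] order_refl order_refl])
         (use le[OF b] in \<open>simp add: norm_mult del: power_Suc\<close>)
  qed (simp del: power_Suc)
qed (simp add: derivs_bounded_0)

text \<open>Plane waves are joint eigenfunctions of all partial derivatives. The eigenvalue depends
  on \<open>bs\<close> only as a multiset, which later yields the symmetry of mixed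
  derivatives.\<close>

lemma iterated_partial_wave:
  "set bs \<subseteq> Basis \<Longrightarrow>
    iterated_partial bs (wave k) x = (\<Prod>b\<leftarrow>bs. - (\<i> * complex_of_real (k \<bullet> b))) * wave k x"
proof (induction bs arbitrary: x)
  case (Cons b bs)
  have "iterated_partial bs (wave k) = (\<lambda>x. (\<Prod>b\<leftarrow>bs. - (\<i> * complex_of_real (k \<bullet> b))) * wave k x)"
    using Cons by auto
  thus ?case
    by (simp add: iterated_partial_Cons partial_deriv_cmult wave_differentiable partial_deriv_wave
         del: iterated_partial.simps(2))
qed simp

section \<open>Test functions and cutoffs\<close>

lemma zero_outside_supp: "x \<notin> supp f \<Longrightarrow> f x = 0"
  using subsetD[OF closure_subset, of x "support_on UNIV f"] by (auto simp: supp_def support_on_def)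

lemma supp_subsetI: "closed K \<Longrightarrow> (\<And>x. x \<notin> K \<Longrightarrow> f x = 0) \<Longrightarrow> supp f \<subseteq> K"
  unfolding supp_def support_on_def by (rule closure_minimal) auto

lemma closed_supp [simp, intro]: "closed (supp f)"
  by (simp add: supp_def)

lemma supp_zero [simp]: "supp (\<lambda>x. 0) = {}"
  by (simp add: supp_def support_on_def)

lemma supp_mult_left: "supp (\<lambda>x. f x * g x) \<subseteq> supp f"
  by (rule supp_subsetI) (auto simp: zero_outside_supp[of _ f])

lemma supp_mult_right: "supp (\<lambda>x. f x * g x) \<subseteq> supp g"
  by (rule supp_subsetI) (auto simp: zero_outside_supp[of _ g])

lemma supp_add: "supp (\<lambda>x. f x + g x) \<subseteq> supp f \<union> supp g"
  by (rule supp_subsetI) (auto simp: zero_outside_supp[of _ f] zero_outside_supp[of _ g])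

lemma supp_partial_deriv: "supp (partial_deriv b f) \<subseteq> supp f"
proof (rule supp_subsetI)
  fix x assume "x \<notin> supp f"
  hence "partial_deriv b (\<lambda>x. 0) x = partial_deriv b f x"
    by (intro partial_deriv_cong_open[of "- supp f"]) (auto simp: zero_outside_supp[of _ f])
  thus "partial_deriv b f x = 0" by (simp add: partial_deriv_const)
qed simp

lemma supp_iterated_partial: "supp (iterated_partial bs f) \<subseteq> supp f"
proof (induction bs)
  case (Cons b bs)
  thus ?case unfolding iterated_partial_Cons using supp_partial_deriv by blast
qed simp

lemma test_functionsD:
  assumes "\<phi> \<in> test_functions \<Omega>"
  shows "smooth \<phi>" "compact (supp \<phi>)" "supp \<phi> \<subseteq> \<Omega>"
  using assms by (auto simp: test_functions_def)

lemma test_functionsI: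
  assumes "smooth \<phi>" "supp \<phi> \<subseteq> K" "compact K" "K \<subseteq> \<Omega>"
  shows "\<phi> \<in> test_functions \<Omega>"
  using assms compact_Int_closed[OF assms(3) closed_supp, of \<phi>]
  by (simp add: test_functions_def inf.absorb2)

lemma test_functions_mult:
  assumes "\<phi> \<in> test_functions \<Omega>" "smooth f"
  shows "(\<lambda>x. \<phi> x * f x) \<in> test_functions \<Omega>"
  using smooth_mult[OF test_functionsD(1)[OF assms(1)] assms(2)] supp_mult_left[of \<phi> f]
    test_functionsD(2,3)[OF assms(1)]
  by (rule test_functionsI)

lemma test_functions_mult_left:
  "\<phi> \<in> test_functions \<Omega> \<Longrightarrow> smooth f \<Longrightarrow> (\<lambda>x. f x * \<phi> x) \<in> test_functions \<Omega>"
  using test_functions_mult[of \<phi> \<Omega> f] by (simp add: mult.commute)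

lemma test_functions_add:
  assumes "\<phi> \<in> test_functions \<Omega>" "\<psi> \<in> test_functions \<Omega>"
  shows "(\<lambda>x. \<phi> x + \<psi> x) \<in> test_functions \<Omega>"
  using smooth_add[OF assms[THEN test_functionsD(1)]] supp_add[of \<phi> \<psi>]
    compact_Un[OF assms[THEN test_functionsD(2)]] Un_least[OF assms[THEN test_functionsD(3)]]
  by (rule test_functionsI)

lemma test_functions_zero: "(\<lambda>x. 0) \<in> test_functions \<Omega>"
  by (simp add: test_functions_def)

lemma test_functions_cmult: "\<phi> \<in> test_functions \<Omega> \<Longrightarrow> (\<lambda>x. c * \<phi> x) \<in> test_functions \<Omega>"
  by (rule test_functions_mult_left) auto

lemma test_functions_lincomb:
  assumes "\<phi> \<in> test_functions \<Omega>" "\<psi> \<in> test_functions \<Omega>"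
  shows "(\<lambda>x. a * \<phi> x + b * \<psi> x) \<in> test_functions \<Omega>"
  by (intro test_functions_add test_functions_cmult assms)

lemma test_functions_diff:
  assumes "\<phi> \<in> test_functions \<Omega>" "\<psi> \<in> test_functions \<Omega>"
  shows "(\<lambda>x. \<phi> x - \<psi> x) \<in> test_functions \<Omega>"
  using test_functions_lincomb[OF assms, of 1 "-1"] by simp

lemma test_functions_sum:
  "(\<And>i. i \<in> I \<Longrightarrow> f i \<in> test_functions \<Omega>) \<Longrightarrow> (\<lambda>x. \<Sum>i\<in>I. f i x) \<in> test_functions \<Omega>"
  by (induction I rule: infinite_finite_induct) (simp_all add: test_functions_zero test_functions_add)

text \<open>Off the support all derivatives vanish, and there the bound only asks for
  \<open>C \<ge> 0\<close>.\<close>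

lemma derivs_bounded_UNIV:
  assumes "derivs_bounded S n C f" "supp f \<subseteq> S" "C \<ge> 0"
  shows "derivs_bounded T n C f"
  unfolding derivs_bounded_def
proof (intro allI impI ballI)
  fix bs x assume bs: "set bs \<subseteq> (Basis::'a set) \<and> length bs \<le> n"
  show "cmod (iterated_partial bs f x) \<le> C"
  proof (cases "x \<in> S")
    case True thus ?thesis using assms(1) bs derivs_boundedD by blast
  next
    case False
    hence "iterated_partial bs f x = 0"
      using assms(2) supp_iterated_partial[of bs f] by (intro zero_outside_supp[of x "iterated_partial bs f"]) blast
    thus ?thesis using assms(3) by simp
  qed
qed

text \<open>The bound on \<open>g\<close> is asked for only on a set containing
  \<open>supp f\<close>. In the applications \<open>g\<close> is the error of a Fourier
  approximation, which is small inside the cube but not elsewhere.\<close>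

lemma derivs_bounded_mult_supp:
  assumes "smooth f" "smooth g" "supp f \<subseteq> S" "derivs_bounded S n C f" "derivs_bounded S n D g" "C \<ge> 0" "D \<ge> 0"
  shows "derivs_bounded T n (2 ^ n * C * D) (\<lambda>x. f x * g x)"
  by (rule derivs_bounded_UNIV[OF derivs_bounded_mult[OF assms(1,2,4,5,6,7)]])
     (use assms supp_mult_left[of f g] in auto)

lemma finite_multiindices: "finite {bs. set bs \<subseteq> (Basis::'a::euclidean_space set) \<and> length bs \<le> n}"
  by (rule finite_lists_length_le) simp

lemma derivs_bounded_compact:
  assumes "smooth f" "compact K"
  obtains C where "C \<ge> 0" "derivs_bounded K n C f"
proof -
  let ?B = "{bs. set bs \<subseteq> (Basis::'a set) \<and> length bs \<le> n}"
  have "\<exists>C. \<forall>x\<in>K. cmod (iterated_partial bs f x) \<le> C" if "bs \<in> ?B" for bs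
  proof -
    have "bounded (iterated_partial bs f ` K)"
      using that assms by (intro compact_imp_bounded compact_continuous_image smooth_continuous_on
          smooth_iterated_partial) auto
    thus ?thesis by (auto simp: bounded_iff)
  qed
  then obtain C where C: "\<And>bs x. bs \<in> ?B \<Longrightarrow> x \<in> K \<Longrightarrow> cmod (iterated_partial bs f x) \<le> C bs"
    by metis
  show ?thesis
  proof
    show "(\<Sum>bs\<in>?B. \<bar>C bs\<bar>) \<ge> 0" by (simp add: sum_nonneg)
    show "derivs_bounded K n (\<Sum>bs\<in>?B. \<bar>C bs\<bar>) f"
      unfolding derivs_bounded_def
    proof (intro allI impI ballI)
      fix bs x assume bs: "set bs \<subseteq> (Basis::'a set) \<and> length bs \<le> n" and x: "x \<in> K"
      have "cmod (iterated_partial bs f x) \<le> \<bar>C bs\<bar>" using C[of bs x] bs x by fastforce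
      also have "\<dots> \<le> (\<Sum>bs\<in>?B. \<bar>C bs\<bar>)"
        using bs by (intro member_le_sum finite_multiindices) auto
      finally show "cmod (iterated_partial bs f x) \<le> (\<Sum>bs\<in>?B. \<bar>C bs\<bar>)" .
    qed
  qed
qed

lemma derivs_bounded_test_function:
  assumes "\<phi> \<in> test_functions \<Omega>"
  obtains C where "C \<ge> 0" "derivs_bounded UNIV n C \<phi>"
proof -
  obtain C where "C \<ge> 0" "derivs_bounded (supp \<phi>) n C \<phi>"
    using derivs_bounded_compact[OF test_functionsD(1,2)[OF assms]] .
  thus ?thesis using that derivs_bounded_UNIV by blast
qed

section \<open>Affine substitutions: slices, projections and exchange of the two factors\<close>

lemma has_derivative_affine:
  assumes A: "bounded_linear A" and f: "f differentiable (at (A x + c))"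
  shows "((\<lambda>x. f (A x + c)) has_derivative
    (\<lambda>h. \<Sum>b\<in>Basis. complex_of_real (A h \<bullet> b) * partial_deriv b f (A x + c))) (at x)"
proof -
  have "((\<lambda>x. A x + c) has_derivative A) (at x)"
    using has_derivative_add[OF bounded_linear_imp_has_derivative[OF A] has_derivative_const] by simp
  from has_derivative_compose[OF this has_derivative_partial_deriv[OF f]]
  show ?thesis by (simp add: scaleR_conv_of_real)
qed

text \<open>Slices, projections and \<open>prod.swap\<close> are all affine, so one chain rule
  handles them. A derivative of the composition is a combination, with constant coefficients, of
  compositions of the same kind.\<close>

lemma n_smooth_affine:
  assumes A: "bounded_linear A" and "n_smooth n f"
  shows "n_smooth n (\<lambda>x. f (A x + c))"
  using assms(2)
proof (induction n arbitrary: f)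
  case 0
  thus ?case using has_derivative_affine[OF A, of f _ c] unfolding n_smooth.simps differentiable_def by blast
next
  case (Suc n)
  have d: "f differentiable (at x)" for x using Suc.prems n_smooth_differentiable by blast
  have pd: "partial_deriv b (\<lambda>x. f (A x + c)) =
      (\<lambda>x. \<Sum>b'\<in>Basis. complex_of_real (A b \<bullet> b') * partial_deriv b' f (A x + c))" for b
    by (rule ext, rule partial_deriv_eqI, rule has_derivative_affine[OF A d])
  show ?case unfolding n_smooth.simps(2) pd
  proof (intro conjI ballI allI n_smooth_sum n_smooth_mult n_smooth_const)
    show "(\<lambda>x. f (A x + c)) differentiable (at x)" for x
      using has_derivative_affine[OF A d] unfolding differentiable_def by blast
  qed (use Suc in auto)
qed

lemma smooth_affine: "bounded_linear A \<Longrightarrow> smooth f \<Longrightarrow> smooth (\<lambda>x. f (A x + c))"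
  by (simp add: smooth_iff_n_smooth n_smooth_affine)

lemma smooth_slice1: "smooth \<phi> \<Longrightarrow> smooth (\<lambda>x. \<phi> (x, y))"
  using smooth_affine[of "\<lambda>x. (x, 0)" \<phi> "(0, y)"] by (simp add: bounded_linear_Pair bounded_linear_ident bounded_linear_zero)

lemma smooth_slice2: "smooth \<phi> \<Longrightarrow> smooth (\<lambda>y. \<phi> (x, y))"
  using smooth_affine[of "\<lambda>y. (0, y)" \<phi> "(x, 0)"] by (simp add: bounded_linear_Pair bounded_linear_ident bounded_linear_zero)

lemma smooth_fst: "smooth f \<Longrightarrow> smooth (\<lambda>z. f (fst z))"
  using smooth_affine[of fst f 0] by (simp add: bounded_linear_fst)

lemma smooth_snd: "smooth f \<Longrightarrow> smooth (\<lambda>z. f (snd z))"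
  using smooth_affine[of snd f 0] by (simp add: bounded_linear_snd)

lemma bounded_linear_swap: "bounded_linear prod.swap"
  unfolding prod.swap_def by (intro bounded_linear_Pair bounded_linear_fst bounded_linear_snd)

lemma smooth_swap: "smooth \<phi> \<Longrightarrow> smooth (\<lambda>z. \<phi> (prod.swap z))"
  using smooth_affine[OF bounded_linear_swap, of \<phi> 0] by simp

lemma Basis_left: "b \<in> Basis \<Longrightarrow> (b, 0) \<in> Basis"
  and Basis_right: "b' \<in> Basis \<Longrightarrow> (0, b') \<in> Basis"
  by (auto simp: Basis_prod_def)

lemma partial_deriv_slice1:
  assumes "\<phi> differentiable (at (x, y))"
  shows "partial_deriv b (\<lambda>x. \<phi> (x, y)) x = partial_deriv (b, 0) \<phi> (x, y)"
proof -
  have "((\<lambda>x. (x, y)) has_derivative (\<lambda>h. (h, 0))) (at x)"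
    by (auto intro!: derivative_eq_intros)
  from has_derivative_compose[OF this assms[unfolded frechet_derivative_works]]
  have "((\<lambda>x. \<phi> (x, y)) has_derivative (\<lambda>h. frechet_derivative \<phi> (at (x, y)) (h, 0))) (at x)" .
  thus ?thesis by (simp add: partial_deriv_eqI partial_deriv_def[of _ \<phi>])
qed

lemma partial_deriv_slice2:
  assumes "\<phi> differentiable (at (x, y))"
  shows "partial_deriv b (\<lambda>y. \<phi> (x, y)) y = partial_deriv (0, b) \<phi> (x, y)"
proof -
  have "((\<lambda>y. (x, y)) has_derivative (\<lambda>h. (0, h))) (at y)"
    by (auto intro!: derivative_eq_intros)
  from has_derivative_compose[OF this assms[unfolded frechet_derivative_works]]
  have "((\<lambda>y. \<phi> (x, y)) has_derivative (\<lambda>h. frechet_derivative \<phi> (at (x, y)) (0, h))) (at y)" .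
  thus ?thesis by (simp add: partial_deriv_eqI partial_deriv_def[of _ \<phi>])
qed

lemma iterated_partial_slice1:
  assumes "smooth \<phi>" "set bs \<subseteq> Basis"
  shows "iterated_partial bs (\<lambda>x. \<phi> (x, y)) = (\<lambda>x. iterated_partial (map (\<lambda>b. (b, 0)) bs) \<phi> (x, y))"
  using assms(2)
proof (induction bs)
  case (Cons b bs)
  hence "smooth (iterated_partial (map (\<lambda>b. (b, 0::'b)) bs) \<phi>)"
    by (intro smooth_iterated_partial assms) (auto simp: Basis_left)
  with Cons show ?case
    by (auto simp: iterated_partial_Cons partial_deriv_slice1 smooth_differentiable simp del: iterated_partial.simps(2))
qed simp

lemma iterated_partial_slice2:
  assumes "smooth \<phi>" "set bs \<subseteq> Basis"
  shows "iterated_partial bs (\<lambda>y. \<phi> (x, y)) = (\<lambda>y. iterated_partial (map (\<lambda>b. (0, b)) bs) \<phi> (x, y))"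
  using assms(2)
proof (induction bs)
  case (Cons b bs)
  hence "smooth (iterated_partial (map (\<lambda>b. (0::'a, b)) bs) \<phi>)"
    by (intro smooth_iterated_partial assms) (auto simp: Basis_right)
  with Cons show ?case
    by (auto simp: iterated_partial_Cons partial_deriv_slice2 smooth_differentiable simp del: iterated_partial.simps(2))
qed simp

lemma derivs_bounded_slice1:
  assumes "smooth \<phi>" "derivs_bounded UNIV n C \<phi>"
  shows "derivs_bounded UNIV n C (\<lambda>x. \<phi> (x, y))"
  unfolding derivs_bounded_def
  using assms by (auto simp: iterated_partial_slice1 intro!: derivs_boundedD[OF assms(2)] Basis_left)

lemma derivs_bounded_slice2:
  assumes "smooth \<phi>" "derivs_bounded UNIV n C \<phi>"
  shows "derivs_bounded UNIV n C (\<lambda>y. \<phi> (x, y))"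
  unfolding derivs_bounded_def
  using assms by (auto simp: iterated_partial_slice2 intro!: derivs_boundedD[OF assms(2)] Basis_right)

lemma iterated_partial_swap:
  fixes \<phi> :: "'a::euclidean_space \<times> 'b::euclidean_space \<Rightarrow> complex"
  assumes "smooth \<phi>" "set bs \<subseteq> Basis"
  shows "iterated_partial bs (\<lambda>z. \<phi> (prod.swap z)) = (\<lambda>z. iterated_partial (map prod.swap bs) \<phi> (prod.swap z))"
  using assms(2)
proof (induction bs)
  case (Cons b bs)
  have *: "partial_deriv b (\<lambda>z. g (prod.swap z)) = (\<lambda>z. partial_deriv (prod.swap b) g (prod.swap z))"
    if "smooth g" for g :: "'a \<times> 'b \<Rightarrow> complex"
  proof (rule ext, rule partial_deriv_eqI[where D="\<lambda>h. partial_deriv (prod.swap h) g (prod.swap z)" for z])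
    fix z :: "'b \<times> 'a"
    have "g differentiable (at (prod.swap z))" using that smooth_differentiable by blast
    hence "(g has_derivative frechet_derivative g (at (prod.swap z))) (at (prod.swap z))"
      by (simp add: frechet_derivative_works)
    thus "((\<lambda>z. g (prod.swap z)) has_derivative (\<lambda>h. partial_deriv (prod.swap h) g (prod.swap z))) (at z)"
      unfolding partial_deriv_def
      by (rule has_derivative_compose[rotated]) (auto simp: prod.swap_def intro!: derivative_eq_intros)
  qed
  have "smooth (iterated_partial (map prod.swap bs) \<phi>)"
    using Cons.prems by (intro smooth_iterated_partial assms) (auto simp: Basis_prod_def)
  with Cons show ?case
    by (auto simp: iterated_partial_Cons * simp del: iterated_partial.simps(2))
qed simp

lemma derivs_bounded_swap:
  assumes "smooth \<phi>" "derivs_bounded UNIV n C \<phi>"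
  shows "derivs_bounded UNIV n C (\<lambda>z. \<phi> (prod.swap z))"
  unfolding derivs_bounded_def
  using assms by (auto simp: iterated_partial_swap Basis_prod_def intro!: derivs_boundedD[OF assms(2)])

text \<open>Off \<open>supp f\<close> the quotient is 0 whatever \<open>g\<close> does, since 0 / 0
  is 0. Such quotients are closed under differentiation: the new denominator is \<open>g * g\<close>
  and the new numerator is again supported in \<open>supp f\<close>, so the induction runs over all
  \<open>f\<close> and \<open>g\<close>.\<close>

lemma n_smooth_divide:
  assumes "smooth f" "smooth g" "\<And>x. x \<in> supp f \<Longrightarrow> g x \<noteq> 0"
  shows "n_smooth n (\<lambda>x. f x / g x)"
  using assms
proof (induction n arbitrary: f g)
  case 0
  show ?case unfolding n_smooth.simps
  proof
    fix x
    show "(\<lambda>x. f x / g x) differentiable (at x)"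
    proof (cases "x \<in> supp f")
      case True
      thus ?thesis using 0 by (intro differentiable_divide smooth_differentiable) auto
    next
      case False
      have "((\<lambda>x. f x / g x) has_derivative (\<lambda>x. 0)) (at x)"
        by (rule has_derivative_transform_within_open[of "\<lambda>x. 0" _ _ _ "- supp f"])
           (use False in \<open>auto simp: zero_outside_supp[of _ f]\<close>)
      thus ?thesis by (auto simp: differentiable_def)
    qed
  qed
next
  case (Suc n)
  let ?f = "\<lambda>b x. partial_deriv b f x * g x - f x * partial_deriv b g x"
  have d: "(\<lambda>x. f x / g x) differentiable (at x)" for x
    using Suc.IH[OF Suc.prems] n_smooth_differentiable by blast
  have pd: "partial_deriv b (\<lambda>x. f x / g x) = (\<lambda>x. ?f b x / (g x * g x))" if b: "b \<in> Basis" for b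
  proof
    fix x
    show "partial_deriv b (\<lambda>x. f x / g x) x = ?f b x / (g x * g x)"
    proof (cases "x \<in> supp f")
      case True
      hence g: "g x \<noteq> 0" using Suc.prems by blast
      have "partial_deriv b (\<lambda>x. f x / g x) x =
          - f x * (inverse (g x) * partial_deriv b g x * inverse (g x)) + partial_deriv b f x / g x"
        using has_derivative_divide[OF smooth_differentiable[OF Suc.prems(1), unfolded frechet_derivative_works]
            smooth_differentiable[OF Suc.prems(2), unfolded frechet_derivative_works] g]
        by (subst partial_deriv_eqI) (auto simp: partial_deriv_def)
      thus ?thesis using g by (simp add: field_simps)
    next
      case False
      moreover have "partial_deriv b (\<lambda>x. f x / g x) x = partial_deriv b (\<lambda>x. 0) x"
        by (rule partial_deriv_cong_open[of "- supp f"]) (use False d in \<open>auto simp: zero_outside_supp[of _ f]\<close>)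
      moreover have "partial_deriv b f x = 0"
        using False supp_partial_deriv by (metis subsetD zero_outside_supp)
      ultimately show ?thesis by (simp add: partial_deriv_const zero_outside_supp[of _ f])
    qed
  qed
  show ?case unfolding n_smooth.simps(2)
  proof (intro conjI ballI allI d)
    fix b :: 'a assume b: "b \<in> Basis"
    have "supp (?f b) \<subseteq> supp f"
    proof (rule supp_subsetI)
      fix x assume x: "x \<notin> supp f"
      hence "partial_deriv b f x = 0"
        using supp_partial_deriv[of b f] zero_outside_supp[of x "partial_deriv b f"] by blast
      thus "?f b x = 0" using zero_outside_supp[OF x] by simp
    qed simp
    hence "n_smooth n (\<lambda>x. ?f b x / (g x * g x))"
      using Suc.prems b by (intro Suc.IH smooth_diff smooth_mult smooth_partial_deriv) auto
    thus "n_smooth n (partial_deriv b (\<lambda>x. f x / g x))" by (simp only: pd[OF b])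
  qed
qed

lemma smooth_divide:
  "smooth f \<Longrightarrow> smooth g \<Longrightarrow> (\<And>x. x \<in> supp f \<Longrightarrow> g x \<noteq> 0) \<Longrightarrow> smooth (\<lambda>x. f x / g x)"
  by (simp add: smooth_iff_n_smooth n_smooth_divide)

section \<open>Smooth cutoffs and localisation of test functions\<close>

lemma smooth_inner: "smooth (\<lambda>x. complex_of_real (x \<bullet> b))"
proof -
  have d: "((\<lambda>x. complex_of_real (x \<bullet> b)) has_derivative (\<lambda>h. complex_of_real (h \<bullet> b))) (at x)" for x
    by (auto intro!: derivative_eq_intros)
  have pd: "partial_deriv b' (\<lambda>x. complex_of_real (x \<bullet> b)) = (\<lambda>x. complex_of_real (b' \<bullet> b))" for b'
    by (rule ext, rule partial_deriv_eqI, rule d)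
  have "n_smooth n (\<lambda>x. complex_of_real (x \<bullet> b))" for n
    using d by (cases n) (auto simp: differentiable_def pd n_smooth_const)
  thus ?thesis by (simp add: smooth_iff_n_smooth)
qed

lemma smooth_norm_square: "smooth (\<lambda>x. complex_of_real ((norm (x - a))\<^sup>2))"
proof -
  have "complex_of_real ((norm (x - a))\<^sup>2) =
      (\<Sum>b\<in>Basis. (complex_of_real (x \<bullet> b) - complex_of_real (a \<bullet> b)) *
                  (complex_of_real (x \<bullet> b) - complex_of_real (a \<bullet> b)))" for x
    unfolding power2_norm_eq_inner by (subst euclidean_inner) (simp add: inner_diff_left)
  thus ?thesis by (simp only:) (intro smooth_sum smooth_mult smooth_diff smooth_inner smooth_const)
qed

text \<open>The functions t^(-j) e^(-1/t), extended by 0. Differentiation maps member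
  \<open>j\<close> to a combination of the members \<open>j + 1\<close> and \<open>j + 2\<close>; an
  induction for e^(-1/t) alone would not close.\<close>

definition exp_neg_inverse :: "nat \<Rightarrow> real \<Rightarrow> real" where
  "exp_neg_inverse j t = (if t > 0 then inverse t ^ j * exp (- inverse t) else 0)"

lemma exp_neg_inverse_deriv:
  "(exp_neg_inverse j has_real_derivative exp_neg_inverse (j + 2) t - real j * exp_neg_inverse (j + 1) t) (at t)"
proof -
  consider "t > 0" | "t < 0" | "t = 0" by linarith
  thus ?thesis
  proof cases
    case 1
    have "((\<lambda>t. inverse t ^ j * exp (- inverse t)) has_real_derivative
        inverse t ^ (j + 2) * exp (- inverse t) - real j * (inverse t ^ (j + 1) * exp (- inverse t))) (at t)"
    proof -
      have "((\<lambda>t. inverse t ^ j * exp (- inverse t)) has_real_derivative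
          real j * inverse t ^ (j - 1) * - (inverse t ^ 2) * exp (- inverse t)
          + inverse t ^ j * (exp (- inverse t) * inverse t ^ 2)) (at t)"
        using 1 by (auto intro!: derivative_eq_intros simp: power2_eq_square)
      moreover have *: "real j * inverse t ^ (j - 1) * inverse t ^ 2 = real j * inverse t ^ (j + 1)"
        by (cases j) (simp_all add: power2_eq_square)
      moreover have "real j * inverse t ^ (j - 1) * - (inverse t ^ 2) * exp (- inverse t)
          + inverse t ^ j * (exp (- inverse t) * inverse t ^ 2)
        = inverse t ^ (j + 2) * exp (- inverse t) - real j * (inverse t ^ (j + 1) * exp (- inverse t))"
        unfolding mult_minus_right mult_minus_left * by (simp add: power_add algebra_simps power2_eq_square)
      ultimately show ?thesis by simp
    qed
    thus ?thesis using 1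
      by (subst DERIV_cong_ev[OF refl _ refl, of _ "\<lambda>t. inverse t ^ j * exp (- inverse t)"])
         (auto simp: exp_neg_inverse_def intro!: eventually_mono[OF eventually_nhds_in_open[of "{0<..}" t]])
  next
    case 2
    thus ?thesis
      by (subst DERIV_cong_ev[OF refl _ refl, of _ "\<lambda>t. 0"])
         (auto simp: exp_neg_inverse_def intro!: eventually_mono[OF eventually_nhds_in_open[of "{..<0}" t]])
  next
    case 3
    \<comment> \<open>For positive \<open>h\<close> the quotient is s^(j+1) e^(-s) with s = 1/h, and
      the exponential beats the power.\<close>
    have "((\<lambda>h. exp_neg_inverse j h / h) \<longlongrightarrow> 0) (at_right 0)"
    proof -
      have "((\<lambda>h. inverse h ^ Suc j / exp (inverse h)) \<longlongrightarrow> (0::real)) (at_right 0)"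
        by (rule filterlim_compose[OF tendsto_power_div_exp_0 filterlim_inverse_at_top_right])
      thus ?thesis
        by (rule Lim_transform_eventually)
           (auto simp: eventually_at_right_field exp_neg_inverse_def exp_minus field_simps intro!: exI[of _ 1])
    qed
    moreover have "((\<lambda>h. exp_neg_inverse j h / h) \<longlongrightarrow> 0) (at_left 0)"
      by (rule Lim_transform_eventually[OF tendsto_const])
         (auto simp: eventually_at_left_field exp_neg_inverse_def intro!: exI[of _ "-1"])
    ultimately have "((\<lambda>h. exp_neg_inverse j h / h) \<longlongrightarrow> 0) (at 0)"
      by (simp add: filterlim_split_at)
    thus ?thesis using 3 by (simp add: DERIV_def exp_neg_inverse_def)
  qed
qed

lemma smooth_exp_neg_inverse:
  assumes q: "smooth (\<lambda>x. complex_of_real (q x))"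
  shows "smooth (\<lambda>x. complex_of_real (exp_neg_inverse j (q x)))"
proof -
  have "n_smooth n (\<lambda>x. complex_of_real (exp_neg_inverse j (q x)))" for n
  proof (induction n arbitrary: j)
    have deriv: "((\<lambda>x. complex_of_real (exp_neg_inverse j (q x))) has_derivative
        (\<lambda>h. frechet_derivative (\<lambda>x. complex_of_real (q x)) (at x) h *
          (complex_of_real (exp_neg_inverse (j + 2) (q x)) +
            complex_of_real (- real j) * complex_of_real (exp_neg_inverse (j + 1) (q x))))) (at x)" for j x
    proof -
      let ?D = "frechet_derivative (\<lambda>x. complex_of_real (q x)) (at x)"
      have D: "((\<lambda>x. complex_of_real (q x)) has_derivative ?D) (at x)"
        using q smooth_differentiable frechet_derivative_works by blast
      have Dr: "(q has_derivative (\<lambda>h. Re (?D h))) (at x)"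
        using has_derivative_compose[OF D bounded_linear_imp_has_derivative[OF bounded_linear_Re]] by simp
      \<comment> \<open>By uniqueness of derivatives, the derivative of a real-valued function takes
        real values; so the real chain rule can be lifted back to the complex-valued
        functions.\<close>
      have eq: "?D = (\<lambda>h. complex_of_real (Re (?D h)))"
        by (rule has_derivative_unique[OF D])
           (rule has_derivative_compose[OF Dr bounded_linear_imp_has_derivative[OF bounded_linear_of_real]])
      have "((\<lambda>x. exp_neg_inverse j (q x)) has_derivative
          (\<lambda>h. (exp_neg_inverse (j + 2) (q x) - real j * exp_neg_inverse (j + 1) (q x)) * Re (?D h))) (at x)"
        using has_derivative_compose[OF Dr exp_neg_inverse_deriv[unfolded has_field_derivative_def]] by simp
      from has_derivative_compose[OF this bounded_linear_imp_has_derivative[OF bounded_linear_of_real]]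
      have "((\<lambda>x. complex_of_real (exp_neg_inverse j (q x))) has_derivative
          (\<lambda>h. complex_of_real (Re (?D h)) * (complex_of_real (exp_neg_inverse (j + 2) (q x)) +
            complex_of_real (- real j) * complex_of_real (exp_neg_inverse (j + 1) (q x))))) (at x)"
        by (simp add: mult.commute)
      thus ?thesis unfolding fun_cong[OF eq, symmetric] .
    qed
    {
      case 0
      show ?case using deriv unfolding n_smooth.simps differentiable_def by blast
    next
      case (Suc n)
      have pd: "partial_deriv b (\<lambda>x. complex_of_real (exp_neg_inverse j (q x))) =
        (\<lambda>x. partial_deriv b (\<lambda>x. complex_of_real (q x)) x *
          (complex_of_real (exp_neg_inverse (j + 2) (q x)) +
            complex_of_real (- real j) * complex_of_real (exp_neg_inverse (j + 1) (q x))))" for b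
        unfolding partial_deriv_def[of _ "\<lambda>x. complex_of_real (q x)"]
        by (rule ext, rule partial_deriv_eqI, rule deriv)
      show ?case
        unfolding n_smooth.simps(2) pd
      proof (intro conjI allI ballI n_smooth_mult n_smooth_add Suc.IH n_smooth_const)
        show "(\<lambda>x. complex_of_real (exp_neg_inverse j (q x))) differentiable (at x)" for x
          using deriv unfolding differentiable_def by blast
        show "n_smooth n (partial_deriv b (\<lambda>x. complex_of_real (q x)))" if "b \<in> Basis" for b
          using smooth_partial_deriv[OF q that] by (simp add: smooth_iff_n_smooth)
      qed
    }
  qed
  thus ?thesis by (simp add: smooth_iff_n_smooth)
qed

lemma exp_neg_inverse_0_pos: "t > 0 \<Longrightarrow> exp_neg_inverse 0 t > 0"
  and exp_neg_inverse_0_nonpos: "t \<le> 0 \<Longrightarrow> exp_neg_inverse 0 t = 0"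
  and exp_neg_inverse_0_nonneg: "exp_neg_inverse 0 t \<ge> 0"
  by (auto simp: exp_neg_inverse_def)

lemma ball_cutoff:
  fixes a :: "'a::euclidean_space"
  assumes "r > 0"
  obtains \<omega> where "smooth \<omega>" "\<forall>x\<in>cball a r. \<omega> x = 1" "supp \<omega> \<subseteq> cball a (2 * r)"
proof -
  \<comment> \<open>\<open>A\<close> is positive exactly inside the ball of radius
    \<open>2 * r\<close>, \<open>B\<close> exactly outside the closed ball of radius
    \<open>r\<close>. Hence \<open>A + B\<close> never vanishes, and the quotient is 1 where
    \<open>B\<close> is 0 and 0 where \<open>A\<close> is 0.\<close>
  define A where "A = (\<lambda>x. exp_neg_inverse 0 (4 * r\<^sup>2 - (norm (x - a))\<^sup>2))"
  define B where "B = (\<lambda>x. exp_neg_inverse 0 ((norm (x - a))\<^sup>2 - r\<^sup>2))"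
  define \<omega> where "\<omega> = (\<lambda>x. complex_of_real (A x) / complex_of_real (A x + B x))"
  have AB: "A x + B x > 0" for x
  proof (cases "4 * r\<^sup>2 - (norm (x - a))\<^sup>2 > 0")
    case True
    thus ?thesis unfolding A_def B_def using exp_neg_inverse_0_pos exp_neg_inverse_0_nonneg add_pos_nonneg by blast
  next
    case False
    moreover have "r\<^sup>2 > 0" using assms by simp
    ultimately have "(norm (x - a))\<^sup>2 - r\<^sup>2 > 0" by linarith
    thus ?thesis unfolding A_def B_def using exp_neg_inverse_0_pos exp_neg_inverse_0_nonneg add_nonneg_pos by blast
  qed
  have "smooth (\<lambda>x. complex_of_real (4 * r\<^sup>2 - (norm (x - a))\<^sup>2))"
    unfolding of_real_diff by (intro smooth_diff smooth_norm_square smooth_const)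
  hence sA: "smooth (\<lambda>x. complex_of_real (A x))"
    unfolding A_def by (rule smooth_exp_neg_inverse)
  have "smooth (\<lambda>x. complex_of_real ((norm (x - a))\<^sup>2 - r\<^sup>2))"
    unfolding of_real_diff by (intro smooth_diff smooth_norm_square smooth_const)
  hence sB: "smooth (\<lambda>x. complex_of_real (B x))"
    unfolding B_def by (rule smooth_exp_neg_inverse)
  show ?thesis
  proof
    have "smooth (\<lambda>x. complex_of_real (A x + B x))"
      unfolding of_real_add by (rule smooth_add[OF sA sB])
    thus "smooth \<omega>" unfolding \<omega>_def
    proof (rule smooth_divide[OF sA])
      fix x show "complex_of_real (A x + B x) \<noteq> 0" using AB[of x] by (simp del: of_real_add)
    qed
    show "\<forall>x\<in>cball a r. \<omega> x = 1"
    proof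
      fix x assume "x \<in> cball a r"
      hence "(norm (x - a))\<^sup>2 \<le> r\<^sup>2"
        by (intro power_mono) (auto simp: dist_norm norm_minus_commute)
      hence "B x = 0" unfolding B_def by (intro exp_neg_inverse_0_nonpos) simp
      thus "\<omega> x = 1" using AB[of x] by (simp add: \<omega>_def)
    qed
    show "supp \<omega> \<subseteq> cball a (2 * r)"
    proof (rule supp_subsetI)
      fix x assume "x \<notin> cball a (2 * r)"
      hence "2 * r \<le> norm (x - a)" by (simp add: dist_norm norm_minus_commute)
      hence "(2 * r)\<^sup>2 \<le> (norm (x - a))\<^sup>2" using assms by (intro power_mono) auto
      hence "A x = 0" unfolding A_def by (intro exp_neg_inverse_0_nonpos) (simp add: power_mult_distrib)
      thus "\<omega> x = 0" by (simp add: \<omega>_def)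
    qed simp
  qed
qed

lemma cutoff_exists:
  fixes \<Omega> :: "'a::euclidean_space set"
  assumes "compact K" "K \<subseteq> \<Omega>" "open \<Omega>"
  obtains \<psi> where "\<psi> \<in> test_functions \<Omega>" "\<forall>x\<in>K. \<psi> x = 1"
proof -
  have "\<forall>x\<in>K. \<exists>r. r > 0 \<and> cball x (2 * r) \<subseteq> \<Omega>"
  proof
    fix x assume "x \<in> K"
    hence "x \<in> \<Omega>" using assms(2) by blast
    then obtain e where "e > 0" "cball x e \<subseteq> \<Omega>"
      using assms(3) unfolding open_contains_cball by blast
    thus "\<exists>r. r > 0 \<and> cball x (2 * r) \<subseteq> \<Omega>" by (intro exI[of _ "e / 2"]) simp
  qed
  from bchoice[OF this] obtain r where r: "\<And>x. x \<in> K \<Longrightarrow> r x > 0" "\<And>x. x \<in> K \<Longrightarrow> cball x (2 * r x) \<subseteq> \<Omega>"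
    by blast
  have "K \<subseteq> (\<Union>x\<in>K. ball x (r x))" using r(1) by fastforce
  then obtain D where D: "D \<subseteq> K" "finite D" "K \<subseteq> (\<Union>x\<in>D. ball x (r x))"
    using compactE_image[OF assms(1), of K "\<lambda>x. ball x (r x)", OF open_ball] by blast
  have "\<forall>x\<in>K. \<exists>\<omega>. smooth \<omega> \<and> (\<forall>y\<in>cball x (r x). \<omega> y = 1) \<and> supp \<omega> \<subseteq> cball x (2 * r x)"
  proof
    fix x assume x: "x \<in> K"
    obtain \<omega> where "smooth \<omega>" "\<forall>y\<in>cball x (r x). \<omega> y = 1" "supp \<omega> \<subseteq> cball x (2 * r x)"
      by (rule ball_cutoff[OF r(1)[OF x], of x])
    thus "\<exists>\<omega>. smooth \<omega> \<and> (\<forall>y\<in>cball x (r x). \<omega> y = 1) \<and> supp \<omega> \<subseteq> cball x (2 * r x)"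
      by blast
  qed
  from bchoice[OF this] obtain \<omega> where
    *: "\<forall>x\<in>K. smooth (\<omega> x) \<and> (\<forall>y\<in>cball x (r x). \<omega> x y = 1) \<and> supp (\<omega> x) \<subseteq> cball x (2 * r x)" ..
  have \<omega>: "smooth (\<omega> x)" "y \<in> cball x (r x) \<Longrightarrow> \<omega> x y = 1" "supp (\<omega> x) \<subseteq> cball x (2 * r x)"
    if "x \<in> K" for x y using bspec[OF * that] by auto
  \<comment> \<open>The product is 0 as soon as one \<open>\<omega> x\<close> equals 1, and it is 1
    where all of them vanish.\<close>
  define \<psi> where "\<psi> = (\<lambda>y. 1 - (\<Prod>x\<in>D. 1 - \<omega> x y))"
  show ?thesis
  proof
    have "smooth \<psi>" unfolding \<psi>_def
      by (intro smooth_diff smooth_prod smooth_const \<omega>) (use D in auto)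
    moreover have "supp \<psi> \<subseteq> (\<Union>x\<in>D. cball x (2 * r x))"
    proof (rule supp_subsetI)
      show "closed (\<Union>x\<in>D. cball x (2 * r x))" using D(2) by (intro closed_UN) auto
      fix y assume y: "y \<notin> (\<Union>x\<in>D. cball x (2 * r x))"
      have "\<omega> x y = 0" if "x \<in> D" for x
      proof (rule zero_outside_supp[of y "\<omega> x"])
        show "y \<notin> supp (\<omega> x)" using \<omega>(3)[of x] D(1) that y by blast
      qed
      thus "\<psi> y = 0" by (simp add: \<psi>_def)
    qed
    ultimately show "\<psi> \<in> test_functions \<Omega>"
      by (rule test_functionsI) (use D r(2) in \<open>auto intro!: compact_UN\<close>)
    show "\<forall>y\<in>K. \<psi> y = 1"
    proof
      fix y assume "y \<in> K"
      then obtain x where x: "x \<in> D" "y \<in> ball x (r x)" using D(3) by blast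
      hence "\<omega> x y = 1" using \<omega>(2)[of x y] D(1) by auto
      hence "(\<Prod>x\<in>D. 1 - \<omega> x y) = 0" using x(1) D(2) by (intro prod_zero) auto
      thus "\<psi> y = 1" by (simp add: \<psi>_def)
    qed
  qed
qed

text \<open>A partition of unity in the form of an induction over a finite cover: a cutoff equal to
  1 on one ball splits \<open>f\<close> into a piece supported near the centre and a remainder whose
  support avoids that ball.\<close>

lemma test_function_localize:
  fixes \<Omega> :: "'a::euclidean_space set"
  assumes \<theta>: "\<theta> \<in> test_functions \<Omega>"
    and zero: "P (\<lambda>x. 0)"
    and add: "\<And>f g. f \<in> test_functions \<Omega> \<Longrightarrow> g \<in> test_functions \<Omega> \<Longrightarrow> P f \<Longrightarrow> P g \<Longrightarrow> P (\<lambda>x. f x + g x)"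
    and loc: "\<And>a. a \<in> supp \<theta> \<Longrightarrow>
      \<exists>r>0. \<forall>f\<in>test_functions \<Omega>. supp f \<subseteq> supp \<theta> \<longrightarrow> supp f \<subseteq> cball a r \<longrightarrow> P f"
  shows "P \<theta>"
proof -
  have "\<forall>a\<in>supp \<theta>. \<exists>r. r > 0 \<and>
      (\<forall>f\<in>test_functions \<Omega>. supp f \<subseteq> supp \<theta> \<longrightarrow> supp f \<subseteq> cball a r \<longrightarrow> P f)"
    using loc by blast
  from bchoice[OF this] obtain r where r: "\<And>a. a \<in> supp \<theta> \<Longrightarrow> r a > 0"
    "\<And>a f. a \<in> supp \<theta> \<Longrightarrow> f \<in> test_functions \<Omega> \<Longrightarrow> supp f \<subseteq> supp \<theta> \<Longrightarrow> supp f \<subseteq> cball a (r a) \<Longrightarrow> P f"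
    by blast
  \<comment> \<open>Half radii, because the cutoff that is 1 on the ball of radius
    \<open>r a / 2\<close> has its support in the ball of radius \<open>r a\<close>.\<close>
  have "supp \<theta> \<subseteq> (\<Union>a\<in>supp \<theta>. ball a (r a / 2))" using r(1) by fastforce
  then obtain D where D: "D \<subseteq> supp \<theta>" "finite D" "supp \<theta> \<subseteq> (\<Union>a\<in>D. ball a (r a / 2))"
    using compactE_image[OF test_functionsD(2)[OF \<theta>], of "supp \<theta>" "\<lambda>a. ball a (r a / 2)", OF open_ball] by blast
  have "P f" if "f \<in> test_functions \<Omega>" "supp f \<subseteq> supp \<theta>" "supp f \<subseteq> (\<Union>a\<in>D. ball a (r a / 2))" for f
    using D(2,1) that
  proof (induction D arbitrary: f rule: finite_induct)
    case empty
    hence "f = (\<lambda>x. 0)" using zero_outside_supp[of _ f] by auto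
    thus ?case using zero by simp
  next
    case (insert a D)
    have ra: "r a > 0" using insert.prems r(1) by blast
    obtain \<omega> where \<omega>: "smooth \<omega>" "\<forall>x\<in>cball a (r a / 2). \<omega> x = 1" "supp \<omega> \<subseteq> cball a (2 * (r a / 2))"
      by (rule ball_cutoff[OF half_gt_zero[OF ra], of a])
    let ?g = "\<lambda>x. f x * \<omega> x" and ?h = "\<lambda>x. f x * (1 - \<omega> x)"
    have g: "?g \<in> test_functions \<Omega>" and h: "?h \<in> test_functions \<Omega>"
      by (intro test_functions_mult smooth_diff smooth_const insert.prems \<omega>)+
    have "supp ?g \<subseteq> supp \<theta>" using supp_mult_left[of f \<omega>] insert.prems(3) by blast
    moreover have "supp ?g \<subseteq> cball a (r a)" using supp_mult_right[of f \<omega>] \<omega>(3) by auto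
    ultimately have Pg: "P ?g" using r(2)[OF _ g] insert.prems(1) by blast
    have "supp ?h \<subseteq> supp f - ball a (r a / 2)"
    proof (rule supp_subsetI)
      show "closed (supp f - ball a (r a / 2))" by (intro closed_Diff) auto
      fix x assume "x \<notin> supp f - ball a (r a / 2)"
      thus "?h x = 0" using zero_outside_supp[of x f] \<omega>(2) by fastforce
    qed
    hence "supp ?h \<subseteq> supp \<theta>" "supp ?h \<subseteq> (\<Union>a\<in>D. ball a (r a / 2))" using insert.prems(3,4) by blast+
    hence "P ?h" using insert.IH[of ?h] insert.prems(1) h by blast
    from add[OF g h Pg this] show ?case by (simp add: algebra_simps)
  qed
  thus ?thesis using \<theta> D(3) by blast
qed

section \<open>Taylor estimates of first and second order\<close>

lemma smooth_lipschitz: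
  fixes f :: "'a::euclidean_space \<Rightarrow> complex" and C :: real
  assumes "smooth f" "\<And>b x. b \<in> Basis \<Longrightarrow> cmod (partial_deriv b f x) \<le> C"
  shows "cmod (f x - f y) \<le> DIM('a) * C * norm (x - y)"
proof (rule differentiable_bound[of UNIV])
  show "(f has_derivative (\<lambda>h. \<Sum>b\<in>Basis. (h \<bullet> b) *\<^sub>R partial_deriv b f x)) (at x within UNIV)" for x
    using has_derivative_partial_deriv[OF smooth_differentiable[OF assms(1)]] by simp
  show "onorm (\<lambda>h. \<Sum>b\<in>Basis. (h \<bullet> b) *\<^sub>R partial_deriv b f x) \<le> DIM('a) * C" for x
  proof (rule onorm_le)
    fix h :: 'a
    have "norm (\<Sum>b\<in>Basis. (h \<bullet> b) *\<^sub>R partial_deriv b f x) \<le> (\<Sum>b\<in>(Basis::'a set). norm h * C)"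
      using assms(2) by (intro order_trans[OF norm_sum] sum_mono) (auto intro!: mult_mono Basis_le_norm)
    thus "norm (\<Sum>b\<in>Basis. (h \<bullet> b) *\<^sub>R partial_deriv b f x) \<le> DIM('a) * C * norm h" by (simp add: mult_ac)
  qed
qed auto

text \<open>The error of the linearisation is controlled by the variation of the derivative over the
  ball of radius \<open>norm h\<close>, which \<open>smooth_lipschitz\<close> bounds. One factor
  \<open>DIM('a)\<close> stems from there, the other from summing over the basis.\<close>

lemma smooth_second_order:
  fixes f :: "'a::euclidean_space \<Rightarrow> complex" and C :: real
  assumes f: "smooth f" and bnd: "derivs_bounded UNIV 2 C f"
  shows "cmod (f (x + h) - f x - (\<Sum>b\<in>Basis. (h \<bullet> b) *\<^sub>R partial_deriv b f x)) \<le> (DIM('a))\<^sup>2 * C * (norm h)\<^sup>2"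
proof -
  let ?D = "\<lambda>x h. \<Sum>b\<in>(Basis::'a set). (h \<bullet> b) *\<^sub>R partial_deriv b f x"
  have lip: "cmod (partial_deriv b f y - partial_deriv b f x) \<le> DIM('a) * C * norm (y - x)" if "b \<in> Basis" for b y
  proof (rule smooth_lipschitz[OF smooth_partial_deriv[OF f that]])
    fix b' z assume "b' \<in> (Basis::'a set)"
    thus "cmod (partial_deriv b' (partial_deriv b f) z) \<le> C"
      using derivs_boundedD[OF bnd, of "[b', b]" z] that by (simp add: partial_deriv_def)
  qed
  have "cmod (f (x + h) - f x - ?D x (x + h - x)) \<le> norm (x + h - x) * (DIM('a) * (DIM('a) * C * norm h))"
  proof (rule differentiable_bound_linearization[where S="cball x (norm h)" and f'="?D"])
    fix t :: real assume "t \<in> {0..1}"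
    thus "x + t *\<^sub>R (x + h - x) \<in> cball x (norm h)" by (auto simp: dist_norm mult_left_le_one_le)
  next
    fix y assume "y \<in> cball x (norm h)"
    hence y: "norm (y - x) \<le> norm h" by (simp add: dist_norm norm_minus_commute)
    show "(f has_derivative ?D y) (at y within cball x (norm h))"
      by (rule has_derivative_at_withinI[OF has_derivative_partial_deriv[OF smooth_differentiable[OF f]]])
    have C: "C \<ge> 0" by (rule order_trans[OF norm_ge_zero derivs_bounded_0D[OF bnd UNIV_I]])
    show "onorm (?D y - ?D x) \<le> DIM('a) * (DIM('a) * C * norm h)"
    proof (rule onorm_le)
      fix k :: 'a
      have "(?D y - ?D x) k = (\<Sum>b\<in>Basis. (k \<bullet> b) *\<^sub>R (partial_deriv b f y - partial_deriv b f x))"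
        by (simp add: scaleR_diff_right sum_subtractf)
      also have "norm \<dots> \<le> (\<Sum>b\<in>(Basis::'a set). norm k * (DIM('a) * C * norm h))"
      proof (intro order_trans[OF norm_sum] sum_mono)
        fix b :: 'a assume b: "b \<in> Basis"
        have "cmod (partial_deriv b f y - partial_deriv b f x) \<le> DIM('a) * C * norm h"
          by (rule order_trans[OF lip[OF b] mult_left_mono[OF y]]) (simp add: C)
        thus "norm ((k \<bullet> b) *\<^sub>R (partial_deriv b f y - partial_deriv b f x)) \<le> norm k * (DIM('a) * C * norm h)"
          using b by (auto intro!: mult_mono Basis_le_norm)
      qed
      finally show "norm ((?D y - ?D x) k) \<le> DIM('a) * (DIM('a) * C * norm h) * norm k" by (simp add: mult_ac)
    qed
  qed simp
  thus ?thesis by (simp add: power2_eq_square mult_ac)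
qed

section \<open>Fourier series on a cube\<close>

definition cube :: "real \<Rightarrow> 'a::euclidean_space set" where
  "cube R = cbox (- (R *\<^sub>R One)) (R *\<^sub>R One)"

definition open_cube :: "real \<Rightarrow> 'a::euclidean_space set" where
  "open_cube R = box (- (R *\<^sub>R One)) (R *\<^sub>R One)"

lemma mem_cube: "x \<in> cube R \<longleftrightarrow> (\<forall>b\<in>Basis. \<bar>x \<bullet> b\<bar> \<le> R)"
  by (auto simp: cube_def mem_box abs_le_iff)

lemma mem_open_cube: "x \<in> open_cube R \<longleftrightarrow> (\<forall>b\<in>Basis. \<bar>x \<bullet> b\<bar> < R)"
  by (auto simp: open_cube_def mem_box abs_less_iff)

lemma open_open_cube [simp]: "open (open_cube R)"
  by (simp add: open_cube_def open_box)

lemma open_cube_subset_cube: "open_cube R \<subseteq> cube R"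
  by (auto simp: mem_cube mem_open_cube less_imp_le)

lemma content_cube_pos: "R > 0 \<Longrightarrow> measure lborel (cube R :: 'a::euclidean_space set) > 0"
  unfolding cube_def by (rule content_pos_lt) simp

lemma bounded_subset_open_cube:
  assumes "bounded (S :: 'a::euclidean_space set)"
  obtains R where "R > 0" "S \<subseteq> open_cube R"
proof -
  obtain B where B: "\<forall>x\<in>S. norm x \<le> B" using assms by (auto simp: bounded_iff)
  have "S \<subseteq> open_cube (\<bar>B\<bar> + 1)"
  proof
    fix x assume "x \<in> S"
    hence "norm x \<le> B" using B by blast
    thus "x \<in> open_cube (\<bar>B\<bar> + 1)" unfolding mem_open_cube
      using Basis_le_norm[of _ x] by (meson abs_ge_self add_strict_increasing2 le_less_trans less_add_one order_trans)
  qed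
  thus ?thesis using that[of "\<bar>B\<bar> + 1"] by linarith
qed

text \<open>The dual lattice of the cube: for \<open>R > 0\<close>, precisely the frequencies whose
  plane waves have period \<open>2 * R\<close> in every coordinate.\<close>

definition wave_lattice :: "real \<Rightarrow> 'a::euclidean_space set" where
  "wave_lattice R = {q. \<forall>b\<in>Basis. \<exists>j::int. q \<bullet> b = of_int j * (pi / R)}"

lemma zero_wave_lattice: "0 \<in> wave_lattice R"
  by (auto simp: wave_lattice_def intro!: exI[of _ 0])

lemma wave_lattice_add: "p \<in> wave_lattice R \<Longrightarrow> q \<in> wave_lattice R \<Longrightarrow> p + q \<in> wave_lattice R"
proof -
  assume p: "p \<in> wave_lattice R" and q: "q \<in> wave_lattice R"
  show "p + q \<in> wave_lattice R" unfolding wave_lattice_def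
  proof (intro CollectI ballI)
    fix b :: 'a assume b: "b \<in> Basis"
    obtain j where "p \<bullet> b = of_int j * (pi / R)" using p b unfolding wave_lattice_def by blast
    moreover obtain k where "q \<bullet> b = of_int k * (pi / R)" using q b unfolding wave_lattice_def by blast
    ultimately have "(p + q) \<bullet> b = of_int (j + k) * (pi / R)" by (simp add: inner_add_left algebra_simps)
    thus "\<exists>j::int. (p + q) \<bullet> b = of_int j * (pi / R)" ..
  qed
qed

lemma wave_lattice_uminus: "p \<in> wave_lattice R \<Longrightarrow> - p \<in> wave_lattice R"
proof -
  assume p: "p \<in> wave_lattice R"
  show "- p \<in> wave_lattice R" unfolding wave_lattice_def
  proof (intro CollectI ballI)
    fix b :: 'a assume b: "b \<in> Basis"
    obtain j where "p \<bullet> b = of_int j * (pi / R)" using p b unfolding wave_lattice_def by blast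
    hence "(- p) \<bullet> b = of_int (- j) * (pi / R)" by simp
    thus "\<exists>j::int. (- p) \<bullet> b = of_int j * (pi / R)" ..
  qed
qed

lemma wave_lattice_basis: "b \<in> Basis \<Longrightarrow> (pi / R) *\<^sub>R b \<in> wave_lattice R"
proof -
  assume b: "b \<in> Basis"
  have "((pi / R) *\<^sub>R b) \<bullet> b' = of_int (if b = b' then 1 else 0) * (pi / R)" if "b' \<in> Basis" for b'
    using b that by (simp add: inner_Basis)
  thus ?thesis unfolding wave_lattice_def by blast
qed

lemma continuous_on_wave: "continuous_on S (wave q)"
  by (rule smooth_continuous_on) simp

lemma wave_integral_shift:
  "integral {x. x + c \<in> cbox a b} (wave q) * wave q c = integral (cbox a b) (wave q)"
proof -
  have eq: "{x. x + c \<in> cbox a b} = cbox (a - c) (b - c)"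
    by (auto simp: mem_box inner_add_left inner_diff_left algebra_simps)
  have "(wave q has_integral integral (cbox a b) (wave q)) (cbox a b)"
    by (intro integrable_integral integrable_continuous continuous_on_wave)
  from has_integral_affinity'[OF this, of 1 c]
  have "((\<lambda>x. wave q (x + c)) has_integral integral (cbox a b) (wave q)) (cbox (a - c) (b - c))" by simp
  hence "((\<lambda>x. wave q x * wave q c) has_integral integral (cbox a b) (wave q)) (cbox (a - c) (b - c))"
    by (simp only: wave_add_right)
  moreover have "((\<lambda>x. wave q x * wave q c) has_integral integral (cbox (a - c) (b - c)) (wave q) * wave q c)
      (cbox (a - c) (b - c))"
    by (intro has_integral_mult_left integrable_integral integrable_continuous continuous_on_wave)
  ultimately show ?thesis unfolding eq using has_integral_unique by blast
qed

lemma exp_int_pi: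
  "exp (\<i> * complex_of_real (of_int j * (2 * pi))) = 1"
  by (metis exp_2pi_1_int mult.commute mult.left_commute of_real_mult of_real_numeral of_real_of_int_eq)

text \<open>Shifting half a period along a coordinate in which \<open>q\<close> does not vanish flips the sign.\<close>
lemma wave_integral_zero:
  fixes q :: "'a::euclidean_space"
  assumes R: "R > 0" and q: "q \<in> wave_lattice R" "q \<noteq> 0"
  shows "integral (cube R) (wave q) = 0"
proof -
  obtain b where b: "b \<in> Basis" "q \<bullet> b \<noteq> 0" using q(2) euclidean_all_zero_iff[of q] by blast
  obtain j :: int where j: "q \<bullet> b = of_int j * (pi / R)" using q(1) b(1) unfolding wave_lattice_def by blast
  have j0: "j \<noteq> 0" using b(2) j by auto
  \<comment> \<open>Half of the period of the wave in the direction \<open>b\<close>.\<close>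
  define t where "t = R / \<bar>of_int j\<bar>"
  have t: "0 < t" "t \<le> R"
    using R j0 by (auto simp: t_def divide_le_eq)
  have w1: "wave q (t *\<^sub>R b) = -1"
  proof -
    have "q \<bullet> (t *\<^sub>R b) = sgn (of_int j) * pi"
      using R j0 by (simp add: j t_def sgn_if)
    hence "q \<bullet> (t *\<^sub>R b) = pi \<or> q \<bullet> (t *\<^sub>R b) = - pi" using j0 by (auto simp: sgn_if)
    thus ?thesis unfolding wave_def
      by (elim disjE) (simp_all add: exp_minus exp_pi_i exp_pi_i')
  qed
  \<comment> \<open>Shifting by \<open>t\<close> pushes a slab of the cube out on one side. Going
    back by the side length \<open>2 * R\<close>, a period of the wave, brings it in again on the
    other side.\<close>
  have w2: "wave q ((t - 2 * R) *\<^sub>R b) = -1"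
  proof -
    have "wave q ((- (2 * R)) *\<^sub>R b) = exp (\<i> * complex_of_real (of_int j * (2 * pi)))"
      using R unfolding wave_def by (simp add: j mult_ac)
    also have "\<dots> = 1" by (rule exp_int_pi)
    finally have "wave q ((- (2 * R)) *\<^sub>R b) = 1" .
    moreover have "(t - 2 * R) *\<^sub>R b = t *\<^sub>R b + (- (2 * R)) *\<^sub>R b" by (simp add: algebra_simps)
    ultimately show ?thesis using w1 by (simp only: wave_add_right) simp
  qed
  let ?Q = "cube R :: 'a set"
  have bx: "\<exists>a' b'. ?Q \<inter> {x. x \<bullet> b \<ge> c} = cbox a' b'" "\<exists>a' b'. ?Q \<inter> {x. x \<bullet> b \<le> c} = cbox a' b'" for c
    unfolding cube_def using interval_split[OF b(1)] by blast+
  have shift: "integral {x. x + c \<in> S} (wave q) * wave q c = integral S (wave q)"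
    if "\<exists>a' b'. S = cbox a' b'" for S c
    using that wave_integral_shift[of c _ _ q] by blast
  define P where "P = (\<lambda>x::'a. \<forall>b'\<in>Basis - {b}. \<bar>x \<bullet> b'\<bar> \<le> R)"
  have mem: "x \<in> ?Q \<longleftrightarrow> P x \<and> \<bar>x \<bullet> b\<bar> \<le> R" for x
    using b(1) by (auto simp: mem_cube P_def)
  have P: "P (x + s *\<^sub>R b) \<longleftrightarrow> P x" for x s
    using b(1) by (auto simp: P_def inner_add_left inner_Basis)
  have xb: "(x + s *\<^sub>R b) \<bullet> b = x \<bullet> b + s" for x s
    using b(1) by (simp add: inner_add_left)
  have s1: "{x. x + t *\<^sub>R b \<in> ?Q \<inter> {x. x \<bullet> b \<ge> t - R}} = ?Q \<inter> {x. x \<bullet> b \<le> R - t}"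
    using t R by (auto simp: mem P xb)
  have s2: "{x. x + (t - 2 * R) *\<^sub>R b \<in> ?Q \<inter> {x. x \<bullet> b \<le> t - R}} = ?Q \<inter> {x. x \<bullet> b \<ge> R - t}"
    using t R by (auto simp: mem P xb)
  have int: "wave q integrable_on ?Q"
    unfolding cube_def by (intro integrable_continuous continuous_on_wave)
  have split: "integral ?Q (wave q) = integral (?Q \<inter> {x. x \<bullet> b \<le> c}) (wave q) + integral (?Q \<inter> {x. x \<bullet> b \<ge> c}) (wave q)" for c
    using integral_split[OF int[unfolded cube_def] b(1), of c] by (simp only: cube_def)
  \<comment> \<open>Up to sign, the two slabs of the cut at \<open>t - R\<close> have the same
    integrals as the two slabs of the cut at \<open>R - t\<close>, so the whole integral equals its
    own negative.\<close>
  have "integral (?Q \<inter> {x. x \<bullet> b \<ge> t - R}) (wave q) = - integral (?Q \<inter> {x. x \<bullet> b \<le> R - t}) (wave q)"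
    using shift[OF bx(1), of "t *\<^sub>R b" "t - R"] unfolding s1 w1 by simp
  moreover have "integral (?Q \<inter> {x. x \<bullet> b \<le> t - R}) (wave q) = - integral (?Q \<inter> {x. x \<bullet> b \<ge> R - t}) (wave q)"
    using shift[OF bx(2), of "(t - 2 * R) *\<^sub>R b" "t - R"] unfolding s2 w2 by simp
  ultimately have "integral ?Q (wave q) = - integral ?Q (wave q)"
    using split[of "t - R"] split[of "R - t"] by simp
  thus ?thesis by simp
qed

lemma two_cos_wave:
  "complex_of_real (2 * cos (r * (x \<bullet> b - y \<bullet> b))) =
    wave (r *\<^sub>R b) x * wave (- (r *\<^sub>R b)) y + wave (- (r *\<^sub>R b)) x * wave (r *\<^sub>R b) y"
proof -
  have "wave (r *\<^sub>R b) x * wave (- (r *\<^sub>R b)) y = exp (- (\<i> * complex_of_real (r * (x \<bullet> b - y \<bullet> b))))"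
    "wave (- (r *\<^sub>R b)) x * wave (r *\<^sub>R b) y = exp (\<i> * complex_of_real (r * (x \<bullet> b - y \<bullet> b)))"
    unfolding wave_def exp_add[symmetric] by (simp_all add: algebra_simps inner_commute)
  thus ?thesis by (simp add: cos_of_real[symmetric] cos_exp_eq del: cos_of_real)
qed

text \<open>
  The trigonometric polynomials \<open>q\<^sup>n\<close> with \<open>0 \<le> q \<le> 1\<close>, where \<open>q\<close> attains the value 1 in the cube
  only at the point in question, concentrate at that point.
\<close>
lemma fourier_unique:
  fixes h :: "'a::euclidean_space \<Rightarrow> complex"
  assumes R: "R > 0" and cont: "continuous_on (cube R) h"
    and int: "\<And>p. p \<in> wave_lattice R \<Longrightarrow> ((\<lambda>x. h x * wave p x) has_integral 0) (cube R)"
    and x0: "x0 \<in> open_cube R"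
  shows "h x0 = 0"
proof (rule ccontr)
  assume h0: "h x0 \<noteq> 0"
  let ?Q = "cube R :: 'a set" and ?d = "real DIM('a)"
  \<comment> \<open>The average over the coordinates of (1 + cos) / 2, hence between 0 and 1. It is
    1 only where all coordinate differences are multiples of \<open>2 * R\<close>; since
    \<open>x0\<close> is interior, \<open>x0\<close> is the only such point of the cube.\<close>
  define q where "q = (\<lambda>x::'a. 1 - (\<Sum>b\<in>Basis. 1 - cos (pi / R * (x \<bullet> b - x0 \<bullet> b))) / (2 * ?d))"
  have d0: "?d > 0" by simp
  have q_nonneg: "0 \<le> q x" and q_le: "q x \<le> 1" for x
  proof -
    have "(\<Sum>b\<in>(Basis::'a set). 1 - cos (pi / R * (x \<bullet> b - x0 \<bullet> b))) \<le> (\<Sum>b\<in>(Basis::'a set). 2)"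
      by (rule sum_mono) (use cos_ge_minus_one in \<open>smt (verit)\<close>)
    thus "0 \<le> q x" using d0 by (simp add: q_def divide_le_eq)
    have "0 \<le> (\<Sum>b\<in>(Basis::'a set). 1 - cos (pi / R * (x \<bullet> b - x0 \<bullet> b)))"
      by (rule sum_nonneg) simp
    thus "q x \<le> 1" by (simp add: q_def)
  qed
  have q_less: "q x < 1" if x: "x \<in> ?Q" "x \<noteq> x0" for x
  proof -
    obtain b where b: "b \<in> Basis" "x \<bullet> b \<noteq> x0 \<bullet> b" using x(2) euclidean_eq_iff[of x x0] by blast
    have lt: "\<bar>x \<bullet> b - x0 \<bullet> b\<bar> < 2 * R"
      using x(1) x0 b(1) unfolding mem_cube mem_open_cube by (smt (verit))
    have "cos (pi / R * (x \<bullet> b - x0 \<bullet> b)) \<noteq> 1"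
    proof
      assume "cos (pi / R * (x \<bullet> b - x0 \<bullet> b)) = 1"
      then obtain m :: int where m: "pi / R * (x \<bullet> b - x0 \<bullet> b) = of_int m * 2 * pi"
        unfolding cos_one_2pi_int by blast
      have "x \<bullet> b - x0 \<bullet> b = R / pi * (pi / R * (x \<bullet> b - x0 \<bullet> b))" using R by simp
      also have "\<dots> = of_int m * (2 * R)" unfolding m by simp
      finally have eq: "x \<bullet> b - x0 \<bullet> b = of_int m * (2 * R)" .
      hence "\<bar>of_int m\<bar> * (2 * R) < 1 * (2 * R)" using lt R by (simp add: abs_mult)
      hence "\<bar>real_of_int m\<bar> < 1" using R by (simp only: mult_less_cancel_right_pos)
      hence "m = 0" by linarith
      thus False using eq b(2) by simp
    qed
    hence "0 < 1 - cos (pi / R * (x \<bullet> b - x0 \<bullet> b))"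
      using cos_le_one[of "pi / R * (x \<bullet> b - x0 \<bullet> b)"] by linarith
    hence "0 < (\<Sum>b\<in>Basis. 1 - cos (pi / R * (x \<bullet> b - x0 \<bullet> b)))"
      using b(1) by (intro sum_pos2[of _ b]) auto
    thus ?thesis using d0 by (simp add: q_def)
  qed
  have q_x0: "q x0 = 1" by (simp add: q_def)
  have q_cont: "continuous_on S q" for S
    unfolding q_def by (intro continuous_intros) (use d0 in auto)
  have q_wave: "complex_of_real (q x) = 1 / 2 + (\<Sum>b\<in>Basis. complex_of_real (1 / (4 * ?d)) *
      (wave (- ((pi / R) *\<^sub>R b)) x0 * wave ((pi / R) *\<^sub>R b) x + wave ((pi / R) *\<^sub>R b) x0 * wave (- ((pi / R) *\<^sub>R b)) x))" for x
  proof -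
    have "q x = 1 / 2 + (\<Sum>b\<in>Basis. 1 / (4 * ?d) * (2 * cos (pi / R * (x \<bullet> b - x0 \<bullet> b))))"
      using d0 by (simp add: q_def sum_subtractf sum_distrib_left[symmetric] diff_divide_distrib sum_divide_distrib[symmetric])
    hence "complex_of_real (q x) = 1 / 2 + (\<Sum>b\<in>Basis. complex_of_real (1 / (4 * ?d)) * complex_of_real (2 * cos (pi / R * (x \<bullet> b - x0 \<bullet> b))))"
      by (simp only: of_real_add of_real_sum of_real_mult of_real_divide of_real_1 of_real_numeral)
    thus ?thesis unfolding two_cos_wave by (simp add: mult.commute)
  qed
  \<comment> \<open>By \<open>q_wave\<close>, multiplication by \<open>q\<close> shifts frequencies
    by lattice vectors only, so vanishing against all lattice waves passes from \<open>h\<close> to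
    \<open>h * q ^ n\<close>.\<close>
  have J: "((\<lambda>x. h x * complex_of_real (q x) ^ n * wave p x) has_integral 0) ?Q" if "p \<in> wave_lattice R" for n p
    using that
  proof (induction n arbitrary: p)
    case 0
    thus ?case using int by simp
  next
    case (Suc n)
    let ?g = "\<lambda>p x. h x * complex_of_real (q x) ^ n * wave p x"
    have "((\<lambda>x. 1 / 2 * ?g p x + (\<Sum>b\<in>Basis. complex_of_real (1 / (4 * ?d)) *
        (wave (- ((pi / R) *\<^sub>R b)) x0 * ?g (p + (pi / R) *\<^sub>R b) x + wave ((pi / R) *\<^sub>R b) x0 * ?g (p + - ((pi / R) *\<^sub>R b)) x)))
      has_integral 1 / 2 * 0 + (\<Sum>b\<in>(Basis::'a set). complex_of_real (1 / (4 * ?d)) *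
        (wave (- ((pi / R) *\<^sub>R b)) x0 * 0 + wave ((pi / R) *\<^sub>R b) x0 * 0))) ?Q"
      by (intro has_integral_add has_integral_sum has_integral_mult_right Suc.IH Suc.prems
            wave_lattice_add wave_lattice_uminus wave_lattice_basis) auto
    moreover have "1 / 2 * ?g p x + (\<Sum>b\<in>Basis. complex_of_real (1 / (4 * ?d)) *
        (wave (- ((pi / R) *\<^sub>R b)) x0 * ?g (p + (pi / R) *\<^sub>R b) x + wave ((pi / R) *\<^sub>R b) x0 * ?g (p + - ((pi / R) *\<^sub>R b)) x))
      = h x * complex_of_real (q x) ^ Suc n * wave p x" for x
    proof -
      have "h x * complex_of_real (q x) ^ Suc n * wave p x = ?g p x * complex_of_real (q x)"
        by (simp add: mult_ac)
      also have "\<dots> = 1 / 2 * ?g p x + (\<Sum>b\<in>Basis. ?g p x * (complex_of_real (1 / (4 * ?d)) *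
        (wave (- ((pi / R) *\<^sub>R b)) x0 * wave ((pi / R) *\<^sub>R b) x + wave ((pi / R) *\<^sub>R b) x0 * wave (- ((pi / R) *\<^sub>R b)) x)))"
        unfolding q_wave[of x] distrib_left sum_distrib_left by (simp add: mult.commute)
      also have "(\<Sum>b\<in>Basis. ?g p x * (complex_of_real (1 / (4 * ?d)) *
        (wave (- ((pi / R) *\<^sub>R b)) x0 * wave ((pi / R) *\<^sub>R b) x + wave ((pi / R) *\<^sub>R b) x0 * wave (- ((pi / R) *\<^sub>R b)) x)))
       = (\<Sum>b\<in>Basis. complex_of_real (1 / (4 * ?d)) *
        (wave (- ((pi / R) *\<^sub>R b)) x0 * ?g (p + (pi / R) *\<^sub>R b) x + wave ((pi / R) *\<^sub>R b) x0 * ?g (p + - ((pi / R) *\<^sub>R b)) x))"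
        by (rule sum.cong) (simp_all only: wave_add distrib_left mult_ac)
      finally show ?thesis by simp
    qed
    ultimately show ?case by simp
  qed
  \<comment> \<open>Multiplying by the conjugate of \<open>h x0\<close> and taking real parts gives
    a real function that is positive at \<open>x0\<close> and still has integral 0 against every
    \<open>q ^ n\<close>.\<close>
  define g where "g = (\<lambda>x. Re (cnj (h x0) * h x))"
  have g_int: "((\<lambda>x. g x * q x ^ n) has_integral 0) ?Q" for n
  proof -
    have "((\<lambda>x. cnj (h x0) * (h x * complex_of_real (q x) ^ n * wave 0 x)) has_integral cnj (h x0) * 0) ?Q"
      by (intro has_integral_mult_right J zero_wave_lattice)
    from has_integral_linear[OF this bounded_linear_Re]
    have "((\<lambda>x. Re (cnj (h x0) * h x * complex_of_real (q x ^ n))) has_integral 0) ?Q"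
      by (simp add: o_def mult.assoc)
    moreover have "Re (cnj (h x0) * h x * complex_of_real (q x ^ n)) = g x * q x ^ n" for x
      unfolding g_def by (simp only: Re_complex_of_real Im_complex_of_real times_complex.simps)
    ultimately show ?thesis by (simp only:)
  qed
  define \<delta> where "\<delta> = (cmod (h x0))\<^sup>2 / 2"
  have \<delta>: "\<delta> > 0" using h0 by (simp add: \<delta>_def)
  have g_cont: "continuous_on ?Q g" unfolding g_def by (intro continuous_intros cont)
  have g_x0: "g x0 = 2 * \<delta>"
    using cmod_power2[of "h x0"] by (simp add: g_def \<delta>_def power2_eq_square)
  have x0Q: "x0 \<in> ?Q" using x0 open_cube_subset_cube by blast
  obtain r where r: "r > 0" "\<forall>x\<in>?Q. dist x x0 < r \<longrightarrow> dist (g x) (g x0) < \<delta>"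
    using g_cont x0Q \<delta> unfolding continuous_on_iff by blast
  have cQ: "compact ?Q" by (simp add: cube_def)
  have "bounded (g ` ?Q)" by (intro compact_imp_bounded compact_continuous_image g_cont cQ)
  then obtain M0 where "\<forall>x\<in>?Q. \<bar>g x\<bar> \<le> M0" by (auto simp: bounded_iff)
  then obtain M where M: "M \<ge> 0" "\<And>x. x \<in> ?Q \<Longrightarrow> \<bar>g x\<bar> \<le> M"
    by (intro that[of "\<bar>M0\<bar>"]) fastforce+
  have "\<exists>\<mu>. 0 \<le> \<mu> \<and> \<mu> < 1 \<and> (\<forall>x\<in>?Q - ball x0 r. q x \<le> \<mu>)"
  proof (cases "?Q - ball x0 r = {}")
    case True thus ?thesis by (intro exI[of _ 0]) auto
  next
    case False
    have "compact (?Q - ball x0 r)" by (intro compact_diff cQ) auto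
    then obtain y where "y \<in> ?Q - ball x0 r" "\<forall>x\<in>?Q - ball x0 r. q x \<le> q y"
      using continuous_attains_sup[OF _ False q_cont] by blast
    moreover from this have "q y < 1" using r(1) by (intro q_less) auto
    ultimately show ?thesis using q_nonneg by blast
  qed
  then obtain \<mu> where \<mu>: "0 \<le> \<mu>" "\<mu> < 1" "\<And>x. x \<in> ?Q \<Longrightarrow> x \<notin> ball x0 r \<Longrightarrow> q x \<le> \<mu>" by blast
  \<comment> \<open>Strictly between \<open>\<mu>\<close> and 1. Away from \<open>x0\<close> the
    powers of \<open>q\<close> are at most \<open>\<mu> ^ n\<close>, while on a small box, of
    positive volume, they are at least \<open>\<nu> ^ n\<close>; the quotient of the two tends to 0,
    so the part near \<open>x0\<close> cannot be cancelled.\<close>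
  define \<nu> where "\<nu> = (1 + \<mu>) / 2"
  have \<nu>: "\<mu> < \<nu>" "\<nu> < 1" "0 < \<nu>" using \<mu> by (auto simp: \<nu>_def)
  define U where "U = open_cube R \<inter> ball x0 r \<inter> {x. q x > \<nu>}"
  have "open {x. q x > \<nu>}" using q_cont by (intro open_Collect_less) auto
  hence "open U" unfolding U_def by (intro open_Int) auto
  moreover have "x0 \<in> U" using x0 r(1) q_x0 \<nu> by (simp add: U_def)
  ultimately obtain a c where ac: "cbox a c \<subseteq> U" "\<forall>i\<in>Basis. a \<bullet> i < c \<bullet> i"
    by (rule open_contains_cbox)
  have UQ: "cbox a c \<subseteq> ?Q" using ac(1) open_cube_subset_cube unfolding U_def by blast
  have key: "\<delta> * \<nu> ^ n * measure lborel (cbox a c) \<le> M * \<mu> ^ n * measure lborel ?Q" for n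
  proof -
    have "((\<lambda>x. if x \<in> cbox a c then \<delta> * \<nu> ^ n else 0) has_integral measure lborel (cbox a c) *\<^sub>R (\<delta> * \<nu> ^ n)) ?Q"
      unfolding has_integral_restrict[OF UQ] by (rule has_integral_const)
    moreover have "((\<lambda>x. M * \<mu> ^ n) has_integral measure lborel ?Q *\<^sub>R (M * \<mu> ^ n)) ?Q"
      unfolding cube_def by (rule has_integral_const)
    ultimately have "((\<lambda>x. (if x \<in> cbox a c then \<delta> * \<nu> ^ n else 0) - M * \<mu> ^ n) has_integral
        measure lborel (cbox a c) *\<^sub>R (\<delta> * \<nu> ^ n) - measure lborel ?Q *\<^sub>R (M * \<mu> ^ n)) ?Q"
      by (rule has_integral_diff)
    hence "measure lborel (cbox a c) *\<^sub>R (\<delta> * \<nu> ^ n) - measure lborel ?Q *\<^sub>R (M * \<mu> ^ n) \<le> 0"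
    proof (rule has_integral_le[OF _ g_int[of n]])
      fix x assume x: "x \<in> ?Q"
      have Mn: "0 \<le> M * \<mu> ^ n" using M(1) \<mu>(1) by simp
      have near: "g x > \<delta>" if "x \<in> ball x0 r"
        using r(2) x that g_x0 by (force simp: dist_commute dist_real_def abs_less_iff)
      show "(if x \<in> cbox a c then \<delta> * \<nu> ^ n else 0) - M * \<mu> ^ n \<le> g x * q x ^ n"
      proof (cases "x \<in> ball x0 r")
        case True
        show ?thesis
        proof (cases "x \<in> cbox a c")
          case xc: True
          hence "q x > \<nu>" using ac(1) by (auto simp: U_def)
          hence "\<delta> * \<nu> ^ n \<le> g x * q x ^ n"
            using near[OF True] \<nu>(3) \<delta> by (intro mult_mono power_mono) auto
          thus ?thesis using Mn xc by simp
        next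
          case False
          have "0 \<le> g x * q x ^ n" using near[OF True] \<delta> q_nonneg[of x] by simp
          thus ?thesis using Mn False by simp
        qed
      next
        case False
        hence "x \<notin> cbox a c" using ac(1) by (auto simp: U_def)
        moreover have "\<bar>g x * q x ^ n\<bar> \<le> M * \<mu> ^ n"
          unfolding abs_mult using M x \<mu> False q_nonneg[of x]
          by (intro mult_mono) (auto simp: power_abs intro!: power_mono)
        ultimately show ?thesis by simp
      qed
    qed
    thus ?thesis by (simp add: mult_ac)
  qed
  have "\<delta> * measure lborel (cbox a c) \<le> M * measure lborel ?Q * (\<mu> / \<nu>) ^ n" for n
    using key[of n] \<nu>(3) by (simp add: power_divide field_simps)
  moreover have "(\<lambda>n. M * measure lborel ?Q * (\<mu> / \<nu>) ^ n) \<longlonglongrightarrow> M * measure lborel ?Q * 0"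
    by (intro tendsto_mult tendsto_const LIMSEQ_power_zero) (use \<mu> \<nu> in auto)
  ultimately have "\<delta> * measure lborel (cbox a c) \<le> 0"
    by (intro LIMSEQ_le_const[of "\<lambda>n. M * measure lborel ?Q * (\<mu> / \<nu>) ^ n"]) auto
  moreover have "measure lborel (cbox a c) > 0" using ac(2) by (rule content_pos_lt)
  ultimately show False using \<delta> by (simp add: mult_le_0_iff)
qed

text \<open>A consequence of translation invariance: g(x + tb) and g(x) have the same integral, and
  their difference is t times the derivative up to O(t^2). Dividing by t and letting t tend to 0
  gives the claim.\<close>

lemma integral_partial_deriv_zero:
  fixes g :: "'a::euclidean_space \<Rightarrow> complex"
  assumes g: "smooth g" "supp g \<subseteq> cube R" and b: "b \<in> Basis"
  shows "integral (cube R) (partial_deriv b g) = 0"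
proof -
  \<comment> \<open>The margin 1 of the larger cube makes room for all translates by at most
    1.\<close>
  let ?Q = "cube R :: 'a set" and ?Q' = "cube (R + 1) :: 'a set"
  have out: "f x = 0" if "supp f \<subseteq> supp g" "x \<notin> ?Q" for f and x :: 'a
  proof (rule zero_outside_supp[of x f])
    show "x \<notin> supp f" using that g(2) by blast
  qed
  have QQ': "?Q \<subseteq> ?Q'" unfolding mem_cube subset_iff by fastforce
  have int: "(f has_integral integral ?Q f) ?Q'" if "smooth f" "supp f \<subseteq> supp g" for f
  proof (rule has_integral_on_superset[OF _ out[OF that(2)] QQ'])
    show "(f has_integral integral ?Q f) ?Q"
      unfolding cube_def by (intro integrable_integral integrable_continuous smooth_continuous_on that)
  qed
  obtain C where C: "C \<ge> 0" "derivs_bounded ?Q 2 C g"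
    by (rule derivs_bounded_compact[OF g(1), of ?Q 2]) (simp_all add: cube_def)
  hence C': "derivs_bounded UNIV 2 C g" using derivs_bounded_UNIV[OF C(2) g(2)] by blast
  define P where "P = integral ?Q (partial_deriv b g)"
  define D where "D = (DIM('a))\<^sup>2 * C * measure lborel ?Q'"
  have le: "cmod P \<le> t * D" if t: "0 < t" "t \<le> 1" for t
  proof -
    have eq: "cbox (- (R *\<^sub>R One) - t *\<^sub>R b) (R *\<^sub>R One - t *\<^sub>R b) = {x. x + t *\<^sub>R b \<in> ?Q}"
      by (auto simp: cube_def mem_box inner_add_left inner_diff_left algebra_simps)
    have "(g has_integral integral ?Q g) (cbox (- (R *\<^sub>R One)) (R *\<^sub>R One))"
      unfolding cube_def by (intro integrable_integral integrable_continuous smooth_continuous_on g)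
    from has_integral_affinity'[OF this, of 1 "t *\<^sub>R b"]
    have "((\<lambda>x. g (x + t *\<^sub>R b)) has_integral integral ?Q g) {x. x + t *\<^sub>R b \<in> ?Q}"
      by (simp add: eq)
    hence "((\<lambda>x. g (x + t *\<^sub>R b)) has_integral integral ?Q g) ?Q'"
    proof (rule has_integral_on_superset)
      show "g (x + t *\<^sub>R b) = 0" if "x \<notin> {x. x + t *\<^sub>R b \<in> ?Q}" for x
        using that out[of g "x + t *\<^sub>R b"] by simp
      show "{x. x + t *\<^sub>R b \<in> ?Q} \<subseteq> ?Q'"
      proof
        fix x assume "x \<in> {x. x + t *\<^sub>R b \<in> ?Q}"
        hence x: "\<bar>x \<bullet> b' + t * (b \<bullet> b')\<bar> \<le> R" if "b' \<in> Basis" for b'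
          using that by (auto simp: mem_cube inner_add_left)
        have "\<bar>t * (b \<bullet> b')\<bar> \<le> 1" if "b' \<in> Basis" for b'
          using that b t by (auto simp: inner_Basis)
        thus "x \<in> ?Q'" unfolding mem_cube using x by (smt (verit))
      qed
    qed
    from has_integral_diff[OF has_integral_diff[OF this int[OF g(1) order_refl]]
        has_integral_mult_right[OF int[OF smooth_partial_deriv[OF g(1) b] supp_partial_deriv], of "complex_of_real t"]]
    have "((\<lambda>x. g (x + t *\<^sub>R b) - g x - complex_of_real t * partial_deriv b g x) has_integral - (complex_of_real t * P)) ?Q'"
      by (simp add: P_def)
    moreover have "cmod (g (x + t *\<^sub>R b) - g x - complex_of_real t * partial_deriv b g x) \<le> (DIM('a))\<^sup>2 * C * t\<^sup>2" for x
    proof -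
      have "(\<Sum>b'\<in>Basis. ((t *\<^sub>R b) \<bullet> b') *\<^sub>R partial_deriv b' g x) = complex_of_real t * partial_deriv b g x"
      proof -
        have "(\<Sum>b'\<in>Basis. ((t *\<^sub>R b) \<bullet> b') *\<^sub>R partial_deriv b' g x) =
            (\<Sum>b'\<in>Basis. if b' = b then complex_of_real t * partial_deriv b g x else 0)"
          by (rule sum.cong) (use b in \<open>auto simp: inner_Basis scaleR_conv_of_real\<close>)
        thus ?thesis using b by simp
      qed
      thus ?thesis using smooth_second_order[OF g(1) C', of x "t *\<^sub>R b"] b by simp
    qed
    ultimately have "cmod (- (complex_of_real t * P)) \<le> (DIM('a))\<^sup>2 * C * t\<^sup>2 * measure lborel ?Q'"
      unfolding cube_def using C(1) by (intro has_integral_bound) auto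
    hence "t * cmod P \<le> t * (t * D)"
      using t by (simp add: norm_mult D_def power2_eq_square mult_ac)
    thus ?thesis using t by simp
  qed
  have D0: "D \<ge> 0" using C(1) by (simp add: D_def)
  have "cmod P \<le> 0"
  proof (rule field_le_epsilon)
    fix e :: real assume e: "e > 0"
    define t where "t = min 1 (e / (\<bar>D\<bar> + 1))"
    have t: "0 < t" "t \<le> 1" "t \<le> e / (\<bar>D\<bar> + 1)" using e by (auto simp: t_def)
    have "cmod P \<le> t * D" by (rule le[OF t(1,2)])
    also have "\<dots> \<le> e / (\<bar>D\<bar> + 1) * (\<bar>D\<bar> + 1)" using t D0 by (intro mult_mono) auto
    also have "\<dots> = e" by (simp add: add_nonneg_eq_0_iff)
    finally show "cmod P \<le> 0 + e" by simp
  qed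
  thus ?thesis by (simp add: P_def)
qed

section \<open>Fourier coefficients: decay, summability and convergence of the series\<close>

definition fourier_coeff :: "real \<Rightarrow> ('a::euclidean_space \<Rightarrow> complex) \<Rightarrow> 'a \<Rightarrow> complex" where
  "fourier_coeff R a q =
    integral (cube R) (\<lambda>x. a x * wave (- q) x) / complex_of_real (measure lborel (cube R :: 'a set))"

text \<open>Integration by parts: the derivative of \<open>a * wave (- q)\<close> integrates to 0,
  because the product is supported in the cube.\<close>

lemma fourier_coeff_partial_deriv:
  assumes "smooth a" "supp a \<subseteq> cube R" "b \<in> Basis"
  shows "fourier_coeff R (partial_deriv b a) q = - (\<i> * complex_of_real (q \<bullet> b)) * fourier_coeff R a q"
proof -
  let ?I = "integral (cube R)"
  have sm: "smooth (\<lambda>x. a x * wave (- q) x)" using assms by (intro smooth_mult) auto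
  have "supp (\<lambda>x. a x * wave (- q) x) \<subseteq> cube R" using supp_mult_left[of a "wave (- q)"] assms(2) by (rule order_trans)
  from integral_partial_deriv_zero[OF sm this assms(3)]
  have "0 = ?I (\<lambda>x. partial_deriv b a x * wave (- q) x + a x * partial_deriv b (wave (- q)) x)"
    using assms(1) by (simp add: partial_deriv_mult smooth_differentiable wave_differentiable)
  also have "\<dots> = ?I (\<lambda>x. partial_deriv b a x * wave (- q) x + (\<i> * complex_of_real (q \<bullet> b)) * (a x * wave (- q) x))"
    by (simp add: partial_deriv_wave mult_ac)
  also have "\<dots> = ?I (\<lambda>x. partial_deriv b a x * wave (- q) x) + (\<i> * complex_of_real (q \<bullet> b)) * ?I (\<lambda>x. a x * wave (- q) x)"
    unfolding cube_def
    by (subst integral_add) (auto intro!: integrable_continuous smooth_continuous_on smooth_mult smooth_partial_deriv assms)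
  finally have "?I (\<lambda>x. partial_deriv b a x * wave (- q) x) = - (\<i> * complex_of_real (q \<bullet> b)) * ?I (\<lambda>x. a x * wave (- q) x)"
    by (simp add: eq_neg_iff_add_eq_0)
  thus ?thesis unfolding fourier_coeff_def by simp
qed

text \<open>Multiplied by the wave, the identity says that Fourier series may be differentiated term
  by term, without any mention of eigenvalues.\<close>

lemma fourier_coeff_iterated_partial:
  assumes "smooth a" "supp a \<subseteq> cube R" "set bs \<subseteq> Basis"
  shows "fourier_coeff R (iterated_partial bs a) q * wave q x = fourier_coeff R a q * iterated_partial bs (wave q) x"
proof -
  have "fourier_coeff R (iterated_partial bs a) q = (\<Prod>b\<leftarrow>bs. - (\<i> * complex_of_real (q \<bullet> b))) * fourier_coeff R a q"
    using assms(3)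
  proof (induction bs)
    case (Cons b bs)
    have "supp (iterated_partial bs a) \<subseteq> cube R" using supp_iterated_partial assms(2) by (rule order_trans)
    moreover have "smooth (iterated_partial bs a)" using Cons.prems assms(1) by (intro smooth_iterated_partial) auto
    ultimately show ?case using Cons
      by (simp add: iterated_partial_Cons fourier_coeff_partial_deriv del: iterated_partial.simps(2))
  qed simp
  thus ?thesis using assms(3) by (simp add: iterated_partial_wave)
qed

lemma fourier_coeff_bound:
  fixes a :: "'a::euclidean_space \<Rightarrow> complex"
  assumes "R > 0" "continuous_on (cube R) a" "C \<ge> 0" "\<And>x. cmod (a x) \<le> C"
  shows "cmod (fourier_coeff R a q) \<le> C"
proof -
  have "cmod (integral (cube R) (\<lambda>x. a x * wave (- q) x)) \<le> C * measure lborel (cube R :: 'a set)"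
    unfolding cube_def
  proof (rule has_integral_bound[OF assms(3)])
    show "((\<lambda>x. a x * wave (- q) x) has_integral integral (cbox (- (R *\<^sub>R One)) (R *\<^sub>R One)) (\<lambda>x. a x * wave (- q) x))
        (cbox (- (R *\<^sub>R One)) (R *\<^sub>R One))"
      using assms(2) unfolding cube_def
      by (intro integrable_integral integrable_continuous continuous_intros continuous_on_wave)
  qed (use assms(4) in \<open>auto simp: norm_mult\<close>)
  thus ?thesis using content_cube_pos[OF assms(1), where 'a='a]
    by (simp add: fourier_coeff_def norm_divide divide_le_eq)
qed

text \<open>Every derivative in the direction of the largest coordinate \<open>m\<close> of
  \<open>q\<close> gains a factor \<open>m\<close>, and \<open>norm q \<le> DIM('a) * m\<close>. For
  \<open>m < 1\<close> nothing is gained, whence \<open>max 1 m\<close>; the constant comes from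
  \<open>1 + norm q \<le> (1 + DIM('a)) * max 1 m\<close>.\<close>

lemma fourier_coeff_decay:
  fixes a :: "'a::euclidean_space \<Rightarrow> complex" and C :: real
  assumes R: "R > 0" and a: "smooth a" "supp a \<subseteq> cube R" "derivs_bounded UNIV M C a"
  shows "cmod (fourier_coeff R a q) \<le> (1 + DIM('a)) ^ M * C / (1 + norm q) ^ M"
proof -
  let ?c = "fourier_coeff R a q" and ?B = "(\<lambda>b. \<bar>q \<bullet> b\<bar>) ` (Basis :: 'a set)"
  have C: "C \<ge> 0" by (rule order_trans[OF norm_ge_zero derivs_bounded_0D[OF a(3) UNIV_I]])
  have "Max ?B \<in> ?B" by (rule Max_in) auto
  then obtain b where b: "b \<in> Basis" "Max ?B = \<bar>q \<bullet> b\<bar>" by (elim imageE) rule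
  define m where "m = \<bar>q \<bullet> b\<bar>"
  have le: "\<bar>q \<bullet> b'\<bar> \<le> m" if "b' \<in> Basis" for b' unfolding m_def b(2)[symmetric] using that by (intro Max_ge) auto
  have "norm q \<le> (\<Sum>b'\<in>(Basis::'a set). m)" by (rule order_trans[OF norm_le_l1 sum_mono]) (rule le)
  hence nq: "norm q \<le> DIM('a) * m" by simp
  have m: "m \<ge> 0" by (simp add: m_def)
  have cle: "max 1 m ^ M * cmod ?c \<le> C"
  proof -
    have key: "m ^ k * cmod ?c \<le> C" if "k \<le> M" for k
    proof -
      let ?bs = "replicate k b"
      have bs: "set ?bs \<subseteq> Basis" using b by auto
      have "cmod (fourier_coeff R (iterated_partial ?bs a) q) \<le> C"
      proof (rule fourier_coeff_bound[OF R _ C])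
        show "continuous_on (cube R) (iterated_partial ?bs a)"
          by (intro smooth_continuous_on smooth_iterated_partial a bs)
        show "cmod (iterated_partial ?bs a x) \<le> C" for x
          using derivs_boundedD[OF a(3) bs] that by simp
      qed
      moreover have "cmod (fourier_coeff R (iterated_partial ?bs a) q) = m ^ k * cmod ?c"
      proof -
        have "cmod (fourier_coeff R (iterated_partial ?bs a) q * wave q 0) = cmod (?c * iterated_partial ?bs (wave q) 0)"
          using fourier_coeff_iterated_partial[OF a(1,2) bs, of q 0] by simp
        thus ?thesis using iterated_partial_wave[OF bs, of q 0]
          by (simp add: norm_mult norm_power m_def prod_list_replicate)
      qed
      ultimately show ?thesis by simp
    qed
    show ?thesis
    proof (cases "m \<ge> 1")
      case True thus ?thesis using key[of M] by (simp add: max_def)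
    next
      case False thus ?thesis using key[of 0] by (simp add: max_def)
    qed
  qed
  have "1 + norm q \<le> 1 + DIM('a) * max 1 m"
    using order_trans[OF nq mult_left_mono[of m "max 1 m" "real DIM('a)"]] by simp
  also have "\<dots> \<le> (1 + DIM('a)) * max 1 m" by (simp add: distrib_right)
  finally have "(1 + norm q) ^ M * cmod ?c \<le> ((1 + DIM('a)) * max 1 m) ^ M * cmod ?c"
    by (intro mult_right_mono power_mono) auto
  also have "\<dots> \<le> (1 + DIM('a)) ^ M * C"
    using mult_left_mono[OF cle, of "(1 + DIM('a)) ^ M"] by (simp add: power_mult_distrib mult_ac)
  finally show ?thesis
    by (subst pos_le_divide_eq) (auto simp: mult.commute intro!: zero_less_power add_pos_nonneg)
qed

text \<open>The exponent \<open>2 * DIM('a)\<close> gives each coordinate its own inverse square, so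
  a sum over lattice points is dominated by a product of convergent one-dimensional sums.\<close>

lemma summable_wave_lattice:
  assumes R: "R > 0" and M: "2 * DIM('a) \<le> M"
  shows "(\<lambda>q::'a::euclidean_space. 1 / (1 + norm q) ^ M) summable_on wave_lattice R"
proof -
  define \<kappa> where "\<kappa> = pi / R"
  have \<kappa>: "\<kappa> > 0" using R by (simp add: \<kappa>_def)
  define G where "G = (\<lambda>i::nat. 1 / (1 + \<kappa> * real i)\<^sup>2)"
  define g where "g = (\<lambda>j::int. 1 / (1 + \<kappa> * \<bar>real_of_int j\<bar>)\<^sup>2)"
  have sG: "summable G"
  proof (rule summable_comparison_test)
    show "summable (\<lambda>n. 1 / \<kappa>\<^sup>2 * inverse (real n ^ 2))"
      by (intro summable_mult inverse_power_summable) simp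
    show "\<exists>N. \<forall>n\<ge>N. norm (G n) \<le> 1 / \<kappa>\<^sup>2 * inverse (real n ^ 2)"
    proof (intro exI[of _ 1] allI impI)
      fix n :: nat assume n: "1 \<le> n"
      have "G n \<le> 1 / (\<kappa> * real n)\<^sup>2"
        unfolding G_def using \<kappa> n
        by (intro divide_left_mono power_mono) (auto intro!: mult_pos_pos zero_less_power add_pos_pos)
      moreover have "0 \<le> G n" by (simp add: G_def)
      ultimately show "norm (G n) \<le> 1 / \<kappa>\<^sup>2 * inverse (real n ^ 2)"
        by (simp add: power_mult_distrib divide_simps)
    qed
  qed
  have g_sum: "(\<Sum>j\<in>{-N..N}. g j) \<le> 2 * suminf G" for N
  proof -
    let ?A = "int ` {..nat N}" and ?B = "(\<lambda>i. - int i) ` {..nat N}"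
    have "{-N..N} \<subseteq> ?A \<union> ?B"
    proof
      fix j assume j: "j \<in> {-N..N}"
      show "j \<in> ?A \<union> ?B"
      proof (cases "j \<ge> 0")
        case True
        hence "j = int (nat j)" "nat j \<le> nat N" using j by auto
        thus ?thesis by blast
      next
        case False
        hence "j = - int (nat (- j))" "nat (- j) \<le> nat N" using j by auto
        thus ?thesis by blast
      qed
    qed
    hence "(\<Sum>j\<in>{-N..N}. g j) \<le> (\<Sum>j\<in>?A \<union> ?B. g j)" by (intro sum_mono2) (auto simp: g_def)
    also have "\<dots> \<le> (\<Sum>j\<in>?A. g j) + (\<Sum>j\<in>?B. g j)"
      by (subst sum_Un) (auto simp: g_def intro!: sum_nonneg)
    also have "(\<Sum>j\<in>?A. g j) = (\<Sum>i\<le>nat N. G i)"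
      by (subst sum.reindex) (auto simp: g_def G_def inj_on_def)
    also have "(\<Sum>j\<in>?B. g j) = (\<Sum>i\<le>nat N. G i)"
      by (subst sum.reindex) (auto simp: g_def G_def inj_on_def)
    also have "(\<Sum>i\<le>nat N. G i) \<le> suminf G"
      by (rule sum_le_suminf[OF sG]) (auto simp: G_def)
    finally show ?thesis by simp
  qed
  have bound: "(\<Sum>q\<in>F. 1 / (1 + norm q) ^ M) \<le> (2 * suminf G) ^ DIM('a)"
    if F: "finite F" "F \<subseteq> wave_lattice R" for F :: "'a set"
  proof -
    have "\<forall>q\<in>F. \<forall>b\<in>Basis. \<exists>j::int. q \<bullet> b = of_int j * \<kappa>"
      using F(2) by (auto simp: wave_lattice_def \<kappa>_def)
    then obtain J0 where J0: "\<forall>q\<in>F. \<forall>b\<in>Basis. q \<bullet> b = of_int (J0 q b) * \<kappa>" by metis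
    \<comment> \<open>Restriction to \<open>Basis\<close> fixes the values elsewhere, so that
      \<open>J\<close> maps into a finite \<open>PiE\<close>, over which sum and product can be
      exchanged.\<close>
    define J where "J = (\<lambda>q. restrict (J0 q) Basis)"
    define N where "N = Max (insert 0 ((\<lambda>(q, b). \<bar>J0 q b\<bar>) ` (F \<times> (Basis::'a set))))"
    have N: "\<bar>J0 q b\<bar> \<le> N" if "q \<in> F" "b \<in> Basis" for q b
      unfolding N_def using that F(1) by (intro Max_ge) auto
    have J: "J q \<in> PiE Basis (\<lambda>_. {-N..N})" if "q \<in> F" for q
      using N[OF that] by (auto simp: J_def abs_le_iff) (smt (verit))
    have inj: "inj_on J F"
    proof (rule inj_onI)
      fix q q' assume q: "q \<in> F" "q' \<in> F" "J q = J q'"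
      have "q \<bullet> b = q' \<bullet> b" if b: "b \<in> Basis" for b
      proof -
        have "J0 q b = J0 q' b" using fun_cong[OF q(3), of b] b by (simp add: J_def)
        thus ?thesis using J0 q(1,2) b by simp
      qed
      thus "q = q'" by (rule euclidean_eqI)
    qed
    have "(\<Sum>q\<in>F. 1 / (1 + norm q) ^ M) \<le> (\<Sum>q\<in>F. \<Prod>b\<in>Basis. g (J q b))"
    proof (rule sum_mono)
      fix q assume q: "q \<in> F"
      have "1 / (1 + norm q) ^ M \<le> 1 / (1 + norm q) ^ (2 * DIM('a))"
        using M by (intro divide_left_mono power_increasing) (auto intro!: mult_pos_pos zero_less_power add_pos_nonneg)
      also have "\<dots> = (\<Prod>b\<in>(Basis::'a set). 1 / (1 + norm q)\<^sup>2)"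
        by (simp add: power_mult power_divide power_one_over)
      also have "\<dots> \<le> (\<Prod>b\<in>Basis. g (J q b))"
      proof (rule prod_mono, intro conjI)
        fix b :: 'a assume b: "b \<in> Basis"
        have "\<kappa> * \<bar>real_of_int (J q b)\<bar> = \<bar>q \<bullet> b\<bar>"
          using J0 q b \<kappa> by (simp add: J_def abs_mult)
        also have "\<dots> \<le> norm q" using Basis_le_norm[OF b] .
        finally show "1 / (1 + norm q)\<^sup>2 \<le> g (J q b)"
          unfolding g_def using \<kappa> by (intro divide_left_mono power_mono) (auto intro!: mult_pos_pos zero_less_power add_pos_nonneg)
      qed simp
      finally show "1 / (1 + norm q) ^ M \<le> (\<Prod>b\<in>Basis. g (J q b))" .
    qed
    also have "\<dots> = (\<Sum>f\<in>J ` F. \<Prod>b\<in>Basis. g (f b))" by (simp add: sum.reindex[OF inj] o_def)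
    also have "\<dots> \<le> (\<Sum>f\<in>PiE (Basis::'a set) (\<lambda>_. {-N..N}). \<Prod>b\<in>Basis. g (f b))"
    proof (rule sum_mono2)
      show "finite (PiE (Basis::'a set) (\<lambda>_. {-N..N}))" by (rule finite_PiE) auto
      show "J ` F \<subseteq> PiE Basis (\<lambda>_. {-N..N})" using J by blast
    qed (auto simp: g_def intro!: prod_nonneg)
    also have "\<dots> = (\<Prod>b\<in>(Basis::'a set). \<Sum>j\<in>{-N..N}. g j)"
      by (rule prod_sum_PiE[symmetric]) auto
    also have "\<dots> = (\<Sum>j\<in>{-N..N}. g j) ^ DIM('a)" by simp
    also have "\<dots> \<le> (2 * suminf G) ^ DIM('a)"
      by (intro power_mono g_sum sum_nonneg) (auto simp: g_def)
    finally show ?thesis .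
  qed
  show ?thesis
  proof (rule nonneg_bdd_above_summable_on)
    show "bdd_above (sum (\<lambda>q::'a. 1 / (1 + norm q) ^ M) ` {F. F \<subseteq> wave_lattice R \<and> finite F})"
      using bound by (intro bdd_aboveI[of _ "(2 * suminf G) ^ DIM('a)"]) auto
  qed (auto intro!: divide_nonneg_nonneg zero_le_power add_nonneg_nonneg)
qed

text \<open>The absolutely convergent series defines a continuous \<open>S\<close> with the Fourier
  coefficients of \<open>a\<close>, and \<open>fourier_unique\<close> identifies the two. On the
  boundary this can fail: \<open>S\<close> takes equal values on opposite faces, and
  \<open>a\<close> need not.\<close>

lemma fourier_series_has_sum:
  fixes a :: "'a::euclidean_space \<Rightarrow> complex"
  assumes R: "R > 0" and a: "continuous_on (cube R) a"
    and s: "(\<lambda>q. cmod (fourier_coeff R a q)) summable_on wave_lattice R"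
    and x: "x \<in> open_cube R"
  shows "((\<lambda>q. fourier_coeff R a q * wave q x) has_sum a x) (wave_lattice R)"
proof -
  let ?Q = "cube R :: 'a set" and ?L = "wave_lattice R :: 'a set" and ?c = "fourier_coeff R a"
  define S where "S = (\<lambda>x. \<Sum>\<^sub>\<infinity>q\<in>?L. ?c q * wave q x)"
  have asum: "(\<lambda>q. cmod (?c q * wave q x)) summable_on ?L" for x
    using s by (simp add: norm_mult)
  have S: "((\<lambda>q. ?c q * wave q x) has_sum S x) ?L" for x
    unfolding S_def by (rule has_sum_infsum[OF abs_summable_summable[OF asum]])
  have unif: "uniform_limit ?Q (\<lambda>F x. \<Sum>q\<in>F. ?c q * wave q x) S (finite_subsets_at_top ?L)"
    by (rule Weierstrass_m_test_general'[OF _ S s]) (simp add: norm_mult)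
  have S_cont: "continuous_on ?Q S"
    by (rule uniform_limit_theorem[OF _ unif])
       (auto intro!: always_eventually continuous_intros continuous_on_wave)
  have "a x - S x = 0"
  proof (rule fourier_unique[OF R _ _ x])
    show "continuous_on ?Q (\<lambda>x. a x - S x)" by (intro continuous_intros a S_cont)
    fix p :: 'a assume p: "p \<in> ?L"
    hence p': "- p \<in> ?L" by (rule wave_lattice_uminus)
    have "((\<lambda>q. ?c q * wave (q + p) x) has_sum S x * wave p x) ?L" for x
      using has_sum_cmult_left[OF S[of x], of "wave p x"] by (simp add: wave_add mult.assoc)
    hence "uniform_limit ?Q (\<lambda>F x. \<Sum>q\<in>F. ?c q * wave (q + p) x) (\<lambda>x. S x * wave p x) (finite_subsets_at_top ?L)"
      by (intro Weierstrass_m_test_general'[OF _ _ s]) (simp add: norm_mult)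
    then obtain I J where IJ: "\<And>F. ((\<lambda>x. \<Sum>q\<in>F. ?c q * wave (q + p) x) has_integral I F) ?Q"
      "((\<lambda>x. S x * wave p x) has_integral J) ?Q" "(I \<longlongrightarrow> J) (finite_subsets_at_top ?L)"
      unfolding cube_def
      by (rule uniform_limit_integral_cbox) (auto intro!: continuous_intros continuous_on_wave)
    let ?v = "complex_of_real (measure lborel ?Q)"
    \<comment> \<open>By orthogonality only the term \<open>q = - p\<close> survives once the finite
      set contains it, so the limit \<open>J\<close> is known exactly.\<close>
    have I: "I F = ?c (- p) * ?v" if F: "finite F" "{- p} \<subseteq> F" "F \<subseteq> ?L" for F
    proof -
      have "((\<lambda>x. \<Sum>q\<in>F. ?c q * wave (q + p) x) has_integral (\<Sum>q\<in>F. ?c q * integral ?Q (wave (q + p)))) ?Q"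
        unfolding cube_def
        by (intro has_integral_sum F has_integral_mult_right integrable_integral integrable_continuous continuous_on_wave)
      hence "I F = (\<Sum>q\<in>F. ?c q * integral ?Q (wave (q + p)))"
        using IJ(1) has_integral_unique by blast
      also have "\<dots> = (\<Sum>q\<in>F. if q = - p then ?c (- p) * ?v else 0)"
      proof (rule sum.cong[OF refl])
        fix q assume q: "q \<in> F"
        show "?c q * integral ?Q (wave (q + p)) = (if q = - p then ?c (- p) * ?v else 0)"
        proof (cases "q = - p")
          case True
          have "wave 0 = (\<lambda>x::'a. 1)" by auto
          thus ?thesis using True by (simp add: cube_def scaleR_conv_of_real)
        next
          case False
          hence "integral ?Q (wave (q + p)) = 0"
            using F(3) q p by (intro wave_integral_zero[OF R] wave_lattice_add) (auto simp: eq_neg_iff_add_eq_0)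
          thus ?thesis using False by simp
        qed
      qed
      also have "\<dots> = ?c (- p) * ?v" using F by simp
      finally show ?thesis .
    qed
    have "eventually (\<lambda>F. I F = ?c (- p) * ?v) (finite_subsets_at_top ?L)"
      unfolding eventually_finite_subsets_at_top
      by (intro exI[of _ "{- p}"]) (use I p' in auto)
    hence "(I \<longlongrightarrow> ?c (- p) * ?v) (finite_subsets_at_top ?L)" by (rule tendsto_eventually)
    hence J: "J = ?c (- p) * ?v" using IJ(3) by (intro tendsto_unique[OF finite_subsets_at_top_neq_bot])
    have "?v \<noteq> 0" using content_cube_pos[OF R, where 'a='a] by simp
    hence "J = integral ?Q (\<lambda>x. a x * wave p x)" by (simp add: J fourier_coeff_def)
    moreover have "((\<lambda>x. a x * wave p x) has_integral integral ?Q (\<lambda>x. a x * wave p x)) ?Q"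
      using a unfolding cube_def
      by (intro integrable_integral integrable_continuous continuous_intros continuous_on_wave)
    ultimately show "((\<lambda>x. (a x - S x) * wave p x) has_integral 0) ?Q"
      using has_integral_diff[OF _ IJ(2), of "\<lambda>x. a x * wave p x" J] by (simp add: left_diff_distrib)
  qed
  thus ?thesis using S[of x] by simp
qed

text \<open>One finite set of frequencies serves all derivatives up to order \<open>n\<close>,
  because their coefficients share the summable majorant \<open>K / (1 + norm q) ^ M\<close>; this
  takes \<open>M + n\<close> derivatives of \<open>a\<close>.\<close>

lemma fourier_approx:
  fixes a :: "'a::euclidean_space \<Rightarrow> complex" and \<epsilon> :: real
  assumes R: "R > 0" and a: "smooth a" "supp a \<subseteq> cube R" and \<epsilon>: "\<epsilon> > 0"
  obtains F where "finite F" "F \<subseteq> wave_lattice R"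
    "derivs_bounded (open_cube R) n \<epsilon> (\<lambda>x. a x - (\<Sum>q\<in>F. fourier_coeff R a q * wave q x))"
proof -
  let ?L = "wave_lattice R :: 'a set"
  define M where "M = 2 * DIM('a)"
  obtain C where C: "C \<ge> 0" "derivs_bounded (cube R) (M + n) C a"
    by (rule derivs_bounded_compact[OF a(1), of "cube R" "M + n"]) (simp_all add: cube_def)
  have C': "derivs_bounded UNIV (M + n) C a" using derivs_bounded_UNIV[OF C(2) a(2) C(1)] .
  define K where "K = (1 + DIM('a)) ^ M * C"
  have decay: "cmod (fourier_coeff R (iterated_partial bs a) q) \<le> K / (1 + norm q) ^ M"
    if "set bs \<subseteq> Basis" "length bs \<le> n" for bs q
    unfolding K_def
  proof (rule fourier_coeff_decay[OF R])
    show "smooth (iterated_partial bs a)" by (rule smooth_iterated_partial[OF a(1) that(1)])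
    show "supp (iterated_partial bs a) \<subseteq> cube R" using supp_iterated_partial a(2) by (rule order_trans)
    show "derivs_bounded UNIV M C (iterated_partial bs a)"
      by (rule derivs_bounded_iterated_partial[OF _ that(1)], rule derivs_bounded_mono[OF C'])
         (use that in auto)
  qed
  have sK: "(\<lambda>q. K / (1 + norm q) ^ M) summable_on ?L"
    using summable_on_cmult_right[OF summable_wave_lattice[OF R, of M, where 'a='a], of K]
    by (simp add: M_def)
  define T where "T = infsum (\<lambda>q. K / (1 + norm q) ^ M) ?L"
  have hsT: "((\<lambda>q. K / (1 + norm q) ^ M) has_sum T) ?L" unfolding T_def by (rule has_sum_infsum[OF sK])
  have "eventually (\<lambda>F. dist (\<Sum>q\<in>F. K / (1 + norm q) ^ M) T < \<epsilon>) (finite_subsets_at_top ?L)"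
    using hsT \<epsilon> unfolding has_sum_def by (rule tendstoD)
  then obtain F where F: "finite F" "F \<subseteq> ?L" "dist (\<Sum>q\<in>F. K / (1 + norm q) ^ M) T < \<epsilon>"
    unfolding eventually_finite_subsets_at_top by blast
  have tail: "((\<lambda>q. K / (1 + norm q) ^ M) has_sum (T - (\<Sum>q\<in>F. K / (1 + norm q) ^ M))) (?L - F)"
    using has_sum_Diff[OF hsT has_sum_finite[OF F(1)] F(2)] .
  show ?thesis
  proof (rule that[OF F(1,2)], unfold derivs_bounded_def, intro allI impI ballI)
    fix bs and x :: 'a assume bs: "set bs \<subseteq> (Basis :: 'a set) \<and> length bs \<le> n" and x: "x \<in> open_cube R"
    let ?c = "fourier_coeff R (iterated_partial bs a)"
    have sb: "set bs \<subseteq> Basis" and len: "length bs \<le> n" using bs by auto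
    have sm: "smooth (iterated_partial bs a)" by (rule smooth_iterated_partial[OF a(1) sb])
    have "(\<lambda>q. cmod (?c q)) summable_on ?L"
      by (rule summable_on_comparison_test[OF sK]) (use decay[OF sb len] in auto)
    hence hs: "((\<lambda>q. ?c q * wave q x) has_sum iterated_partial bs a x) ?L"
      using R x smooth_continuous_on[OF sm] by (intro fourier_series_has_sum)
    have "((\<lambda>q. ?c q * wave q x) has_sum (iterated_partial bs a x - (\<Sum>q\<in>F. ?c q * wave q x))) (?L - F)"
      using has_sum_Diff[OF hs has_sum_finite[OF F(1)] F(2)] .
    hence "cmod (iterated_partial bs a x - (\<Sum>q\<in>F. ?c q * wave q x)) \<le> T - (\<Sum>q\<in>F. K / (1 + norm q) ^ M)"
      by (rule norm_infsum_le[OF _ tail]) (use decay[OF sb len] in \<open>simp add: norm_mult\<close>)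
    also have "\<dots> \<le> \<epsilon>" using F(3) by (simp add: dist_real_def)
    finally have "cmod (iterated_partial bs a x - (\<Sum>q\<in>F. ?c q * wave q x)) \<le> \<epsilon>" .
    moreover have "iterated_partial bs (\<lambda>x. a x - (\<Sum>q\<in>F. fourier_coeff R a q * wave q x)) x
        = iterated_partial bs a x - (\<Sum>q\<in>F. ?c q * wave q x)"
      using a(1) sb
      by (simp add: iterated_partial_diff iterated_partial_sum iterated_partial_cmult smooth_sum smooth_cmult
          fourier_coeff_iterated_partial[OF a sb])
    ultimately show "cmod (iterated_partial bs (\<lambda>x. a x - (\<Sum>q\<in>F. fourier_coeff R a q * wave q x)) x) \<le> \<epsilon>" by simp
  qed
qed

section \<open>Bounded sets and distributions of finite order\<close>

text \<open>The properties of an extended-valued seminorm on which the arguments about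
  neighbourhoods and bounded sets rest. Subadditivity is phrased with the difference
  \<open>g - f\<close>, the shape that occurs in \<open>seminorm_topology\<close>.\<close>

definition seminorm_like :: "('s \<Rightarrow> complex) set \<Rightarrow> (('s \<Rightarrow> complex) \<Rightarrow> ennreal) \<Rightarrow> bool" where
  "seminorm_like E p \<longleftrightarrow>
    (\<forall>f\<in>E. \<forall>g\<in>E. p g \<le> p (\<lambda>s. g s - f s) + p f) \<and>
    (\<forall>r>0. \<forall>f\<in>E. p (\<lambda>s. complex_of_real r * f s) = ennreal r * p f) \<and> p (\<lambda>s. 0) = 0"

lemma seminorm_like_diff: "seminorm_like E p \<Longrightarrow> f \<in> E \<Longrightarrow> g \<in> E \<Longrightarrow> p g \<le> p (\<lambda>s. g s - f s) + p f"
  and seminorm_like_scale: "seminorm_like E p \<Longrightarrow> r > 0 \<Longrightarrow> f \<in> E \<Longrightarrow> p (\<lambda>s. complex_of_real r * f s) = ennreal r * p f"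
  and seminorm_like_zero: "seminorm_like E p \<Longrightarrow> p (\<lambda>s. 0) = 0"
  by (simp_all add: seminorm_like_def)

lemma seminorm_on_add: "seminorm_on E p \<Longrightarrow> f \<in> E \<Longrightarrow> g \<in> E \<Longrightarrow> p (\<lambda>s. f s + g s) \<le> p f + p g"
  and seminorm_on_scale: "seminorm_on E p \<Longrightarrow> f \<in> E \<Longrightarrow> p (\<lambda>s. c * f s) = cmod c * p f"
  by (simp_all add: seminorm_on_def)

section \<open>Neighbourhoods and bounded sets in terms of seminorms\<close>

lemma zero_neighborhood_seminormsD:
  assumes "zero_neighborhood (seminorm_topology E P) W"
  obtains F \<epsilon> where "finite F" "F \<subseteq> P" "0 < \<epsilon>" "{g \<in> E. \<forall>p\<in>F. p g < ennreal \<epsilon>} \<subseteq> W"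
proof -
  obtain U where U: "openin (seminorm_topology E P) U" "(\<lambda>s. 0) \<in> U" "U \<subseteq> W"
    using assms unfolding zero_neighborhood_def by blast
  from bspec[OF conjunct2[OF U(1)[unfolded openin_seminorm_topology]] U(2)]
  obtain F \<epsilon> where F: "finite F" "F \<subseteq> P" "0 < \<epsilon>" "{g \<in> E. \<forall>p\<in>F. p (\<lambda>s. g s - 0) < ennreal \<epsilon>} \<subseteq> U"
    by (elim exE conjE) rule
  have "{g \<in> E. \<forall>p\<in>F. p g < ennreal \<epsilon>} \<subseteq> W" using F(4) U(3) by simp
  thus ?thesis by (rule that[OF F(1-3)])
qed

lemma openin_seminorm_ball:
  assumes p: "p \<in> P" "seminorm_like E p" and "\<epsilon> > 0"
  shows "openin (seminorm_topology E P) {g \<in> E. p g < ennreal \<epsilon>}"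
  unfolding openin_seminorm_topology
proof (intro conjI ballI)
  fix f assume f: "f \<in> {g \<in> E. p g < ennreal \<epsilon>}"
  then obtain a where a: "p f = ennreal a" "a \<ge> 0" "a < \<epsilon>"
    by (cases "p f") (auto simp: ennreal_less_iff)
  have "{g \<in> E. \<forall>q\<in>{p}. q (\<lambda>s. g s - f s) < ennreal (\<epsilon> - a)} \<subseteq> {g \<in> E. p g < ennreal \<epsilon>}"
  proof safe
    fix g assume g: "g \<in> E" "\<forall>q\<in>{p}. q (\<lambda>s. g s - f s) < ennreal (\<epsilon> - a)"
    have "p (\<lambda>s. g s - f s) < ennreal (\<epsilon> - a)" using g(2) by blast
    then obtain b where b: "p (\<lambda>s. g s - f s) = ennreal b" "b \<ge> 0" "b < \<epsilon> - a"
      by (cases "p (\<lambda>s. g s - f s)") (auto simp: ennreal_less_iff)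
    have "p g \<le> p (\<lambda>s. g s - f s) + p f" using p(2) f g(1) by (intro seminorm_like_diff) auto
    also have "\<dots> = ennreal (b + a)" using a b by simp
    also have "\<dots> < ennreal \<epsilon>" using a b by (intro ennreal_lessI) auto
    finally show "p g < ennreal \<epsilon>" .
  qed
  thus "\<exists>F \<delta>. finite F \<and> F \<subseteq> P \<and> 0 < \<delta> \<and> {g \<in> E. \<forall>p\<in>F. p (\<lambda>s. g s - f s) < ennreal \<delta>} \<subseteq> {g \<in> E. p g < ennreal \<epsilon>}"
    using p(1) a(3) by (intro exI[of _ "{p}"] exI[of _ "\<epsilon> - a"]) auto
qed auto

lemma zero_neighborhood_Int:
  "zero_neighborhood T V \<Longrightarrow> zero_neighborhood T W \<Longrightarrow> zero_neighborhood T (V \<inter> W)"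
proof -
  assume V: "zero_neighborhood T V" and W: "zero_neighborhood T W"
  obtain U where U: "openin T U" "(\<lambda>s. 0) \<in> U" "U \<subseteq> V" using V unfolding zero_neighborhood_def by blast
  obtain U' where U': "openin T U'" "(\<lambda>s. 0) \<in> U'" "U' \<subseteq> W" using W unfolding zero_neighborhood_def by blast
  have "openin T (U \<inter> U')" by (rule openin_Int[OF U(1) U'(1)])
  moreover have "V \<inter> W \<subseteq> topspace T" using V unfolding zero_neighborhood_def by blast
  moreover have "(\<lambda>s. 0) \<in> U \<inter> U'" "U \<inter> U' \<subseteq> V \<inter> W" using U U' by blast+
  ultimately show ?thesis unfolding zero_neighborhood_def by blast
qed

lemma zero_neighborhood_seminorm_ball:
  assumes "p \<in> P" "seminorm_like E p" "\<epsilon> > 0" "(\<lambda>s. 0) \<in> E"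
  shows "zero_neighborhood (seminorm_topology E P) {g \<in> E. p g < ennreal \<epsilon>}"
  unfolding zero_neighborhood_def
proof (intro conjI exI[of _ "{g \<in> E. p g < ennreal \<epsilon>}"] openin_seminorm_ball assms order_refl)
  show "(\<lambda>s. 0) \<in> {g \<in> E. p g < ennreal \<epsilon>}"
    using assms(3,4) seminorm_like_zero[OF assms(2)] by simp
qed simp

lemma tvs_bounded_seminormD:
  assumes A: "tvs_bounded (seminorm_topology E P) A" and p: "p \<in> P" "seminorm_like E p" and E: "(\<lambda>s. 0) \<in> E"
  obtains C where "C > 0" "\<forall>f\<in>A. p f \<le> ennreal C"
proof -
  have "zero_neighborhood (seminorm_topology E P) {g \<in> E. p g < ennreal 1}"
    by (intro zero_neighborhood_seminorm_ball p E) simp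
  then obtain r where r: "r > 0" "A \<subseteq> (\<lambda>f s. complex_of_real r * f s) ` {g \<in> E. p g < ennreal 1}"
    using A unfolding tvs_bounded_def by blast
  have "p f \<le> ennreal r" if f: "f \<in> A" for f
  proof -
    obtain g where g: "f = (\<lambda>s. complex_of_real r * g s)" "g \<in> E" "p g < ennreal 1" using r(2) f by blast
    hence "p f = ennreal r * p g" using seminorm_like_scale[OF p(2) r(1)] by simp
    also have "\<dots> \<le> ennreal r * 1" using g(3) by (intro mult_left_mono) auto
    finally show ?thesis by simp
  qed
  thus ?thesis using r(1) that by blast
qed

lemma tvs_bounded_seminormI:
  assumes "A \<subseteq> E" and E: "\<And>r f. f \<in> E \<Longrightarrow> (\<lambda>s. complex_of_real r * f s) \<in> E"
    and p: "\<And>p. p \<in> P \<Longrightarrow> seminorm_like E p" "\<And>p. p \<in> P \<Longrightarrow> \<exists>C. \<forall>f\<in>A. p f \<le> ennreal C"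
  shows "tvs_bounded (seminorm_topology E P) A"
  unfolding tvs_bounded_def topspace_seminorm_topology
proof (intro conjI allI impI assms)
  fix V assume "zero_neighborhood (seminorm_topology E P) V"
  then obtain F \<epsilon> where F: "finite F" "F \<subseteq> P" "0 < \<epsilon>" "{g \<in> E. \<forall>p\<in>F. p g < ennreal \<epsilon>} \<subseteq> V"
    by (rule zero_neighborhood_seminormsD)
  have "\<forall>p\<in>F. \<exists>C. \<forall>f\<in>A. p f \<le> ennreal C" using p(2) F(2) by blast
  from bchoice[OF this] obtain C where C: "\<forall>p\<in>F. \<forall>f\<in>A. p f \<le> ennreal (C p)" by blast
  define D where "D = (\<Sum>p\<in>F. \<bar>C p\<bar>)"
  have D: "p f \<le> ennreal D" if "p \<in> F" "f \<in> A" for p f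
  proof -
    have "C p \<le> D" unfolding D_def using member_le_sum[OF that(1), of "\<lambda>p. \<bar>C p\<bar>"] F(1) by simp
    thus ?thesis using C that ennreal_leI order_trans by blast
  qed
  have D0: "D \<ge> 0" by (simp add: D_def sum_nonneg)
  \<comment> \<open>The additional 1 makes the rescaled seminorms strictly smaller than
    \<open>\<epsilon>\<close> and keeps \<open>r\<close> positive when \<open>D = 0\<close>.\<close>
  define r where "r = (D + 1) / \<epsilon>"
  have r: "r > 0" using F(3) D0 by (simp add: r_def)
  have "A \<subseteq> (\<lambda>f s. complex_of_real r * f s) ` V"
  proof
    fix f assume f: "f \<in> A"
    let ?g = "\<lambda>s. complex_of_real (1 / r) * f s"
    have "p ?g < ennreal \<epsilon>" if "p \<in> F" for p
    proof -
      have "p ?g = ennreal (1 / r) * p f"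
        using p(1)[of p] F(2) that r f assms(1) by (intro seminorm_like_scale[of E p "1 / r" f]) auto
      also have "\<dots> \<le> ennreal (1 / r) * ennreal D" using D[OF that f] by (intro mult_left_mono) auto
      also have "\<dots> = ennreal (D / r)" using r D0 by (simp flip: ennreal_mult)
      also have "\<dots> < ennreal \<epsilon>"
      proof (rule ennreal_lessI[OF F(3)])
        have "D * \<epsilon> < (D + 1) * \<epsilon>" using F(3) by simp
        thus "D / r < \<epsilon>" using F(3) D0 by (simp add: r_def divide_less_eq mult.commute)
      qed
      finally show ?thesis .
    qed
    moreover have "?g \<in> E" using f assms(1) E by blast
    ultimately have "?g \<in> V" using F(4) by blast
    moreover have "f = (\<lambda>s. complex_of_real r * ?g s)" using r by simp
    ultimately show "f \<in> (\<lambda>f s. complex_of_real r * f s) ` V"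
      by (intro image_eqI[where x="?g"])
  qed
  thus "\<exists>r>0. A \<subseteq> (\<lambda>f s. complex_of_real r * f s) ` V" using r by blast
qed

text \<open>Boundedness of sets of test functions made concrete. For open \<open>\<Omega>\<close> it
  agrees with \<open>tvs_bounded (test_topology \<Omega>)\<close>, by
  \<open>tvs_bounded_test_bounded\<close> and \<open>test_bounded_tvs_bounded\<close>.\<close>

definition test_bounded :: "'a::euclidean_space set \<Rightarrow> ('a \<Rightarrow> complex) set \<Rightarrow> bool" where
  "test_bounded \<Omega> B \<longleftrightarrow> (\<exists>K. compact K \<and> K \<subseteq> \<Omega> \<and> (\<forall>\<phi>\<in>B. smooth \<phi> \<and> supp \<phi> \<subseteq> K)) \<and>
     (\<forall>n. \<exists>C. \<forall>\<phi>\<in>B. derivs_bounded UNIV n C \<phi>)"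

text \<open>The estimate of a distribution of order \<open>n\<close> on \<open>K\<close>. Letting
  \<open>c\<close> range over all bounds takes the place of the C^n norm of
  \<open>\<phi>\<close>.\<close>

definition order_bound ::
    "'a::euclidean_space set \<Rightarrow> nat \<Rightarrow> real \<Rightarrow> (('a \<Rightarrow> complex) \<Rightarrow> complex) \<Rightarrow> bool" where
  "order_bound K n C u \<longleftrightarrow> (\<forall>\<phi> c. smooth \<phi> \<longrightarrow> supp \<phi> \<subseteq> K \<longrightarrow> derivs_bounded UNIV n c \<phi> \<longrightarrow> cmod (u \<phi>) \<le> C * c)"

lemma derivs_bounded_nonneg: "derivs_bounded UNIV n c \<phi> \<Longrightarrow> c \<ge> 0"
  by (rule order_trans[OF norm_ge_zero derivs_bounded_0D[OF _ UNIV_I]])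

lemma seminorm_on_nonneg:
  assumes "seminorm_on E p" "f \<in> E" "(\<lambda>s. - f s) \<in> E"
  shows "p f \<ge> 0"
proof -
  have "p (\<lambda>s. 0 * f s) = cmod 0 * p f" "p (\<lambda>s. -1 * f s) = cmod (-1) * p f"
    by (rule seminorm_on_scale[OF assms(1,2)])+
  moreover have "p (\<lambda>s. f s + (- f s)) \<le> p f + p (\<lambda>s. - f s)"
    by (rule seminorm_on_add[OF assms])
  ultimately show ?thesis by simp
qed

lemma seminorm_onI:
  assumes E: "\<And>c f. f \<in> E \<Longrightarrow> (\<lambda>s. c * f s) \<in> E"
    and add: "\<And>f g. f \<in> E \<Longrightarrow> g \<in> E \<Longrightarrow> p (\<lambda>s. f s + g s) \<le> p f + p g"
    and scale: "\<And>c f. f \<in> E \<Longrightarrow> p (\<lambda>s. c * f s) \<le> cmod c * p f"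
    and nonneg: "\<And>f. f \<in> E \<Longrightarrow> p f \<ge> 0"
  shows "seminorm_on E p"
  unfolding seminorm_on_def
proof (intro conjI ballI allI add)
  fix c f assume f: "f \<in> E"
  show "p (\<lambda>s. c * f s) = cmod c * p f"
  proof (cases "c = 0")
    case True
    thus ?thesis using scale[OF f, of 0] nonneg[OF E[OF f, of 0]] by simp
  next
    case False
    have "p (\<lambda>s. inverse c * (c * f s)) \<le> cmod (inverse c) * p (\<lambda>s. c * f s)" by (rule scale[OF E[OF f]])
    hence "p f \<le> p (\<lambda>s. c * f s) / cmod c"
      using False by (simp add: norm_inverse divide_inverse mult.commute mult.assoc[symmetric])
    hence "cmod c * p f \<le> p (\<lambda>s. c * f s)" using False by (simp add: pos_le_divide_eq mult.commute)
    thus ?thesis using scale[OF f, of c] by simp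
  qed
qed auto

text \<open>Stated for an abstract family \<open>L\<close>, as it serves twice: for derivatives at
  all points and for weighted point evaluations.\<close>

lemma seminorm_on_SUP:
  fixes L :: "'i \<Rightarrow> ('s \<Rightarrow> complex) \<Rightarrow> complex"
  assumes E: "\<And>c f. f \<in> E \<Longrightarrow> (\<lambda>s. c * f s) \<in> E"
    and add: "\<And>i f g. f \<in> E \<Longrightarrow> g \<in> E \<Longrightarrow> L i (\<lambda>s. f s + g s) = L i f + L i g"
    and scale: "\<And>i c f. f \<in> E \<Longrightarrow> L i (\<lambda>s. c * f s) = c * L i f"
    and bdd: "\<And>f. f \<in> E \<Longrightarrow> bdd_above (range (\<lambda>i. cmod (L i f)))"
  shows "seminorm_on E (\<lambda>f. SUP i. cmod (L i f))"
proof (rule seminorm_onI[OF E])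
  have upper: "cmod (L i f) \<le> (SUP i. cmod (L i f))" if "f \<in> E" for i f
    by (rule cSUP_upper[OF UNIV_I bdd[OF that]])
  fix f assume f: "f \<in> E"
  show "0 \<le> (SUP i. cmod (L i f))" using upper[OF f] norm_ge_zero order_trans by blast
  show "(SUP i. cmod (L i (\<lambda>s. c * f s))) \<le> cmod c * (SUP i. cmod (L i f))" for c
    by (rule cSUP_least) (auto simp: scale[OF f] norm_mult intro!: mult_left_mono upper f)
  fix g assume g: "g \<in> E"
  show "(SUP i. cmod (L i (\<lambda>s. f s + g s))) \<le> (SUP i. cmod (L i f)) + (SUP i. cmod (L i g))"
    by (rule cSUP_least) (auto simp: add[OF f g] intro!: norm_triangle_mono upper f g)
qed

lemma seminorm_on_diff:
  assumes "seminorm_on (test_functions \<Omega>) p" "f \<in> test_functions \<Omega>" "g \<in> test_functions \<Omega>"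
  shows "p g \<le> p (\<lambda>s. g s - f s) + p f" "p (\<lambda>s. f s - g s) = p (\<lambda>s. g s - f s)"
proof -
  have d: "(\<lambda>s. g s - f s) \<in> test_functions \<Omega>" by (intro test_functions_diff assms)
  have "p (\<lambda>s. (g s - f s) + f s) \<le> p (\<lambda>s. g s - f s) + p f"
    by (rule seminorm_on_add[OF assms(1) d assms(2)])
  thus "p g \<le> p (\<lambda>s. g s - f s) + p f" by simp
  have "p (\<lambda>s. -1 * (g s - f s)) = cmod (-1) * p (\<lambda>s. g s - f s)"
    by (rule seminorm_on_scale[OF assms(1) d])
  thus "p (\<lambda>s. f s - g s) = p (\<lambda>s. g s - f s)" by simp
qed

text \<open>A C^n estimate gives continuity, because the finitely many generating seminorms of order
  at most \<open>n\<close> control \<open>p\<close> of a difference.\<close>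

lemma continuous_map_fixed_supportI:
  assumes p: "seminorm_on (test_functions \<Omega>) p" and K: "compact K" "K \<subseteq> \<Omega>"
    and bnd: "\<And>\<phi> c. smooth \<phi> \<Longrightarrow> supp \<phi> \<subseteq> K \<Longrightarrow> derivs_bounded UNIV n c \<phi> \<Longrightarrow> p \<phi> \<le> C * c"
  shows "continuous_map (fixed_support_topology K) euclideanreal p"
proof -
  let ?D = "{\<phi>. smooth \<phi> \<and> supp \<phi> \<subseteq> K}"
  let ?q = "\<lambda>bs \<phi>. SUP x. ennreal (cmod (iterated_partial bs \<phi> x))"
  have sub: "?D \<subseteq> test_functions \<Omega>" using K test_functionsI by blast
  have "openin (fixed_support_topology K) {f \<in> ?D. p f \<in> U}" if U: "open U" for U
    unfolding fixed_support_topology_def openin_seminorm_topology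
  proof (intro conjI ballI)
    fix f assume f: "f \<in> {f \<in> ?D. p f \<in> U}"
    then obtain e where e: "e > 0" "\<And>y. dist y (p f) < e \<Longrightarrow> y \<in> U" using U unfolding open_dist by blast
    define \<delta> where "\<delta> = e / (\<bar>C\<bar> + 1)"
    have \<delta>: "\<delta> > 0" using e by (simp add: \<delta>_def add_nonneg_pos)
    let ?F = "?q ` {bs. set bs \<subseteq> (Basis::'a set) \<and> length bs \<le> n}"
    have "p g \<in> U" if g: "g \<in> ?D" and q: "\<forall>q\<in>?F. q (\<lambda>s. g s - f s) < ennreal \<delta>" for g
    proof -
      have gf: "smooth (\<lambda>s. g s - f s)" "supp (\<lambda>s. g s - f s) \<subseteq> K"
        using f g smooth_diff supp_add[of g "\<lambda>s. - f s"] by (auto simp: supp_def support_on_def)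
      have "derivs_bounded UNIV n \<delta> (\<lambda>s. g s - f s)"
        unfolding derivs_bounded_def
      proof (intro allI impI ballI)
        fix bs x assume bs: "set bs \<subseteq> (Basis::'a set) \<and> length bs \<le> n"
        have "ennreal (cmod (iterated_partial bs (\<lambda>s. g s - f s) x)) \<le> ?q bs (\<lambda>s. g s - f s)"
          by (rule SUP_upper) simp
        also have "\<dots> < ennreal \<delta>"
        proof -
          have "?q bs \<in> ?F" using bs by (intro imageI) simp
          with q show ?thesis by (rule bspec)
        qed
        finally show "cmod (iterated_partial bs (\<lambda>s. g s - f s) x) \<le> \<delta>"
          using \<delta> by (simp add: ennreal_less_iff)
      qed
      from bnd[OF gf this] have "p (\<lambda>s. g s - f s) \<le> C * \<delta>" .
      also have "\<dots> \<le> \<bar>C\<bar> * \<delta>" using \<delta> by (intro mult_right_mono) auto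
      also have "\<dots> < (\<bar>C\<bar> + 1) * \<delta>" using \<delta> by simp
      also have "\<dots> = e" by (simp add: \<delta>_def add_nonneg_eq_0_iff)
      finally have "p (\<lambda>s. g s - f s) < e" .
      moreover have "f \<in> test_functions \<Omega>" "g \<in> test_functions \<Omega>" using f g sub by auto
      ultimately show ?thesis
      proof (intro e(2))
        assume fg: "f \<in> test_functions \<Omega>" "g \<in> test_functions \<Omega>" and lt: "p (\<lambda>s. g s - f s) < e"
        have "p g \<le> p (\<lambda>s. g s - f s) + p f" by (rule seminorm_on_diff(1)[OF p fg])
        moreover have "p f \<le> p (\<lambda>s. g s - f s) + p g"
          using seminorm_on_diff(1)[OF p fg(2,1)] seminorm_on_diff(2)[OF p fg] by linarith
        ultimately show "dist (p g) (p f) < e" unfolding dist_real_def using lt by linarith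
      qed
    qed
    hence "{g \<in> ?D. \<forall>q\<in>?F. q (\<lambda>s. g s - f s) < ennreal \<delta>} \<subseteq> {f \<in> ?D. p f \<in> U}" by blast
    thus "\<exists>F \<epsilon>. finite F \<and> F \<subseteq> {?q bs | bs. set bs \<subseteq> Basis} \<and> 0 < \<epsilon> \<and>
        {g \<in> ?D. \<forall>p\<in>F. p (\<lambda>s. g s - f s) < ennreal \<epsilon>} \<subseteq> {f \<in> ?D. p f \<in> U}"
      using \<delta> finite_multiindices[where 'a='a, of n]
      by (intro exI[of _ ?F] exI[of _ \<delta>] conjI finite_imageI) auto
  qed auto
  thus ?thesis
    unfolding continuous_map_def by (simp add: fixed_support_topology_def)
qed

text \<open>By continuity \<open>p\<close> is below 1 on a ball given by finitely many generating
  seminorms; homogeneity turns this into an estimate of finite order.\<close>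

lemma continuous_map_fixed_supportD:
  assumes p: "seminorm_on (test_functions \<Omega>) p" and K: "compact K" "K \<subseteq> \<Omega>"
    and cont: "continuous_map (fixed_support_topology K) euclideanreal p"
  obtains n C where "C \<ge> 0"
    "\<forall>\<phi> c. smooth \<phi> \<longrightarrow> supp \<phi> \<subseteq> K \<longrightarrow> derivs_bounded UNIV n c \<phi> \<longrightarrow> p \<phi> \<le> C * c"
proof -
  let ?D = "{\<phi>. smooth \<phi> \<and> supp \<phi> \<subseteq> K}"
  let ?q = "\<lambda>bs \<phi>. SUP x. ennreal (cmod (iterated_partial bs \<phi> x))"
  have sub: "?D \<subseteq> test_functions \<Omega>" using K test_functionsI by blast
  have "openin (fixed_support_topology K) {f \<in> topspace (fixed_support_topology K). p f \<in> {..<1}}"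
    by (rule openin_continuous_map_preimage[OF cont]) simp
  hence op: "openin (seminorm_topology ?D {?q bs | bs. set bs \<subseteq> Basis}) {f \<in> ?D. p f < 1}"
    by (simp add: fixed_support_topology_def)
  have "p (\<lambda>s. 0 * (0::complex)) = cmod 0 * p (\<lambda>s. 0)"
    by (rule seminorm_on_scale[OF p test_functions_zero])
  hence "(\<lambda>s. 0) \<in> {f \<in> ?D. p f < 1}" by simp
  hence "zero_neighborhood (seminorm_topology ?D {?q bs | bs. set bs \<subseteq> Basis}) {f \<in> ?D. p f < 1}"
    unfolding zero_neighborhood_def topspace_seminorm_topology
    by (intro conjI exI[of _ "{f \<in> ?D. p f < 1}"] op order_refl) auto
  then obtain F \<epsilon> where F: "finite F" "F \<subseteq> {?q bs | bs. set bs \<subseteq> Basis}" "0 < \<epsilon>"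
    "{g \<in> ?D. \<forall>q\<in>F. q g < ennreal \<epsilon>} \<subseteq> {f \<in> ?D. p f < 1}"
    by (rule zero_neighborhood_seminormsD)
  have "F \<subseteq> ?q ` {bs. set bs \<subseteq> (Basis::'a set)}" using F(2) by blast
  then obtain S where S: "S \<subseteq> {bs. set bs \<subseteq> (Basis::'a set)}" "finite S" "F = ?q ` S"
    using finite_subset_image[OF F(1)] by blast
  \<comment> \<open>Any number that bounds the lengths of all lists in \<open>S\<close> would
    do.\<close>
  define n where "n = (\<Sum>bs\<in>S. length bs)"
  show ?thesis
  proof (rule that[of "2 / \<epsilon>" n])
    show "2 / \<epsilon> \<ge> 0" using F(3) by simp
    show "\<forall>\<phi> c. smooth \<phi> \<longrightarrow> supp \<phi> \<subseteq> K \<longrightarrow> derivs_bounded UNIV n c \<phi> \<longrightarrow> p \<phi> \<le> 2 / \<epsilon> * c"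
    proof (intro allI impI)
      fix \<phi> c assume \<phi>: "smooth \<phi>" "supp \<phi> \<subseteq> K" "derivs_bounded UNIV n c \<phi>"
      have c: "c \<ge> 0" by (rule derivs_bounded_nonneg[OF \<phi>(3)])
      have "p \<phi> \<le> 2 / \<epsilon> * c + \<eta>" if \<eta>: "\<eta> > 0" for \<eta>
      proof -
        \<comment> \<open>A slightly larger, positive constant, so that \<open>\<phi>\<close> can be
          rescaled even if \<open>c = 0\<close>. The price is the additive
          \<open>\<eta>\<close>.\<close>
        define c' where "c' = c + \<eta> * \<epsilon> / 2"
        have c': "c' > 0" "c \<le> c'" using c \<eta> F(3) by (auto simp: c'_def add_nonneg_pos)
        define s where "s = \<epsilon> / (2 * c')"
        have s: "s > 0" using F(3) c' by (simp add: s_def)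
        let ?g = "\<lambda>x. complex_of_real s * \<phi> x"
        have "q ?g < ennreal \<epsilon>" if "q \<in> F" for q
        proof -
          obtain bs where bs: "bs \<in> S" "q = ?q bs" using \<open>q \<in> F\<close> S(3) by blast
          have "length bs \<le> n" unfolding n_def using bs(1) S(2) by (intro member_le_sum) auto
          moreover have sb: "set bs \<subseteq> Basis" using bs(1) S(1) by blast
          ultimately have "cmod (iterated_partial bs ?g x) \<le> \<epsilon> / 2" for x
          proof -
            have "cmod (iterated_partial bs ?g x) = s * cmod (iterated_partial bs \<phi> x)"
              using iterated_partial_cmult[OF \<phi>(1) sb, of "complex_of_real s"] s by (simp add: norm_mult)
            also have "\<dots> \<le> s * c'"
              using derivs_boundedD[OF \<phi>(3) sb, of x] \<open>length bs \<le> n\<close> c' s by (intro mult_left_mono) auto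
            also have "\<dots> = \<epsilon> / 2" using c' by (simp add: s_def)
            finally show ?thesis .
          qed
          hence "q ?g \<le> ennreal (\<epsilon> / 2)" unfolding bs(2) by (intro SUP_least ennreal_leI)
          also have "\<dots> < ennreal \<epsilon>" using F(3) by (intro ennreal_lessI) auto
          finally show ?thesis .
        qed
        moreover have "?g \<in> ?D" using \<phi> supp_mult_right[of "\<lambda>_. complex_of_real s" \<phi>] smooth_cmult by auto
        ultimately have "p ?g < 1" using F(4) by auto
        moreover have "p ?g = cmod (complex_of_real s) * p \<phi>"
          using sub \<phi>(1,2) by (intro seminorm_on_scale[OF p]) blast
        ultimately have "s * p \<phi> < 1" using s by simp
        hence "p \<phi> < 1 / s" using s by (simp add: less_divide_eq mult.commute)
        also have "1 / s = 2 / \<epsilon> * c + \<eta>" using F(3) by (simp add: s_def c'_def field_simps)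
        finally show ?thesis by simp
      qed
      thus "p \<phi> \<le> 2 / \<epsilon> * c" by (rule field_le_epsilon)
    qed
  qed
qed

section \<open>Bounded sets of test functions\<close>

definition test_seminorm :: "'a::euclidean_space set \<Rightarrow> (('a \<Rightarrow> complex) \<Rightarrow> real) \<Rightarrow> bool" where
  "test_seminorm \<Omega> p \<longleftrightarrow> seminorm_on (test_functions \<Omega>) p \<and>
     (\<forall>K. compact K \<and> K \<subseteq> \<Omega> \<longrightarrow> continuous_map (fixed_support_topology K) euclideanreal p)"

lemma test_topology_alt:
  "test_topology \<Omega> = seminorm_topology (test_functions \<Omega>) {(\<lambda>\<phi>. ennreal (p \<phi>)) | p. test_seminorm \<Omega> p}"
  by (simp add: test_topology_def test_seminorm_def)

lemma topspace_test_topology [simp]: "topspace (test_topology \<Omega>) = test_functions \<Omega>"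
  by (simp add: test_topology_def)

lemma test_seminorm_nonneg: "test_seminorm \<Omega> p \<Longrightarrow> \<phi> \<in> test_functions \<Omega> \<Longrightarrow> p \<phi> \<ge> 0"
  using seminorm_on_nonneg[of "test_functions \<Omega>" p \<phi>] test_functions_cmult[of \<phi> \<Omega> "-1"]
  by (simp add: test_seminorm_def)

lemma seminorm_like_test_seminorm:
  assumes p: "test_seminorm \<Omega> p"
  shows "seminorm_like (test_functions \<Omega>) (\<lambda>\<phi>. ennreal (p \<phi>))"
  unfolding seminorm_like_def
proof (intro conjI ballI allI impI)
  have s: "seminorm_on (test_functions \<Omega>) p" using p by (simp add: test_seminorm_def)
  fix f assume f: "f \<in> test_functions \<Omega>"
  {
    fix g assume g: "g \<in> test_functions \<Omega>"
    have "ennreal (p g) \<le> ennreal (p (\<lambda>s. g s - f s) + p f)"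
      by (rule ennreal_leI[OF seminorm_on_diff(1)[OF s f g]])
    also have "\<dots> = ennreal (p (\<lambda>s. g s - f s)) + ennreal (p f)"
      by (intro ennreal_plus test_seminorm_nonneg[OF p] test_functions_diff f g)
    finally show "ennreal (p g) \<le> ennreal (p (\<lambda>s. g s - f s)) + ennreal (p f)" .
  }
  fix r :: real assume r: "r > 0"
  have "p (\<lambda>s. complex_of_real r * f s) = cmod (complex_of_real r) * p f"
    by (rule seminorm_on_scale[OF s f])
  thus "ennreal (p (\<lambda>s. complex_of_real r * f s)) = ennreal r * ennreal (p f)"
    using r test_seminorm_nonneg[OF p f] by (simp add: ennreal_mult)
next
  have "p (\<lambda>s. 0 * (0::complex)) = cmod 0 * p (\<lambda>s. 0)"
    using seminorm_on_scale[of "test_functions \<Omega>" p "\<lambda>s. 0" 0] p test_functions_zero[of \<Omega>]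
    unfolding test_seminorm_def by blast
  thus "ennreal (p (\<lambda>s. 0)) = 0" by simp
qed

lemma tvs_bounded_test_seminorm:
  assumes "tvs_bounded (test_topology \<Omega>) B" "test_seminorm \<Omega> p"
  obtains C where "C > 0" "\<forall>\<phi>\<in>B. p \<phi> \<le> C"
proof -
  have "(\<lambda>\<phi>. ennreal (p \<phi>)) \<in> {(\<lambda>\<phi>. ennreal (p \<phi>)) | p. test_seminorm \<Omega> p}" using assms(2) by blast
  then obtain C where C: "C > 0" "\<forall>f\<in>B. ennreal (p f) \<le> ennreal C"
    using tvs_bounded_seminormD[OF assms(1)[unfolded test_topology_alt] _
        seminorm_like_test_seminorm[OF assms(2)] test_functions_zero] by blast
  thus ?thesis using that[of C] by (auto simp: ennreal_le_iff)
qed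

text \<open>Suprema of derivatives are continuous seminorms, which gives the uniform bounds. If the
  supports did not lie in one compact set, members of \<open>B\<close> would be nonzero at points
  \<open>x n\<close> escaping from every compact set. A weighted supremum of evaluations at these
  points is a continuous seminorm, since only finitely many of them matter on a given compact set,
  and it is unbounded on \<open>B\<close>.\<close>

lemma tvs_bounded_test_bounded:
  fixes \<Omega> :: "'a::euclidean_space set"
  assumes \<Omega>: "open \<Omega>" and B: "tvs_bounded (test_topology \<Omega>) B"
  shows "test_bounded \<Omega> B"
proof -
  have sub: "B \<subseteq> test_functions \<Omega>" using B by (simp add: tvs_bounded_def)
  have "\<exists>C. \<forall>\<phi>\<in>B. derivs_bounded UNIV n C \<phi>" for n
  proof -
    let ?I = "{bs. set bs \<subseteq> (Basis::'a set) \<and> length bs \<le> n}"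
    have "\<forall>bs\<in>?I. \<exists>C. C > 0 \<and> (\<forall>\<phi>\<in>B. \<forall>x. cmod (iterated_partial bs \<phi> x) \<le> C)"
    proof
      fix bs assume "bs \<in> ?I"
      hence bs: "set bs \<subseteq> Basis" by blast
      let ?p = "\<lambda>\<phi>. SUP x. cmod (iterated_partial bs \<phi> x)"
      have bdd: "bdd_above (range (\<lambda>x. cmod (iterated_partial bs f x)))" if f: "f \<in> test_functions \<Omega>" for f
      proof -
        obtain C where "C \<ge> 0" and C: "derivs_bounded UNIV (length bs) C f" using derivs_bounded_test_function[OF f] .
        show ?thesis by (rule bdd_aboveI[of _ C]) (use derivs_boundedD[OF C bs] in auto)
      qed
      have sn: "seminorm_on (test_functions \<Omega>) ?p"
      proof (rule seminorm_on_SUP[OF test_functions_cmult _ _ bdd])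
        fix x and c and f :: "'a \<Rightarrow> complex" assume f: "f \<in> test_functions \<Omega>"
        show "iterated_partial bs (\<lambda>s. c * f s) x = c * iterated_partial bs f x"
          by (simp add: iterated_partial_cmult[OF test_functionsD(1)[OF f] bs])
        fix g assume g: "g \<in> test_functions \<Omega>"
        show "iterated_partial bs (\<lambda>s. f s + g s) x = iterated_partial bs f x + iterated_partial bs g x"
          by (simp add: iterated_partial_add[OF test_functionsD(1)[OF f] test_functionsD(1)[OF g] bs])
      qed
      have "test_seminorm \<Omega> ?p"
        unfolding test_seminorm_def
      proof (intro conjI allI impI sn)
        fix K assume K: "compact K \<and> K \<subseteq> \<Omega>"
        show "continuous_map (fixed_support_topology K) euclideanreal ?p"
        proof (rule continuous_map_fixed_supportI[OF sn])
          fix \<phi> :: "'a \<Rightarrow> complex" and c assume "derivs_bounded UNIV (length bs) c \<phi>"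
          thus "?p \<phi> \<le> 1 * c" using bs by (auto intro!: cSUP_least derivs_boundedD)
        qed (use K in auto)
      qed
      then obtain C where C: "C > 0" "\<forall>\<phi>\<in>B. ?p \<phi> \<le> C" by (rule tvs_bounded_test_seminorm[OF B])
      have "cmod (iterated_partial bs \<phi> x) \<le> C" if "\<phi> \<in> B" for \<phi> x
        by (rule order_trans[OF cSUP_upper[OF UNIV_I bdd]]) (use that sub C in auto)
      thus "\<exists>C. C > 0 \<and> (\<forall>\<phi>\<in>B. \<forall>x. cmod (iterated_partial bs \<phi> x) \<le> C)" using C(1) by blast
    qed
    from bchoice[OF this] obtain C where
      C: "\<forall>bs\<in>?I. C bs > 0 \<and> (\<forall>\<phi>\<in>B. \<forall>x. cmod (iterated_partial bs \<phi> x) \<le> C bs)" by blast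
    have "derivs_bounded UNIV n (\<Sum>bs\<in>?I. C bs) \<phi>" if "\<phi> \<in> B" for \<phi>
      unfolding derivs_bounded_def
    proof (intro allI impI ballI)
      fix bs x assume bs: "set bs \<subseteq> (Basis::'a set) \<and> length bs \<le> n"
      hence "cmod (iterated_partial bs \<phi> x) \<le> C bs" using C that by blast
      also have "\<dots> \<le> (\<Sum>bs\<in>?I. C bs)"
        by (rule member_le_sum) (use bs C finite_multiindices[where 'a='a, of n] in \<open>auto intro: less_imp_le\<close>)
      finally show "cmod (iterated_partial bs \<phi> x) \<le> (\<Sum>bs\<in>?I. C bs)" .
    qed
    thus ?thesis by blast
  qed
  moreover have "\<exists>K. compact K \<and> K \<subseteq> \<Omega> \<and> (\<forall>\<phi>\<in>B. smooth \<phi> \<and> supp \<phi> \<subseteq> K)"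
  proof (rule ccontr)
    assume no: "\<not> ?thesis"
    obtain C :: "nat \<Rightarrow> 'a set" where C: "\<And>n. compact (C n)" "\<And>n. C n \<subseteq> \<Omega>"
      "\<And>K. compact K \<Longrightarrow> K \<subseteq> \<Omega> \<Longrightarrow> \<exists>N. \<forall>n\<ge>N. K \<subseteq> C n"
      by (rule open_Union_compact_subsets[OF \<Omega>]) blast
    have "\<forall>n. \<exists>z. fst z \<in> B \<and> snd z \<notin> C n \<and> fst z (snd z) \<noteq> 0"
    proof
      fix n
      have "\<not> (\<forall>\<phi>\<in>B. smooth \<phi> \<and> supp \<phi> \<subseteq> C n)" using no C(1)[of n] C(2)[of n] by blast
      then obtain \<phi> where \<phi>: "\<phi> \<in> B" "\<not> (smooth \<phi> \<and> supp \<phi> \<subseteq> C n)" by blast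
      have "smooth \<phi>" using \<phi>(1) sub test_functionsD(1) by blast
      hence "\<not> supp \<phi> \<subseteq> C n" using \<phi>(2) by blast
      moreover have "supp \<phi> \<subseteq> C n" if "\<And>x. x \<notin> C n \<Longrightarrow> \<phi> x = 0"
        using compact_imp_closed[OF C(1)] that by (rule supp_subsetI)
      ultimately obtain x where "x \<notin> C n" "\<phi> x \<noteq> 0" by blast
      thus "\<exists>z. fst z \<in> B \<and> snd z \<notin> C n \<and> fst z (snd z) \<noteq> 0" using \<phi>(1) by (intro exI[of _ "(\<phi>, x)"]) simp
    qed
    from choice[OF this] obtain z where z0: "\<forall>n. fst (z n) \<in> B \<and> snd (z n) \<notin> C n \<and> fst (z n) (snd (z n)) \<noteq> 0" ..
    have z: "fst (z n) \<in> B" "snd (z n) \<notin> C n" "fst (z n) (snd (z n)) \<noteq> 0" for n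
      using spec[OF z0, of n] by auto
    define x where "x = (\<lambda>n. snd (z n))"
    \<comment> \<open>With this weight, the evaluation at \<open>x n\<close> has modulus
      \<open>n\<close> on the function chosen for that point.\<close>
    define w where "w = (\<lambda>n. complex_of_real (real n / cmod (fst (z n) (x n))))"
    let ?L = "\<lambda>n \<phi>. w n * \<phi> (x n)" and ?p = "\<lambda>\<phi>. SUP n. cmod (w n * \<phi> (x n))"
    have fin: "cmod (?L n \<phi>) \<le> (\<Sum>k<N. cmod (w k)) * c"
      if "\<forall>n\<ge>N. K \<subseteq> C n" "supp \<phi> \<subseteq> K" "\<And>y. cmod (\<phi> y) \<le> c" for N K \<phi> c n
    proof (cases "n < N")
      case True
      have "cmod (w n) \<le> (\<Sum>k<N. cmod (w k))" using True by (intro member_le_sum) auto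
      thus ?thesis unfolding norm_mult using that(3) by (intro mult_mono) (auto intro: sum_nonneg)
    next
      case False
      hence "x n \<notin> supp \<phi>" using that(1,2) z(2)[of n] unfolding x_def by (meson not_less subsetD)
      hence "\<phi> (x n) = 0" by (rule zero_outside_supp)
      moreover have "c \<ge> 0" using order_trans[OF norm_ge_zero that(3)] .
      ultimately show ?thesis by (simp add: sum_nonneg)
    qed
    have bdd: "bdd_above (range (\<lambda>n. cmod (?L n \<phi>)))" if \<phi>: "\<phi> \<in> test_functions \<Omega>" for \<phi>
    proof -
      obtain N where N: "\<forall>n\<ge>N. supp \<phi> \<subseteq> C n" using C(3) test_functionsD[OF \<phi>] by blast
      obtain c where "c \<ge> 0" and c: "derivs_bounded UNIV 0 c \<phi>" using derivs_bounded_test_function[OF \<phi>] .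
      show ?thesis
        by (rule bdd_aboveI2[where M="(\<Sum>k<N. cmod (w k)) * c"])
           (rule fin[OF N order_refl derivs_bounded_0D[OF c UNIV_I]])
    qed
    have sn: "seminorm_on (test_functions \<Omega>) ?p"
      by (rule seminorm_on_SUP[where L="?L"]) (simp_all add: test_functions_cmult distrib_left bdd)
    have "test_seminorm \<Omega> ?p"
      unfolding test_seminorm_def
    proof (intro conjI allI impI sn)
      fix K assume K: "compact K \<and> K \<subseteq> \<Omega>"
      then obtain N where N: "\<forall>n\<ge>N. K \<subseteq> C n" using C(3) by blast
      show "continuous_map (fixed_support_topology K) euclideanreal ?p"
      proof (rule continuous_map_fixed_supportI[OF sn])
        fix \<phi> c assume \<phi>: "supp \<phi> \<subseteq> K" "derivs_bounded UNIV 0 c \<phi>"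
        show "?p \<phi> \<le> (\<Sum>k<N. cmod (w k)) * c"
          by (rule cSUP_least) (use fin[OF N \<phi>(1) derivs_bounded_0D[OF \<phi>(2) UNIV_I]] in auto)
      qed (use K in auto)
    qed
    then obtain c where c: "c > 0" "\<forall>\<phi>\<in>B. ?p \<phi> \<le> c" by (rule tvs_bounded_test_seminorm[OF B])
    obtain n :: nat where n: "real n > c" using reals_Archimedean2 by blast
    have zn: "fst (z n) \<in> test_functions \<Omega>" using z(1) sub by blast
    have "real n = cmod (?L n (fst (z n)))"
      using z(3)[of n] by (simp add: w_def x_def norm_mult norm_divide)
    also have "\<dots> \<le> ?p (fst (z n))" by (rule cSUP_upper[OF UNIV_I bdd[OF zn]])
    also have "\<dots> \<le> c" using c(2) z(1) by blast
    finally show False using n by simp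
  qed
  ultimately show ?thesis unfolding test_bounded_def by blast
qed

lemma test_bounded_subset: "test_bounded \<Omega> B \<Longrightarrow> B \<subseteq> test_functions \<Omega>"
proof
  fix \<phi> assume B: "test_bounded \<Omega> B" and \<phi>: "\<phi> \<in> B"
  obtain K where "compact K" "K \<subseteq> \<Omega>" "\<forall>\<phi>\<in>B. smooth \<phi> \<and> supp \<phi> \<subseteq> K"
    using B unfolding test_bounded_def by blast
  thus "\<phi> \<in> test_functions \<Omega>" using \<phi> by (intro test_functionsI[of \<phi> K]) auto
qed

lemma test_bounded_tvs_bounded:
  assumes B: "test_bounded \<Omega> B"
  shows "tvs_bounded (test_topology \<Omega>) B"
  unfolding test_topology_alt
proof (rule tvs_bounded_seminormI)
  show "B \<subseteq> test_functions \<Omega>" by (rule test_bounded_subset[OF B])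
  show "(\<lambda>s. complex_of_real r * f s) \<in> test_functions \<Omega>" if "f \<in> test_functions \<Omega>" for r f
    by (rule test_functions_cmult[OF that])
  fix q assume "q \<in> {(\<lambda>\<phi>. ennreal (p \<phi>)) | p. test_seminorm \<Omega> p}"
  then obtain p where p: "q = (\<lambda>\<phi>. ennreal (p \<phi>))" "test_seminorm \<Omega> p" by blast
  show "seminorm_like (test_functions \<Omega>) q" unfolding p(1) by (rule seminorm_like_test_seminorm[OF p(2)])
  obtain K where K: "compact K" "K \<subseteq> \<Omega>" "\<forall>\<phi>\<in>B. smooth \<phi> \<and> supp \<phi> \<subseteq> K"
    using B unfolding test_bounded_def by blast
  have sn: "seminorm_on (test_functions \<Omega>) p" and cm: "continuous_map (fixed_support_topology K) euclideanreal p"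
    using p(2) K unfolding test_seminorm_def by blast+
  obtain n C where C: "C \<ge> 0"
    "\<forall>\<phi> c. smooth \<phi> \<longrightarrow> supp \<phi> \<subseteq> K \<longrightarrow> derivs_bounded UNIV n c \<phi> \<longrightarrow> p \<phi> \<le> C * c"
    by (rule continuous_map_fixed_supportD[OF sn K(1,2) cm])
  obtain c where c: "\<forall>\<phi>\<in>B. derivs_bounded UNIV n c \<phi>" using B unfolding test_bounded_def by blast
  have "q f \<le> ennreal (C * c)" if "f \<in> B" for f
    unfolding p(1) using C(2) K(3) c that by (intro ennreal_leI) blast
  thus "\<exists>C. \<forall>f\<in>B. q f \<le> ennreal C" by blast
qed

section \<open>Linear functionals of locally finite order\<close>

lemma linear_on_functions_scale:
  assumes "linear_on_functions E u" "f \<in> E"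
  shows "u (\<lambda>s. c * f s) = c * u f"
proof -
  have "u (\<lambda>s. c * f s + 0 * f s) = c * u f + 0 * u f" using assms unfolding linear_on_functions_def by blast
  thus ?thesis by simp
qed

lemma linear_on_functions_add:
  assumes "linear_on_functions E u" "f \<in> E" "g \<in> E"
  shows "u (\<lambda>s. f s + g s) = u f + u g"
proof -
  have "u (\<lambda>s. 1 * f s + 1 * g s) = 1 * u f + 1 * u g" using assms unfolding linear_on_functions_def by blast
  thus ?thesis by simp
qed

lemma linear_on_functions_diff:
  assumes "linear_on_functions E u" "f \<in> E" "g \<in> E"
  shows "u (\<lambda>s. f s - g s) = u f - u g"
proof -
  have "u (\<lambda>s. 1 * f s + -1 * g s) = 1 * u f + -1 * u g" using assms unfolding linear_on_functions_def by blast
  thus ?thesis by simp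
qed

lemma linear_on_functions_zero:
  assumes "linear_on_functions (test_functions \<Omega>) u"
  shows "u (\<lambda>s. 0) = 0"
  using linear_on_functions_scale[OF assms test_functions_zero, of 0] by simp

lemma linear_on_functions_sum:
  assumes "linear_on_functions (test_functions \<Omega>) u" "\<And>i. i \<in> I \<Longrightarrow> f i \<in> test_functions \<Omega>"
  shows "u (\<lambda>s. \<Sum>i\<in>I. f i s) = (\<Sum>i\<in>I. u (f i))"
  using assms(2)
proof (induction I rule: infinite_finite_induct)
  case (insert i I)
  have "u (\<lambda>s. f i s + (\<Sum>i\<in>I. f i s)) = u (f i) + u (\<lambda>s. \<Sum>i\<in>I. f i s)"
    using insert.prems by (intro linear_on_functions_add[OF assms(1)] test_functions_sum) auto
  thus ?case using insert by simp
qed (simp_all add: linear_on_functions_zero[OF assms(1)])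

text \<open>
  Boundedness on bounded sets already gives a uniform order: otherwise normalised counterexamples
  would form a bounded sequence on which the functionals are unbounded.
\<close>
lemma uniform_order_bound:
  fixes \<Omega> :: "'a::euclidean_space set"
  assumes lin: "\<And>u. u \<in> A \<Longrightarrow> linear_on_functions (test_functions \<Omega>) u"
    and bdd: "\<And>B. test_bounded \<Omega> B \<Longrightarrow> \<exists>C. \<forall>u\<in>A. \<forall>\<phi>\<in>B. cmod (u \<phi>) \<le> C"
    and K: "compact K" "K \<subseteq> \<Omega>"
  shows "\<exists>n C. C \<ge> 0 \<and> (\<forall>u\<in>A. order_bound K n C u)"
proof (rule ccontr)
  assume no: "\<not> ?thesis"
  have "\<forall>n::nat. \<exists>z. fst z \<in> A \<and> smooth (snd z) \<and> supp (snd z) \<subseteq> K \<and> derivs_bounded UNIV n 1 (snd z) \<and>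
      cmod (fst z (snd z)) > real n"
  proof
    fix n :: nat
    \<comment> \<open>The negated claim is applied with order and constant both equal to
      \<open>n\<close>, so that a single sequence defeats every order and every constant.\<close>
    have "\<not> (real n \<ge> 0 \<and> (\<forall>u\<in>A. order_bound K n (real n) u))" using no by blast
    then obtain u where u: "u \<in> A" "\<not> order_bound K n (real n) u" by auto
    then obtain \<phi> c where \<phi>: "smooth \<phi>" "supp \<phi> \<subseteq> K" "derivs_bounded UNIV n c \<phi>"
      and gt: "\<not> cmod (u \<phi>) \<le> real n * c"
      unfolding order_bound_def by blast
    have T: "\<phi> \<in> test_functions \<Omega>" using \<phi> K test_functionsI by blast
    have "c \<noteq> 0"
    proof
      assume "c = 0"
      hence "\<phi> = (\<lambda>s. 0)" using derivs_bounded_0D[OF \<phi>(3)] by (intro ext) simp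
      thus False using gt \<open>c = 0\<close> linear_on_functions_zero[OF lin[OF u(1)]] by simp
    qed
    hence c: "c > 0" using derivs_bounded_nonneg[OF \<phi>(3)] by simp
    let ?\<psi> = "\<lambda>x. complex_of_real (1 / c) * \<phi> x"
    have "derivs_bounded UNIV n 1 ?\<psi>"
      using derivs_bounded_cmult[OF \<phi>(1,3), of "complex_of_real (1 / c)"] c by (simp add: norm_divide)
    moreover have "cmod (u ?\<psi>) > real n"
    proof -
      have eq: "cmod (u ?\<psi>) = 1 / c * cmod (u \<phi>)"
        unfolding linear_on_functions_scale[OF lin[OF u(1)] T] norm_mult using c by (simp add: norm_divide)
      have "real n < 1 / c * cmod (u \<phi>)" using gt c by (simp add: field_simps)
      thus ?thesis unfolding eq .
    qed
    moreover have "smooth ?\<psi>" by (rule smooth_cmult[OF \<phi>(1)])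
    moreover have "supp ?\<psi> \<subseteq> K" using supp_mult_right \<phi>(2) by (rule order_trans)
    ultimately show "\<exists>z. fst z \<in> A \<and> smooth (snd z) \<and> supp (snd z) \<subseteq> K \<and> derivs_bounded UNIV n 1 (snd z) \<and>
      cmod (fst z (snd z)) > real n" using u(1) by (intro exI[of _ "(u, ?\<psi>)"]) simp
  qed
  from choice[OF this] obtain z where z0: "\<forall>n. fst (z n) \<in> A \<and> smooth (snd (z n)) \<and> supp (snd (z n)) \<subseteq> K \<and>
    derivs_bounded UNIV n 1 (snd (z n)) \<and> cmod (fst (z n) (snd (z n))) > real n" ..
  have z: "fst (z n) \<in> A" "smooth (snd (z n))" "supp (snd (z n)) \<subseteq> K"
    "derivs_bounded UNIV n 1 (snd (z n))" "cmod (fst (z n) (snd (z n))) > real n" for n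
    using spec[OF z0, of n] by auto
  have "\<exists>C. \<forall>\<phi>\<in>range (\<lambda>n. snd (z n)). derivs_bounded UNIV m C \<phi>" for m
  proof -
    have "\<forall>n. \<exists>C. C \<ge> 0 \<and> derivs_bounded UNIV m C (snd (z n))"
    proof
      fix n
      obtain C where "C \<ge> 0" "derivs_bounded UNIV m C (snd (z n))"
        using derivs_bounded_test_function[OF test_functionsI[OF z(2,3) K]] .
      thus "\<exists>C. C \<ge> 0 \<and> derivs_bounded UNIV m C (snd (z n))" by blast
    qed
    from choice[OF this] obtain C where C0: "\<forall>n. C n \<ge> 0 \<and> derivs_bounded UNIV m (C n) (snd (z n))" ..
    have C: "C n \<ge> 0" "derivs_bounded UNIV m (C n) (snd (z n))" for n using spec[OF C0, of n] by auto
    \<comment> \<open>At order \<open>m\<close> the members with index at least \<open>m\<close> are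
      bounded by 1; the finitely many earlier ones contribute their own constants.\<close>
    have "derivs_bounded UNIV m (1 + (\<Sum>n<m. C n)) (snd (z n))" for n
    proof (cases "n < m")
      case True
      hence "C n \<le> (\<Sum>n<m. C n)" using C(1) by (intro member_le_sum) auto
      thus ?thesis using C(2)[of n] by (elim derivs_bounded_mono) auto
    next
      case False
      have "0 \<le> (\<Sum>n<m. C n)" using C(1) by (intro sum_nonneg) auto
      thus ?thesis using z(4)[of n] False by (elim derivs_bounded_mono) auto
    qed
    thus ?thesis by blast
  qed
  hence "test_bounded \<Omega> (range (\<lambda>n. snd (z n)))"
    unfolding test_bounded_def
    by (intro conjI exI[of _ K] allI K) (use z(2,3) in auto)
  from bdd[OF this] obtain C where C: "\<forall>u\<in>A. \<forall>\<phi>\<in>range (\<lambda>n. snd (z n)). cmod (u \<phi>) \<le> C" ..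
  obtain n :: nat where n: "real n > C" using reals_Archimedean2 by blast
  have "cmod (fst (z n) (snd (z n))) \<le> C" using C z(1)[of n] by blast
  thus False using z(5)[of n] n by linarith
qed

lemma distributionsD:
  assumes "u \<in> distributions \<Omega>"
  shows "linear_on_functions (test_functions \<Omega>) u" "\<phi> \<notin> test_functions \<Omega> \<Longrightarrow> u \<phi> = 0"
  using assms unfolding distributions_def by auto

text \<open>The set where \<open>u\<close> has modulus below 1 is a zero neighbourhood and therefore
  absorbs \<open>B\<close>.\<close>

lemma distribution_bounded:
  assumes u: "u \<in> distributions \<Omega>" and B: "test_bounded \<Omega> B"
  shows "\<exists>C. \<forall>\<phi>\<in>B. cmod (u \<phi>) \<le> C"
proof -
  have "openin (test_topology \<Omega>) {f \<in> topspace (test_topology \<Omega>). u f \<in> ball 0 1}"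
    using u unfolding distributions_def by (intro openin_continuous_map_preimage) auto
  hence "zero_neighborhood (test_topology \<Omega>) {f \<in> test_functions \<Omega>. cmod (u f) < 1}"
    unfolding zero_neighborhood_def
    using linear_on_functions_zero[OF distributionsD(1)[OF u]] test_functions_zero[of \<Omega>]
    by (auto intro!: exI[of _ "{f \<in> test_functions \<Omega>. cmod (u f) < 1}"])
  then obtain r where r: "r > 0" "B \<subseteq> (\<lambda>f s. complex_of_real r * f s) ` {f \<in> test_functions \<Omega>. cmod (u f) < 1}"
    using test_bounded_tvs_bounded[OF B] unfolding tvs_bounded_def by blast
  have "cmod (u \<phi>) \<le> r" if "\<phi> \<in> B" for \<phi>
  proof -
    have "\<phi> \<in> (\<lambda>f s. complex_of_real r * f s) ` {f \<in> test_functions \<Omega>. cmod (u f) < 1}"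
      using r(2) that by blast
    then obtain f where "\<phi> = (\<lambda>s. complex_of_real r * f s)" "f \<in> {f \<in> test_functions \<Omega>. cmod (u f) < 1}"
      by (rule imageE)
    hence f: "\<phi> = (\<lambda>s. complex_of_real r * f s)" "f \<in> test_functions \<Omega>" "cmod (u f) < 1" by auto
    hence "cmod (u \<phi>) = r * cmod (u f)"
      using linear_on_functions_scale[OF distributionsD(1)[OF u] f(2), of "complex_of_real r"] r(1)
      by (simp add: norm_mult)
    also have "\<dots> \<le> r * 1" using f(3) r(1) by (intro mult_left_mono) auto
    finally show ?thesis by simp
  qed
  thus ?thesis by blast
qed

lemma distribution_order_bound:
  assumes u: "u \<in> distributions \<Omega>" and K: "compact K" "K \<subseteq> \<Omega>"
  obtains n C where "C \<ge> 0" "order_bound K n C u"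
proof -
  have "\<exists>n C. C \<ge> 0 \<and> (\<forall>u\<in>{u}. order_bound K n C u)"
    by (rule uniform_order_bound[OF _ _ K]) (use distributionsD(1)[OF u] distribution_bounded[OF u] in auto)
  thus ?thesis using that by blast
qed

text \<open>Order bounds on compact sets make \<open>\<lambda>\<phi>. cmod (u \<phi>)\<close> one of
  the generating seminorms of \<open>test_topology\<close>, and \<open>u\<close> is trivially
  continuous with respect to it.\<close>

lemma distributionsI:
  assumes lin: "linear_on_functions (test_functions \<Omega>) u"
    and out: "\<And>\<phi>. \<phi> \<notin> test_functions \<Omega> \<Longrightarrow> u \<phi> = 0"
    and ord: "\<And>K. compact K \<Longrightarrow> K \<subseteq> \<Omega> \<Longrightarrow> \<exists>n C. order_bound K n C u"
  shows "u \<in> distributions \<Omega>"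
proof -
  let ?p = "\<lambda>\<phi>. cmod (u \<phi>)"
  have sn: "seminorm_on (test_functions \<Omega>) ?p"
  proof (rule seminorm_onI[OF test_functions_cmult])
    fix c and f g :: "'a \<Rightarrow> complex" assume f: "f \<in> test_functions \<Omega>"
    show "cmod (u (\<lambda>s. c * f s)) \<le> cmod c * cmod (u f)"
      unfolding linear_on_functions_scale[OF lin f] norm_mult by simp
    assume g: "g \<in> test_functions \<Omega>"
    show "cmod (u (\<lambda>s. f s + g s)) \<le> cmod (u f) + cmod (u g)"
      unfolding linear_on_functions_add[OF lin f g] by (rule norm_triangle_ineq)
  qed auto
  have ts: "test_seminorm \<Omega> ?p"
    unfolding test_seminorm_def
  proof (intro conjI allI impI sn)
    fix K assume K: "compact K \<and> K \<subseteq> \<Omega>"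
    then obtain n C where nC: "order_bound K n C u" using ord by blast
    show "continuous_map (fixed_support_topology K) euclideanreal ?p"
      by (rule continuous_map_fixed_supportI[OF sn]) (use K nC in \<open>auto simp: order_bound_def\<close>)
  qed
  have "continuous_map (test_topology \<Omega>) euclidean u"
    unfolding continuous_map_def
  proof (intro conjI allI impI)
    fix U :: "complex set" assume "openin euclidean U"
    hence U: "open U" by simp
    show "openin (test_topology \<Omega>) {x \<in> topspace (test_topology \<Omega>). u x \<in> U}"
      unfolding test_topology_alt openin_seminorm_topology topspace_seminorm_topology
    proof (intro conjI ballI)
      fix f assume f: "f \<in> {x \<in> test_functions \<Omega>. u x \<in> U}"
      hence "u f \<in> U" by simp
      then obtain e where e: "e > 0" "\<And>y. dist y (u f) < e \<Longrightarrow> y \<in> U" using U unfolding open_dist by blast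
      have "u g \<in> U" if g: "g \<in> test_functions \<Omega>" and lt: "ennreal (?p (\<lambda>s. g s - f s)) < ennreal e" for g
      proof (rule e(2))
        have "u (\<lambda>s. g s - f s) = u g - u f" using f by (intro linear_on_functions_diff[OF lin g]) simp
        thus "dist (u g) (u f) < e" using lt by (simp add: dist_norm ennreal_less_iff)
      qed
      hence "{g \<in> test_functions \<Omega>. \<forall>p\<in>{\<lambda>\<phi>. ennreal (?p \<phi>)}. p (\<lambda>s. g s - f s) < ennreal e}
          \<subseteq> {x \<in> test_functions \<Omega>. u x \<in> U}" by auto
      moreover have "{\<lambda>\<phi>. ennreal (?p \<phi>)} \<subseteq> {(\<lambda>\<phi>. ennreal (p \<phi>)) | p. test_seminorm \<Omega> p}"
        by (unfold insert_subset, intro conjI CollectI exI[of _ ?p] refl ts empty_subsetI)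
      ultimately show "\<exists>F \<epsilon>. finite F \<and> F \<subseteq> {(\<lambda>\<phi>. ennreal (p \<phi>)) | p. test_seminorm \<Omega> p} \<and> 0 < \<epsilon> \<and>
          {g \<in> test_functions \<Omega>. \<forall>p\<in>F. p (\<lambda>s. g s - f s) < ennreal \<epsilon>} \<subseteq> {x \<in> test_functions \<Omega>. u x \<in> U}"
        using e(1) by (intro exI[of _ "{\<lambda>\<phi>. ennreal (?p \<phi>)}"] exI[of _ e] conjI) auto
    qed auto
  qed auto
  thus ?thesis using lin out unfolding distributions_def by blast
qed

section \<open>Fubini for the tensor product\<close>

text \<open>Approximation by trigonometric polynomials reduces the claim to plane waves.\<close>
lemma iterated_partial_permute:
  assumes \<phi>: "\<phi> \<in> test_functions \<Omega>" and bs: "set bs \<subseteq> Basis" "mset bs = mset bs'"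
  shows "iterated_partial bs \<phi> x = iterated_partial bs' \<phi> x"
proof -
  have bs': "set bs' \<subseteq> Basis" "length bs' = length bs"
    using bs mset_eq_setD[OF bs(2)] mset_eq_length[OF bs(2)] by auto
  have "bounded (insert x (supp \<phi>))" using test_functionsD(2)[OF \<phi>] compact_imp_bounded by simp
  then obtain R where R: "R > 0" "insert x (supp \<phi>) \<subseteq> open_cube R" by (rule bounded_subset_open_cube)
  have sub: "supp \<phi> \<subseteq> cube R" using R(2) open_cube_subset_cube by blast
  have x: "x \<in> open_cube R" using R(2) by simp
  have "cmod (iterated_partial bs \<phi> x - iterated_partial bs' \<phi> x) \<le> 0 + \<epsilon>" if \<epsilon>: "\<epsilon> > 0" for \<epsilon>
  proof -
    have "\<epsilon> / 2 > 0" using \<epsilon> by simp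
    then obtain F where F: "finite F" "F \<subseteq> wave_lattice R"
      "derivs_bounded (open_cube R) (length bs) (\<epsilon> / 2) (\<lambda>x. \<phi> x - (\<Sum>q\<in>F. fourier_coeff R \<phi> q * wave q x))"
      by (rule fourier_approx[OF R(1) test_functionsD(1)[OF \<phi>] sub])
    let ?s = "\<lambda>x. \<Sum>q\<in>F. fourier_coeff R \<phi> q * wave q x"
    have sm: "smooth ?s" by (intro smooth_sum smooth_cmult smooth_wave)
    have eq: "iterated_partial bs ?s x = iterated_partial bs' ?s x"
    proof -
      \<comment> \<open>On plane waves an iterated derivative is a product over the list, hence
        insensitive to the order of its entries.\<close>
      have "prod_list (map f bs) = prod_list (map f bs')" for f :: "'a \<Rightarrow> complex"
        using bs(2) by (metis mset_map prod_mset_prod_list)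
      thus ?thesis using bs(1) bs'(1)
        by (simp add: iterated_partial_sum iterated_partial_cmult iterated_partial_wave smooth_cmult)
    qed
    have 1: "cmod (iterated_partial bs \<phi> x - iterated_partial bs ?s x) \<le> \<epsilon> / 2"
      using derivs_boundedD[OF F(3) bs(1) order_refl x]
      by (simp add: iterated_partial_diff[OF test_functionsD(1)[OF \<phi>] sm bs(1)])
    have 2: "cmod (iterated_partial bs' \<phi> x - iterated_partial bs' ?s x) \<le> \<epsilon> / 2"
      using derivs_boundedD[OF F(3) bs'(1) _ x] bs'(2)
      by (simp add: iterated_partial_diff[OF test_functionsD(1)[OF \<phi>] sm bs'(1)])
    have "cmod (iterated_partial bs \<phi> x - iterated_partial bs' \<phi> x) \<le>
        cmod (iterated_partial bs \<phi> x - iterated_partial bs ?s x) + cmod (iterated_partial bs' \<phi> x - iterated_partial bs ?s x)"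
      using dist_triangle2[of "iterated_partial bs \<phi> x" "iterated_partial bs' \<phi> x" "iterated_partial bs ?s x"]
      by (simp add: dist_norm)
    thus ?thesis using 1 2 eq by simp
  qed
  hence "cmod (iterated_partial bs \<phi> x - iterated_partial bs' \<phi> x) \<le> 0" by (rule field_le_epsilon)
  thus ?thesis by simp
qed

lemma order_boundD:
  "order_bound K n C u \<Longrightarrow> smooth \<phi> \<Longrightarrow> supp \<phi> \<subseteq> K \<Longrightarrow> derivs_bounded UNIV n c \<phi> \<Longrightarrow> cmod (u \<phi>) \<le> C * c"
  unfolding order_bound_def by blast

lemma supp_slice2:
  assumes "supp \<phi> \<subseteq> K1 \<times> K2" "closed K2"
  shows "supp (\<lambda>y. \<phi> (x, y)) \<subseteq> K2"
proof (rule supp_subsetI[OF assms(2)])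
  fix y assume "y \<notin> K2"
  hence "(x, y) \<notin> supp \<phi>" using assms(1) by blast
  thus "\<phi> (x, y) = 0" by (rule zero_outside_supp)
qed

text \<open>The setting for functions \<open>\<lambda>x. v (\<lambda>y. \<phi> (x, y))\<close>. An
  order bound with explicit \<open>N\<close> and \<open>C\<close> is all that is known of the
  continuity of \<open>v\<close>, so the conclusions are uniform over every family of functionals
  that shares these numbers.\<close>

locale slice_functional =
  fixes \<Omega> K2 :: "'b::euclidean_space set" and N :: nat and C :: real and v :: "('b \<Rightarrow> complex) \<Rightarrow> complex"
  assumes lin: "linear_on_functions (test_functions \<Omega>) v"
    and ord: "order_bound K2 N C v" and K2: "compact K2" "K2 \<subseteq> \<Omega>"
begin

lemma slice_test: "smooth \<phi> \<Longrightarrow> supp \<phi> \<subseteq> K1 \<times> K2 \<Longrightarrow> (\<lambda>y. \<phi> (x, y)) \<in> test_functions \<Omega>"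
  by (rule test_functionsI[OF smooth_slice2 supp_slice2 K2]) (simp_all add: compact_imp_closed K2)

text \<open>As a function of \<open>y\<close>, the Taylor remainder in \<open>x\<close> is supported
  in \<open>K2\<close> and is O(|h|^2) together with its derivatives up to order \<open>N\<close>,
  so \<open>v\<close> maps it to O(|h|^2). A \<open>y\<close>-derivative of the remainder is
  estimated as the remainder of that \<open>y\<close>-derivative of \<open>\<phi>\<close>.\<close>

lemma has_derivative_slice:
  fixes \<phi> :: "'a::euclidean_space \<times> 'b \<Rightarrow> complex"
  assumes \<phi>: "smooth \<phi>" "supp \<phi> \<subseteq> K1 \<times> K2" and K1: "compact K1"
  shows "((\<lambda>x. v (\<lambda>y. \<phi> (x, y))) has_derivative
    (\<lambda>h. \<Sum>b\<in>Basis. complex_of_real (h \<bullet> b) * v (\<lambda>y. partial_deriv (b, 0) \<phi> (x, y)))) (at x)"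
proof -
  let ?p = "\<lambda>b. partial_deriv (b, 0) \<phi>"
  have T: "\<phi> \<in> test_functions UNIV" by (rule test_functionsI[OF \<phi> compact_Times[OF K1 K2(1)]]) simp
  obtain c where c: "c \<ge> 0" "derivs_bounded UNIV (2 + N) c \<phi>" using derivs_bounded_test_function[OF T] .
  have C: "order_bound K2 N \<bar>C\<bar> v"
    unfolding order_bound_def
  proof (intro allI impI)
    fix \<psi> c assume \<psi>: "smooth \<psi>" "supp \<psi> \<subseteq> K2" "derivs_bounded UNIV N c \<psi>"
    have "cmod (v \<psi>) \<le> C * c" by (rule order_boundD[OF ord \<psi>])
    also have "\<dots> \<le> \<bar>C\<bar> * c" using derivs_bounded_nonneg[OF \<psi>(3)] by (intro mult_right_mono) auto
    finally show "cmod (v \<psi>) \<le> \<bar>C\<bar> * c" .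
  qed
  define M where "M = \<bar>C\<bar> * ((DIM('a))\<^sup>2 * c)"
  have sp: "smooth (?p b)" "supp (?p b) \<subseteq> K1 \<times> K2" if "b \<in> Basis" for b
    using smooth_partial_deriv[OF \<phi>(1) Basis_left[OF that]] order_trans[OF supp_partial_deriv \<phi>(2)] by auto
  have le: "cmod (v (\<lambda>y. \<phi> (x + h, y)) - v (\<lambda>y. \<phi> (x, y)) -
      (\<Sum>b\<in>Basis. complex_of_real (h \<bullet> b) * v (\<lambda>y. ?p b (x, y)))) \<le> M * (norm h)\<^sup>2" for h
  proof -
    let ?r = "\<lambda>y. \<phi> (x + h, y) - \<phi> (x, y) - (\<Sum>b\<in>Basis. complex_of_real (h \<bullet> b) * ?p b (x, y))"
    have t: "(\<lambda>y. \<phi> (x', y)) \<in> test_functions \<Omega>" for x' by (rule slice_test[OF \<phi>])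
    have tp: "(\<lambda>y. ?p b (x, y)) \<in> test_functions \<Omega>" if "b \<in> Basis" for b by (rule slice_test[OF sp[OF that]])
    have ts: "(\<lambda>y. \<Sum>b\<in>Basis. complex_of_real (h \<bullet> b) * ?p b (x, y)) \<in> test_functions \<Omega>"
      by (intro test_functions_sum test_functions_cmult tp)
    have "v ?r = v (\<lambda>y. \<phi> (x + h, y)) - v (\<lambda>y. \<phi> (x, y)) - v (\<lambda>y. \<Sum>b\<in>Basis. complex_of_real (h \<bullet> b) * ?p b (x, y))"
      unfolding linear_on_functions_diff[OF lin test_functions_diff[OF t t] ts] linear_on_functions_diff[OF lin t t] ..
    also have "v (\<lambda>y. \<Sum>b\<in>Basis. complex_of_real (h \<bullet> b) * ?p b (x, y)) = (\<Sum>b\<in>Basis. v (\<lambda>y. complex_of_real (h \<bullet> b) * ?p b (x, y)))"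
      by (intro linear_on_functions_sum[OF lin] test_functions_cmult tp)
    also have "\<dots> = (\<Sum>b\<in>Basis. complex_of_real (h \<bullet> b) * v (\<lambda>y. ?p b (x, y)))"
      by (intro sum.cong refl linear_on_functions_scale[OF lin] tp)
    finally have vr: "v ?r = v (\<lambda>y. \<phi> (x + h, y)) - v (\<lambda>y. \<phi> (x, y)) - (\<Sum>b\<in>Basis. complex_of_real (h \<bullet> b) * v (\<lambda>y. ?p b (x, y)))" .
    have sm: "smooth (\<lambda>y. \<phi> (x', y))" for x' by (rule smooth_slice2[OF \<phi>(1)])
    have smp: "smooth (\<lambda>y. ?p b (x, y))" if "b \<in> Basis" for b by (rule smooth_slice2[OF sp(1)[OF that]])
    have sms: "smooth (\<lambda>y. \<Sum>b\<in>Basis. complex_of_real (h \<bullet> b) * ?p b (x, y))"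
      by (intro smooth_sum smooth_cmult smp)
    have smr: "smooth ?r" by (intro smooth_diff sm sms)
    have out: "\<psi> (x', y) = 0" if "supp \<psi> \<subseteq> K1 \<times> K2" "y \<notin> K2" for \<psi> :: "'a \<times> 'b \<Rightarrow> complex" and x' y
    proof (rule zero_outside_supp[of "(x', y)" \<psi>])
      show "(x', y) \<notin> supp \<psi>" using that by blast
    qed
    have spr: "supp ?r \<subseteq> K2"
      by (rule supp_subsetI) (use out[OF \<phi>(2)] out[OF sp(2)] in \<open>simp_all add: compact_imp_closed K2\<close>)
    have "derivs_bounded UNIV N ((DIM('a))\<^sup>2 * c * (norm h)\<^sup>2) ?r"
      unfolding derivs_bounded_def
    proof (intro allI impI ballI)
      fix bs and y :: 'b assume bs: "set bs \<subseteq> (Basis::'b set) \<and> length bs \<le> N"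
      hence sb: "set bs \<subseteq> Basis" and len: "length bs \<le> N" by auto
      let ?bs = "map (\<lambda>b. (0::'a, b)) bs"
      have sb': "set ?bs \<subseteq> Basis" using sb by (auto intro: Basis_right)
      let ?f = "iterated_partial ?bs \<phi>"
      have smf: "smooth ?f" by (rule smooth_iterated_partial[OF \<phi>(1) sb'])
      have "derivs_bounded UNIV 2 c ?f"
        by (rule derivs_bounded_iterated_partial[OF derivs_bounded_mono[OF c(2)] sb']) (use len in auto)
      hence bf: "derivs_bounded UNIV 2 c (\<lambda>x. ?f (x, y))" by (rule derivs_bounded_slice1[OF smf])
      \<comment> \<open>Symmetry of mixed derivatives: with the \<open>x\<close>-derivative moved
        outside, the expression becomes the Taylor remainder of \<open>?f\<close> in
        \<open>x\<close>.\<close>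
      have comm: "iterated_partial ?bs (?p b) (x, y) = partial_deriv b (\<lambda>x. ?f (x, y)) x" if b: "b \<in> Basis" for b
      proof -
        have "iterated_partial ?bs (?p b) (x, y) = iterated_partial (?bs @ [(b, 0)]) \<phi> (x, y)"
          by (simp only: iterated_partial_snoc)
        also have "\<dots> = iterated_partial ((b, 0) # ?bs) \<phi> (x, y)"
          by (rule iterated_partial_permute[OF T]) (use sb' Basis_left[OF b] in auto)
        also have "\<dots> = partial_deriv b (\<lambda>x. ?f (x, y)) x"
          unfolding iterated_partial_Cons by (rule partial_deriv_slice1[symmetric, OF smooth_differentiable[OF smf]])
        finally show ?thesis .
      qed
      have "iterated_partial bs ?r y = ?f (x + h, y) - ?f (x, y) - (\<Sum>b\<in>Basis. complex_of_real (h \<bullet> b) * iterated_partial ?bs (?p b) (x, y))"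
        using iterated_partial_diff[OF smooth_diff[OF sm sm] sms sb, of "x + h" x]
          iterated_partial_diff[OF sm sm sb, of "x + h" x]
        by (simp add: iterated_partial_sum[OF smooth_cmult[OF smp] sb] iterated_partial_cmult[OF smp sb]
            iterated_partial_slice2[OF \<phi>(1) sb] iterated_partial_slice2[OF sp(1) sb])
      also have "\<dots> = ?f (x + h, y) - ?f (x, y) - (\<Sum>b\<in>Basis. (h \<bullet> b) *\<^sub>R partial_deriv b (\<lambda>x. ?f (x, y)) x)"
        by (simp add: comm scaleR_conv_of_real)
      also have "cmod \<dots> \<le> (DIM('a))\<^sup>2 * c * (norm h)\<^sup>2"
        by (rule smooth_second_order[OF smooth_slice1[OF smf] bf])
      finally show "cmod (iterated_partial bs ?r y) \<le> (DIM('a))\<^sup>2 * c * (norm h)\<^sup>2" .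
    qed
    from order_boundD[OF C smr spr this] show ?thesis unfolding vr M_def by (simp add: mult.assoc)
  qed
  show ?thesis
  proof (rule has_derivativeI_sandwich[where H="\<lambda>y. M * norm (y - x)" and e=1])
    show "bounded_linear (\<lambda>h. \<Sum>b\<in>Basis. complex_of_real (h \<bullet> b) * v (\<lambda>y. ?p b (x, y)))"
      by (intro bounded_linear_sum bounded_linear_mult_const bounded_linear_compose[OF bounded_linear_of_real]
          bounded_linear_inner_left)
    show "((\<lambda>y. M * norm (y - x)) \<longlongrightarrow> 0) (at x within UNIV)"
      by (auto intro!: tendsto_eq_intros)
    fix z assume "z \<noteq> x"
    hence "norm (z - x) > 0" by simp
    thus "norm (v (\<lambda>y. \<phi> (z, y)) - v (\<lambda>y. \<phi> (x, y)) - (\<Sum>b\<in>Basis. complex_of_real ((z - x) \<bullet> b) * v (\<lambda>y. ?p b (x, y)))) / norm (z - x)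
        \<le> M * norm (z - x)"
      using le[of "z - x"] by (simp add: pos_divide_le_eq power2_eq_square mult.assoc)
  qed simp
qed

lemma partial_deriv_slice_functional:
  fixes \<phi> :: "'a::euclidean_space \<times> 'b \<Rightarrow> complex"
  assumes "smooth \<phi>" "supp \<phi> \<subseteq> K1 \<times> K2" "compact K1" "b \<in> Basis"
  shows "partial_deriv b (\<lambda>x. v (\<lambda>y. \<phi> (x, y))) = (\<lambda>x. v (\<lambda>y. partial_deriv (b, 0) \<phi> (x, y)))"
proof
  fix x
  have "(\<Sum>b'\<in>Basis. complex_of_real (b \<bullet> b') * v (\<lambda>y. partial_deriv (b', 0) \<phi> (x, y))) =
      (\<Sum>b'\<in>Basis. if b' = b then v (\<lambda>y. partial_deriv (b, 0) \<phi> (x, y)) else 0)"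
    by (rule sum.cong) (use assms(4) in \<open>auto simp: inner_Basis\<close>)
  thus "partial_deriv b (\<lambda>x. v (\<lambda>y. \<phi> (x, y))) x = v (\<lambda>y. partial_deriv (b, 0) \<phi> (x, y))"
    using partial_deriv_eqI[OF has_derivative_slice[OF assms(1-3)], of b x] assms(4) by simp
qed

lemma smooth_slice_functional:
  fixes \<phi> :: "'a::euclidean_space \<times> 'b \<Rightarrow> complex"
  assumes "smooth \<phi>" "supp \<phi> \<subseteq> K1 \<times> K2" "compact K1"
  shows "smooth (\<lambda>x. v (\<lambda>y. \<phi> (x, y)))"
proof -
  have "n_smooth n (\<lambda>x. v (\<lambda>y. \<phi> (x, y)))" for n
    using assms(1,2)
  proof (induction n arbitrary: \<phi>)
    case 0
    show ?case using has_derivative_slice[OF 0 assms(3)] unfolding n_smooth.simps differentiable_def by blast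
  next
    case (Suc n)
    show ?case unfolding n_smooth.simps(2)
    proof (intro conjI allI ballI)
      show "(\<lambda>x. v (\<lambda>y. \<phi> (x, y))) differentiable (at x)" for x
        using has_derivative_slice[OF Suc.prems assms(3)] unfolding differentiable_def by blast
      fix b :: 'a assume b: "b \<in> Basis"
      have "n_smooth n (\<lambda>x. v (\<lambda>y. partial_deriv (b, 0) \<phi> (x, y)))"
        by (intro Suc.IH smooth_partial_deriv Suc.prems Basis_left b order_trans[OF supp_partial_deriv Suc.prems(2)])
      thus "n_smooth n (partial_deriv b (\<lambda>x. v (\<lambda>y. \<phi> (x, y))))"
        by (simp only: partial_deriv_slice_functional[OF Suc.prems assms(3) b])
    qed
  qed
  thus ?thesis by (simp add: smooth_iff_n_smooth)
qed

lemma iterated_partial_slice_functional: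
  fixes \<phi> :: "'a::euclidean_space \<times> 'b \<Rightarrow> complex"
  assumes "smooth \<phi>" "supp \<phi> \<subseteq> K1 \<times> K2" "compact K1" "set bs \<subseteq> Basis"
  shows "iterated_partial bs (\<lambda>x. v (\<lambda>y. \<phi> (x, y))) =
    (\<lambda>x. v (\<lambda>y. iterated_partial (map (\<lambda>b. (b, 0)) bs) \<phi> (x, y)))"
  using assms(4)
proof (induction bs)
  case (Cons b bs)
  hence b: "b \<in> Basis" "set bs \<subseteq> Basis" by auto
  have sm: "smooth (iterated_partial (map (\<lambda>b. (b, 0)) bs) \<phi>)"
    using b(2) by (intro smooth_iterated_partial assms) (auto intro: Basis_left)
  have sp: "supp (iterated_partial (map (\<lambda>b. (b, 0)) bs) \<phi>) \<subseteq> K1 \<times> K2"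
    using supp_iterated_partial assms(2) by (rule order_trans)
  show ?case
    unfolding iterated_partial_Cons list.map Cons.IH[OF b(2)]
    by (rule partial_deriv_slice_functional[OF sm sp assms(3) b(1)])
qed simp

lemma supp_slice_functional:
  assumes "supp \<phi> \<subseteq> K1 \<times> K2" "closed K1"
  shows "supp (\<lambda>x. v (\<lambda>y. \<phi> (x, y))) \<subseteq> K1"
proof (rule supp_subsetI[OF assms(2)])
  fix x assume "x \<notin> K1"
  hence "\<phi> (x, y) = 0" for y
    using assms(1) by (intro zero_outside_supp[of "(x, y)" \<phi>]) blast
  thus "v (\<lambda>y. \<phi> (x, y)) = 0" using linear_on_functions_zero[OF lin] by simp
qed

text \<open>The \<open>x\<close>-derivatives pass to \<open>\<phi>\<close>, and \<open>v\<close>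
  spends another \<open>N\<close> derivatives in \<open>y\<close>; hence the order
  \<open>N + m\<close>.\<close>

lemma derivs_bounded_slice_functional:
  fixes \<phi> :: "'a::euclidean_space \<times> 'b \<Rightarrow> complex"
  assumes \<phi>: "smooth \<phi>" "supp \<phi> \<subseteq> K1 \<times> K2" and K1: "compact K1" and c: "derivs_bounded UNIV (N + m) c \<phi>"
  shows "derivs_bounded UNIV m (C * c) (\<lambda>x. v (\<lambda>y. \<phi> (x, y)))"
  unfolding derivs_bounded_def
proof (intro allI impI ballI)
  fix bs and x :: 'a assume bs: "set bs \<subseteq> (Basis::'a set) \<and> length bs \<le> m"
  let ?f = "iterated_partial (map (\<lambda>b. (b, 0)) bs) \<phi>"
  have sb: "set (map (\<lambda>b. (b, 0::'b)) bs) \<subseteq> Basis" using bs by (auto intro: Basis_left)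
  have sm: "smooth ?f" by (rule smooth_iterated_partial[OF \<phi>(1) sb])
  have sp: "supp ?f \<subseteq> K1 \<times> K2" using supp_iterated_partial \<phi>(2) by (rule order_trans)
  have "derivs_bounded UNIV N c ?f"
    by (rule derivs_bounded_iterated_partial[OF derivs_bounded_mono[OF c] sb]) (use bs in auto)
  hence "cmod (v (\<lambda>y. ?f (x, y))) \<le> C * c"
    by (intro order_boundD[OF ord smooth_slice2[OF sm] supp_slice2[OF sp]] derivs_bounded_slice2 sm compact_imp_closed K2)
  thus "cmod (iterated_partial bs (\<lambda>x. v (\<lambda>y. \<phi> (x, y))) x) \<le> C * c"
    using iterated_partial_slice_functional[OF \<phi> K1, of bs] bs by simp
qed

end

section \<open>The iterated pairing and its symmetry\<close>

lemma test_functions_prod_supp: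
  assumes "\<phi> \<in> test_functions (\<Omega>1 \<times> \<Omega>2)"
  obtains K1 K2 where "compact K1" "K1 \<subseteq> \<Omega>1" "compact K2" "K2 \<subseteq> \<Omega>2" "supp \<phi> \<subseteq> K1 \<times> K2"
proof
  have s: "compact (supp \<phi>)" "supp \<phi> \<subseteq> \<Omega>1 \<times> \<Omega>2" using test_functionsD[OF assms] by auto
  show "compact (fst ` supp \<phi>)" "compact (snd ` supp \<phi>)"
    by (intro compact_continuous_image s continuous_on_fst continuous_on_snd continuous_on_id)+
  show "fst ` supp \<phi> \<subseteq> \<Omega>1" "snd ` supp \<phi> \<subseteq> \<Omega>2" using s(2) by auto
  show "supp \<phi> \<subseteq> fst ` supp \<phi> \<times> snd ` supp \<phi>" by (rule subset_fst_snd)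
qed

lemma slice_functional_distribution:
  assumes "v \<in> distributions \<Omega>" "compact K" "K \<subseteq> \<Omega>"
  obtains n C where "C \<ge> 0" "slice_functional \<Omega> K n C v"
proof -
  obtain n C where "C \<ge> 0" "order_bound K n C v" by (rule distribution_order_bound[OF assms])
  thus ?thesis using that distributionsD(1)[OF assms(1)] assms(2,3) by (simp add: slice_functional_def)
qed

text \<open>\<open>tensor_distribution\<close> without the default value 0 outside the test
  functions, which is convenient for exchanging the variables.\<close>

definition iterated_pairing ::
    "(('a \<Rightarrow> complex) \<Rightarrow> complex) \<Rightarrow> (('b \<Rightarrow> complex) \<Rightarrow> complex) \<Rightarrow> ('a \<times> 'b \<Rightarrow> complex) \<Rightarrow> complex" where
  "iterated_pairing u v \<phi> = u (\<lambda>x. v (\<lambda>y. \<phi> (x, y)))"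

lemma slice2_test_function:
  assumes \<phi>: "\<phi> \<in> test_functions (\<Omega>1 \<times> \<Omega>2)"
  shows "(\<lambda>y. \<phi> (x, y)) \<in> test_functions \<Omega>2"
proof -
  obtain K1 K2 where K: "compact K1" "K1 \<subseteq> \<Omega>1" "compact K2" "K2 \<subseteq> \<Omega>2" "supp \<phi> \<subseteq> K1 \<times> K2"
    by (rule test_functions_prod_supp[OF \<phi>])
  show ?thesis
    by (rule test_functionsI[OF smooth_slice2[OF test_functionsD(1)[OF \<phi>]] supp_slice2[OF K(5)] K(3,4)])
       (rule compact_imp_closed[OF K(3)])
qed

lemma slice_pairing_test_function:
  assumes v: "v \<in> distributions \<Omega>2" and \<phi>: "\<phi> \<in> test_functions (\<Omega>1 \<times> \<Omega>2)"
  shows "(\<lambda>x. v (\<lambda>y. \<phi> (x, y))) \<in> test_functions \<Omega>1"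
proof -
  obtain K1 K2 where K: "compact K1" "K1 \<subseteq> \<Omega>1" "compact K2" "K2 \<subseteq> \<Omega>2" "supp \<phi> \<subseteq> K1 \<times> K2"
    by (rule test_functions_prod_supp[OF \<phi>])
  obtain n C where "slice_functional \<Omega>2 K2 n C v" by (rule slice_functional_distribution[OF v K(3,4)])
  then interpret slice_functional \<Omega>2 K2 n C v .
  show ?thesis
    by (rule test_functionsI[OF smooth_slice_functional[OF test_functionsD(1)[OF \<phi>] K(5,1)]
          supp_slice_functional[OF K(5) compact_imp_closed[OF K(1)]] K(1,2)])
qed

lemma linear_iterated_pairing:
  assumes u: "u \<in> distributions \<Omega>1" and v: "v \<in> distributions \<Omega>2"
  shows "linear_on_functions (test_functions (\<Omega>1 \<times> \<Omega>2)) (iterated_pairing u v)"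
  unfolding linear_on_functions_def
proof (intro ballI allI)
  fix f g a b assume f: "f \<in> test_functions (\<Omega>1 \<times> \<Omega>2)" and g: "g \<in> test_functions (\<Omega>1 \<times> \<Omega>2)"
  have "v (\<lambda>y. a * f (x, y) + b * g (x, y)) = a * v (\<lambda>y. f (x, y)) + b * v (\<lambda>y. g (x, y))" for x
    using distributionsD(1)[OF v] slice2_test_function[OF f, of x] slice2_test_function[OF g, of x]
    by (simp add: linear_on_functions_def)
  moreover have "u (\<lambda>x. a * v (\<lambda>y. f (x, y)) + b * v (\<lambda>y. g (x, y))) =
      a * u (\<lambda>x. v (\<lambda>y. f (x, y))) + b * u (\<lambda>x. v (\<lambda>y. g (x, y)))"
    using distributionsD(1)[OF u] slice_pairing_test_function[OF v f] slice_pairing_test_function[OF v g]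
    by (simp add: linear_on_functions_def)
  ultimately show "iterated_pairing u v (\<lambda>s. a * f s + b * g s) = a * iterated_pairing u v f + b * iterated_pairing u v g"
    by (simp add: iterated_pairing_def)
qed

text \<open>On top of the \<open>n\<close> derivatives spent by \<open>v\<close>, the functional
  \<open>u\<close> spends \<open>m\<close> derivatives of the partial pairing; orders add and
  constants multiply.\<close>

lemma order_bound_iterated_pairing:
  assumes u: "order_bound K1 m C1 u" "C1 \<ge> 0" "compact K1" and v: "slice_functional \<Omega>2 K2 n C2 v"
  shows "order_bound (K1 \<times> K2) (n + m) (C1 * C2) (iterated_pairing u v)"
  unfolding order_bound_def iterated_pairing_def
proof (intro allI impI)
  interpret slice_functional \<Omega>2 K2 n C2 v by (rule v)
  fix \<phi> c assume \<phi>: "smooth \<phi>" "supp \<phi> \<subseteq> K1 \<times> K2" "derivs_bounded UNIV (n + m) c \<phi>"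
  have "cmod (u (\<lambda>x. v (\<lambda>y. \<phi> (x, y)))) \<le> C1 * (C2 * c)"
    using u(3) compact_imp_closed[OF u(3)]
    by (intro order_boundD[OF u(1)] smooth_slice_functional[OF \<phi>(1,2)] supp_slice_functional[OF \<phi>(2)]
        derivs_bounded_slice_functional[OF \<phi>(1,2) _ \<phi>(3)]) auto
  thus "cmod (u (\<lambda>x. v (\<lambda>y. \<phi> (x, y)))) \<le> C1 * C2 * c" by (simp add: mult.assoc)
qed

lemma swap_test_function:
  assumes "\<phi> \<in> test_functions (\<Omega>1 \<times> \<Omega>2)"
  shows "(\<lambda>z. \<phi> (prod.swap z)) \<in> test_functions (\<Omega>2 \<times> \<Omega>1)"
proof -
  obtain K1 K2 where K: "compact K1" "K1 \<subseteq> \<Omega>1" "compact K2" "K2 \<subseteq> \<Omega>2" "supp \<phi> \<subseteq> K1 \<times> K2"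
    by (rule test_functions_prod_supp[OF assms])
  have "supp (\<lambda>z. \<phi> (prod.swap z)) \<subseteq> K2 \<times> K1"
  proof (rule supp_subsetI)
    show "closed (K2 \<times> K1)" using K by (intro closed_Times compact_imp_closed)
    fix z assume "z \<notin> K2 \<times> K1"
    hence "prod.swap z \<notin> supp \<phi>" using K(5) by (cases z) auto
    thus "\<phi> (prod.swap z) = 0" by (rule zero_outside_supp)
  qed
  thus ?thesis
    by (rule test_functionsI[OF smooth_swap[OF test_functionsD(1)[OF assms]] _ compact_Times[OF K(3,1)] Sigma_mono])
       (use K in auto)
qed

text \<open>Both sides are continuous and agree on products of plane waves with cutoffs.\<close>
lemma iterated_pairing_swap:
  fixes \<Omega>1 :: "'a::euclidean_space set" and \<Omega>2 :: "'b::euclidean_space set"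
  assumes \<Omega>: "open \<Omega>1" "open \<Omega>2" and u: "u \<in> distributions \<Omega>1" and v: "v \<in> distributions \<Omega>2"
    and \<phi>: "\<phi> \<in> test_functions (\<Omega>1 \<times> \<Omega>2)"
  shows "iterated_pairing u v \<phi> = iterated_pairing v u (\<lambda>z. \<phi> (prod.swap z))"
proof -
  define T where "T = iterated_pairing u v"
  define T' where "T' = (\<lambda>\<phi>. iterated_pairing v u (\<lambda>z. \<phi> (prod.swap z)))"
  obtain K1 K2 where K: "compact K1" "K1 \<subseteq> \<Omega>1" "compact K2" "K2 \<subseteq> \<Omega>2" "supp \<phi> \<subseteq> K1 \<times> K2"
    by (rule test_functions_prod_supp[OF \<phi>])
  obtain f where f: "f \<in> test_functions \<Omega>1" "\<forall>x\<in>K1. f x = 1" by (rule cutoff_exists[OF K(1,2) \<Omega>(1)])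
  obtain g where g: "g \<in> test_functions \<Omega>2" "\<forall>x\<in>K2. g x = 1" by (rule cutoff_exists[OF K(3,4) \<Omega>(2)])
  \<comment> \<open>Plane waves are not test functions. This cutoff makes them so, leaves
    \<open>\<phi>\<close> unchanged and respects the product structure.\<close>
  define \<psi> where "\<psi> = (\<lambda>z. f (fst z) * g (snd z))"
  have fD: "smooth f" "compact (supp f)" "supp f \<subseteq> \<Omega>1" and gD: "smooth g" "compact (supp g)" "supp g \<subseteq> \<Omega>2"
    using test_functionsD[OF f(1)] test_functionsD[OF g(1)] by auto
  have ps: "smooth \<psi>" unfolding \<psi>_def by (intro smooth_mult smooth_fst smooth_snd fD gD)
  have psupp: "supp \<psi> \<subseteq> supp f \<times> supp g"
  proof (rule supp_subsetI)
    fix z assume "z \<notin> supp f \<times> supp g"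
    hence "fst z \<notin> supp f \<or> snd z \<notin> supp g" by (cases z) auto
    thus "\<psi> z = 0" unfolding \<psi>_def using zero_outside_supp[of "fst z" f] zero_outside_supp[of "snd z" g] by auto
  qed (intro closed_Times closed_supp)
  have pT: "\<psi> \<in> test_functions (\<Omega>1 \<times> \<Omega>2)"
    by (rule test_functionsI[OF ps psupp compact_Times[OF fD(2) gD(2)] Sigma_mono[OF fD(3) gD(3)]])
  have p1: "\<psi> z * \<phi> z = \<phi> z" for z
  proof (cases "z \<in> supp \<phi>")
    case True
    hence "\<psi> z = 1" unfolding \<psi>_def using K(5) f(2) g(2) by (cases z) auto
    thus ?thesis by simp
  next
    case False thus ?thesis using zero_outside_supp[of z \<phi>] by simp
  qed
  obtain n1 C1 where s1: "C1 \<ge> 0" "slice_functional \<Omega>1 (supp f) n1 C1 u"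
    by (rule slice_functional_distribution[OF u fD(2,3)])
  obtain n2 C2 where s2: "C2 \<ge> 0" "slice_functional \<Omega>2 (supp g) n2 C2 v"
    by (rule slice_functional_distribution[OF v gD(2,3)])
  have o1: "order_bound (supp f) n1 C1 u" and o2: "order_bound (supp g) n2 C2 v"
    using s1(2) s2(2) by (auto simp: slice_functional_def)
  define n where "n = n1 + n2"
  have oT: "cmod (T \<eta>) \<le> C1 * C2 * c" if "smooth \<eta>" "supp \<eta> \<subseteq> supp f \<times> supp g" "derivs_bounded UNIV n c \<eta>" for \<eta> c
    using order_boundD[OF order_bound_iterated_pairing[OF o1 s1(1) fD(2) s2(2)] that(1,2)] that(3)
    by (simp add: T_def n_def add.commute)
  have oT': "cmod (T' \<eta>) \<le> C1 * C2 * c" if "smooth \<eta>" "supp \<eta> \<subseteq> supp f \<times> supp g" "derivs_bounded UNIV n c \<eta>" for \<eta> c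
  proof -
    have "supp (\<lambda>z. \<eta> (prod.swap z)) \<subseteq> supp g \<times> supp f"
    proof (rule supp_subsetI)
      fix z assume "z \<notin> supp g \<times> supp f"
      hence "prod.swap z \<notin> supp \<eta>" using that(2) by (cases z) auto
      thus "\<eta> (prod.swap z) = 0" by (rule zero_outside_supp)
    qed (intro closed_Times closed_supp)
    from order_boundD[OF order_bound_iterated_pairing[OF o2 s2(1) gD(2) s1(2)] smooth_swap[OF that(1)] this]
    show ?thesis using derivs_bounded_swap[OF that(1,3)] by (simp add: T'_def n_def mult.commute)
  qed
  have linT: "linear_on_functions (test_functions (\<Omega>1 \<times> \<Omega>2)) T"
    unfolding T_def by (rule linear_iterated_pairing[OF u v])
  have linT': "linear_on_functions (test_functions (\<Omega>1 \<times> \<Omega>2)) T'"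
    unfolding linear_on_functions_def T'_def
  proof (intro ballI allI)
    fix h k a b assume h: "h \<in> test_functions (\<Omega>1 \<times> \<Omega>2)" and k: "k \<in> test_functions (\<Omega>1 \<times> \<Omega>2)"
    show "iterated_pairing v u (\<lambda>z. a * h (prod.swap z) + b * k (prod.swap z)) =
        a * iterated_pairing v u (\<lambda>z. h (prod.swap z)) + b * iterated_pairing v u (\<lambda>z. k (prod.swap z))"
      using linear_iterated_pairing[OF v u] swap_test_function[OF h] swap_test_function[OF k]
      by (simp add: linear_on_functions_def)
  qed
  \<comment> \<open>Both pairings factor into the value of \<open>u\<close> at \<open>?a\<close>
    times the value of \<open>v\<close> at \<open>?b\<close>.\<close>
  have wq: "T (\<lambda>z. \<psi> z * wave q z) = T' (\<lambda>z. \<psi> z * wave q z)" for q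
  proof -
    obtain q1 q2 where q: "q = (q1, q2)" by (cases q)
    let ?a = "\<lambda>x. f x * wave q1 x" and ?b = "\<lambda>y. g y * wave q2 y"
    have ta: "?a \<in> test_functions \<Omega>1" and tb: "?b \<in> test_functions \<Omega>2"
      by (intro test_functions_mult f g smooth_wave)+
    have "T (\<lambda>z. \<psi> z * wave q z) = u (\<lambda>x. v (\<lambda>y. ?a x * ?b y))"
      by (simp add: T_def iterated_pairing_def \<psi>_def q wave_Pair mult_ac)
    also have "\<dots> = u (\<lambda>x. v ?b * ?a x)"
      using linear_on_functions_scale[OF distributionsD(1)[OF v] tb] by (simp add: mult.commute)
    also have "\<dots> = v ?b * u ?a"
      by (rule linear_on_functions_scale[OF distributionsD(1)[OF u] ta])
    also have "\<dots> = v (\<lambda>y. u ?a * ?b y)"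
      using linear_on_functions_scale[OF distributionsD(1)[OF v] tb, of "u ?a"] by (simp add: mult.commute)
    also have "\<dots> = v (\<lambda>y. u (\<lambda>x. ?b y * ?a x))"
    proof -
      have "u (\<lambda>x. ?b y * ?a x) = u ?a * ?b y" for y
        using linear_on_functions_scale[OF distributionsD(1)[OF u] ta, of "?b y"] by (simp add: mult.commute)
      thus ?thesis by simp
    qed
    also have "\<dots> = T' (\<lambda>z. \<psi> z * wave q z)"
      by (simp add: T'_def iterated_pairing_def \<psi>_def q wave_Pair mult_ac)
    finally show ?thesis .
  qed
  have "bounded (supp f \<times> supp g)" using fD gD by (intro bounded_Times compact_imp_bounded)
  then obtain R where R: "R > 0" "supp f \<times> supp g \<subseteq> open_cube R" by (rule bounded_subset_open_cube)
  have sub: "supp \<phi> \<subseteq> cube R"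
  proof
    fix z assume z: "z \<in> supp \<phi>"
    hence "z \<in> K1 \<times> K2" using K(5) by blast
    hence "f (fst z) = 1" "g (snd z) = 1" using f(2) g(2) by auto
    hence "fst z \<in> supp f" "snd z \<in> supp g"
      using zero_outside_supp[of "fst z" f] zero_outside_supp[of "snd z" g] by force+
    hence "z \<in> supp f \<times> supp g" by (cases z) auto
    thus "z \<in> cube R" using R(2) open_cube_subset_cube by blast
  qed
  obtain Cp where Cp: "Cp \<ge> 0" "derivs_bounded UNIV n Cp \<psi>" using derivs_bounded_test_function[OF pT] .
  \<comment> \<open>Twice the common constant \<open>C1 * C2\<close> of the two functionals, times
    the cost \<open>2 ^ n * Cp\<close> of multiplying by \<open>\<psi>\<close>.\<close>
  define B where "B = 2 * (C1 * C2 * (2 ^ n * Cp))"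
  have B: "B \<ge> 0" using s1(1) s2(1) Cp(1) by (simp add: B_def)
  have le: "cmod (T \<phi> - T' \<phi>) \<le> B * \<epsilon>" if \<epsilon>: "\<epsilon> > 0" for \<epsilon>
  proof -
    obtain F where F: "finite F" "F \<subseteq> wave_lattice R"
      "derivs_bounded (open_cube R) n \<epsilon> (\<lambda>x. \<phi> x - (\<Sum>q\<in>F. fourier_coeff R \<phi> q * wave q x))"
      by (rule fourier_approx[OF R(1) test_functionsD(1)[OF \<phi>] sub \<epsilon>])
    let ?s = "\<lambda>z. \<Sum>q\<in>F. fourier_coeff R \<phi> q * wave q z" and ?c = "fourier_coeff R \<phi>"
    let ?d = "\<lambda>z. \<phi> z - ?s z"
    let ?e = "\<lambda>z. \<psi> z * ?d z"
    have sd: "smooth ?d" by (intro smooth_diff test_functionsD(1)[OF \<phi>] smooth_sum smooth_cmult smooth_wave)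
    have se: "smooth ?e" by (rule smooth_mult[OF ps sd])
    have spe: "supp ?e \<subseteq> supp f \<times> supp g" using supp_mult_left psupp by (rule order_trans)
    have "derivs_bounded UNIV n (2 ^ n * Cp * \<epsilon>) ?e"
      by (rule derivs_bounded_mult_supp[OF ps sd _ derivs_bounded_mono[OF Cp(2)] F(3)])
         (use psupp R(2) Cp \<epsilon> in auto)
    hence e1: "cmod (T ?e) \<le> C1 * C2 * (2 ^ n * Cp * \<epsilon>)" and e2: "cmod (T' ?e) \<le> C1 * C2 * (2 ^ n * Cp * \<epsilon>)"
      using oT[OF se spe] oT'[OF se spe] by auto
    have te: "?e \<in> test_functions (\<Omega>1 \<times> \<Omega>2)" by (rule test_functions_mult[OF pT sd])
    have tw: "(\<lambda>z. \<psi> z * wave q z) \<in> test_functions (\<Omega>1 \<times> \<Omega>2)" for q by (rule test_functions_mult[OF pT smooth_wave])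
    have dec: "\<phi> = (\<lambda>z. ?e z + (\<Sum>q\<in>F. ?c q * (\<psi> z * wave q z)))"
    proof
      fix z
      have "(\<Sum>q\<in>F. ?c q * (\<psi> z * wave q z)) = \<psi> z * ?s z" by (simp add: sum_distrib_left mult_ac)
      thus "\<phi> z = ?e z + (\<Sum>q\<in>F. ?c q * (\<psi> z * wave q z))"
        using p1[of z] by (simp add: right_diff_distrib)
    qed
    have L: "L \<phi> = L ?e + (\<Sum>q\<in>F. ?c q * L (\<lambda>z. \<psi> z * wave q z))"
      if lin: "linear_on_functions (test_functions (\<Omega>1 \<times> \<Omega>2)) L" for L
    proof -
      have "L \<phi> = L (\<lambda>z. ?e z + (\<Sum>q\<in>F. ?c q * (\<psi> z * wave q z)))" using dec by (rule arg_cong)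
      also have "\<dots> = L ?e + L (\<lambda>z. \<Sum>q\<in>F. ?c q * (\<psi> z * wave q z))"
        by (intro linear_on_functions_add[OF lin] te test_functions_sum test_functions_cmult tw)
      also have "L (\<lambda>z. \<Sum>q\<in>F. ?c q * (\<psi> z * wave q z)) = (\<Sum>q\<in>F. L (\<lambda>z. ?c q * (\<psi> z * wave q z)))"
        by (intro linear_on_functions_sum[OF lin] test_functions_cmult tw)
      also have "\<dots> = (\<Sum>q\<in>F. ?c q * L (\<lambda>z. \<psi> z * wave q z))"
        by (intro sum.cong refl linear_on_functions_scale[OF lin] tw)
      finally show ?thesis .
    qed
    have "T \<phi> - T' \<phi> = T ?e - T' ?e" unfolding L[OF linT] L[OF linT'] wq by simp
    hence "cmod (T \<phi> - T' \<phi>) \<le> cmod (T ?e) + cmod (T' ?e)" using norm_triangle_ineq4[of "T ?e" "T' ?e"] by simp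
    also have "\<dots> \<le> B * \<epsilon>" using e1 e2 by (simp add: B_def mult_ac)
    finally show ?thesis .
  qed
  have "cmod (T \<phi> - T' \<phi>) \<le> 0"
  proof (rule field_le_epsilon)
    fix e :: real assume e: "e > 0"
    have "cmod (T \<phi> - T' \<phi>) \<le> B * (e / (B + 1))" using e B by (intro le) simp
    also have "\<dots> \<le> e" using e B by (simp add: pos_divide_le_eq add_nonneg_pos mult.commute distrib_left)
    finally show "cmod (T \<phi> - T' \<phi>) \<le> 0 + e" by simp
  qed
  thus ?thesis by (simp add: T_def T'_def)
qed

lemma tensor_distribution_iterated_pairing:
  "\<phi> \<in> test_functions (\<Omega>1 \<times> \<Omega>2) \<Longrightarrow> tensor_distribution \<Omega>1 \<Omega>2 u v \<phi> = iterated_pairing u v \<phi>"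
  by (simp add: tensor_distribution_def iterated_pairing_def)

text \<open>A compact set is enlarged to the product of its two projections, on which the order
  bounds of \<open>u\<close> and \<open>v\<close> combine.\<close>

lemma tensor_distribution_in_distributions:
  assumes u: "u \<in> distributions \<Omega>1" and v: "v \<in> distributions \<Omega>2"
  shows "tensor_distribution \<Omega>1 \<Omega>2 u v \<in> distributions (\<Omega>1 \<times> \<Omega>2)"
proof (rule distributionsI)
  have "\<forall>f\<in>test_functions (\<Omega>1 \<times> \<Omega>2). \<forall>g\<in>test_functions (\<Omega>1 \<times> \<Omega>2). \<forall>a b.
      iterated_pairing u v (\<lambda>s. a * f s + b * g s) = a * iterated_pairing u v f + b * iterated_pairing u v g"
    using linear_iterated_pairing[OF u v] unfolding linear_on_functions_def .
  thus "linear_on_functions (test_functions (\<Omega>1 \<times> \<Omega>2)) (tensor_distribution \<Omega>1 \<Omega>2 u v)"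
    unfolding linear_on_functions_def
    by (simp add: tensor_distribution_iterated_pairing test_functions_lincomb)
  show "tensor_distribution \<Omega>1 \<Omega>2 u v \<phi> = 0" if "\<phi> \<notin> test_functions (\<Omega>1 \<times> \<Omega>2)" for \<phi>
    using that by (simp add: tensor_distribution_def)
  fix K assume K: "compact K" "K \<subseteq> \<Omega>1 \<times> \<Omega>2"
  have K1: "compact (fst ` K)" "fst ` K \<subseteq> \<Omega>1" and K2: "compact (snd ` K)" "snd ` K \<subseteq> \<Omega>2"
    using K by (auto intro!: compact_continuous_image continuous_on_fst continuous_on_snd continuous_on_id)
  obtain m C1 where 1: "C1 \<ge> 0" "order_bound (fst ` K) m C1 u" by (rule distribution_order_bound[OF u K1])
  obtain n C2 where 2: "C2 \<ge> 0" "slice_functional \<Omega>2 (snd ` K) n C2 v" by (rule slice_functional_distribution[OF v K2])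
  have "order_bound K (n + m) (C1 * C2) (tensor_distribution \<Omega>1 \<Omega>2 u v)"
    unfolding order_bound_def
  proof (intro allI impI)
    fix \<phi> c assume \<phi>: "smooth \<phi>" "supp \<phi> \<subseteq> K" "derivs_bounded UNIV (n + m) c \<phi>"
    have "K \<subseteq> fst ` K \<times> snd ` K" by (rule subset_fst_snd)
    hence "supp \<phi> \<subseteq> fst ` K \<times> snd ` K" using \<phi>(2) by (rule order_trans[rotated])
    from order_boundD[OF order_bound_iterated_pairing[OF 1(2,1) K1(1) 2(2)] \<phi>(1) this \<phi>(3)]
    show "cmod (tensor_distribution \<Omega>1 \<Omega>2 u v \<phi>) \<le> C1 * C2 * c"
      by (simp add: tensor_distribution_iterated_pairing test_functionsI[OF \<phi>(1,2) K])
  qed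
  thus "\<exists>n C. order_bound K n C (tensor_distribution \<Omega>1 \<Omega>2 u v)" by blast
qed

section \<open>Localized Fourier transforms and the normal topology\<close>

lemma localized_fourier_wave: "localized_fourier \<theta> u k = u (\<lambda>x. \<theta> x * wave k x)"
  by (simp add: localized_fourier_def wave_def)

text \<open>This and \<open>test_bound\<close> are real-valued forms of bounds for the two kinds of
  seminorms; the estimates below are linear in these bounds.\<close>

definition localized_bound ::
    "(('a::euclidean_space \<Rightarrow> complex) \<Rightarrow> complex) \<Rightarrow> nat \<Rightarrow> 'a set \<Rightarrow> ('a \<Rightarrow> complex) \<Rightarrow> real \<Rightarrow> bool" where
  "localized_bound u N V \<theta> S \<longleftrightarrow> (\<forall>k\<in>V. (1 + norm k) ^ N * cmod (localized_fourier \<theta> u k) \<le> S)"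

definition test_bound ::
    "(('a::euclidean_space \<Rightarrow> complex) \<Rightarrow> complex) \<Rightarrow> ('a \<Rightarrow> complex) set \<Rightarrow> real \<Rightarrow> bool" where
  "test_bound u B P \<longleftrightarrow> (\<forall>\<phi>\<in>B. cmod (u \<phi>) \<le> P)"

lemma localized_boundD:
  "localized_bound u N V \<theta> S \<Longrightarrow> k \<in> V \<Longrightarrow> (1 + norm k) ^ N * cmod (localized_fourier \<theta> u k) \<le> S"
  by (simp add: localized_bound_def)

lemma test_boundD: "test_bound u B P \<Longrightarrow> \<phi> \<in> B \<Longrightarrow> cmod (u \<phi>) \<le> P"
  by (simp add: test_bound_def)

text \<open>Peetre's inequality: it moves a polynomial weight from \<open>k\<close> to
  \<open>k + q\<close> at the cost of a weight in \<open>q\<close>.\<close>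

lemma one_plus_norm_le_mult:
  fixes k q :: "'a::real_normed_vector"
  shows "1 + norm k \<le> (1 + norm (k + q)) * (1 + norm q)"
proof -
  have "norm k \<le> norm (k + q) + norm q" using norm_triangle_ineq4[of "k + q" q] by simp
  moreover have "0 \<le> norm (k + q) * norm q" by simp
  moreover have "(1 + norm (k + q)) * (1 + norm q) = 1 + norm (k + q) + norm q + norm (k + q) * norm q"
    by (simp add: distrib_left distrib_right)
  ultimately show ?thesis by linarith
qed

text \<open>
  Expanding \<open>a\<close> in a Fourier series turns the localisation by \<open>a\<psi>\<close> at \<open>k\<close> into a superposition of
  localisations by \<open>\<psi>\<close> at the points \<open>k + q\<close>. The points outside \<open>V\<close> have \<open>q\<close> comparable to \<open>k\<close>, so the
  rapid decay of the Fourier coefficients makes their total contribution a bounded set of test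
  functions.
\<close>
lemma localized_fourier_transfer:
  fixes \<psi> :: "'a::euclidean_space \<Rightarrow> complex" and W V :: "'a set" and c :: real
  assumes \<psi>: "\<psi> \<in> test_functions \<Omega>" and A: "test_bounded UNIV A"
    and c: "c > 0" and sep: "\<And>k q. k \<in> W \<Longrightarrow> k + q \<notin> V \<Longrightarrow> c * norm k \<le> norm q"
  obtains C B where "C \<ge> 0" "test_bounded \<Omega> B"
    "\<forall>u\<in>distributions \<Omega>. \<forall>S\<ge>0. \<forall>P\<ge>0. localized_bound u N V \<psi> S \<longrightarrow> test_bound u B P \<longrightarrow>
      (\<forall>a\<in>A. localized_bound u N W (\<lambda>x. a x * \<psi> x) (C * S + P))"
proof -
  obtain K where K: "compact K" "\<forall>a\<in>A. smooth a \<and> supp a \<subseteq> K"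
    using A unfolding test_bounded_def by blast
  have "bounded (supp \<psi> \<union> K)"
    using compact_imp_bounded[OF test_functionsD(2)[OF \<psi>]] compact_imp_bounded[OF K(1)] by simp
  then obtain R where R: "R > 0" "supp \<psi> \<union> K \<subseteq> open_cube R" by (rule bounded_subset_open_cube)
  let ?L = "wave_lattice R :: 'a set" and ?c = "\<lambda>a q. fourier_coeff R a q"
  have aD: "smooth a" "supp a \<subseteq> cube R" if "a \<in> A" for a
    using K(2) that R(2) open_cube_subset_cube[where R=R] by blast+
  have decay: "\<exists>Q\<ge>0. \<forall>a\<in>A. \<forall>q. cmod (?c a q) \<le> Q / (1 + norm q) ^ M" for M
  proof -
    obtain C where C: "\<forall>a\<in>A. derivs_bounded UNIV M C a" using A unfolding test_bounded_def by blast
    have "cmod (?c a q) \<le> (1 + DIM('a)) ^ M * \<bar>C\<bar> / (1 + norm q) ^ M" if "a \<in> A" for a q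
    proof (rule fourier_coeff_decay[OF R(1) aD[OF that]])
      show "derivs_bounded UNIV M \<bar>C\<bar> a"
        by (rule derivs_bounded_mono[OF bspec[OF C that] order_refl order_refl abs_ge_self])
    qed
    thus ?thesis by (intro exI[of _ "(1 + DIM('a)) ^ M * \<bar>C\<bar>"]) auto
  qed
  define D where "D = 2 * DIM('a)"
  have sD: "(\<lambda>q::'a. 1 / (1 + norm q) ^ D) summable_on ?L"
    by (rule summable_wave_lattice[OF R(1)]) (simp add: D_def)
  define T where "T = infsum (\<lambda>q::'a. 1 / (1 + norm q) ^ D) ?L"
  have pos: "1 + norm q > 0" for q :: 'a using norm_ge_zero[of q] by linarith
  have T_sum: "(\<Sum>q\<in>F. 1 / (1 + norm q) ^ D) \<le> T" if "finite F" "F \<subseteq> ?L" for F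
    unfolding T_def by (rule finite_sum_le_infsum[OF sD that]) (use pos in \<open>auto intro: less_imp_le\<close>)
  have T0: "T \<ge> 0" using T_sum[of "{}"] by simp
  \<comment> \<open>The weighted contribution of the frequencies outside \<open>V\<close>, packaged
    as a single test function. Finite sets \<open>F\<close> suffice, since \<open>a\<close> is only
    approximated by finite partial sums.\<close>
  define \<beta> where "\<beta> = (\<lambda>F k a x. complex_of_real ((1 + norm k) ^ N) *
    (\<Sum>q\<in>{q\<in>F. k + q \<notin> V}. ?c a q * (\<psi> x * wave (k + q) x)))"
  define B where "B = {\<beta> F k a | F k a. finite F \<and> F \<subseteq> ?L \<and> k \<in> W \<and> a \<in> A}"
  have sw: "smooth (\<lambda>x. \<psi> x * wave k x)" for k by (intro smooth_mult test_functionsD(1)[OF \<psi>] smooth_wave)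
  \<comment> \<open>The power \<open>N\<close> pays for moving the weight from \<open>k\<close> to
    \<open>k + q\<close>, the power \<open>D\<close> for the sum over the lattice.\<close>
  obtain Q where Q: "Q \<ge> 0" "\<forall>a\<in>A. \<forall>q. cmod (?c a q) \<le> Q / (1 + norm q) ^ (N + D)" using decay by blast
  define C where "C = Q * T"
  have C: "C \<ge> 0" using Q(1) T0 by (simp add: C_def)
  have B: "test_bounded \<Omega> B"
    unfolding test_bounded_def
  proof (intro conjI exI[of _ "supp \<psi>"] test_functionsD[OF \<psi>] ballI allI)
    fix \<phi> assume "\<phi> \<in> B"
    then obtain F k a where \<phi>: "\<phi> = \<beta> F k a" unfolding B_def by blast
    show "smooth \<phi>" unfolding \<phi> \<beta>_def by (intro smooth_cmult smooth_sum sw)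
    show "supp \<phi> \<subseteq> supp \<psi>"
      by (rule supp_subsetI) (simp_all add: \<phi> \<beta>_def zero_outside_supp[of _ \<psi>])
  next
    fix n
    obtain Cp where Cp: "Cp \<ge> 0" "derivs_bounded UNIV n Cp \<psi>" using derivs_bounded_test_function[OF \<psi>] .
    \<comment> \<open>Outside \<open>V\<close> the weight in \<open>k\<close> costs \<open>N\<close>
      powers of \<open>1 + norm q\<close>, the derivatives of \<open>wave (k + q)\<close> cost
      \<open>n\<close>, and the sum over the lattice costs \<open>D\<close>.\<close>
    obtain Q' where Q': "Q' \<ge> 0" "\<forall>a\<in>A. \<forall>q. cmod (?c a q) \<le> Q' / (1 + norm q) ^ (N + n + D)" using decay by blast
    \<comment> \<open>Chosen so that \<open>c * norm k \<le> norm q\<close> implies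
      \<open>1 + norm k \<le> c' * (1 + norm q)\<close>.\<close>
    define c' where "c' = 1 + 1 / c"
    have c': "c' \<ge> 1" using c by (simp add: c'_def)
    define X where "X = c' ^ N * (c' + 1) ^ n * (2 ^ n * Cp) * Q'"
    have X: "X \<ge> 0" using c' Cp(1) Q'(1) by (simp add: X_def)
    have "derivs_bounded UNIV n (X * T) (\<beta> F k a)" if F: "finite F" "F \<subseteq> ?L" and k: "k \<in> W" and a: "a \<in> A" for F k a
    proof -
      let ?G = "{q\<in>F. k + q \<notin> V}"
      let ?t = "\<lambda>q. cmod (?c a q) * (2 ^ n * Cp * (1 + norm (k + q)) ^ n)"
      have G: "finite ?G" "?G \<subseteq> ?L" using F by auto
      have "derivs_bounded UNIV n (cmod (complex_of_real ((1 + norm k) ^ N)) * (\<Sum>q\<in>?G. ?t q)) (\<beta> F k a)"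
        unfolding \<beta>_def
        by (intro derivs_bounded_cmult smooth_sum smooth_cmult sw derivs_bounded_sum G
              derivs_bounded_mult test_functionsD(1)[OF \<psi>] smooth_wave Cp derivs_bounded_wave)
           (simp add: less_imp_le[OF pos])
      moreover have "cmod (complex_of_real ((1 + norm k) ^ N)) * (\<Sum>q\<in>?G. ?t q) \<le> X * T"
      proof -
        have "cmod (complex_of_real ((1 + norm k) ^ N)) * (\<Sum>q\<in>?G. ?t q) = (\<Sum>q\<in>?G. (1 + norm k) ^ N * ?t q)"
          using pos[of k] by (simp add: sum_distrib_left norm_power del: of_real_add of_real_power)
        also have "\<dots> \<le> (\<Sum>q\<in>?G. X * (1 / (1 + norm q) ^ D))"
        proof (rule sum_mono)
          fix q assume q: "q \<in> ?G"
          have "norm k \<le> norm q / c" using sep[OF k] q c by (simp add: pos_le_divide_eq mult.commute)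
          moreover have "c' * (1 + norm q) = 1 + 1 / c + norm q + norm q / c"
            by (simp add: c'_def distrib_left distrib_right)
          moreover have "0 \<le> 1 / c" using c by simp
          ultimately have k1: "1 + norm k \<le> c' * (1 + norm q)"
            using norm_ge_zero[of q] by linarith
          have "1 + norm (k + q) \<le> (1 + norm k) + norm q" using norm_triangle_ineq[of k q] by simp
          hence k2: "1 + norm (k + q) \<le> (c' + 1) * (1 + norm q)" using k1 by (simp add: algebra_simps)
          have p: "(1 + norm q) ^ m > 0" for m using pos[of q] by simp
          have "(1 + norm k) ^ N * ?t q \<le>
              (c' * (1 + norm q)) ^ N * ((Q' / (1 + norm q) ^ (N + n + D)) * (2 ^ n * Cp * ((c' + 1) * (1 + norm q)) ^ n))"
            using k1 k2 Q' a Cp(1) c' pos[of k] pos[of "k + q"] pos[of q]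
            by (intro mult_mono power_mono mult_nonneg_nonneg zero_le_power divide_nonneg_nonneg) (auto intro: less_imp_le)
          also have "\<dots> = X * (1 / (1 + norm q) ^ D)"
          proof -
            have "(c' * z) ^ N * ((Q' / z ^ (N + n + D)) * (2 ^ n * Cp * ((c' + 1) * z) ^ n)) = X * (1 / z ^ D)"
              if "z > 0" for z
              using that unfolding X_def power_mult_distrib power_add by (simp add: divide_simps mult_ac)
            from this[OF pos[of q]] show ?thesis .
          qed
          finally show "(1 + norm k) ^ N * ?t q \<le> X * (1 / (1 + norm q) ^ D)" .
        qed
        also have "\<dots> = X * (\<Sum>q\<in>?G. 1 / (1 + norm q) ^ D)" by (simp add: sum_distrib_left)
        also have "\<dots> \<le> X * T" by (intro mult_left_mono T_sum G X)
        finally show ?thesis .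
      qed
      ultimately show ?thesis by (rule derivs_bounded_mono[OF _ order_refl order_refl])
    qed
    hence "\<forall>\<phi>\<in>B. derivs_bounded UNIV n (X * T) \<phi>" unfolding B_def by blast
    thus "\<exists>C. \<forall>\<phi>\<in>B. derivs_bounded UNIV n C \<phi>" ..
  qed
  have main: "(1 + norm k) ^ N * cmod (localized_fourier (\<lambda>x. a x * \<psi> x) u k) \<le> C * S + P"
    if u: "u \<in> distributions \<Omega>" and S: "S \<ge> 0" "\<And>q. q \<in> V \<Longrightarrow> (1 + norm q) ^ N * cmod (localized_fourier \<psi> u q) \<le> S"
      and P: "\<And>\<phi>. \<phi> \<in> B \<Longrightarrow> cmod (u \<phi>) \<le> P" and a: "a \<in> A" and k: "k \<in> W" and "P \<ge> 0" for u S P a k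
  proof (rule field_le_epsilon)
    fix e :: real assume e: "e > 0"
    have lin: "linear_on_functions (test_functions \<Omega>) u" by (rule distributionsD(1)[OF u])
    obtain n Cu where Cu: "Cu \<ge> 0" "order_bound (supp \<psi>) n Cu u"
      by (rule distribution_order_bound[OF u test_functionsD(2,3)[OF \<psi>]])
    let ?w = "\<lambda>q x. \<psi> x * wave q x"
    have tw: "?w q \<in> test_functions \<Omega>" for q by (rule test_functions_mult[OF \<psi> smooth_wave])
    have wsupp: "supp (?w k) \<subseteq> supp \<psi>" by (rule supp_mult_left)
    obtain Cg where Cg: "Cg \<ge> 0" "derivs_bounded UNIV n Cg (?w k)" using derivs_bounded_test_function[OF tw] .
    \<comment> \<open>\<open>E * \<epsilon>\<close> bounds the weighted error of approximating
      \<open>a\<close>. That \<open>E\<close> depends on \<open>k\<close> and \<open>u\<close> is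
      harmless, because the bounds for the two remaining sums do not depend on
      \<open>\<epsilon>\<close> or on the resulting \<open>F\<close>.\<close>
    define E where "E = (1 + norm k) ^ N * (Cu * (2 ^ n * Cg))"
    have E: "E \<ge> 0" using Cu(1) Cg(1) pos[of k] by (simp add: E_def)
    define \<epsilon> where "\<epsilon> = e / (E + 1)"
    have \<epsilon>: "\<epsilon> > 0" using e E by (simp add: \<epsilon>_def)
    obtain F where F: "finite F" "F \<subseteq> ?L" "derivs_bounded (open_cube R) n \<epsilon> (\<lambda>x. a x - (\<Sum>q\<in>F. ?c a q * wave q x))"
      by (rule fourier_approx[OF R(1) aD[OF a] \<epsilon>])
    let ?d = "\<lambda>x. a x - (\<Sum>q\<in>F. ?c a q * wave q x)"
    have sd: "smooth ?d" by (intro smooth_diff aD(1)[OF a] smooth_sum smooth_cmult smooth_wave)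
    let ?e = "\<lambda>x. ?w k x * ?d x"
    have te: "?e \<in> test_functions \<Omega>" by (rule test_functions_mult[OF tw sd])
    have "derivs_bounded UNIV n (2 ^ n * Cg * \<epsilon>) ?e"
      by (rule derivs_bounded_mult_supp[OF test_functionsD(1)[OF tw] sd _ derivs_bounded_mono[OF Cg(2)] F(3)])
         (use wsupp R(2) Cg \<epsilon> in auto)
    hence "cmod (u ?e) \<le> Cu * (2 ^ n * Cg * \<epsilon>)"
      by (intro order_boundD[OF Cu(2)] test_functionsD(1)[OF te] order_trans[OF supp_mult_left wsupp])
    hence "(1 + norm k) ^ N * cmod (u ?e) \<le> (1 + norm k) ^ N * (Cu * (2 ^ n * Cg * \<epsilon>))"
      using pos[of k] by (intro mult_left_mono) auto
    also have "\<dots> = E * \<epsilon>" by (simp add: E_def mult_ac)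
    also have "\<dots> \<le> e" using e E by (simp add: \<epsilon>_def pos_divide_le_eq add_nonneg_pos mult.commute distrib_left)
    finally have ue: "(1 + norm k) ^ N * cmod (u ?e) \<le> e" .
    have dec: "(\<lambda>x. a x * \<psi> x * wave k x) = (\<lambda>x. ?e x + (\<Sum>q\<in>F. ?c a q * ?w (k + q) x))"
    proof
      fix x
      have "(\<Sum>q\<in>F. ?c a q * ?w (k + q) x) = ?w k x * (\<Sum>q\<in>F. ?c a q * wave q x)"
        by (simp add: sum_distrib_left wave_add mult_ac)
      thus "a x * \<psi> x * wave k x = ?e x + (\<Sum>q\<in>F. ?c a q * ?w (k + q) x)"
        by (simp add: right_diff_distrib mult_ac)
    qed
    let ?G = "{q\<in>F. k + q \<in> V}" and ?H = "{q\<in>F. k + q \<notin> V}"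
    have "localized_fourier (\<lambda>x. a x * \<psi> x) u k = u (\<lambda>x. ?e x + (\<Sum>q\<in>F. ?c a q * ?w (k + q) x))"
      unfolding localized_fourier_wave by (rule arg_cong[OF dec])
    also have "\<dots> = u ?e + u (\<lambda>x. \<Sum>q\<in>F. ?c a q * ?w (k + q) x)"
      by (intro linear_on_functions_add[OF lin] te test_functions_sum test_functions_cmult tw)
    also have "u (\<lambda>x. \<Sum>q\<in>F. ?c a q * ?w (k + q) x) = (\<Sum>q\<in>F. u (\<lambda>x. ?c a q * ?w (k + q) x))"
      by (intro linear_on_functions_sum[OF lin] test_functions_cmult tw)
    also have "\<dots> = (\<Sum>q\<in>F. ?c a q * u (?w (k + q)))"
      by (intro sum.cong refl linear_on_functions_scale[OF lin] tw)
    also have "\<dots> = (\<Sum>q\<in>?G. ?c a q * u (?w (k + q))) + (\<Sum>q\<in>?H. ?c a q * u (?w (k + q)))"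
      using F(1) by (subst sum.union_disjoint[symmetric]) (auto intro!: sum.cong)
    finally have split: "localized_fourier (\<lambda>x. a x * \<psi> x) u k =
        u ?e + ((\<Sum>q\<in>?G. ?c a q * u (?w (k + q))) + (\<Sum>q\<in>?H. ?c a q * u (?w (k + q))))" .
    have good: "(1 + norm k) ^ N * cmod (\<Sum>q\<in>?G. ?c a q * u (?w (k + q))) \<le> C * S"
    proof -
      have "(1 + norm k) ^ N * cmod (\<Sum>q\<in>?G. ?c a q * u (?w (k + q))) \<le>
          (1 + norm k) ^ N * (\<Sum>q\<in>?G. cmod (?c a q * u (?w (k + q))))"
        using pos[of k] by (intro mult_left_mono norm_sum) auto
      also have "\<dots> = (\<Sum>q\<in>?G. (1 + norm k) ^ N * (cmod (?c a q) * cmod (u (?w (k + q)))))"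
        by (simp add: sum_distrib_left norm_mult)
      also have "\<dots> \<le> (\<Sum>q\<in>?G. Q * S * (1 / (1 + norm q) ^ D))"
      proof (rule sum_mono)
        fix q assume q: "q \<in> ?G"
        have S': "(1 + norm (k + q)) ^ N * cmod (u (?w (k + q))) \<le> S"
          using S(2)[of "k + q"] q by (simp add: localized_fourier_wave)
        have "(1 + norm k) ^ N * (cmod (?c a q) * cmod (u (?w (k + q)))) \<le>
            ((1 + norm (k + q)) * (1 + norm q)) ^ N * (Q / (1 + norm q) ^ (N + D) * cmod (u (?w (k + q))))"
          using one_plus_norm_le_mult[of k q] Q a pos[of k] pos[of q] pos[of "k + q"]
          by (intro mult_mono power_mono mult_nonneg_nonneg) (auto intro: less_imp_le)
        also have "\<dots> = Q / (1 + norm q) ^ D * ((1 + norm (k + q)) ^ N * cmod (u (?w (k + q))))"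
        proof -
          have "(y * z) ^ N * (Q / z ^ (N + D) * t) = Q / z ^ D * (y ^ N * t)" if "z > 0" for y z t :: real
            using that unfolding power_mult_distrib power_add by (simp add: divide_simps mult_ac)
          from this[OF pos[of q]] show ?thesis .
        qed
        also have "\<dots> \<le> Q / (1 + norm q) ^ D * S"
          using S' Q(1) pos[of q] by (intro mult_left_mono) auto
        finally show "(1 + norm k) ^ N * (cmod (?c a q) * cmod (u (?w (k + q)))) \<le> Q * S * (1 / (1 + norm q) ^ D)"
          by simp
      qed
      also have "\<dots> = Q * S * (\<Sum>q\<in>?G. 1 / (1 + norm q) ^ D)" by (simp add: sum_distrib_left)
      also have "\<dots> \<le> Q * S * T" using F Q(1) S(1) by (intro mult_left_mono T_sum) auto
      finally show ?thesis by (simp add: C_def mult_ac)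
    qed
    have bad: "(1 + norm k) ^ N * cmod (\<Sum>q\<in>?H. ?c a q * u (?w (k + q))) \<le> P"
    proof -
      have "u (\<beta> F k a) = complex_of_real ((1 + norm k) ^ N) * u (\<lambda>x. \<Sum>q\<in>?H. ?c a q * ?w (k + q) x)"
        unfolding \<beta>_def by (intro linear_on_functions_scale[OF lin] test_functions_sum test_functions_cmult tw)
      also have "u (\<lambda>x. \<Sum>q\<in>?H. ?c a q * ?w (k + q) x) = (\<Sum>q\<in>?H. u (\<lambda>x. ?c a q * ?w (k + q) x))"
        by (intro linear_on_functions_sum[OF lin] test_functions_cmult tw)
      also have "\<dots> = (\<Sum>q\<in>?H. ?c a q * u (?w (k + q)))"
        by (intro sum.cong refl linear_on_functions_scale[OF lin] tw)
      finally have "cmod (u (\<beta> F k a)) = (1 + norm k) ^ N * cmod (\<Sum>q\<in>?H. ?c a q * u (?w (k + q)))"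
        using pos[of k] by (simp add: norm_mult norm_power del: of_real_add of_real_power)
      moreover have "\<beta> F k a \<in> B" using F k a unfolding B_def by blast
      ultimately show ?thesis using P by metis
    qed
    have "(1 + norm k) ^ N * cmod (localized_fourier (\<lambda>x. a x * \<psi> x) u k) \<le>
        (1 + norm k) ^ N * (cmod (u ?e) + (cmod (\<Sum>q\<in>?G. ?c a q * u (?w (k + q))) + cmod (\<Sum>q\<in>?H. ?c a q * u (?w (k + q)))))"
      unfolding split using pos[of k] by (intro mult_left_mono norm_triangle_mono norm_triangle_ineq order_refl) auto
    also have "\<dots> \<le> C * S + P + e" using ue good bad by (simp add: distrib_left)
    finally show "(1 + norm k) ^ N * cmod (localized_fourier (\<lambda>x. a x * \<psi> x) u k) \<le> C * S + P + e" .
  qed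
  show ?thesis
  proof (rule that[OF C B], intro ballI allI impI)
    fix u S P a assume u: "u \<in> distributions \<Omega>" "S \<ge> (0::real)" "P \<ge> (0::real)"
      "localized_bound u N V \<psi> S" "test_bound u B P" and a: "a \<in> A"
    show "localized_bound u N W (\<lambda>x. a x * \<psi> x) (C * S + P)"
      unfolding localized_bound_def
      by (intro ballI main[OF u(1,2) localized_boundD[OF u(4)] test_boundD[OF u(5)] a _ u(3)])
  qed
qed

text \<open>For \<open>k \<noteq> 0\<close> membership means that \<open>k\<close>, rescaled to the
  length of \<open>\<eta>\<close>, lies within \<open>\<delta>\<close> of \<open>\<eta>\<close>.
  Without the denominator the set is visibly closed; it also contains 0.\<close>

definition cone_nbhd :: "'a::real_normed_vector \<Rightarrow> real \<Rightarrow> 'a set" where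
  "cone_nbhd \<eta> \<delta> = {k. norm (norm \<eta> *\<^sub>R k - norm k *\<^sub>R \<eta>) \<le> \<delta> * norm k}"

lemma closed_cone_nbhd: "closed (cone_nbhd \<eta> \<delta>)"
  unfolding cone_nbhd_def by (intro closed_Collect_le continuous_intros)

lemma positive_cone_cone_nbhd: "positive_cone (cone_nbhd \<eta> \<delta>)"
  unfolding positive_cone_def
proof (intro ballI allI impI)
  fix k and l :: real assume k: "k \<in> cone_nbhd \<eta> \<delta>" and l: "l > 0"
  have "norm \<eta> *\<^sub>R l *\<^sub>R k - norm (l *\<^sub>R k) *\<^sub>R \<eta> = l *\<^sub>R (norm \<eta> *\<^sub>R k - norm k *\<^sub>R \<eta>)"
    using l by (simp add: algebra_simps)
  thus "l *\<^sub>R k \<in> cone_nbhd \<eta> \<delta>" using k l by (simp add: cone_nbhd_def mult.left_commute)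
qed

lemma cone_nbhd_normalize:
  assumes "k \<in> cone_nbhd \<eta> \<delta>" "k \<noteq> 0"
  shows "(norm \<eta> / norm k) *\<^sub>R k \<in> cball \<eta> \<delta>"
proof -
  have "(norm \<eta> / norm k) *\<^sub>R k - \<eta> = (1 / norm k) *\<^sub>R (norm \<eta> *\<^sub>R k - norm k *\<^sub>R \<eta>)"
    using assms(2) by (simp add: algebra_simps)
  hence "norm ((norm \<eta> / norm k) *\<^sub>R k - \<eta>) = norm (norm \<eta> *\<^sub>R k - norm k *\<^sub>R \<eta>) / norm k" by simp
  also have "\<dots> \<le> \<delta>" using assms by (simp add: cone_nbhd_def pos_divide_le_eq)
  finally show ?thesis by (simp add: dist_norm norm_minus_commute)
qed

text \<open>The map from \<open>k\<close> to
  \<open>norm \<eta> *\<^sub>R k - norm k *\<^sub>R \<eta>\<close> has Lipschitz constant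
  \<open>2 * norm \<eta>\<close>, so leaving the cone of double aperture takes a step
  \<open>q\<close> comparable to \<open>k\<close>. The deleted point 0 is reached only with
  \<open>norm q = norm k\<close>.\<close>

lemma cone_nbhd_separated:
  fixes \<eta> :: "'a::real_normed_vector"
  assumes \<eta>: "\<eta> \<noteq> 0" and \<delta>: "\<delta> > 0" and k: "k \<in> cone_nbhd \<eta> \<delta>" and q: "k + q \<notin> cone_nbhd \<eta> (2 * \<delta>) - {0}"
  shows "\<delta> / (2 * \<delta> + 2 * norm \<eta>) * norm k \<le> norm q"
proof -
  have pos: "2 * \<delta> + 2 * norm \<eta> > 0" using \<delta> by (simp add: add_pos_nonneg)
  have "\<delta> * norm k \<le> (2 * \<delta> + 2 * norm \<eta>) * norm q"
  proof (cases "k + q = 0")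
    case True
    hence "norm q = norm k" by (metis add.inverse_unique norm_minus_cancel)
    moreover have "\<delta> * norm k \<le> (2 * \<delta> + 2 * norm \<eta>) * norm k" using \<delta> by (intro mult_right_mono) auto
    ultimately show ?thesis by simp
  next
    case False
    hence "2 * \<delta> * norm (k + q) < norm (norm \<eta> *\<^sub>R (k + q) - norm (k + q) *\<^sub>R \<eta>)"
      using q by (simp add: cone_nbhd_def not_le)
    also have "norm \<eta> *\<^sub>R (k + q) - norm (k + q) *\<^sub>R \<eta> =
        (norm \<eta> *\<^sub>R k - norm k *\<^sub>R \<eta>) + (norm \<eta> *\<^sub>R q - (norm (k + q) - norm k) *\<^sub>R \<eta>)"
      by (simp add: algebra_simps)
    also have "norm \<dots> \<le> \<delta> * norm k + (norm \<eta> * norm q + norm q * norm \<eta>)"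
    proof (intro norm_triangle_mono)
      show "norm (norm \<eta> *\<^sub>R k - norm k *\<^sub>R \<eta>) \<le> \<delta> * norm k" using k by (simp add: cone_nbhd_def)
      have "\<bar>norm (k + q) - norm k\<bar> \<le> norm q" using norm_triangle_ineq3[of "k + q" k] by simp
      hence "norm ((norm (k + q) - norm k) *\<^sub>R \<eta>) \<le> norm q * norm \<eta>" by (simp add: mult_right_mono)
      moreover have "norm (norm \<eta> *\<^sub>R q) = norm \<eta> * norm q" by simp
      ultimately show "norm (norm \<eta> *\<^sub>R q - (norm (k + q) - norm k) *\<^sub>R \<eta>) \<le> norm \<eta> * norm q + norm q * norm \<eta>"
        using norm_triangle_ineq4[of "norm \<eta> *\<^sub>R q" "(norm (k + q) - norm k) *\<^sub>R \<eta>"] by linarith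
    qed
    finally have *: "2 * \<delta> * norm (k + q) < \<delta> * norm k + (norm \<eta> * norm q + norm q * norm \<eta>)" .
    have "norm k - norm q \<le> norm (k + q)" using norm_diff_ineq[of k q] .
    hence "2 * \<delta> * (norm k - norm q) \<le> 2 * \<delta> * norm (k + q)" using \<delta> by (intro mult_left_mono) auto
    thus ?thesis using * by (simp add: algebra_simps)
  qed
  thus ?thesis using pos by (simp add: pos_divide_le_eq mult.commute)
qed

section \<open>The normal topology in terms of explicit estimates\<close>

lemma seminorm_like_SUP:
  fixes \<phi> :: "'i \<Rightarrow> 's"
  assumes "\<And>i. w i \<ge> 0"
  shows "seminorm_like E (\<lambda>u. SUP i\<in>I. ennreal (w i * cmod (u (\<phi> i))))"
  unfolding seminorm_like_def
proof (intro conjI ballI allI impI)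
  fix f g :: "'s \<Rightarrow> complex"
  show "(SUP i\<in>I. ennreal (w i * cmod (g (\<phi> i)))) \<le>
      (SUP i\<in>I. ennreal (w i * cmod (g (\<phi> i) - f (\<phi> i)))) + (SUP i\<in>I. ennreal (w i * cmod (f (\<phi> i))))"
  proof (rule SUP_least)
    fix i assume i: "i \<in> I"
    have "cmod (g (\<phi> i)) \<le> cmod (g (\<phi> i) - f (\<phi> i)) + cmod (f (\<phi> i))"
      using norm_triangle_ineq[of "g (\<phi> i) - f (\<phi> i)" "f (\<phi> i)"] by simp
    hence "w i * cmod (g (\<phi> i)) \<le> w i * cmod (g (\<phi> i) - f (\<phi> i)) + w i * cmod (f (\<phi> i))"
      using mult_left_mono[OF _ assms[of i]] by (fastforce simp: distrib_left[symmetric])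
    hence "ennreal (w i * cmod (g (\<phi> i))) \<le> ennreal (w i * cmod (g (\<phi> i) - f (\<phi> i)) + w i * cmod (f (\<phi> i)))"
      by (rule ennreal_leI)
    also have "\<dots> = ennreal (w i * cmod (g (\<phi> i) - f (\<phi> i))) + ennreal (w i * cmod (f (\<phi> i)))"
      using assms by (intro ennreal_plus) auto
    also have "\<dots> \<le> (SUP i\<in>I. ennreal (w i * cmod (g (\<phi> i) - f (\<phi> i)))) + (SUP i\<in>I. ennreal (w i * cmod (f (\<phi> i))))"
      by (intro add_mono SUP_upper i)
    finally show "ennreal (w i * cmod (g (\<phi> i))) \<le>
      (SUP i\<in>I. ennreal (w i * cmod (g (\<phi> i) - f (\<phi> i)))) + (SUP i\<in>I. ennreal (w i * cmod (f (\<phi> i))))" .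
  qed
  fix r :: real assume r: "r > 0"
  have "ennreal (w i * cmod (complex_of_real r * f (\<phi> i))) = ennreal r * ennreal (w i * cmod (f (\<phi> i)))" for i
    using r assms[of i] by (simp add: norm_mult ennreal_mult[symmetric] mult_ac)
  thus "(SUP i\<in>I. ennreal (w i * cmod (complex_of_real r * f (\<phi> i)))) = ennreal r * (SUP i\<in>I. ennreal (w i * cmod (f (\<phi> i))))"
    by (simp add: SUP_mult_left_ennreal)
next
  show "(SUP i\<in>I. ennreal (w i * cmod 0)) = 0"
    by (cases "I = {}") (simp_all add: bot_ennreal)
qed

lemma seminorm_like_bounded: "seminorm_like E (\<lambda>u. SUP \<phi>\<in>B. ennreal (cmod (u \<phi>)))"
  using seminorm_like_SUP[where w="\<lambda>_. 1" and \<phi>="\<lambda>\<phi>. \<phi>" and I=B] by simp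

lemma seminorm_like_fourier: "seminorm_like E (fourier_seminorm N V \<theta>)"
proof -
  have "seminorm_like E (\<lambda>u. SUP k\<in>V. ennreal ((1 + norm k) ^ N * cmod (u (\<lambda>x. \<theta> x * exp (- (\<i> * complex_of_real (k \<bullet> x)))))))"
    by (rule seminorm_like_SUP[where w="\<lambda>k. (1 + norm k) ^ N"]) (simp add: add_nonneg_nonneg)
  thus ?thesis unfolding fourier_seminorm_def localized_fourier_def .
qed

lemma fourier_seminorm_le:
  "(\<And>k. k \<in> V \<Longrightarrow> (1 + norm k) ^ N * cmod (localized_fourier \<theta> u k) \<le> S) \<Longrightarrow> fourier_seminorm N V \<theta> u \<le> ennreal S"
  unfolding fourier_seminorm_def by (intro SUP_least ennreal_leI) blast

lemma fourier_seminorm_leD: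
  assumes "fourier_seminorm N V \<theta> u \<le> ennreal S" "S \<ge> 0" "k \<in> V"
  shows "(1 + norm k) ^ N * cmod (localized_fourier \<theta> u k) \<le> S"
proof -
  have "ennreal ((1 + norm k) ^ N * cmod (localized_fourier \<theta> u k)) \<le> fourier_seminorm N V \<theta> u"
    unfolding fourier_seminorm_def using assms(3) by (rule SUP_upper)
  also note assms(1)
  finally show ?thesis using assms(2) by (simp add: ennreal_le_iff)
qed

text \<open>Openness supplies, at each point, the nonvanishing cutoff that the definition of the
  wave front set asks for.\<close>

lemma zero_in_distributions_WF:
  assumes "open \<Omega>"
  shows "(\<lambda>\<phi>. 0) \<in> distributions_WF \<Omega> \<Gamma>"
proof -
  have z: "(\<lambda>\<phi>. 0) \<in> distributions \<Omega>"
    by (rule distributionsI) (auto simp: linear_on_functions_def order_bound_def intro!: exI[of _ 0])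
  have "wave_front_set \<Omega> (\<lambda>\<phi>. 0) = {}"
  proof -
    have "\<exists>\<theta>\<in>test_functions \<Omega>. \<theta> x \<noteq> 0 \<and> (\<exists>V. open V \<and> positive_cone V \<and> \<xi> \<in> V \<and>
        (\<forall>N. fourier_seminorm N V \<theta> (\<lambda>\<phi>. 0) < \<infinity>))" if x: "x \<in> \<Omega>" for x \<xi>
    proof -
      obtain \<theta> where \<theta>: "\<theta> \<in> test_functions \<Omega>" "\<forall>y\<in>{x}. \<theta> y = 1"
        by (rule cutoff_exists[of "{x}" \<Omega>]) (use x assms in auto)
      have "fourier_seminorm N UNIV \<theta> (\<lambda>\<phi>. 0) < \<infinity>" for N
        using fourier_seminorm_le[of UNIV N \<theta> "\<lambda>\<phi>. 0" 0] by (simp add: localized_fourier_def)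
      thus ?thesis using \<theta> by (intro bexI[of _ \<theta>] conjI exI[of _ UNIV]) (auto simp: positive_cone_def)
    qed
    thus ?thesis unfolding wave_front_set_def punctured_cotangent_def by blast
  qed
  thus ?thesis using z by (simp add: distributions_WF_def)
qed

definition fourier_admissible :: "'a::euclidean_space set \<Rightarrow> ('a \<times> 'a) set \<Rightarrow> 'a set \<Rightarrow> ('a \<Rightarrow> complex) \<Rightarrow> bool" where
  "fourier_admissible \<Omega> \<Gamma> V \<theta> \<longleftrightarrow> \<theta> \<in> test_functions \<Omega> \<and> closed V \<and> positive_cone V \<and> (supp \<theta> \<times> V) \<inter> \<Gamma> = {}"

definition normal_seminorms :: "'a::euclidean_space set \<Rightarrow> ('a \<times> 'a) set \<Rightarrow> ((('a \<Rightarrow> complex) \<Rightarrow> complex) \<Rightarrow> ennreal) set" where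
  "normal_seminorms \<Omega> \<Gamma> = {(\<lambda>u. SUP \<phi>\<in>B. ennreal (cmod (u \<phi>))) | B. tvs_bounded (test_topology \<Omega>) B} \<union>
      {fourier_seminorm N V \<theta> | N V \<theta>. fourier_admissible \<Omega> \<Gamma> V \<theta>}"

lemma normal_topology_alt: "normal_topology \<Omega> \<Gamma> = seminorm_topology (distributions_WF \<Omega> \<Gamma>) (normal_seminorms \<Omega> \<Gamma>)"
  by (simp add: normal_topology_def normal_seminorms_def fourier_admissible_def)

lemma topspace_normal_topology [simp]: "topspace (normal_topology \<Omega> \<Gamma>) = distributions_WF \<Omega> \<Gamma>"
  by (simp add: normal_topology_alt)

text \<open>This lemma and the next three translate bounded sets and zero neighbourhoods of the
  normal topology into bounds for each of the two kinds of seminorms; the estimates for the tensor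
  product are fed only with these.\<close>

lemma normal_bounded_test:
  assumes \<Omega>: "open \<Omega>" and A: "tvs_bounded (normal_topology \<Omega> \<Gamma>) A" and B: "test_bounded \<Omega> B"
  shows "\<exists>P\<ge>0. \<forall>u\<in>A. test_bound u B P"
proof -
  have "(\<lambda>u. SUP \<phi>\<in>B. ennreal (cmod (u \<phi>))) \<in> normal_seminorms \<Omega> \<Gamma>"
    unfolding normal_seminorms_def using test_bounded_tvs_bounded[OF B] by blast
  from tvs_bounded_seminormD[OF A[unfolded normal_topology_alt] this seminorm_like_bounded zero_in_distributions_WF[OF \<Omega>]]
  obtain C where C: "C > 0" "\<forall>u\<in>A. (SUP \<phi>\<in>B. ennreal (cmod (u \<phi>))) \<le> ennreal C" by blast
  have "cmod (u \<phi>) \<le> C" if "u \<in> A" "\<phi> \<in> B" for u \<phi>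
  proof -
    have "ennreal (cmod (u \<phi>)) \<le> (SUP \<phi>\<in>B. ennreal (cmod (u \<phi>)))" using that(2) by (rule SUP_upper)
    also have "\<dots> \<le> ennreal C" using C(2) that(1) by blast
    finally show ?thesis using C(1) by (simp add: ennreal_le_iff)
  qed
  thus ?thesis using C(1) unfolding test_bound_def by (intro exI[of _ C]) auto
qed

lemma normal_bounded_fourier:
  assumes \<Omega>: "open \<Omega>" and A: "tvs_bounded (normal_topology \<Omega> \<Gamma>) A" and V: "fourier_admissible \<Omega> \<Gamma> V \<theta>"
  shows "\<exists>S\<ge>0. \<forall>u\<in>A. localized_bound u N V \<theta> S"
proof -
  have "fourier_seminorm N V \<theta> \<in> normal_seminorms \<Omega> \<Gamma>"
    unfolding normal_seminorms_def using V by blast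
  from tvs_bounded_seminormD[OF A[unfolded normal_topology_alt] this seminorm_like_fourier zero_in_distributions_WF[OF \<Omega>]]
  obtain C where C: "C > 0" "\<forall>u\<in>A. fourier_seminorm N V \<theta> u \<le> ennreal C" by blast
  thus ?thesis unfolding localized_bound_def by (auto intro!: exI[of _ C] fourier_seminorm_leD)
qed

lemma normal_nbhd_test:
  assumes \<Omega>: "open \<Omega>" and B: "test_bounded \<Omega> B" and \<epsilon>: "\<epsilon> > 0"
  shows "\<exists>U. zero_neighborhood (normal_topology \<Omega> \<Gamma>) U \<and> (\<forall>u\<in>U. test_bound u B \<epsilon>)"
proof -
  let ?p = "\<lambda>u. SUP \<phi>\<in>B. ennreal (cmod (u \<phi>))"
  have "?p \<in> normal_seminorms \<Omega> \<Gamma>"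
    unfolding normal_seminorms_def using test_bounded_tvs_bounded[OF B] by blast
  from zero_neighborhood_seminorm_ball[OF this seminorm_like_bounded \<epsilon> zero_in_distributions_WF[OF \<Omega>]]
  have "zero_neighborhood (normal_topology \<Omega> \<Gamma>) {u \<in> distributions_WF \<Omega> \<Gamma>. ?p u < ennreal \<epsilon>}"
    unfolding normal_topology_alt .
  moreover have "cmod (u \<phi>) \<le> \<epsilon>" if "?p u < ennreal \<epsilon>" "\<phi> \<in> B" for u \<phi>
  proof -
    have "ennreal (cmod (u \<phi>)) \<le> ?p u" using that(2) by (rule SUP_upper)
    also note that(1)
    finally show ?thesis using \<epsilon> by (simp add: ennreal_less_iff)
  qed
  ultimately show ?thesis
    unfolding test_bound_def by (intro exI[of _ "{u \<in> distributions_WF \<Omega> \<Gamma>. ?p u < ennreal \<epsilon>}"]) auto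
qed

lemma normal_nbhd_fourier:
  assumes \<Omega>: "open \<Omega>" and V: "fourier_admissible \<Omega> \<Gamma> V \<theta>" and \<epsilon>: "\<epsilon> > 0"
  shows "\<exists>U. zero_neighborhood (normal_topology \<Omega> \<Gamma>) U \<and>
    (\<forall>u\<in>U. localized_bound u N V \<theta> \<epsilon>)"
proof -
  let ?p = "fourier_seminorm N V \<theta>"
  have "?p \<in> normal_seminorms \<Omega> \<Gamma>" unfolding normal_seminorms_def using V by blast
  from zero_neighborhood_seminorm_ball[OF this seminorm_like_fourier \<epsilon> zero_in_distributions_WF[OF \<Omega>]]
  have "zero_neighborhood (normal_topology \<Omega> \<Gamma>) {u \<in> distributions_WF \<Omega> \<Gamma>. ?p u < ennreal \<epsilon>}"
    unfolding normal_topology_alt .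
  thus ?thesis
    using \<epsilon> unfolding localized_bound_def by (auto intro!: exI[of _ "{u \<in> distributions_WF \<Omega> \<Gamma>. ?p u < ennreal \<epsilon>}"]
        fourier_seminorm_leD[OF less_imp_le])
qed

lemma zero_neighborhood_subset_topspace: "zero_neighborhood T U \<Longrightarrow> U \<subseteq> topspace T"
  by (simp add: zero_neighborhood_def)

lemma tvs_bounded_subset_topspace: "tvs_bounded T A \<Longrightarrow> A \<subseteq> topspace T"
  by (simp add: tvs_bounded_def)

section \<open>Microlocal estimates for the tensor product\<close>

text \<open>\<open>wave (0, l)\<close> does not vary with \<open>x\<close>, so all
  \<open>x\<close>-derivatives fall on \<open>\<theta>\<close>.\<close>

lemma iterated_partial_mult_wave_snd:
  fixes \<theta> :: "'a::euclidean_space \<times> 'b::euclidean_space \<Rightarrow> complex"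
  assumes "smooth \<theta>" "set bs \<subseteq> Basis"
  shows "iterated_partial (map (\<lambda>b. (b, 0)) bs) (\<lambda>z. \<theta> z * wave (0, l) z) =
    (\<lambda>z. iterated_partial (map (\<lambda>b. (b, 0)) bs) \<theta> z * wave (0, l) z)"
  using assms(2)
proof (induction bs)
  case (Cons b bs)
  hence b: "b \<in> Basis" "set bs \<subseteq> Basis" by auto
  let ?f = "iterated_partial (map (\<lambda>b. (b, 0)) bs) \<theta>"
  have sm: "smooth ?f" using b(2) by (intro smooth_iterated_partial assms) (auto intro: Basis_left)
  have "partial_deriv (b, 0) (\<lambda>z. ?f z * wave (0, l) z) = (\<lambda>z. partial_deriv (b, 0) ?f z * wave (0, l) z)"
    using sm by (simp add: partial_deriv_mult smooth_differentiable wave_differentiable partial_deriv_wave)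
  thus ?case unfolding list.map iterated_partial_Cons Cons.IH[OF b(2)] .
qed simp

text \<open>The cutoffs by which \<open>v\<close> gets localised when its partial Fourier transform
  is differentiated in \<open>x\<close>. As the base point \<open>x\<close> is arbitrary the family
  is in general infinite, yet it is bounded for compactly supported smooth
  \<open>\<theta>\<close>.\<close>

definition slice_derivatives :: "nat \<Rightarrow> ('a::euclidean_space \<times> 'b::euclidean_space \<Rightarrow> complex) \<Rightarrow> ('b \<Rightarrow> complex) set" where
  "slice_derivatives n \<theta> = {(\<lambda>y. iterated_partial (map (\<lambda>b. (b, 0)) bs) \<theta> (x, y)) | bs x.
     set bs \<subseteq> Basis \<and> length bs \<le> n}"

lemma slice_derivatives_bounded:
  assumes \<theta>: "smooth \<theta>" "supp \<theta> \<subseteq> K1 \<times> K2" and K: "compact K1" "compact K2"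
  shows "test_bounded UNIV (slice_derivatives n \<theta>)"
    "\<And>\<phi>. \<phi> \<in> slice_derivatives n \<theta> \<Longrightarrow> supp \<phi> \<subseteq> K2"
proof -
  have T: "\<theta> \<in> test_functions UNIV" by (rule test_functionsI[OF \<theta> compact_Times[OF K]]) simp
  have sm: "smooth (iterated_partial (map (\<lambda>b. (b, 0)) bs) \<theta>)" if "set bs \<subseteq> Basis" for bs
    using that by (intro smooth_iterated_partial \<theta>) (auto intro: Basis_left)
  have sp: "supp (iterated_partial bs \<theta>) \<subseteq> K1 \<times> K2" for bs
    using supp_iterated_partial \<theta>(2) by (rule order_trans)
  show supp: "supp \<phi> \<subseteq> K2" if \<phi>: "\<phi> \<in> slice_derivatives n \<theta>" for \<phi>
  proof -
    obtain bs x where "\<phi> = (\<lambda>y. iterated_partial (map (\<lambda>b. (b, 0)) bs) \<theta> (x, y))"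
      using \<phi> unfolding slice_derivatives_def by blast
    thus ?thesis using supp_slice2[OF sp compact_imp_closed[OF K(2)]] by simp
  qed
  show "test_bounded UNIV (slice_derivatives n \<theta>)"
    unfolding test_bounded_def
  proof (intro conjI exI[of _ K2] K(2) ballI supp allI)
    show "smooth \<phi>" if "\<phi> \<in> slice_derivatives n \<theta>" for \<phi>
      using that unfolding slice_derivatives_def by (auto intro!: smooth_slice2 sm)
    fix m
    obtain C where C: "C \<ge> 0" "derivs_bounded UNIV (m + n) C \<theta>" using derivs_bounded_test_function[OF T] .
    have "derivs_bounded UNIV m C \<phi>" if \<phi>_in: "\<phi> \<in> slice_derivatives n \<theta>" for \<phi>
    proof -
      obtain bs x where bs: "set bs \<subseteq> Basis" "length bs \<le> n"
        and \<phi>: "\<phi> = (\<lambda>y. iterated_partial (map (\<lambda>b. (b, 0)) bs) \<theta> (x, y))"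
        using \<phi>_in unfolding slice_derivatives_def by blast
      have "derivs_bounded UNIV m C (iterated_partial (map (\<lambda>b. (b, 0)) bs) \<theta>)"
        by (rule derivs_bounded_iterated_partial[OF derivs_bounded_mono[OF C(2)]])
           (use bs in \<open>auto intro: Basis_left\<close>)
      thus ?thesis unfolding \<phi> by (rule derivs_bounded_slice2[OF sm[OF bs(1)]])
    qed
    thus "\<exists>C. \<forall>\<phi>\<in>slice_derivatives n \<theta>. derivs_bounded UNIV m C \<phi>" by blast
  qed simp
qed

text \<open>The partial Fourier transform of \<open>v\<close> localised by \<open>\<theta>\<close>,
  as a function of \<open>x\<close>. It keeps the oscillation in \<open>x\<close> and contains the
  weight of the seminorm, so applying \<open>u\<close> gives the weighted transform of the tensor
  product.\<close>

definition partial_fourier ::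
    "nat \<Rightarrow> ('a::euclidean_space \<times> 'b::euclidean_space \<Rightarrow> complex) \<Rightarrow> (('b \<Rightarrow> complex) \<Rightarrow> complex) \<Rightarrow> 'a \<Rightarrow> 'b \<Rightarrow> 'a \<Rightarrow> complex" where
  "partial_fourier N \<theta> v k l x =
    complex_of_real ((1 + norm (k, l)) ^ N) * v (\<lambda>y. \<theta> (x, y) * wave (k, l) (x, y))"

lemma partial_fourier_test_function:
  assumes v: "v \<in> distributions \<Omega>2" and \<theta>: "\<theta> \<in> test_functions (\<Omega>1 \<times> \<Omega>2)"
  shows "partial_fourier N \<theta> v k l \<in> test_functions \<Omega>1"
  unfolding partial_fourier_def[abs_def]
  by (intro test_functions_cmult slice_pairing_test_function[OF v test_functions_mult[OF \<theta> smooth_wave]])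

lemma supp_partial_fourier:
  assumes v: "v \<in> distributions \<Omega>2" and \<theta>: "supp \<theta> \<subseteq> K1 \<times> K2" "closed K1"
  shows "supp (partial_fourier N \<theta> v k l) \<subseteq> K1"
proof (rule supp_subsetI[OF \<theta>(2)])
  fix x assume "x \<notin> K1"
  hence "\<theta> (x, y) = 0" for y using \<theta>(1) by (intro zero_outside_supp[of "(x, y)" \<theta>]) blast
  thus "partial_fourier N \<theta> v k l x = 0"
    using linear_on_functions_zero[OF distributionsD(1)[OF v]] by (simp add: partial_fourier_def)
qed

lemma localized_fourier_tensor:
  assumes u: "u \<in> distributions \<Omega>1" and v: "v \<in> distributions \<Omega>2" and \<theta>: "\<theta> \<in> test_functions (\<Omega>1 \<times> \<Omega>2)"
  shows "(1 + norm (k, l)) ^ N * cmod (localized_fourier \<theta> (tensor_distribution \<Omega>1 \<Omega>2 u v) (k, l)) =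
    cmod (u (partial_fourier N \<theta> v k l))"
proof -
  have T: "(\<lambda>z. \<theta> z * wave (k, l) z) \<in> test_functions (\<Omega>1 \<times> \<Omega>2)" by (rule test_functions_mult[OF \<theta> smooth_wave])
  have "u (partial_fourier N \<theta> v k l) = complex_of_real ((1 + norm (k, l)) ^ N) * u (\<lambda>x. v (\<lambda>y. \<theta> (x, y) * wave (k, l) (x, y)))"
    unfolding partial_fourier_def[abs_def]
    by (intro linear_on_functions_scale[OF distributionsD(1)[OF u]] slice_pairing_test_function[OF v T])
  moreover have "localized_fourier \<theta> (tensor_distribution \<Omega>1 \<Omega>2 u v) (k, l) = u (\<lambda>x. v (\<lambda>y. \<theta> (x, y) * wave (k, l) (x, y)))"
    unfolding localized_fourier_wave tensor_distribution_iterated_pairing[OF T] iterated_pairing_def ..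
  moreover have "1 + norm (k, l) \<ge> 0" using norm_ge_zero[of "(k, l)"] by linarith
  ultimately show ?thesis by (simp add: norm_mult norm_power del: of_real_add of_real_power)
qed

text \<open>Apart from the weight and \<open>wave k x\<close>, this is a transform of
  \<open>v\<close> localised by slices of \<open>\<theta>\<close>. Of its decay of order
  \<open>n + N\<close> in \<open>l\<close>, the part \<open>N\<close> absorbs the weight and the
  part \<open>n\<close> the derivatives of \<open>wave k\<close>, both by way of
  \<open>norm k \<le> c * norm l\<close>.\<close>

lemma derivs_bounded_partial_fourier:
  fixes \<theta> :: "'a::euclidean_space \<times> 'b::euclidean_space \<Rightarrow> complex" and c S :: real
  assumes v: "v \<in> distributions \<Omega>2" and \<theta>: "smooth \<theta>" "supp \<theta> \<subseteq> K1 \<times> K2"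
    and K: "compact K1" "compact K2" "K2 \<subseteq> \<Omega>2" and c: "c \<ge> 0" "norm k \<le> c * norm l" and S: "S \<ge> 0"
    and decay: "\<And>\<phi>. \<phi> \<in> slice_derivatives n \<theta> \<Longrightarrow> (1 + norm l) ^ (n + N) * cmod (localized_fourier \<phi> v l) \<le> S"
  shows "derivs_bounded UNIV n (2 ^ n * (1 + c) ^ (n + N) * S) (partial_fourier N \<theta> v k l)"
proof -
  obtain m C where "C \<ge> 0" "slice_functional \<Omega>2 K2 m C v" by (rule slice_functional_distribution[OF v K(2,3)])
  then interpret slice_functional \<Omega>2 K2 m C v by simp
  let ?\<phi> = "\<lambda>z. \<theta> z * wave (0, l) z" and ?z = "1 + norm l"
  define g where "g = (\<lambda>x. v (\<lambda>y. \<theta> (x, y) * wave (0, l) (x, y)))"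
  have s: "smooth ?\<phi>" "supp ?\<phi> \<subseteq> K1 \<times> K2"
    using smooth_mult[OF \<theta>(1) smooth_wave] order_trans[OF supp_mult_left \<theta>(2)] by auto
  have sg: "smooth g" unfolding g_def by (rule smooth_slice_functional[OF s K(1)])
  have z: "?z > 0" using norm_ge_zero[of l] by linarith
  have bg: "derivs_bounded UNIV n (S / ?z ^ (n + N)) g"
    unfolding derivs_bounded_def
  proof (intro allI impI ballI)
    fix bs and x :: 'a assume bs: "set bs \<subseteq> (Basis::'a set) \<and> length bs \<le> n"
    let ?\<eta> = "\<lambda>y. iterated_partial (map (\<lambda>b. (b, 0)) bs) \<theta> (x, y)"
    have "iterated_partial bs g x = localized_fourier ?\<eta> v l"
      using bs iterated_partial_slice_functional[OF s K(1), of bs] iterated_partial_mult_wave_snd[OF \<theta>(1), of bs l]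
      by (simp add: g_def localized_fourier_wave wave_Pair)
    moreover have "?\<eta> \<in> slice_derivatives n \<theta>" unfolding slice_derivatives_def using bs by blast
    ultimately have "?z ^ (n + N) * cmod (iterated_partial bs g x) \<le> S" using decay by simp
    thus "cmod (iterated_partial bs g x) \<le> S / ?z ^ (n + N)" using z by (simp add: pos_le_divide_eq mult.commute)
  qed
  have eq: "partial_fourier N \<theta> v k l = (\<lambda>x. complex_of_real ((1 + norm (k, l)) ^ N) * (wave k x * g x))"
  proof
    fix x
    have "v (\<lambda>y. \<theta> (x, y) * wave (k, l) (x, y)) = v (\<lambda>y. wave k x * ?\<phi> (x, y))"
      by (simp add: wave_Pair mult_ac)
    also have "\<dots> = wave k x * g x" unfolding g_def by (rule linear_on_functions_scale[OF lin slice_test[OF s]])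
    finally show "partial_fourier N \<theta> v k l x = complex_of_real ((1 + norm (k, l)) ^ N) * (wave k x * g x)"
      by (simp add: partial_fourier_def)
  qed
  have S': "S / ?z ^ (n + N) \<ge> 0" using S z by simp
  have k0: "1 + norm k \<ge> 0" "1 + norm (k, l) \<ge> 0" using norm_ge_zero[of k] norm_ge_zero[of "(k, l)"] by linarith+
  have "derivs_bounded UNIV n (cmod (complex_of_real ((1 + norm (k, l)) ^ N)) * (2 ^ n * (1 + norm k) ^ n * (S / ?z ^ (n + N))))
      (partial_fourier N \<theta> v k l)"
    unfolding eq using k0 S'
    by (intro derivs_bounded_cmult derivs_bounded_mult smooth_mult smooth_wave sg derivs_bounded_wave bg) auto
  moreover have "cmod (complex_of_real ((1 + norm (k, l)) ^ N)) * (2 ^ n * (1 + norm k) ^ n * (S / ?z ^ (n + N)))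
      \<le> 2 ^ n * (1 + c) ^ (n + N) * S"
  proof -
    have cz: "(1 + c) * ?z = 1 + norm l + c + c * norm l" by (simp add: distrib_left distrib_right)
    have k1: "1 + norm k \<le> (1 + c) * ?z" unfolding cz using c norm_ge_zero[of l] by linarith
    have k2: "1 + norm (k, l) \<le> (1 + c) * ?z" unfolding cz using c norm_Pair_le[of k l] by linarith
    have "cmod (complex_of_real ((1 + norm (k, l)) ^ N)) = (1 + norm (k, l)) ^ N"
      using k0 by (simp add: norm_power del: of_real_add of_real_power)
    also have "(1 + norm (k, l)) ^ N * (2 ^ n * (1 + norm k) ^ n * (S / ?z ^ (n + N))) \<le>
        ((1 + c) * ?z) ^ N * (2 ^ n * ((1 + c) * ?z) ^ n * (S / ?z ^ (n + N)))"
      using k1 k2 k0 S' c(1) z by (intro mult_mono power_mono mult_nonneg_nonneg) auto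
    also have "\<dots> = 2 ^ n * (1 + c) ^ (n + N) * S"
    proof -
      have "(d * t) ^ N * (2 ^ n * (d * t) ^ n * (S / t ^ (n + N))) = 2 ^ n * d ^ (n + N) * S" if "t > 0" for d t
        using that unfolding power_mult_distrib power_add by (simp add: divide_simps mult_ac)
      from this[OF z] show ?thesis .
    qed
    finally show ?thesis .
  qed
  ultimately show ?thesis by (rule derivs_bounded_mono[OF _ order_refl order_refl])
qed

text \<open>\<open>a0\<close> inverts \<open>\<psi>\<close> near \<open>y0\<close>. A cutoff for an
  admissible seminorm can be chosen equal to 1 there, with \<open>a0 = 1\<close>; a cutoff provided
  by a wave front set is merely nonzero at \<open>y0\<close>, and \<open>a0\<close> then divides by
  it. Both situations share the estimates of this locale.\<close>

locale microlocal_cutoff =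
  fixes \<Omega> :: "'b::euclidean_space set" and y0 \<eta> :: 'b and r \<delta> :: real and \<psi> a0 :: "'b \<Rightarrow> complex"
  assumes \<psi>: "\<psi> \<in> test_functions \<Omega>" and a0: "smooth a0" "\<And>y. y \<in> cball y0 r \<Longrightarrow> a0 y * \<psi> y = 1"
    and \<eta>: "\<eta> \<noteq> 0" and \<delta>: "\<delta> > 0" and r: "r > 0"
begin

text \<open>A function supported near \<open>y0\<close> is the product of \<open>\<phi> * a0\<close>
  and \<open>\<psi>\<close>, so decay passes from \<open>\<psi>\<close> in the larger cone to
  \<open>\<phi>\<close> in the smaller one. The larger cone omits 0 because a wave front set gives
  no information there.\<close>

lemma localized_bound_transfer:
  assumes X: "test_bounded UNIV X" "\<And>\<phi>. \<phi> \<in> X \<Longrightarrow> supp \<phi> \<subseteq> cball y0 r"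
  obtains C B where "C \<ge> 0" "test_bounded \<Omega> B"
    "\<forall>v\<in>distributions \<Omega>. \<forall>S\<ge>0. \<forall>P\<ge>0. localized_bound v N (cone_nbhd \<eta> (2 * \<delta>) - {0}) \<psi> S \<longrightarrow>
      test_bound v B P \<longrightarrow> (\<forall>\<phi>\<in>X. localized_bound v N (cone_nbhd \<eta> \<delta>) \<phi> (C * S + P))"
proof -
  let ?A = "(\<lambda>\<phi> y. \<phi> y * a0 y) ` X" and ?c = "\<delta> / (2 * \<delta> + 2 * norm \<eta>)"
  have sX: "smooth \<phi>" if "\<phi> \<in> X" for \<phi> using X(1) that unfolding test_bounded_def by blast
  have A: "test_bounded UNIV ?A"
    unfolding test_bounded_def
  proof (intro conjI exI[of _ "cball y0 r"] ballI allI)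
    fix a assume "a \<in> ?A"
    then obtain \<phi> where \<phi>: "\<phi> \<in> X" "a = (\<lambda>y. \<phi> y * a0 y)" by blast
    show "smooth a" unfolding \<phi>(2) by (rule smooth_mult[OF sX[OF \<phi>(1)] a0(1)])
    show "supp a \<subseteq> cball y0 r" unfolding \<phi>(2) by (rule order_trans[OF supp_mult_left X(2)[OF \<phi>(1)]])
  next
    fix n
    obtain C where C: "\<forall>\<phi>\<in>X. derivs_bounded UNIV n C \<phi>" using X(1) unfolding test_bounded_def by blast
    obtain D where D: "D \<ge> 0" "derivs_bounded (cball y0 r) n D a0"
      by (rule derivs_bounded_compact[OF a0(1) compact_cball])
    have "derivs_bounded UNIV n (2 ^ n * C * D) (\<lambda>y. \<phi> y * a0 y)" if \<phi>: "\<phi> \<in> X" for \<phi>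
    proof -
      have b: "derivs_bounded UNIV n C \<phi>" using C \<phi> by blast
      show ?thesis
        by (rule derivs_bounded_mult_supp[OF sX[OF \<phi>] a0(1) X(2)[OF \<phi>] derivs_bounded_mono[OF b] D(2)])
           (use D(1) derivs_bounded_nonneg[OF b] in auto)
    qed
    hence "\<forall>a\<in>?A. derivs_bounded UNIV n (2 ^ n * C * D) a" by blast
    thus "\<exists>C. \<forall>a\<in>?A. derivs_bounded UNIV n C a" ..
  qed auto
  have c: "?c > 0" using \<delta> by (simp add: add_pos_nonneg)
  obtain C B where CB: "C \<ge> 0" "test_bounded \<Omega> B"
    "\<forall>u\<in>distributions \<Omega>. \<forall>S\<ge>0. \<forall>P\<ge>0. localized_bound u N (cone_nbhd \<eta> (2 * \<delta>) - {0}) \<psi> S \<longrightarrow>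
      test_bound u B P \<longrightarrow> (\<forall>a\<in>?A. localized_bound u N (cone_nbhd \<eta> \<delta>) (\<lambda>x. a x * \<psi> x) (C * S + P))"
    by (rule localized_fourier_transfer[OF \<psi> A c cone_nbhd_separated[OF \<eta> \<delta>]])
  have eq: "(\<lambda>y. \<phi> y * a0 y * \<psi> y) = \<phi>" if \<phi>: "\<phi> \<in> X" for \<phi>
  proof
    fix y
    show "\<phi> y * a0 y * \<psi> y = \<phi> y"
    proof (cases "y \<in> cball y0 r")
      case True thus ?thesis using a0(2)[OF True] by (simp add: mult.assoc)
    next
      case False
      hence "\<phi> y = 0" using X(2)[OF \<phi>] by (intro zero_outside_supp[of y \<phi>]) blast
      thus ?thesis by simp
    qed
  qed
  show ?thesis
  proof (rule that[OF CB(1,2)], intro ballI allI impI)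
    fix v S P \<phi> assume H: "v \<in> distributions \<Omega>" "S \<ge> (0::real)" "P \<ge> (0::real)"
      "localized_bound v N (cone_nbhd \<eta> (2 * \<delta>) - {0}) \<psi> S" "test_bound v B P" and \<phi>: "\<phi> \<in> X"
    from CB(3)[rule_format, OF H imageI[OF \<phi>]] show "localized_bound v N (cone_nbhd \<eta> \<delta>) \<phi> (C * S + P)"
      by (simp add: eq[OF \<phi>])
  qed
qed

text \<open>Linearity in \<open>S + P\<close>, which measures \<open>v\<close>, covers small and
  bounded sets of \<open>v\<close> at once. \<open>C\<close> and \<open>B\<close> may depend on
  \<open>n\<close> and \<open>N\<close>, but not on \<open>v\<close>, \<open>k\<close> or
  \<open>l\<close>.\<close>

lemma partial_fourier_decay:
  fixes \<theta> :: "'a::euclidean_space \<times> 'b \<Rightarrow> complex" and c :: real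
  assumes \<theta>: "smooth \<theta>" "supp \<theta> \<subseteq> K1 \<times> K2" and K: "compact K1" "compact K2" "K2 \<subseteq> \<Omega>" "K2 \<subseteq> cball y0 r"
    and c: "c \<ge> 0"
  obtains C B where "C \<ge> 0" "test_bounded \<Omega> B"
    "\<forall>v\<in>distributions \<Omega>. \<forall>S\<ge>0. \<forall>P\<ge>0. localized_bound v (n + N) (cone_nbhd \<eta> (2 * \<delta>) - {0}) \<psi> S \<longrightarrow>
      test_bound v B P \<longrightarrow> (\<forall>l\<in>cone_nbhd \<eta> \<delta>. \<forall>k. norm k \<le> c * norm l \<longrightarrow>
      derivs_bounded UNIV n (C * (S + P)) (partial_fourier N \<theta> v k l))"
proof -
  note sd = slice_derivatives_bounded[OF \<theta> K(1,2), where n=n]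
  obtain C B where CB: "C \<ge> 0" "test_bounded \<Omega> B"
    "\<forall>v\<in>distributions \<Omega>. \<forall>S\<ge>0. \<forall>P\<ge>0. localized_bound v (n + N) (cone_nbhd \<eta> (2 * \<delta>) - {0}) \<psi> S \<longrightarrow>
      test_bound v B P \<longrightarrow> (\<forall>\<phi>\<in>slice_derivatives n \<theta>. localized_bound v (n + N) (cone_nbhd \<eta> \<delta>) \<phi> (C * S + P))"
    by (rule localized_bound_transfer[OF sd(1) order_trans[OF sd(2) K(4)]])
  define D where "D = 2 ^ n * (1 + c) ^ (n + N) * (C + 1)"
  have D: "D \<ge> 0" using c CB(1) by (simp add: D_def)
  show ?thesis
  proof (rule that[OF D CB(2)], intro ballI allI impI)
    fix v S P l and k :: 'a
    assume v: "v \<in> distributions \<Omega>" and S: "S \<ge> (0::real)" and P: "P \<ge> (0::real)"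
      and H: "localized_bound v (n + N) (cone_nbhd \<eta> (2 * \<delta>) - {0}) \<psi> S" "test_bound v B P"
      and l: "l \<in> cone_nbhd \<eta> \<delta>" and k: "norm k \<le> c * norm l"
    have SP: "C * S + P \<ge> 0" using CB(1) S P by simp
    have lb: "localized_bound v (n + N) (cone_nbhd \<eta> \<delta>) \<phi> (C * S + P)" if "\<phi> \<in> slice_derivatives n \<theta>" for \<phi>
      using CB(3) v S P H that by blast
    have "derivs_bounded UNIV n (2 ^ n * (1 + c) ^ (n + N) * (C * S + P)) (partial_fourier N \<theta> v k l)"
      by (rule derivs_bounded_partial_fourier[OF v \<theta> K(1,2,3) c k SP]) (rule localized_boundD[OF lb l])
    moreover have "2 ^ n * (1 + c) ^ (n + N) * (C * S + P) \<le> D * (S + P)"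
    proof -
      have "C * S + P \<le> (C + 1) * (S + P)"
        using CB(1) S P by (simp add: distrib_left distrib_right)
      thus ?thesis unfolding D_def mult.assoc using c by (intro mult_left_mono) auto
    qed
    ultimately show "derivs_bounded UNIV n (D * (S + P)) (partial_fourier N \<theta> v k l)"
      by (rule derivs_bounded_mono[OF _ order_refl order_refl])
  qed
qed

end

text \<open>Closedness of \<open>\<Gamma>\<close> gives a product neighbourhood of
  \<open>(y0, \<eta>)\<close> that avoids it, and the cone property extends this to all
  \<open>k\<close> in the cone by rescaling to the length of \<open>\<eta>\<close>. Nothing happens
  at \<open>k = 0\<close>, as \<open>\<Gamma>\<close> contains no zero covectors.\<close>

lemma microlocal_cutoff_admissible:
  fixes y0 \<eta> :: "'b::euclidean_space"
  assumes \<Omega>: "open \<Omega>" and \<Gamma>: "closed_cone_in \<Omega> \<Gamma>" and y0: "y0 \<in> \<Omega>" and \<eta>: "\<eta> \<noteq> 0" "(y0, \<eta>) \<notin> \<Gamma>"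
  obtains r \<delta> \<psi> where "microlocal_cutoff \<Omega> y0 \<eta> r \<delta> \<psi> (\<lambda>_. 1)"
    "fourier_admissible \<Omega> \<Gamma> (cone_nbhd \<eta> (2 * \<delta>)) \<psi>"
proof -
  have cl: "closedin (top_of_set (punctured_cotangent \<Omega>)) \<Gamma>" using \<Gamma> by (simp add: closed_cone_in_def)
  then obtain T where T: "closed T" "\<Gamma> = punctured_cotangent \<Omega> \<inter> T" by (auto simp: closedin_closed)
  have mT: "(y0, \<eta>) \<in> - T" using T(2) y0 \<eta> by (auto simp: punctured_cotangent_def)
  have "open (- T)" using T(1) by (simp add: open_Compl)
  then obtain A B where AB: "open A" "open B" "(y0, \<eta>) \<in> A \<times> B" "A \<times> B \<subseteq> - T"
    using mT by (rule open_prod_elim)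
  have "y0 \<in> A \<inter> \<Omega>" "open (A \<inter> \<Omega>)" using AB y0 \<Omega> by auto
  then obtain e where e: "e > 0" "cball y0 e \<subseteq> A \<inter> \<Omega>" unfolding open_contains_cball by blast
  obtain d where d: "d > 0" "cball \<eta> d \<subseteq> B" using AB(2,3) unfolding open_contains_cball by blast
  \<comment> \<open>Halved, because the cutoff has its support in the ball of twice the radius and
    the larger cone has twice the aperture.\<close>
  define r \<delta> where "r = e / 2" and "\<delta> = d / 2"
  have r: "r > 0" "\<delta> > 0" "2 * r = e" "2 * \<delta> = d" using e d by (auto simp: r_def \<delta>_def)
  obtain \<psi> where \<psi>: "smooth \<psi>" "\<forall>x\<in>cball y0 r. \<psi> x = 1" "supp \<psi> \<subseteq> cball y0 (2 * r)" by (rule ball_cutoff[OF r(1)])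
  have T\<psi>: "\<psi> \<in> test_functions \<Omega>"
    by (rule test_functionsI[OF \<psi>(1,3) compact_cball]) (use e r in auto)
  have "microlocal_cutoff \<Omega> y0 \<eta> r \<delta> \<psi> (\<lambda>_. 1)"
    by unfold_locales (use T\<psi> \<psi> \<eta> r in auto)
  moreover have "fourier_admissible \<Omega> \<Gamma> (cone_nbhd \<eta> (2 * \<delta>)) \<psi>"
    unfolding fourier_admissible_def
  proof (intro conjI T\<psi> closed_cone_nbhd positive_cone_cone_nbhd equals0I)
    fix z assume "z \<in> (supp \<psi> \<times> cone_nbhd \<eta> (2 * \<delta>)) \<inter> \<Gamma>"
    then obtain y k where y: "y \<in> supp \<psi>" and k: "k \<in> cone_nbhd \<eta> d" and yk: "(y, k) \<in> \<Gamma>"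
      using r(4) by (cases z) auto
    have k0: "k \<noteq> 0" using yk T(2) by (auto simp: punctured_cotangent_def)
    define t where "t = norm \<eta> / norm k"
    have t: "t > 0" using k0 \<eta>(1) by (simp add: t_def)
    have "(y, t *\<^sub>R k) \<in> \<Gamma>" using \<Gamma> yk t unfolding closed_cone_in_def by blast
    hence "(y, t *\<^sub>R k) \<in> T" using T(2) by blast
    moreover have "t *\<^sub>R k \<in> B" using cone_nbhd_normalize[OF k k0] d(2) unfolding t_def by blast
    moreover have "y \<in> A" using y \<psi>(3) e(2) r(3) by auto
    ultimately show False using AB(4) by blast
  qed
  ultimately show ?thesis by (rule that)
qed

text \<open>The counterpart for one distribution: cutoff and cone are the witnesses that
  \<open>(y0, \<eta>)\<close> is not in its wave front set.\<close>

lemma microlocal_cutoff_wave_front_set: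
  fixes y0 \<eta> :: "'b::euclidean_space"
  assumes \<Omega>: "open \<Omega>" and y0: "y0 \<in> \<Omega>" and \<eta>: "\<eta> \<noteq> 0" "(y0, \<eta>) \<notin> wave_front_set \<Omega> v"
  obtains r \<delta> \<psi> a0 where "microlocal_cutoff \<Omega> y0 \<eta> r \<delta> \<psi> a0"
    "\<forall>N. \<exists>S\<ge>0. localized_bound v N (cone_nbhd \<eta> (2 * \<delta>) - {0}) \<psi> S"
proof -
  have "(y0, \<eta>) \<in> punctured_cotangent \<Omega>" using y0 \<eta>(1) by (simp add: punctured_cotangent_def)
  then obtain \<psi> V where \<psi>: "\<psi> \<in> test_functions \<Omega>" "\<psi> y0 \<noteq> 0"
    and V: "open V" "positive_cone V" "\<eta> \<in> V" "\<And>N. fourier_seminorm N V \<psi> v < \<infinity>"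
    using \<eta>(2) unfolding wave_front_set_def by blast
  have sm: "smooth \<psi>" by (rule test_functionsD(1)[OF \<psi>(1)])
  have "open (\<psi> -` (- {0}))"
    using smooth_continuous_on[OF sm, of UNIV] by (intro open_vimage) auto
  then obtain e where e: "e > 0" "cball y0 e \<subseteq> \<psi> -` (- {0})" using \<psi>(2) unfolding open_contains_cball by blast
  obtain d where d: "d > 0" "cball \<eta> d \<subseteq> V" using V(1,3) unfolding open_contains_cball by blast
  define r \<delta> where "r = e / 2" and "\<delta> = d / 2"
  have r: "r > 0" "\<delta> > 0" "2 * r = e" "2 * \<delta> = d" using e d by (auto simp: r_def \<delta>_def)
  obtain \<omega> where \<omega>: "smooth \<omega>" "\<forall>x\<in>cball y0 r. \<omega> x = 1" "supp \<omega> \<subseteq> cball y0 (2 * r)" by (rule ball_cutoff[OF r(1)])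
  have nz: "\<psi> x \<noteq> 0" if "x \<in> cball y0 e" for x using e(2) that by blast
  \<comment> \<open>\<open>\<psi>\<close> has no zero on the support of \<open>\<omega>\<close>, so
    the quotient is smooth on the whole space.\<close>
  have sa: "smooth (\<lambda>x. \<omega> x / \<psi> x)"
  proof (rule smooth_divide[OF \<omega>(1) sm])
    fix x assume "x \<in> supp \<omega>" thus "\<psi> x \<noteq> 0" using \<omega>(3) r(3) nz by auto
  qed
  have "microlocal_cutoff \<Omega> y0 \<eta> r \<delta> \<psi> (\<lambda>x. \<omega> x / \<psi> x)"
  proof
    fix y assume y: "y \<in> cball y0 r"
    hence "\<psi> y \<noteq> 0" using nz[of y] r(1,3) by auto
    thus "\<omega> y / \<psi> y * \<psi> y = 1" using \<omega>(2) y by simp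
  qed (use \<psi> sa \<eta> r in auto)
  moreover have "\<forall>N. \<exists>S\<ge>0. localized_bound v N (cone_nbhd \<eta> (2 * \<delta>) - {0}) \<psi> S"
  proof
    fix N
    obtain S where S: "S \<ge> 0" "fourier_seminorm N V \<psi> v = ennreal S"
      using V(4)[of N] by (cases "fourier_seminorm N V \<psi> v") auto
    have "(1 + norm q) ^ N * cmod (localized_fourier \<psi> v q) \<le> S" if q: "q \<in> cone_nbhd \<eta> (2 * \<delta>) - {0}" for q
    proof -
      have q0: "q \<noteq> 0" using q by blast
      have "(norm \<eta> / norm q) *\<^sub>R q \<in> V" using cone_nbhd_normalize[of q \<eta> d] q r(4) d(2) by auto
      moreover have "norm q / norm \<eta> > 0" using q0 \<eta>(1) by simp
      ultimately have "(norm q / norm \<eta>) *\<^sub>R ((norm \<eta> / norm q) *\<^sub>R q) \<in> V" using V(2) unfolding positive_cone_def by blast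
      hence "q \<in> V" using q0 \<eta>(1) by simp
      thus ?thesis using S by (intro fourier_seminorm_leD[of N V \<psi> v S]) auto
    qed
    thus "\<exists>S\<ge>0. localized_bound v N (cone_nbhd \<eta> (2 * \<delta>) - {0}) \<psi> S"
      using S(1) unfolding localized_bound_def by blast
  qed
  ultimately show ?thesis by (rule that)
qed

text \<open>Strict inequalities make the set open and exclude \<open>l = 0\<close>. The summand 1
  puts \<open>(\<xi>, \<eta>)\<close> inside for \<open>\<eta> \<noteq> 0\<close> and positive
  \<open>\<delta>\<close>.\<close>

definition product_cone :: "'a::real_normed_vector \<Rightarrow> 'b::real_normed_vector \<Rightarrow> real \<Rightarrow> ('a \<times> 'b) set" where
  "product_cone \<xi> \<eta> \<delta> = {(k, l). norm (norm \<eta> *\<^sub>R l - norm l *\<^sub>R \<eta>) < \<delta> * norm l \<and> norm k < (norm \<xi> / norm \<eta> + 1) * norm l}"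

lemma product_cone_props:
  assumes "\<eta> \<noteq> 0" "\<delta> > 0"
  shows "open (product_cone \<xi> \<eta> \<delta>)" "positive_cone (product_cone \<xi> \<eta> \<delta>)" "(\<xi>, \<eta>) \<in> product_cone \<xi> \<eta> \<delta>"
    "(k, l) \<in> product_cone \<xi> \<eta> \<delta> \<Longrightarrow> l \<in> cone_nbhd \<eta> \<delta> \<and> norm k \<le> (norm \<xi> / norm \<eta> + 1) * norm l"
proof -
  have eq: "product_cone \<xi> \<eta> \<delta> = {z. norm (norm \<eta> *\<^sub>R snd z - norm (snd z) *\<^sub>R \<eta>) < \<delta> * norm (snd z)} \<inter>
      {z. norm (fst z) < (norm \<xi> / norm \<eta> + 1) * norm (snd z)}"
    by (auto simp: product_cone_def)
  show "open (product_cone \<xi> \<eta> \<delta>)" unfolding eq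
    by (intro open_Int open_Collect_less continuous_intros)
  show "positive_cone (product_cone \<xi> \<eta> \<delta>)" unfolding positive_cone_def
  proof (intro ballI allI impI)
    fix z and t :: real assume z: "z \<in> product_cone \<xi> \<eta> \<delta>" and t: "t > 0"
    have "norm \<eta> *\<^sub>R t *\<^sub>R snd z - norm (t *\<^sub>R snd z) *\<^sub>R \<eta> = t *\<^sub>R (norm \<eta> *\<^sub>R snd z - norm (snd z) *\<^sub>R \<eta>)"
      using t by (simp add: algebra_simps)
    thus "t *\<^sub>R z \<in> product_cone \<xi> \<eta> \<delta>" using z t unfolding eq by (simp add: mult.left_commute)
  qed
  show "(\<xi>, \<eta>) \<in> product_cone \<xi> \<eta> \<delta>" using assms by (simp add: product_cone_def distrib_right)
  show "(k, l) \<in> product_cone \<xi> \<eta> \<delta> \<Longrightarrow> l \<in> cone_nbhd \<eta> \<delta> \<and> norm k \<le> (norm \<xi> / norm \<eta> + 1) * norm l"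
    by (auto simp: product_cone_def cone_nbhd_def)
qed

section \<open>Hypocontinuity\<close>

lemma normal_bounded_distributions: "tvs_bounded (normal_topology \<Omega> \<Gamma>) A \<Longrightarrow> u \<in> A \<Longrightarrow> u \<in> distributions \<Omega>"
  using tvs_bounded_subset_topspace[of "normal_topology \<Omega> \<Gamma>" A] by (auto simp: distributions_WF_def)

lemma normal_nbhd_distributions: "zero_neighborhood (normal_topology \<Omega> \<Gamma>) U \<Longrightarrow> u \<in> U \<Longrightarrow> u \<in> distributions \<Omega>"
  using zero_neighborhood_subset_topspace[of "normal_topology \<Omega> \<Gamma>" U] by (auto simp: distributions_WF_def)

text \<open>The seminorms \<open>p\<^sub>B\<close> of the normal topology provide the boundedness
  that \<open>uniform_order_bound\<close> asks for.\<close>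

lemma normal_bounded_order:
  assumes \<Omega>: "open \<Omega>" and A: "tvs_bounded (normal_topology \<Omega> \<Gamma>) A" and K: "compact K" "K \<subseteq> \<Omega>"
  obtains n C where "C \<ge> 0" "\<forall>u\<in>A. order_bound K n C u"
proof -
  have "\<exists>n C. C \<ge> 0 \<and> (\<forall>u\<in>A. order_bound K n C u)"
  proof (rule uniform_order_bound[OF _ _ K])
    show "linear_on_functions (test_functions \<Omega>) u" if "u \<in> A" for u
      by (rule distributionsD(1)[OF normal_bounded_distributions[OF A that]])
    fix B assume "test_bounded \<Omega> B"
    from normal_bounded_test[OF \<Omega> A this] show "\<exists>C. \<forall>u\<in>A. \<forall>\<phi>\<in>B. cmod (u \<phi>) \<le> C"
      unfolding test_bound_def by blast
  qed
  thus ?thesis using that by blast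
qed

text \<open>The hypocontinuity condition for one scalar quantity, typically a seminorm of the tensor
  product. In this form it can be summed, dominated and transferred to exchanged arguments.\<close>

definition hypo_small ::
    "('s \<Rightarrow> complex) topology \<Rightarrow> ('t \<Rightarrow> complex) topology \<Rightarrow> (('s \<Rightarrow> complex) \<Rightarrow> ('t \<Rightarrow> complex) \<Rightarrow> ennreal) \<Rightarrow> bool" where
  "hypo_small E F q \<longleftrightarrow> (\<forall>\<epsilon>>0.
     (\<forall>A. tvs_bounded E A \<longrightarrow> (\<exists>V. zero_neighborhood F V \<and> (\<forall>u\<in>A. \<forall>v\<in>V. q u v \<le> ennreal \<epsilon>))) \<and>
     (\<forall>B. tvs_bounded F B \<longrightarrow> (\<exists>U. zero_neighborhood E U \<and> (\<forall>u\<in>U. \<forall>v\<in>B. q u v \<le> ennreal \<epsilon>))))"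

lemma hypo_smallD:
  assumes "hypo_small E F q" "\<epsilon> > 0"
  shows "tvs_bounded E A \<Longrightarrow> \<exists>V. zero_neighborhood F V \<and> (\<forall>u\<in>A. \<forall>v\<in>V. q u v \<le> ennreal \<epsilon>)"
    "tvs_bounded F B \<Longrightarrow> \<exists>U. zero_neighborhood E U \<and> (\<forall>u\<in>U. \<forall>v\<in>B. q u v \<le> ennreal \<epsilon>)"
  using assms unfolding hypo_small_def by simp_all

lemma hypo_smallI:
  assumes "\<And>\<epsilon> A. \<epsilon> > 0 \<Longrightarrow> tvs_bounded E A \<Longrightarrow> \<exists>V. zero_neighborhood F V \<and> (\<forall>u\<in>A. \<forall>v\<in>V. q u v \<le> ennreal \<epsilon>)"
    "\<And>\<epsilon> B. \<epsilon> > 0 \<Longrightarrow> tvs_bounded F B \<Longrightarrow> \<exists>U. zero_neighborhood E U \<and> (\<forall>u\<in>U. \<forall>v\<in>B. q u v \<le> ennreal \<epsilon>)"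
  shows "hypo_small E F q"
  unfolding hypo_small_def by (intro allI impI conjI assms)

lemma hypo_small_swap:
  assumes "hypo_small E F q"
  shows "hypo_small F E (\<lambda>v u. q u v)"
proof (rule hypo_smallI)
  fix \<epsilon> :: real and A assume "\<epsilon> > 0" "tvs_bounded F A"
  from hypo_smallD(2)[OF assms this]
  show "\<exists>V. zero_neighborhood E V \<and> (\<forall>v\<in>A. \<forall>u\<in>V. q u v \<le> ennreal \<epsilon>)" by blast
next
  fix \<epsilon> :: real and B assume "\<epsilon> > 0" "tvs_bounded E B"
  from hypo_smallD(1)[OF assms this]
  show "\<exists>U. zero_neighborhood F U \<and> (\<forall>v\<in>U. \<forall>u\<in>B. q u v \<le> ennreal \<epsilon>)" by blast
qed

lemma hypo_small_mono:
  assumes "hypo_small E F q'" "\<And>u v. u \<in> topspace E \<Longrightarrow> v \<in> topspace F \<Longrightarrow> q u v \<le> q' u v"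
  shows "hypo_small E F q"
proof (rule hypo_smallI)
  fix \<epsilon> :: real and A assume \<epsilon>: "\<epsilon> > 0" and A: "tvs_bounded E A"
  obtain V where V: "zero_neighborhood F V" "\<forall>u\<in>A. \<forall>v\<in>V. q' u v \<le> ennreal \<epsilon>"
    using hypo_smallD(1)[OF assms(1) \<epsilon> A] by blast
  have "q u v \<le> ennreal \<epsilon>" if "u \<in> A" "v \<in> V" for u v
    using assms(2)[of u v] V(2) that tvs_bounded_subset_topspace[OF A] zero_neighborhood_subset_topspace[OF V(1)]
    by (meson order_trans subsetD)
  thus "\<exists>V. zero_neighborhood F V \<and> (\<forall>u\<in>A. \<forall>v\<in>V. q u v \<le> ennreal \<epsilon>)" using V(1) by blast
next
  fix \<epsilon> :: real and B assume \<epsilon>: "\<epsilon> > 0" and B: "tvs_bounded F B"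
  obtain U where U: "zero_neighborhood E U" "\<forall>u\<in>U. \<forall>v\<in>B. q' u v \<le> ennreal \<epsilon>"
    using hypo_smallD(2)[OF assms(1) \<epsilon> B] by blast
  have "q u v \<le> ennreal \<epsilon>" if "u \<in> U" "v \<in> B" for u v
    using assms(2)[of u v] U(2) that tvs_bounded_subset_topspace[OF B] zero_neighborhood_subset_topspace[OF U(1)]
    by (meson order_trans subsetD)
  thus "\<exists>U. zero_neighborhood E U \<and> (\<forall>u\<in>U. \<forall>v\<in>B. q u v \<le> ennreal \<epsilon>)" using U(1) by blast
qed

lemma hypo_small_zero:
  assumes "(\<lambda>s. 0) \<in> topspace E" "(\<lambda>s. 0) \<in> topspace F"
  shows "hypo_small E F (\<lambda>u v. 0)"
proof (rule hypo_smallI)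
  have "zero_neighborhood E (topspace E)" "zero_neighborhood F (topspace F)"
    unfolding zero_neighborhood_def using assms openin_topspace by blast+
  thus "\<exists>V. zero_neighborhood F V \<and> (\<forall>u\<in>A. \<forall>v\<in>V. 0 \<le> ennreal \<epsilon>)"
    "\<exists>U. zero_neighborhood E U \<and> (\<forall>u\<in>U. \<forall>v\<in>B. 0 \<le> ennreal \<epsilon>)" for A B \<epsilon> by auto
qed

lemma hypo_small_add:
  assumes "hypo_small E F q1" "hypo_small E F q2"
  shows "hypo_small E F (\<lambda>u v. q1 u v + q2 u v)"
proof (rule hypo_smallI)
  fix \<epsilon> :: real and A assume \<epsilon>: "\<epsilon> > 0" and A: "tvs_bounded E A"
  have e: "\<epsilon> / 2 > 0" "ennreal (\<epsilon> / 2) + ennreal (\<epsilon> / 2) = ennreal \<epsilon>" using \<epsilon> by (simp_all flip: ennreal_plus)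
  obtain V1 where V1: "zero_neighborhood F V1" "\<forall>u\<in>A. \<forall>v\<in>V1. q1 u v \<le> ennreal (\<epsilon> / 2)"
    using hypo_smallD(1)[OF assms(1) e(1) A] by blast
  obtain V2 where V2: "zero_neighborhood F V2" "\<forall>u\<in>A. \<forall>v\<in>V2. q2 u v \<le> ennreal (\<epsilon> / 2)"
    using hypo_smallD(1)[OF assms(2) e(1) A] by blast
  have "q1 u v + q2 u v \<le> ennreal \<epsilon>" if "u \<in> A" "v \<in> V1 \<inter> V2" for u v
    unfolding e(2)[symmetric] using V1(2) V2(2) that by (intro add_mono) auto
  thus "\<exists>V. zero_neighborhood F V \<and> (\<forall>u\<in>A. \<forall>v\<in>V. q1 u v + q2 u v \<le> ennreal \<epsilon>)"
    using zero_neighborhood_Int[OF V1(1) V2(1)] by blast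
next
  fix \<epsilon> :: real and B assume \<epsilon>: "\<epsilon> > 0" and B: "tvs_bounded F B"
  have e: "\<epsilon> / 2 > 0" "ennreal (\<epsilon> / 2) + ennreal (\<epsilon> / 2) = ennreal \<epsilon>" using \<epsilon> by (simp_all flip: ennreal_plus)
  obtain U1 where U1: "zero_neighborhood E U1" "\<forall>u\<in>U1. \<forall>v\<in>B. q1 u v \<le> ennreal (\<epsilon> / 2)"
    using hypo_smallD(2)[OF assms(1) e(1) B] by blast
  obtain U2 where U2: "zero_neighborhood E U2" "\<forall>u\<in>U2. \<forall>v\<in>B. q2 u v \<le> ennreal (\<epsilon> / 2)"
    using hypo_smallD(2)[OF assms(2) e(1) B] by blast
  have "q1 u v + q2 u v \<le> ennreal \<epsilon>" if "u \<in> U1 \<inter> U2" "v \<in> B" for u v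
    unfolding e(2)[symmetric] using U1(2) U2(2) that by (intro add_mono) auto
  thus "\<exists>U. zero_neighborhood E U \<and> (\<forall>u\<in>U. \<forall>v\<in>B. q1 u v + q2 u v \<le> ennreal \<epsilon>)"
    using zero_neighborhood_Int[OF U1(1) U2(1)] by blast
qed

lemma hypo_small_sum:
  assumes "finite I" "\<And>i. i \<in> I \<Longrightarrow> hypo_small E F (q i)" "(\<lambda>s. 0) \<in> topspace E" "(\<lambda>s. 0) \<in> topspace F"
  shows "hypo_small E F (\<lambda>u v. \<Sum>i\<in>I. q i u v)"
  using assms(1,2)
proof (induction I rule: finite_induct)
  case empty
  show ?case using hypo_small_zero[OF assms(3,4)] by simp
next
  case (insert i I)
  have "hypo_small E F (\<lambda>u v. q i u v + (\<Sum>i\<in>I. q i u v))"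
    by (intro hypo_small_add insert.prems insert.IH) auto
  thus ?case using insert.hyps by simp
qed

text \<open>A common order \<open>n\<close> of all \<open>v\<close> in \<open>A\<close> turns bounds
  of order \<open>n + m\<close> on \<open>B\<close> into bounds of order \<open>m\<close> on the
  partial pairings.\<close>

lemma slice_images_bounded:
  fixes \<Omega>1 :: "'a::euclidean_space set" and \<Omega>2 :: "'b::euclidean_space set"
  assumes \<Omega>: "open \<Omega>2" and B: "test_bounded (\<Omega>1 \<times> \<Omega>2) B" and A: "tvs_bounded (normal_topology \<Omega>2 \<Gamma>) A"
  shows "test_bounded \<Omega>1 {(\<lambda>x. v (\<lambda>y. \<phi> (x, y))) | v \<phi>. v \<in> A \<and> \<phi> \<in> B}"
proof -
  obtain K where K: "compact K" "K \<subseteq> \<Omega>1 \<times> \<Omega>2" "\<forall>\<phi>\<in>B. smooth \<phi> \<and> supp \<phi> \<subseteq> K"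
    using B unfolding test_bounded_def by blast
  have K1: "compact (fst ` K)" "fst ` K \<subseteq> \<Omega>1" and K2: "compact (snd ` K)" "snd ` K \<subseteq> \<Omega>2"
    using K(1,2) by (auto intro!: compact_continuous_image continuous_on_fst continuous_on_snd continuous_on_id)
  obtain n C where C: "C \<ge> 0" "\<forall>v\<in>A. order_bound (snd ` K) n C v" by (rule normal_bounded_order[OF \<Omega> A K2])
  have sf: "slice_functional \<Omega>2 (snd ` K) n C v" if "v \<in> A" for v
    unfolding slice_functional_def
    using distributionsD(1)[OF normal_bounded_distributions[OF A that]] C(2) that K2 by blast
  have \<phi>: "smooth \<phi>" "supp \<phi> \<subseteq> fst ` K \<times> snd ` K" if "\<phi> \<in> B" for \<phi>
    using K(3) that subset_fst_snd[of K] by blast+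
  show ?thesis
    unfolding test_bounded_def
  proof (intro conjI exI[of _ "fst ` K"] K1 ballI allI)
    fix g assume "g \<in> {(\<lambda>x. v (\<lambda>y. \<phi> (x, y))) | v \<phi>. v \<in> A \<and> \<phi> \<in> B}"
    then obtain v f where g: "g = (\<lambda>x. v (\<lambda>y. f (x, y)))" "v \<in> A" "f \<in> B" by blast
    show "smooth g" unfolding g(1) by (rule slice_functional.smooth_slice_functional[OF sf[OF g(2)] \<phi>[OF g(3)] K1(1)])
    show "supp g \<subseteq> fst ` K"
      unfolding g(1) by (rule slice_functional.supp_slice_functional[OF sf[OF g(2)] \<phi>(2)[OF g(3)] compact_imp_closed[OF K1(1)]])
  next
    fix m
    obtain c where c: "\<forall>\<phi>\<in>B. derivs_bounded UNIV (n + m) c \<phi>" using B unfolding test_bounded_def by blast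
    have "derivs_bounded UNIV m (C * c) (\<lambda>x. v (\<lambda>y. f (x, y)))" if "v \<in> A" "f \<in> B" for v f
      by (rule slice_functional.derivs_bounded_slice_functional[OF sf[OF that(1)] \<phi>[OF that(2)] K1(1)]) (use c that in blast)
    thus "\<exists>C. \<forall>g\<in>{(\<lambda>x. v (\<lambda>y. \<phi> (x, y))) | v \<phi>. v \<in> A \<and> \<phi> \<in> B}. derivs_bounded UNIV m C g" by blast
  qed
qed

lemma test_bounded_swap:
  assumes "test_bounded (\<Omega>1 \<times> \<Omega>2) B"
  shows "test_bounded (\<Omega>2 \<times> \<Omega>1) ((\<lambda>\<phi> z. \<phi> (prod.swap z)) ` B)"
proof -
  obtain K where K: "compact K" "K \<subseteq> \<Omega>1 \<times> \<Omega>2" "\<forall>\<phi>\<in>B. smooth \<phi> \<and> supp \<phi> \<subseteq> K"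
    using assms unfolding test_bounded_def by blast
  have cK: "compact (prod.swap ` K)"
    by (intro compact_continuous_image K(1)) (auto simp: prod.swap_def intro!: continuous_intros)
  show ?thesis
    unfolding test_bounded_def
  proof (intro conjI exI[of _ "prod.swap ` K"] cK ballI allI)
    show "prod.swap ` K \<subseteq> \<Omega>2 \<times> \<Omega>1" using K(2) by auto
    fix g assume "g \<in> (\<lambda>\<phi> z. \<phi> (prod.swap z)) ` B"
    then obtain f where g: "g = (\<lambda>z. f (prod.swap z))" "f \<in> B" by blast
    show "smooth g" unfolding g(1) using K(3) g(2) by (intro smooth_swap) blast
    show "supp g \<subseteq> prod.swap ` K"
    proof (rule supp_subsetI[OF compact_imp_closed[OF cK]])
      fix z assume z: "z \<notin> prod.swap ` K"
      have "prod.swap z \<notin> K"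
      proof
        assume "prod.swap z \<in> K"
        hence "prod.swap (prod.swap z) \<in> prod.swap ` K" by (rule imageI)
        thus False using z by simp
      qed
      hence "prod.swap z \<notin> supp f" using K(3) g(2) by blast
      thus "g z = 0" unfolding g(1) by (rule zero_outside_supp)
    qed
  next
    fix n
    obtain C where C: "\<forall>\<phi>\<in>B. derivs_bounded UNIV n C \<phi>" using assms unfolding test_bounded_def by blast
    have "derivs_bounded UNIV n C (\<lambda>z. f (prod.swap z))" if "f \<in> B" for f
      by (rule derivs_bounded_swap) (use K(3) C that in blast)+
    thus "\<exists>C. \<forall>g\<in>(\<lambda>\<phi> z. \<phi> (prod.swap z)) ` B. derivs_bounded UNIV n C g" by blast
  qed
qed

lemma hypo_small_test:
  fixes \<Omega>1 :: "'a::euclidean_space set" and \<Omega>2 :: "'b::euclidean_space set"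
  assumes \<Omega>: "open \<Omega>1" "open \<Omega>2" and B: "test_bounded (\<Omega>1 \<times> \<Omega>2) B"
  shows "hypo_small (normal_topology \<Omega>1 \<Gamma>1) (normal_topology \<Omega>2 \<Gamma>2)
    (\<lambda>u v. SUP \<phi>\<in>B. ennreal (cmod (tensor_distribution \<Omega>1 \<Omega>2 u v \<phi>)))"
proof (rule hypo_smallI)
  have BT: "\<phi> \<in> test_functions (\<Omega>1 \<times> \<Omega>2)" if "\<phi> \<in> B" for \<phi> using test_bounded_subset[OF B] that by blast
  {
    fix \<epsilon> :: real and A assume \<epsilon>: "\<epsilon> > 0" and A: "tvs_bounded (normal_topology \<Omega>1 \<Gamma>1) A"
    let ?S = "(\<lambda>\<phi> z. \<phi> (prod.swap z)) ` B"
    let ?B = "{(\<lambda>y. u (\<lambda>x. \<phi> (y, x))) | u \<phi>. u \<in> A \<and> \<phi> \<in> ?S}"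
    \<comment> \<open>With \<open>u\<close> in a bounded set, the pairing with \<open>u\<close> has
      to be carried out first; this is where the exchange of the variables enters.\<close>
    have "test_bounded \<Omega>2 ?B" by (rule slice_images_bounded[OF \<Omega>(1) test_bounded_swap[OF B] A])
    then obtain V where V: "zero_neighborhood (normal_topology \<Omega>2 \<Gamma>2) V" "\<forall>v\<in>V. test_bound v ?B \<epsilon>"
      using normal_nbhd_test[OF \<Omega>(2) _ \<epsilon>] by blast
    have "(SUP \<phi>\<in>B. ennreal (cmod (tensor_distribution \<Omega>1 \<Omega>2 u v \<phi>))) \<le> ennreal \<epsilon>" if u: "u \<in> A" and v: "v \<in> V" for u v
    proof (intro SUP_least ennreal_leI)
      fix \<phi> assume \<phi>: "\<phi> \<in> B"
      have "tensor_distribution \<Omega>1 \<Omega>2 u v \<phi> = v (\<lambda>y. u (\<lambda>x. (\<lambda>z. \<phi> (prod.swap z)) (y, x)))"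
        unfolding tensor_distribution_iterated_pairing[OF BT[OF \<phi>]]
          iterated_pairing_swap[OF \<Omega> normal_bounded_distributions[OF A u] normal_nbhd_distributions[OF V(1) v] BT[OF \<phi>]]
        by (simp only: iterated_pairing_def)
      moreover have "(\<lambda>y. u (\<lambda>x. (\<lambda>z. \<phi> (prod.swap z)) (y, x))) \<in> ?B"
        by (intro CollectI exI[of _ u] exI[of _ "\<lambda>z. \<phi> (prod.swap z)"] conjI refl u) (rule imageI[OF \<phi>])
      ultimately show "cmod (tensor_distribution \<Omega>1 \<Omega>2 u v \<phi>) \<le> \<epsilon>"
        using test_boundD[OF bspec[OF V(2) v]] by simp
    qed
    thus "\<exists>V. zero_neighborhood (normal_topology \<Omega>2 \<Gamma>2) V \<and>
        (\<forall>u\<in>A. \<forall>v\<in>V. (SUP \<phi>\<in>B. ennreal (cmod (tensor_distribution \<Omega>1 \<Omega>2 u v \<phi>))) \<le> ennreal \<epsilon>)"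
      using V(1) by blast
  next
    fix \<epsilon> :: real and A assume \<epsilon>: "\<epsilon> > 0" and A: "tvs_bounded (normal_topology \<Omega>2 \<Gamma>2) A"
    let ?B = "{(\<lambda>x. v (\<lambda>y. \<phi> (x, y))) | v \<phi>. v \<in> A \<and> \<phi> \<in> B}"
    have "test_bounded \<Omega>1 ?B" by (rule slice_images_bounded[OF \<Omega>(2) B A])
    then obtain U where U: "zero_neighborhood (normal_topology \<Omega>1 \<Gamma>1) U" "\<forall>u\<in>U. test_bound u ?B \<epsilon>"
      using normal_nbhd_test[OF \<Omega>(1) _ \<epsilon>] by blast
    have "(SUP \<phi>\<in>B. ennreal (cmod (tensor_distribution \<Omega>1 \<Omega>2 u v \<phi>))) \<le> ennreal \<epsilon>" if u: "u \<in> U" and v: "v \<in> A" for u v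
    proof (intro SUP_least ennreal_leI)
      fix \<phi> assume \<phi>: "\<phi> \<in> B"
      have "(\<lambda>x. v (\<lambda>y. \<phi> (x, y))) \<in> ?B" using v \<phi> by blast
      thus "cmod (tensor_distribution \<Omega>1 \<Omega>2 u v \<phi>) \<le> \<epsilon>"
        unfolding tensor_distribution_iterated_pairing[OF BT[OF \<phi>]] iterated_pairing_def
        by (rule test_boundD[OF bspec[OF U(2) u]])
    qed
    thus "\<exists>U. zero_neighborhood (normal_topology \<Omega>1 \<Gamma>1) U \<and>
        (\<forall>u\<in>U. \<forall>v\<in>A. (SUP \<phi>\<in>B. ennreal (cmod (tensor_distribution \<Omega>1 \<Omega>2 u v \<phi>))) \<le> ennreal \<epsilon>)"
      using U(1) by blast
  }
qed

text \<open>If \<open>u\<close> is bounded, one order \<open>n\<close> serves all \<open>u\<close>,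
  and \<open>v\<close> is made small at decay order \<open>n + N\<close>. If \<open>v\<close> is
  bounded, the functions \<open>partial_fourier N \<theta> v k l\<close> have bounds of every order,
  hence form a bounded set of test functions on which \<open>u\<close> is made small.\<close>

lemma hypo_small_fourier_cone:
  fixes \<Omega>1 :: "'a::euclidean_space set" and \<Omega>2 :: "'b::euclidean_space set" and c :: real
  assumes \<Omega>: "open \<Omega>1" "open \<Omega>2" and mc: "microlocal_cutoff \<Omega>2 y0 \<eta> r \<delta> \<psi> a0"
    and adm: "fourier_admissible \<Omega>2 \<Gamma>2 (cone_nbhd \<eta> (2 * \<delta>)) \<psi>"
    and \<theta>: "\<theta> \<in> test_functions (\<Omega>1 \<times> \<Omega>2)" "snd ` supp \<theta> \<subseteq> cball y0 r"
    and c: "c \<ge> 0" and W: "\<And>k l. (k, l) \<in> W \<Longrightarrow> l \<in> cone_nbhd \<eta> \<delta> \<and> norm k \<le> c * norm l"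
  shows "hypo_small (normal_topology \<Omega>1 \<Gamma>1) (normal_topology \<Omega>2 \<Gamma>2)
    (\<lambda>u v. fourier_seminorm N W \<theta> (tensor_distribution \<Omega>1 \<Omega>2 u v))"
proof -
  interpret microlocal_cutoff \<Omega>2 y0 \<eta> r \<delta> \<psi> a0 by (rule mc)
  let ?K1 = "fst ` supp \<theta>" and ?K2 = "snd ` supp \<theta>" and ?V = "cone_nbhd \<eta> (2 * \<delta>)"
  have s: "compact (supp \<theta>)" "supp \<theta> \<subseteq> \<Omega>1 \<times> \<Omega>2" and sm: "smooth \<theta>" using test_functionsD[OF \<theta>(1)] by auto
  have K1: "compact ?K1" "?K1 \<subseteq> \<Omega>1" and K2: "compact ?K2" "?K2 \<subseteq> \<Omega>2"
    using s by (auto intro!: compact_continuous_image continuous_on_fst continuous_on_snd continuous_on_id)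
  note \<theta>K = subset_fst_snd[of "supp \<theta>"]
  have lb: "localized_bound v n (?V - {0}) \<psi> S" if "localized_bound v n ?V \<psi> S" for v n S
    using that by (simp add: localized_bound_def)
  show ?thesis
  proof (rule hypo_smallI)
    fix \<epsilon> :: real and A assume \<epsilon>: "\<epsilon> > 0" and A: "tvs_bounded (normal_topology \<Omega>1 \<Gamma>1) A"
    obtain n C1 where C1: "C1 \<ge> 0" "\<forall>u\<in>A. order_bound ?K1 n C1 u" by (rule normal_bounded_order[OF \<Omega>(1) A K1])
    obtain C B where CB: "C \<ge> 0" "test_bounded \<Omega>2 B"
      "\<forall>v\<in>distributions \<Omega>2. \<forall>S\<ge>0. \<forall>P\<ge>0. localized_bound v (n + N) (?V - {0}) \<psi> S \<longrightarrow>
        test_bound v B P \<longrightarrow> (\<forall>l\<in>cone_nbhd \<eta> \<delta>. \<forall>k. norm k \<le> c * norm l \<longrightarrow>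
        derivs_bounded UNIV n (C * (S + P)) (partial_fourier N \<theta> v k l))"
      by (rule partial_fourier_decay[OF sm \<theta>K K1(1) K2 \<theta>(2) c])
    \<comment> \<open>Both \<open>S\<close> and \<open>P\<close> will be \<open>s\<close>, which
      produces \<open>2 * (C1 * C) * s\<close>; the added 1 keeps the denominator positive.\<close>
    define s where "s = \<epsilon> / (2 * (C1 * C) + 1)"
    have CC: "C1 * C \<ge> 0" using C1(1) CB(1) by simp
    have s: "s > 0" using \<epsilon> CC by (simp add: s_def)
    have se: "C1 * (C * (s + s)) \<le> \<epsilon>"
    proof -
      have "C1 * (C * (s + s)) = (2 * (C1 * C)) * s" by (simp add: algebra_simps)
      also have "\<dots> \<le> (2 * (C1 * C) + 1) * s" using s by (intro mult_right_mono) auto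
      also have "\<dots> = \<epsilon>" using CC by (simp add: s_def)
      finally show ?thesis .
    qed
    obtain V1 where V1: "zero_neighborhood (normal_topology \<Omega>2 \<Gamma>2) V1" "\<forall>v\<in>V1. test_bound v B s"
      using normal_nbhd_test[OF \<Omega>(2) CB(2) s] by blast
    obtain V2 where V2: "zero_neighborhood (normal_topology \<Omega>2 \<Gamma>2) V2" "\<forall>v\<in>V2. localized_bound v (n + N) ?V \<psi> s"
      using normal_nbhd_fourier[OF \<Omega>(2) adm s] by blast
    have "fourier_seminorm N W \<theta> (tensor_distribution \<Omega>1 \<Omega>2 u v) \<le> ennreal \<epsilon>" if u: "u \<in> A" and v: "v \<in> V1 \<inter> V2" for u v
    proof (rule fourier_seminorm_le)
      have uD: "u \<in> distributions \<Omega>1" by (rule normal_bounded_distributions[OF A u])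
      have vD: "v \<in> distributions \<Omega>2" using normal_nbhd_distributions[OF V1(1)] v by blast
      fix z assume z: "z \<in> W"
      obtain k l where kl: "z = (k, l)" by (cases z)
      have kl': "l \<in> cone_nbhd \<eta> \<delta>" "norm k \<le> c * norm l" using W z kl by auto
      have "localized_bound v (n + N) (?V - {0}) \<psi> s" "test_bound v B s" using V1(2) V2(2) v lb by auto
      from CB(3)[rule_format, OF vD less_imp_le[OF s] less_imp_le[OF s] this kl']
      have "cmod (u (partial_fourier N \<theta> v k l)) \<le> C1 * (C * (s + s))"
        using u by (intro order_boundD[OF bspec[OF C1(2)]]
          test_functionsD(1)[OF partial_fourier_test_function[OF vD \<theta>(1)]]
          supp_partial_fourier[OF vD \<theta>K compact_imp_closed[OF K1(1)]])
      thus "(1 + norm z) ^ N * cmod (localized_fourier \<theta> (tensor_distribution \<Omega>1 \<Omega>2 u v) z) \<le> \<epsilon>"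
        unfolding kl localized_fourier_tensor[OF uD vD \<theta>(1)] using se by linarith
    qed
    thus "\<exists>V. zero_neighborhood (normal_topology \<Omega>2 \<Gamma>2) V \<and>
        (\<forall>u\<in>A. \<forall>v\<in>V. fourier_seminorm N W \<theta> (tensor_distribution \<Omega>1 \<Omega>2 u v) \<le> ennreal \<epsilon>)"
      using zero_neighborhood_Int[OF V1(1) V2(1)] by blast
  next
    fix \<epsilon> :: real and A assume \<epsilon>: "\<epsilon> > 0" and A: "tvs_bounded (normal_topology \<Omega>2 \<Gamma>2) A"
    let ?B = "{partial_fourier N \<theta> v k l | v k l. v \<in> A \<and> (k, l) \<in> W}"
    have AD: "v \<in> distributions \<Omega>2" if "v \<in> A" for v by (rule normal_bounded_distributions[OF A that])
    have "test_bounded \<Omega>1 ?B"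
      unfolding test_bounded_def
    proof (intro conjI exI[of _ ?K1] K1 ballI allI)
      fix g assume "g \<in> ?B"
      then obtain v k l where g: "g = partial_fourier N \<theta> v k l" "v \<in> A" by blast
      show "smooth g" unfolding g(1)
        by (rule test_functionsD(1)[OF partial_fourier_test_function[OF AD[OF g(2)] \<theta>(1)]])
      show "supp g \<subseteq> ?K1" unfolding g(1)
        by (rule supp_partial_fourier[OF AD[OF g(2)] \<theta>K compact_imp_closed[OF K1(1)]])
    next
      \<comment> \<open>Here \<open>n\<close> is arbitrary: a bounded set of test functions needs
        bounds of all orders, and the constants may change with \<open>n\<close>.\<close>
      fix n
      obtain C B where CB: "C \<ge> 0" "test_bounded \<Omega>2 B"
        "\<forall>v\<in>distributions \<Omega>2. \<forall>S\<ge>0. \<forall>P\<ge>0. localized_bound v (n + N) (?V - {0}) \<psi> S \<longrightarrow>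
          test_bound v B P \<longrightarrow> (\<forall>l\<in>cone_nbhd \<eta> \<delta>. \<forall>k. norm k \<le> c * norm l \<longrightarrow>
          derivs_bounded UNIV n (C * (S + P)) (partial_fourier N \<theta> v k l))"
        by (rule partial_fourier_decay[OF sm \<theta>K K1(1) K2 \<theta>(2) c])
      obtain P where P: "P \<ge> 0" "\<forall>v\<in>A. test_bound v B P" using normal_bounded_test[OF \<Omega>(2) A CB(2)] by blast
      obtain S where S: "S \<ge> 0" "\<forall>v\<in>A. localized_bound v (n + N) ?V \<psi> S"
        using normal_bounded_fourier[OF \<Omega>(2) A adm] by blast
      have "derivs_bounded UNIV n (C * (S + P)) (partial_fourier N \<theta> v k l)" if "v \<in> A" "(k, l) \<in> W" for v k l
      proof -
        have H: "localized_bound v (n + N) (?V - {0}) \<psi> S" "test_bound v B P" using S(2) P(2) that(1) lb by auto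
        have kl: "l \<in> cone_nbhd \<eta> \<delta>" "norm k \<le> c * norm l" using W that(2) by auto
        show ?thesis by (rule CB(3)[rule_format, OF AD[OF that(1)] S(1) P(1) H kl])
      qed
      thus "\<exists>C. \<forall>g\<in>?B. derivs_bounded UNIV n C g" by blast
    qed
    then obtain U where U: "zero_neighborhood (normal_topology \<Omega>1 \<Gamma>1) U" "\<forall>u\<in>U. test_bound u ?B \<epsilon>"
      using normal_nbhd_test[OF \<Omega>(1) _ \<epsilon>] by blast
    have "fourier_seminorm N W \<theta> (tensor_distribution \<Omega>1 \<Omega>2 u v) \<le> ennreal \<epsilon>" if u: "u \<in> U" and v: "v \<in> A" for u v
    proof (rule fourier_seminorm_le)
      have uD: "u \<in> distributions \<Omega>1" by (rule normal_nbhd_distributions[OF U(1) u])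
      fix z assume z: "z \<in> W"
      obtain k l where kl: "z = (k, l)" by (cases z)
      have "partial_fourier N \<theta> v k l \<in> ?B" using v z kl by blast
      thus "(1 + norm z) ^ N * cmod (localized_fourier \<theta> (tensor_distribution \<Omega>1 \<Omega>2 u v) z) \<le> \<epsilon>"
        unfolding kl localized_fourier_tensor[OF uD AD[OF v] \<theta>(1)]
        by (rule test_boundD[OF bspec[OF U(2) u]])
    qed
    thus "\<exists>U. zero_neighborhood (normal_topology \<Omega>1 \<Gamma>1) U \<and>
        (\<forall>u\<in>U. \<forall>v\<in>A. fourier_seminorm N W \<theta> (tensor_distribution \<Omega>1 \<Omega>2 u v) \<le> ennreal \<epsilon>)"
      using U(1) by blast
  qed
qed

section \<open>Exchange of the factors and estimates in small conic neighbourhoods\<close>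

lemma norm_swap: "norm (prod.swap z) = norm z"
  by (cases z) (simp add: norm_Pair add.commute)

lemma swap_image_swap: "prod.swap ` prod.swap ` V = V"
  by (simp add: image_image)

lemma mem_swap_image: "z \<in> prod.swap ` V \<longleftrightarrow> prod.swap z \<in> V"
  by (cases z) force

lemma open_swap_image:
  fixes V :: "('a::topological_space \<times> 'b::topological_space) set"
  assumes "open V"
  shows "open (prod.swap ` V)"
proof -
  have eq: "prod.swap ` V = prod.swap -` V" by (auto simp: mem_swap_image)
  have "continuous_on UNIV (prod.swap :: 'b \<times> 'a \<Rightarrow> 'a \<times> 'b)"
    unfolding prod.swap_def by (intro continuous_intros)
  thus ?thesis unfolding eq by (rule open_vimage[OF assms])
qed

lemma positive_cone_swap_image:
  assumes "positive_cone V"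
  shows "positive_cone (prod.swap ` V)"
  using assms unfolding positive_cone_def mem_swap_image by (auto simp: prod.swap_def)

lemma supp_swap_cball:
  assumes "supp \<theta> \<subseteq> cball (x0, y0) r"
  shows "supp (\<lambda>z. \<theta> (prod.swap z)) \<subseteq> cball (y0, x0) r"
proof (rule supp_subsetI[OF closed_cball])
  fix z assume z: "z \<notin> cball (y0, x0) r"
  have "dist (x0, y0) (prod.swap z) = dist (y0, x0) z"
    by (cases z) (simp add: dist_Pair_Pair add.commute)
  hence "prod.swap z \<notin> cball (x0, y0) r" using z by simp
  thus "\<theta> (prod.swap z) = 0" using assms by (intro zero_outside_supp[of "prod.swap z" \<theta>]) blast
qed

text \<open>Fubini, applied to \<open>\<theta>\<close> times a plane wave: exchanging positions and
  frequencies together leaves the transform unchanged.\<close>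

lemma fourier_seminorm_swap:
  fixes \<Omega>1 :: "'a::euclidean_space set" and \<Omega>2 :: "'b::euclidean_space set"
  assumes \<Omega>: "open \<Omega>1" "open \<Omega>2" and u: "u \<in> distributions \<Omega>1" and v: "v \<in> distributions \<Omega>2"
    and \<theta>: "\<theta> \<in> test_functions (\<Omega>1 \<times> \<Omega>2)"
  shows "fourier_seminorm N V \<theta> (tensor_distribution \<Omega>1 \<Omega>2 u v) =
    fourier_seminorm N (prod.swap ` V) (\<lambda>z. \<theta> (prod.swap z)) (tensor_distribution \<Omega>2 \<Omega>1 v u)"
proof -
  have eq: "localized_fourier \<theta> (tensor_distribution \<Omega>1 \<Omega>2 u v) z =
      localized_fourier (\<lambda>z. \<theta> (prod.swap z)) (tensor_distribution \<Omega>2 \<Omega>1 v u) (prod.swap z)" for z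
  proof -
    have T: "(\<lambda>w. \<theta> w * wave z w) \<in> test_functions (\<Omega>1 \<times> \<Omega>2)" by (rule test_functions_mult[OF \<theta> smooth_wave])
    have w: "wave z (prod.swap w) = wave (prod.swap z) w" for w
      by (cases z; cases w) (simp add: wave_Pair mult.commute)
    have "tensor_distribution \<Omega>1 \<Omega>2 u v (\<lambda>w. \<theta> w * wave z w) =
        tensor_distribution \<Omega>2 \<Omega>1 v u (\<lambda>w. \<theta> (prod.swap w) * wave z (prod.swap w))"
      unfolding tensor_distribution_iterated_pairing[OF T]
        tensor_distribution_iterated_pairing[OF swap_test_function[OF T]]
      by (rule iterated_pairing_swap[OF \<Omega> u v T])
    thus ?thesis by (simp add: localized_fourier_wave w)
  qed
  show ?thesis unfolding fourier_seminorm_def by (simp add: eq image_image norm_swap)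
qed

lemma fourier_seminorm_zero:
  assumes w: "w \<in> distributions \<Omega>"
  shows "fourier_seminorm N V (\<lambda>x. 0) w = 0"
proof -
  have "fourier_seminorm N V (\<lambda>x. 0) w \<le> ennreal 0"
    by (rule fourier_seminorm_le) (simp add: localized_fourier_wave linear_on_functions_zero[OF distributionsD(1)[OF w]])
  thus ?thesis by simp
qed

lemma fourier_seminorm_add:
  assumes w: "w \<in> distributions \<Omega>" and f: "f \<in> test_functions \<Omega>" and g: "g \<in> test_functions \<Omega>"
  shows "fourier_seminorm N V (\<lambda>x. f x + g x) w \<le> fourier_seminorm N V f w + fourier_seminorm N V g w"
  unfolding fourier_seminorm_def[of N V "\<lambda>x. f x + g x"]
proof (rule SUP_least)
  fix k assume k: "k \<in> V"
  have "localized_fourier (\<lambda>x. f x + g x) w k = localized_fourier f w k + localized_fourier g w k"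
    unfolding localized_fourier_wave distrib_right
    by (rule linear_on_functions_add[OF distributionsD(1)[OF w] test_functions_mult[OF f smooth_wave] test_functions_mult[OF g smooth_wave]])
  hence "ennreal ((1 + norm k) ^ N * cmod (localized_fourier (\<lambda>x. f x + g x) w k)) \<le>
      ennreal ((1 + norm k) ^ N * cmod (localized_fourier f w k) + (1 + norm k) ^ N * cmod (localized_fourier g w k))"
    by (intro ennreal_leI) (simp add: norm_triangle_ineq mult_left_mono flip: distrib_left)
  also have "\<dots> = ennreal ((1 + norm k) ^ N * cmod (localized_fourier f w k)) +
      ennreal ((1 + norm k) ^ N * cmod (localized_fourier g w k))"
    by (rule ennreal_plus) auto
  also have "\<dots> \<le> fourier_seminorm N V f w + fourier_seminorm N V g w"
    unfolding fourier_seminorm_def by (intro add_mono SUP_upper k)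
  finally show "ennreal ((1 + norm k) ^ N * cmod (localized_fourier (\<lambda>x. f x + g x) w k)) \<le>
    fourier_seminorm N V f w + fourier_seminorm N V g w" .
qed

text \<open>Where \<open>l\<close> dominates \<open>k\<close>, the decay of \<open>v\<close>
  suffices. \<open>r\<close> and \<open>U\<close> are found before \<open>\<theta>\<close>, since
  the compactness argument fixes the radii first and the localised cutoffs afterwards.\<close>

lemma hypo_small_local_right:
  fixes \<Omega>1 :: "'a::euclidean_space set" and \<Omega>2 :: "'b::euclidean_space set"
  assumes \<Omega>: "open \<Omega>1" "open \<Omega>2" and \<Gamma>2: "closed_cone_in \<Omega>2 \<Gamma>2"
    and y0: "y0 \<in> \<Omega>2" and \<eta>: "\<eta> \<noteq> 0" "(y0, \<eta>) \<notin> \<Gamma>2"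
  shows "\<exists>r>0. \<exists>U. open U \<and> positive_cone U \<and> (\<xi>, \<eta>) \<in> U \<and>
    (\<forall>N. \<forall>\<theta>\<in>test_functions (\<Omega>1 \<times> \<Omega>2). supp \<theta> \<subseteq> cball (x0, y0) r \<longrightarrow>
      hypo_small (normal_topology \<Omega>1 \<Gamma>1) (normal_topology \<Omega>2 \<Gamma>2)
        (\<lambda>u v. fourier_seminorm N U \<theta> (tensor_distribution \<Omega>1 \<Omega>2 u v)))"
proof -
  obtain r \<delta> \<psi> where mc: "microlocal_cutoff \<Omega>2 y0 \<eta> r \<delta> \<psi> (\<lambda>_. 1)"
    and adm: "fourier_admissible \<Omega>2 \<Gamma>2 (cone_nbhd \<eta> (2 * \<delta>)) \<psi>"
    by (rule microlocal_cutoff_admissible[OF \<Omega>(2) \<Gamma>2 y0 \<eta>])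
  interpret microlocal_cutoff \<Omega>2 y0 \<eta> r \<delta> \<psi> "\<lambda>_. 1" by (rule mc)
  note U = product_cone_props[OF \<eta>(1) \<delta>, where \<xi>=\<xi>]
  have "hypo_small (normal_topology \<Omega>1 \<Gamma>1) (normal_topology \<Omega>2 \<Gamma>2)
        (\<lambda>u v. fourier_seminorm N (product_cone \<xi> \<eta> \<delta>) \<theta> (tensor_distribution \<Omega>1 \<Omega>2 u v))"
    if \<theta>: "\<theta> \<in> test_functions (\<Omega>1 \<times> \<Omega>2)" and s: "supp \<theta> \<subseteq> cball (x0, y0) r" for \<theta> N
  proof (rule hypo_small_fourier_cone[OF \<Omega> mc adm \<theta> _ _ U(4)])
    show "snd ` supp \<theta> \<subseteq> cball y0 r"
    proof
      fix y assume "y \<in> snd ` supp \<theta>"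
      then obtain z where z: "z \<in> supp \<theta>" "y = snd z" by blast
      have "dist y0 y \<le> dist (x0, y0) z" using dist_snd_le[of "(x0, y0)" z] z(2) by simp
      thus "y \<in> cball y0 r" using z(1) s by auto
    qed
    show "0 \<le> norm \<xi> / norm \<eta> + 1" by simp
  qed
  thus ?thesis using r U(1-3) by blast
qed

text \<open>The mirror image: \<open>hypo_small\<close> is symmetric and
  \<open>fourier_seminorm_swap\<close> matches the seminorms.\<close>

lemma hypo_small_local_left:
  fixes \<Omega>1 :: "'a::euclidean_space set" and \<Omega>2 :: "'b::euclidean_space set"
  assumes \<Omega>: "open \<Omega>1" "open \<Omega>2" and \<Gamma>1: "closed_cone_in \<Omega>1 \<Gamma>1"
    and x0: "x0 \<in> \<Omega>1" and \<xi>: "\<xi> \<noteq> 0" "(x0, \<xi>) \<notin> \<Gamma>1"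
  shows "\<exists>r>0. \<exists>U. open U \<and> positive_cone U \<and> (\<xi>, \<eta>) \<in> U \<and>
    (\<forall>N. \<forall>\<theta>\<in>test_functions (\<Omega>1 \<times> \<Omega>2). supp \<theta> \<subseteq> cball (x0, y0) r \<longrightarrow>
      hypo_small (normal_topology \<Omega>1 \<Gamma>1) (normal_topology \<Omega>2 \<Gamma>2)
        (\<lambda>u v. fourier_seminorm N U \<theta> (tensor_distribution \<Omega>1 \<Omega>2 u v)))"
proof -
  obtain r U where r: "r > 0" and U: "open U" "positive_cone U" "(\<eta>, \<xi>) \<in> U"
    and H: "\<forall>N. \<forall>\<theta>\<in>test_functions (\<Omega>2 \<times> \<Omega>1). supp \<theta> \<subseteq> cball (y0, x0) r \<longrightarrow>
      hypo_small (normal_topology \<Omega>2 \<Gamma>2) (normal_topology \<Omega>1 \<Gamma>1)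
        (\<lambda>v u. fourier_seminorm N U \<theta> (tensor_distribution \<Omega>2 \<Omega>1 v u))"
    using hypo_small_local_right[OF \<Omega>(2,1) \<Gamma>1 x0 \<xi>, of \<eta> y0 \<Gamma>2] by (elim exE conjE)
  have "hypo_small (normal_topology \<Omega>1 \<Gamma>1) (normal_topology \<Omega>2 \<Gamma>2)
        (\<lambda>u v. fourier_seminorm N (prod.swap ` U) \<theta> (tensor_distribution \<Omega>1 \<Omega>2 u v))"
    if \<theta>: "\<theta> \<in> test_functions (\<Omega>1 \<times> \<Omega>2)" and s: "supp \<theta> \<subseteq> cball (x0, y0) r" for \<theta> N
  proof (rule hypo_small_mono[OF hypo_small_swap[OF H[rule_format, OF swap_test_function[OF \<theta>] supp_swap_cball[OF s]]]])
    fix u v assume "u \<in> topspace (normal_topology \<Omega>1 \<Gamma>1)" "v \<in> topspace (normal_topology \<Omega>2 \<Gamma>2)"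
    hence "u \<in> distributions \<Omega>1" "v \<in> distributions \<Omega>2" by (auto simp: distributions_WF_def)
    from fourier_seminorm_swap[OF \<Omega> this \<theta>, of N "prod.swap ` U"]
    show "fourier_seminorm N (prod.swap ` U) \<theta> (tensor_distribution \<Omega>1 \<Omega>2 u v) \<le>
        fourier_seminorm N U (\<lambda>z. \<theta> (prod.swap z)) (tensor_distribution \<Omega>2 \<Omega>1 v u)"
      by (simp add: swap_image_swap)
  qed
  moreover have "(\<xi>, \<eta>) \<in> prod.swap ` U" using U(3) by (simp add: mem_swap_image)
  ultimately show ?thesis using r open_swap_image[OF U(1)] positive_cone_swap_image[OF U(2)] by blast
qed

text \<open>\<open>partial_fourier_decay\<close> for one \<open>u\<close> and one \<open>v\<close>:
  the cutoff comes from the wave front set of \<open>v\<close>, and \<open>u\<close> enters through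
  its order on a compact set.\<close>

lemma wave_front_tensor_right:
  fixes \<Omega>1 :: "'a::euclidean_space set" and \<Omega>2 :: "'b::euclidean_space set"
  assumes \<Omega>: "open \<Omega>1" "open \<Omega>2" and u: "u \<in> distributions \<Omega>1" and v: "v \<in> distributions \<Omega>2"
    and x0: "x0 \<in> \<Omega>1" and y0: "y0 \<in> \<Omega>2" and \<eta>: "\<eta> \<noteq> 0" "(y0, \<eta>) \<notin> wave_front_set \<Omega>2 v"
  shows "((x0, y0), (\<xi>, \<eta>)) \<notin> wave_front_set (\<Omega>1 \<times> \<Omega>2) (tensor_distribution \<Omega>1 \<Omega>2 u v)"
proof -
  obtain r \<delta> \<psi> a0 where mc: "microlocal_cutoff \<Omega>2 y0 \<eta> r \<delta> \<psi> a0"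
    and dec: "\<forall>N. \<exists>S\<ge>0. localized_bound v N (cone_nbhd \<eta> (2 * \<delta>) - {0}) \<psi> S"
    by (rule microlocal_cutoff_wave_front_set[OF \<Omega>(2) y0 \<eta>])
  interpret microlocal_cutoff \<Omega>2 y0 \<eta> r \<delta> \<psi> a0 by (rule mc)
  \<comment> \<open>The second variable is confined to the ball around \<open>y0\<close> on which
    \<open>a0\<close> inverts \<open>\<psi>\<close>.\<close>
  have sub: "{(x0, y0)} \<subseteq> \<Omega>1 \<times> (\<Omega>2 \<inter> ball y0 r)" using x0 y0 r by simp
  have op: "open (\<Omega>1 \<times> (\<Omega>2 \<inter> ball y0 r))" using \<Omega> by (intro open_Times open_Int open_ball)
  obtain \<theta> where \<theta>: "\<theta> \<in> test_functions (\<Omega>1 \<times> (\<Omega>2 \<inter> ball y0 r))" "\<forall>z\<in>{(x0, y0)}. \<theta> z = 1"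
    by (rule cutoff_exists[OF _ sub op]) simp
  obtain K1 K2 where K: "compact K1" "K1 \<subseteq> \<Omega>1" "compact K2" "K2 \<subseteq> \<Omega>2 \<inter> ball y0 r" "supp \<theta> \<subseteq> K1 \<times> K2"
    by (rule test_functions_prod_supp[OF \<theta>(1)])
  have \<theta>T: "\<theta> \<in> test_functions (\<Omega>1 \<times> \<Omega>2)" using \<theta>(1) unfolding test_functions_def by blast
  have K2: "K2 \<subseteq> \<Omega>2" "K2 \<subseteq> cball y0 r" using K(4) by auto
  note U = product_cone_props[OF \<eta>(1) \<delta>, where \<xi>=\<xi>]
  let ?U = "product_cone \<xi> \<eta> \<delta>" and ?c = "norm \<xi> / norm \<eta> + 1"
  have c: "?c \<ge> 0" by simp
  obtain n C1 where C1: "C1 \<ge> 0" "order_bound K1 n C1 u" by (rule distribution_order_bound[OF u K(1,2)])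
  have "fourier_seminorm N ?U \<theta> (tensor_distribution \<Omega>1 \<Omega>2 u v) < \<infinity>" for N
  proof -
    obtain C B where CB: "C \<ge> 0" "test_bounded \<Omega>2 B"
      "\<forall>v\<in>distributions \<Omega>2. \<forall>S\<ge>0. \<forall>P\<ge>0. localized_bound v (n + N) (cone_nbhd \<eta> (2 * \<delta>) - {0}) \<psi> S \<longrightarrow>
        test_bound v B P \<longrightarrow> (\<forall>l\<in>cone_nbhd \<eta> \<delta>. \<forall>k. norm k \<le> ?c * norm l \<longrightarrow>
        derivs_bounded UNIV n (C * (S + P)) (partial_fourier N \<theta> v k l))"
      by (rule partial_fourier_decay[OF test_functionsD(1)[OF \<theta>T] K(5) K(1,3) K2 c])
    obtain S where S: "S \<ge> 0" "localized_bound v (n + N) (cone_nbhd \<eta> (2 * \<delta>) - {0}) \<psi> S" using dec by blast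
    obtain P where P: "\<forall>\<phi>\<in>B. cmod (v \<phi>) \<le> P" using distribution_bounded[OF v CB(2)] by blast
    have tb: "test_bound v B (max 0 P)" using P unfolding test_bound_def by (auto simp: le_max_iff_disj)
    have "fourier_seminorm N ?U \<theta> (tensor_distribution \<Omega>1 \<Omega>2 u v) \<le> ennreal (C1 * (C * (S + max 0 P)))"
    proof (rule fourier_seminorm_le)
      fix z assume z: "z \<in> ?U"
      obtain k l where kl: "z = (k, l)" by (cases z)
      have kl': "l \<in> cone_nbhd \<eta> \<delta>" "norm k \<le> ?c * norm l" using U(4) z kl by auto
      have "cmod (u (partial_fourier N \<theta> v k l)) \<le> C1 * (C * (S + max 0 P))"
        by (rule order_boundD[OF C1(2) test_functionsD(1)[OF partial_fourier_test_function[OF v \<theta>T]]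
            supp_partial_fourier[OF v K(5) compact_imp_closed[OF K(1)]]
            CB(3)[rule_format, OF v S(1) max.cobounded1 S(2) tb kl']])
      thus "(1 + norm z) ^ N * cmod (localized_fourier \<theta> (tensor_distribution \<Omega>1 \<Omega>2 u v) z) \<le> C1 * (C * (S + max 0 P))"
        unfolding kl localized_fourier_tensor[OF u v \<theta>T] .
    qed
    thus ?thesis by (rule le_less_trans) simp
  qed
  hence "\<forall>N. fourier_seminorm N ?U \<theta> (tensor_distribution \<Omega>1 \<Omega>2 u v) < \<infinity>" ..
  moreover have "\<theta> (x0, y0) \<noteq> 0" using \<theta>(2) by simp
  ultimately show ?thesis using \<theta>T U(1-3) unfolding wave_front_set_def by blast
qed

lemma wave_front_tensor_left:
  fixes \<Omega>1 :: "'a::euclidean_space set" and \<Omega>2 :: "'b::euclidean_space set"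
  assumes \<Omega>: "open \<Omega>1" "open \<Omega>2" and u: "u \<in> distributions \<Omega>1" and v: "v \<in> distributions \<Omega>2"
    and x0: "x0 \<in> \<Omega>1" and y0: "y0 \<in> \<Omega>2" and \<xi>: "\<xi> \<noteq> 0" "(x0, \<xi>) \<notin> wave_front_set \<Omega>1 u"
  shows "((x0, y0), (\<xi>, \<eta>)) \<notin> wave_front_set (\<Omega>1 \<times> \<Omega>2) (tensor_distribution \<Omega>1 \<Omega>2 u v)"
proof -
  have "((y0, x0), (\<eta>, \<xi>)) \<in> punctured_cotangent (\<Omega>2 \<times> \<Omega>1)"
    using x0 y0 \<xi>(1) by (simp add: punctured_cotangent_def zero_prod_def)
  with wave_front_tensor_right[OF \<Omega>(2,1) v u y0 x0 \<xi>, of \<eta>]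
  obtain \<theta> V where \<theta>: "\<theta> \<in> test_functions (\<Omega>2 \<times> \<Omega>1)" "\<theta> (y0, x0) \<noteq> 0"
    and V: "open V" "positive_cone V" "(\<eta>, \<xi>) \<in> V"
      "\<forall>N. fourier_seminorm N V \<theta> (tensor_distribution \<Omega>2 \<Omega>1 v u) < \<infinity>"
    unfolding wave_front_set_def by blast
  have "(\<xi>, \<eta>) \<in> prod.swap ` V" using V(3) by (simp add: mem_swap_image)
  moreover have "\<theta> (prod.swap (x0, y0)) \<noteq> 0" using \<theta>(2) by simp
  moreover have "\<forall>N. fourier_seminorm N (prod.swap ` V) (\<lambda>z. \<theta> (prod.swap z)) (tensor_distribution \<Omega>1 \<Omega>2 u v) < \<infinity>"
    using V(4) unfolding fourier_seminorm_swap[OF \<Omega>(2,1) v u \<theta>(1)] .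
  ultimately have "\<exists>\<theta>\<in>test_functions (\<Omega>1 \<times> \<Omega>2). \<theta> (x0, y0) \<noteq> 0 \<and> (\<exists>V. open V \<and> positive_cone V \<and> (\<xi>, \<eta>) \<in> V \<and>
      (\<forall>N. fourier_seminorm N V \<theta> (tensor_distribution \<Omega>1 \<Omega>2 u v) < \<infinity>))"
    using open_swap_image[OF V(1)] positive_cone_swap_image[OF V(2)]
    by (intro bexI[of _ "\<lambda>z. \<theta> (prod.swap z)"] conjI exI[of _ "prod.swap ` V"] swap_test_function[OF \<theta>(1)])
  thus ?thesis unfolding wave_front_set_def by blast
qed

lemma mem_cotangent_product: "((x, y), (\<xi>, \<eta>)) \<in> cotangent_product A B \<longleftrightarrow> (x, \<xi>) \<in> A \<and> (y, \<eta>) \<in> B"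
  unfolding cotangent_product_def by force

definition tensor_cone ::
    "'a::euclidean_space set \<Rightarrow> 'b::euclidean_space set \<Rightarrow> ('a \<times> 'a) set \<Rightarrow> ('b \<times> 'b) set \<Rightarrow>
     (('a \<times> 'b) \<times> ('a \<times> 'b)) set" where
  "tensor_cone \<Omega>1 \<Omega>2 \<Gamma>1 \<Gamma>2 = cotangent_product \<Gamma>1 \<Gamma>2 \<union> cotangent_product (\<Omega>1 \<times> {0}) \<Gamma>2
     \<union> cotangent_product \<Gamma>1 (\<Omega>2 \<times> {0})"

text \<open>If both alternatives failed, each of \<open>\<xi>\<close> and \<open>\<eta>\<close>
  would be 0 or belong to its cone; as they are not both 0, the point would lie in one of the three
  pieces.\<close>

lemma not_in_tensor_cone:
  assumes "((x, y), (\<xi>, \<eta>)) \<notin> tensor_cone \<Omega>1 \<Omega>2 \<Gamma>1 \<Gamma>2" "x \<in> \<Omega>1" "y \<in> \<Omega>2" "(\<xi>, \<eta>) \<noteq> 0"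
  shows "(\<eta> \<noteq> 0 \<and> (y, \<eta>) \<notin> \<Gamma>2) \<or> (\<xi> \<noteq> 0 \<and> (x, \<xi>) \<notin> \<Gamma>1)"
  using assms by (auto simp: tensor_cone_def mem_cotangent_product zero_prod_def)

lemma tensor_distribution_WF:
  fixes \<Omega>1 :: "'a::euclidean_space set" and \<Omega>2 :: "'b::euclidean_space set"
  assumes \<Omega>: "open \<Omega>1" "open \<Omega>2" and u: "u \<in> distributions_WF \<Omega>1 \<Gamma>1" and v: "v \<in> distributions_WF \<Omega>2 \<Gamma>2"
  shows "tensor_distribution \<Omega>1 \<Omega>2 u v \<in> distributions_WF (\<Omega>1 \<times> \<Omega>2) (tensor_cone \<Omega>1 \<Omega>2 \<Gamma>1 \<Gamma>2)"
proof -
  have u': "u \<in> distributions \<Omega>1" "wave_front_set \<Omega>1 u \<subseteq> \<Gamma>1"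
    and v': "v \<in> distributions \<Omega>2" "wave_front_set \<Omega>2 v \<subseteq> \<Gamma>2"
    using u v by (auto simp: distributions_WF_def)
  have "z \<in> tensor_cone \<Omega>1 \<Omega>2 \<Gamma>1 \<Gamma>2"
    if z: "z \<in> wave_front_set (\<Omega>1 \<times> \<Omega>2) (tensor_distribution \<Omega>1 \<Omega>2 u v)" for z
  proof (rule ccontr)
    assume n: "z \<notin> tensor_cone \<Omega>1 \<Omega>2 \<Gamma>1 \<Gamma>2"
    obtain x y \<xi> \<eta> where e: "z = ((x, y), (\<xi>, \<eta>))" by (metis surj_pair)
    have xy: "x \<in> \<Omega>1" "y \<in> \<Omega>2" "(\<xi>, \<eta>) \<noteq> 0"
      using z unfolding e wave_front_set_def punctured_cotangent_def by auto
    from not_in_tensor_cone[OF n[unfolded e] xy] show False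
      using wave_front_tensor_right[OF \<Omega> u'(1) v'(1) xy(1,2), of \<eta> \<xi>]
        wave_front_tensor_left[OF \<Omega> u'(1) v'(1) xy(1,2), of \<xi> \<eta>] u'(2) v'(2) z unfolding e by blast
  qed
  thus ?thesis using tensor_distribution_in_distributions[OF u'(1) v'(1)] by (auto simp: distributions_WF_def)
qed

text \<open>Cones that cover the unit vectors of \<open>V\<close> cover all of \<open>V\<close>
  except possibly 0, which gets a seminorm of its own.\<close>

lemma fourier_seminorm_cover:
  assumes fin: "finite I" and U: "\<And>\<zeta>. \<zeta> \<in> I \<Longrightarrow> positive_cone (U \<zeta>)"
    and V: "positive_cone V" "V \<inter> sphere 0 1 \<subseteq> (\<Union>\<zeta>\<in>I. U \<zeta>)"
  shows "fourier_seminorm N V f w \<le> fourier_seminorm N {0} f w + (\<Sum>\<zeta>\<in>I. fourier_seminorm N (U \<zeta>) f w)"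
  unfolding fourier_seminorm_def[of N V]
proof (rule SUP_least)
  fix k assume k: "k \<in> V"
  let ?t = "ennreal ((1 + norm k) ^ N * cmod (localized_fourier f w k))"
  show "?t \<le> fourier_seminorm N {0} f w + (\<Sum>\<zeta>\<in>I. fourier_seminorm N (U \<zeta>) f w)"
  proof (cases "k = 0")
    case True
    hence "?t \<le> fourier_seminorm N {0} f w" unfolding fourier_seminorm_def by (intro SUP_upper) simp
    also have "\<dots> \<le> fourier_seminorm N {0} f w + (\<Sum>\<zeta>\<in>I. fourier_seminorm N (U \<zeta>) f w)" by simp
    finally show ?thesis .
  next
    case False
    have "(1 / norm k) *\<^sub>R k \<in> V" using V(1) k False unfolding positive_cone_def by simp
    moreover have "(1 / norm k) *\<^sub>R k \<in> sphere 0 1" using False by simp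
    ultimately obtain \<zeta> where \<zeta>: "\<zeta> \<in> I" "(1 / norm k) *\<^sub>R k \<in> U \<zeta>" using V(2) by blast
    have "norm k *\<^sub>R ((1 / norm k) *\<^sub>R k) \<in> U \<zeta>"
      using U[OF \<zeta>(1)] \<zeta>(2) False unfolding positive_cone_def by (metis zero_less_norm_iff)
    hence "k \<in> U \<zeta>" using False by simp
    hence "?t \<le> fourier_seminorm N (U \<zeta>) f w" unfolding fourier_seminorm_def by (rule SUP_upper)
    also have "\<dots> \<le> (\<Sum>\<zeta>\<in>I. fourier_seminorm N (U \<zeta>) f w)" using \<zeta>(1) fin by (intro member_le_sum) auto
    also have "\<dots> \<le> fourier_seminorm N {0} f w + (\<Sum>\<zeta>\<in>I. fourier_seminorm N (U \<zeta>) f w)" by simp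
    finally show ?thesis .
  qed
qed

lemma hypo_small_fourier:
  fixes \<Omega>1 :: "'a::euclidean_space set" and \<Omega>2 :: "'b::euclidean_space set"
  assumes \<Omega>: "open \<Omega>1" "open \<Omega>2" and \<Gamma>: "closed_cone_in \<Omega>1 \<Gamma>1" "closed_cone_in \<Omega>2 \<Gamma>2"
    and adm: "fourier_admissible (\<Omega>1 \<times> \<Omega>2) (tensor_cone \<Omega>1 \<Omega>2 \<Gamma>1 \<Gamma>2) V \<theta>"
  shows "hypo_small (normal_topology \<Omega>1 \<Gamma>1) (normal_topology \<Omega>2 \<Gamma>2)
    (\<lambda>u v. fourier_seminorm N V \<theta> (tensor_distribution \<Omega>1 \<Omega>2 u v))"
proof -
  let ?E = "normal_topology \<Omega>1 \<Gamma>1" and ?F = "normal_topology \<Omega>2 \<Gamma>2" and ?T = "tensor_distribution \<Omega>1 \<Omega>2"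
  have \<theta>: "\<theta> \<in> test_functions (\<Omega>1 \<times> \<Omega>2)" and V: "closed V" "positive_cone V"
    and dj: "(supp \<theta> \<times> V) \<inter> tensor_cone \<Omega>1 \<Omega>2 \<Gamma>1 \<Gamma>2 = {}"
    using adm unfolding fourier_admissible_def by auto
  have z: "(\<lambda>s. 0) \<in> topspace ?E" "(\<lambda>s. 0) \<in> topspace ?F"
    using zero_in_distributions_WF \<Omega> by auto
  have T: "?T u v \<in> distributions (\<Omega>1 \<times> \<Omega>2)" if "u \<in> topspace ?E" "v \<in> topspace ?F" for u v
    using that by (intro tensor_distribution_in_distributions) (auto simp: distributions_WF_def)
  show ?thesis
  proof (rule test_function_localize[where P="\<lambda>f. hypo_small ?E ?F (\<lambda>u v. fourier_seminorm N V f (?T u v))", OF \<theta>])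
    show "hypo_small ?E ?F (\<lambda>u v. fourier_seminorm N V (\<lambda>x. 0) (?T u v))"
      by (rule hypo_small_mono[OF hypo_small_zero[OF z]]) (use fourier_seminorm_zero T in force)
  next
    fix f g assume f: "f \<in> test_functions (\<Omega>1 \<times> \<Omega>2)" and g: "g \<in> test_functions (\<Omega>1 \<times> \<Omega>2)"
      and P: "hypo_small ?E ?F (\<lambda>u v. fourier_seminorm N V f (?T u v))"
        "hypo_small ?E ?F (\<lambda>u v. fourier_seminorm N V g (?T u v))"
    show "hypo_small ?E ?F (\<lambda>u v. fourier_seminorm N V (\<lambda>x. f x + g x) (?T u v))"
      by (rule hypo_small_mono[OF hypo_small_add[OF P]]) (rule fourier_seminorm_add[OF T f g])
  next
    fix a assume a: "a \<in> supp \<theta>"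
    obtain x0 y0 where a0: "a = (x0, y0)" by (cases a)
    have xy: "x0 \<in> \<Omega>1" "y0 \<in> \<Omega>2" using test_functionsD(3)[OF \<theta>] a a0 by auto
    \<comment> \<open>Radius and cone depend on the direction; compactness leaves finitely many
      directions and thus a positive smallest radius.\<close>
    have "\<forall>\<zeta>\<in>V \<inter> sphere 0 1. \<exists>r U. r > 0 \<and> open U \<and> positive_cone U \<and> \<zeta> \<in> U \<and>
      (\<forall>N. \<forall>f\<in>test_functions (\<Omega>1 \<times> \<Omega>2). supp f \<subseteq> cball a r \<longrightarrow>
        hypo_small ?E ?F (\<lambda>u v. fourier_seminorm N U f (?T u v)))"
    proof
      fix \<zeta> assume \<zeta>: "\<zeta> \<in> V \<inter> sphere 0 1"
      obtain \<xi> \<eta> where e: "\<zeta> = (\<xi>, \<eta>)" by (cases \<zeta>)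
      have nz: "(\<xi>, \<eta>) \<noteq> 0" using \<zeta> unfolding e[symmetric] by auto
      have "((x0, y0), (\<xi>, \<eta>)) \<notin> tensor_cone \<Omega>1 \<Omega>2 \<Gamma>1 \<Gamma>2" using dj a \<zeta> unfolding a0 e by blast
      from not_in_tensor_cone[OF this xy nz]
      have "\<exists>r>0. \<exists>U. open U \<and> positive_cone U \<and> (\<xi>, \<eta>) \<in> U \<and>
        (\<forall>N. \<forall>f\<in>test_functions (\<Omega>1 \<times> \<Omega>2). supp f \<subseteq> cball (x0, y0) r \<longrightarrow>
          hypo_small ?E ?F (\<lambda>u v. fourier_seminorm N U f (?T u v)))"
      proof
        assume "\<eta> \<noteq> 0 \<and> (y0, \<eta>) \<notin> \<Gamma>2"
        thus ?thesis by (elim conjE) (rule hypo_small_local_right[OF \<Omega> \<Gamma>(2) xy(2)])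
      next
        assume "\<xi> \<noteq> 0 \<and> (x0, \<xi>) \<notin> \<Gamma>1"
        thus ?thesis by (elim conjE) (rule hypo_small_local_left[OF \<Omega> \<Gamma>(1) xy(1)])
      qed
      thus "\<exists>r U. r > 0 \<and> open U \<and> positive_cone U \<and> \<zeta> \<in> U \<and>
        (\<forall>N. \<forall>f\<in>test_functions (\<Omega>1 \<times> \<Omega>2). supp f \<subseteq> cball a r \<longrightarrow>
          hypo_small ?E ?F (\<lambda>u v. fourier_seminorm N U f (?T u v)))" unfolding a0 e by simp
    qed
    from bchoice[OF this] obtain r where "\<forall>\<zeta>\<in>V \<inter> sphere 0 1. \<exists>U. r \<zeta> > 0 \<and> open U \<and> positive_cone U \<and> \<zeta> \<in> U \<and>
      (\<forall>N. \<forall>f\<in>test_functions (\<Omega>1 \<times> \<Omega>2). supp f \<subseteq> cball a (r \<zeta>) \<longrightarrow>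
        hypo_small ?E ?F (\<lambda>u v. fourier_seminorm N U f (?T u v)))" by (elim exE)
    from bchoice[OF this] obtain U where rU: "\<forall>\<zeta>\<in>V \<inter> sphere 0 1. r \<zeta> > 0 \<and> open (U \<zeta>) \<and> positive_cone (U \<zeta>) \<and> \<zeta> \<in> U \<zeta> \<and>
      (\<forall>N. \<forall>f\<in>test_functions (\<Omega>1 \<times> \<Omega>2). supp f \<subseteq> cball a (r \<zeta>) \<longrightarrow>
        hypo_small ?E ?F (\<lambda>u v. fourier_seminorm N (U \<zeta>) f (?T u v)))" by (elim exE)
    have "compact (V \<inter> sphere 0 1)" using V(1) by (simp add: closed_Int_compact)
    moreover have "\<And>\<zeta>. \<zeta> \<in> V \<inter> sphere 0 1 \<Longrightarrow> open (U \<zeta>)" using rU by blast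
    moreover have "V \<inter> sphere 0 1 \<subseteq> (\<Union>\<zeta>\<in>V \<inter> sphere 0 1. U \<zeta>)" using rU by blast
    ultimately obtain I where I: "I \<subseteq> V \<inter> sphere 0 1" "finite I" "V \<inter> sphere 0 1 \<subseteq> (\<Union>\<zeta>\<in>I. U \<zeta>)"
      by (rule compactE_image)
    \<comment> \<open>The element 1 takes care of an empty \<open>I\<close>.\<close>
    define s where "s = Min (insert 1 (r ` I))"
    have rI: "r \<zeta> > 0" "positive_cone (U \<zeta>)" if "\<zeta> \<in> I" for \<zeta> using rU I(1) that by blast+
    have s: "s > 0" unfolding s_def using I(2) rI by (subst Min_gr_iff) auto
    have sr: "s \<le> r \<zeta>" if "\<zeta> \<in> I" for \<zeta> unfolding s_def using I(2) that by (intro Min_le) auto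
    show "\<exists>r>0. \<forall>f\<in>test_functions (\<Omega>1 \<times> \<Omega>2). supp f \<subseteq> supp \<theta> \<longrightarrow> supp f \<subseteq> cball a r \<longrightarrow>
      hypo_small ?E ?F (\<lambda>u v. fourier_seminorm N V f (?T u v))"
    proof (intro exI[of _ s] conjI s ballI impI)
      fix f assume f: "f \<in> test_functions (\<Omega>1 \<times> \<Omega>2)" and sf: "supp f \<subseteq> cball a s"
      \<comment> \<open>At the single frequency 0 the Fourier seminorm is the pairing with
        \<open>f\<close>, that is, the seminorm of the bounded set \<open>{f}\<close>.\<close>
      have 0: "fourier_seminorm N {0} f w = (SUP \<phi>\<in>{f}. ennreal (cmod (w \<phi>)))" for w
        by (simp add: fourier_seminorm_def localized_fourier_def)
      have tb: "test_bounded (\<Omega>1 \<times> \<Omega>2) {f}"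
        unfolding test_bounded_def
      proof (intro conjI exI[of _ "supp f"] allI)
        show "\<exists>C. \<forall>\<phi>\<in>{f}. derivs_bounded UNIV n C \<phi>" for n
          using derivs_bounded_test_function[OF f, of n] by blast
      qed (use test_functionsD[OF f] in auto)
      have h: "hypo_small ?E ?F (\<lambda>u v. fourier_seminorm N {0} f (?T u v) + (\<Sum>\<zeta>\<in>I. fourier_seminorm N (U \<zeta>) f (?T u v)))"
      proof (intro hypo_small_add hypo_small_sum I(2) z)
        show "hypo_small ?E ?F (\<lambda>u v. fourier_seminorm N {0} f (?T u v))"
          unfolding 0 by (rule hypo_small_test[OF \<Omega> tb])
        fix \<zeta> assume \<zeta>: "\<zeta> \<in> I"
        have "supp f \<subseteq> cball a (r \<zeta>)" using sf sr[OF \<zeta>] by auto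
        thus "hypo_small ?E ?F (\<lambda>u v. fourier_seminorm N (U \<zeta>) f (?T u v))"
          using bspec[OF rU subsetD[OF I(1) \<zeta>]] f by blast
      qed
      show "hypo_small ?E ?F (\<lambda>u v. fourier_seminorm N V f (?T u v))"
        by (rule hypo_small_mono[OF h]) (rule fourier_seminorm_cover[OF I(2) rI(2) V(2) I(3)])
    qed
  qed
qed

text \<open>In \<open>u\<close> linearity is pointwise. In \<open>v\<close> it rests on linearity of
  \<open>u\<close> and on the partial pairings being test functions.\<close>

lemma bilinear_tensor_distribution:
  fixes \<Omega>1 :: "'a::euclidean_space set" and \<Omega>2 :: "'b::euclidean_space set"
  assumes \<Omega>: "open \<Omega>1" "open \<Omega>2"
  shows "bilinear_on (distributions_WF \<Omega>1 \<Gamma>1) (distributions_WF \<Omega>2 \<Gamma>2)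
    (distributions_WF (\<Omega>1 \<times> \<Omega>2) (tensor_cone \<Omega>1 \<Omega>2 \<Gamma>1 \<Gamma>2)) (tensor_distribution \<Omega>1 \<Omega>2)"
  unfolding bilinear_on_def
proof (intro conjI ballI allI ext tensor_distribution_WF[OF \<Omega>])
  fix u v v' a b \<phi>
  assume u: "u \<in> distributions_WF \<Omega>1 \<Gamma>1" and v: "v \<in> distributions_WF \<Omega>2 \<Gamma>2" and v': "v' \<in> distributions_WF \<Omega>2 \<Gamma>2"
  show "tensor_distribution \<Omega>1 \<Omega>2 u (\<lambda>t. a * v t + b * v' t) \<phi> =
    a * tensor_distribution \<Omega>1 \<Omega>2 u v \<phi> + b * tensor_distribution \<Omega>1 \<Omega>2 u v' \<phi>"
  proof (cases "\<phi> \<in> test_functions (\<Omega>1 \<times> \<Omega>2)")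
    case True
    have "linear_on_functions (test_functions \<Omega>1) u"
      using u by (intro distributionsD(1)) (simp add: distributions_WF_def)
    moreover have "(\<lambda>x. v (\<lambda>y. \<phi> (x, y))) \<in> test_functions \<Omega>1" "(\<lambda>x. v' (\<lambda>y. \<phi> (x, y))) \<in> test_functions \<Omega>1"
      using v v' by (auto simp: distributions_WF_def intro: slice_pairing_test_function[OF _ True])
    ultimately have "u (\<lambda>x. a * v (\<lambda>y. \<phi> (x, y)) + b * v' (\<lambda>y. \<phi> (x, y))) =
        a * u (\<lambda>x. v (\<lambda>y. \<phi> (x, y))) + b * u (\<lambda>x. v' (\<lambda>y. \<phi> (x, y)))"
      unfolding linear_on_functions_def by (elim ballE allE) (assumption | erule notE)+
    thus ?thesis using True by (simp add: tensor_distribution_def)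
  qed (simp add: tensor_distribution_def)
qed (simp_all add: tensor_distribution_def)

theorem theorem4p6:
  fixes \<Omega>1 :: "'a::euclidean_space set" and \<Omega>2 :: "'b::euclidean_space set"
    and \<Gamma>1 :: "('a \<times> 'a) set" and \<Gamma>2 :: "('b \<times> 'b) set"
    and \<Gamma> :: "(('a \<times> 'b) \<times> ('a \<times> 'b)) set"
  assumes "open \<Omega>1" and "open \<Omega>2"
    and "closed_cone_in \<Omega>1 \<Gamma>1" and "closed_cone_in \<Omega>2 \<Gamma>2"
    and "\<Gamma> = cotangent_product \<Gamma>1 \<Gamma>2 \<union> cotangent_product (\<Omega>1 \<times> {0}) \<Gamma>2
             \<union> cotangent_product \<Gamma>1 (\<Omega>2 \<times> {0})"
  shows "hypocontinuous (normal_topology \<Omega>1 \<Gamma>1) (normal_topology \<Omega>2 \<Gamma>2)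
           (normal_topology (\<Omega>1 \<times> \<Omega>2) \<Gamma>) (tensor_distribution \<Omega>1 \<Omega>2)"
proof -
  let ?E = "normal_topology \<Omega>1 \<Gamma>1" and ?F = "normal_topology \<Omega>2 \<Gamma>2" and ?T = "tensor_distribution \<Omega>1 \<Omega>2"
  have \<Gamma>: "\<Gamma> = tensor_cone \<Omega>1 \<Omega>2 \<Gamma>1 \<Gamma>2" using assms(5) by (simp add: tensor_cone_def)
  note \<Omega> = assms(1,2)
  have small: "hypo_small ?E ?F (\<lambda>u v. p (?T u v))" if "p \<in> normal_seminorms (\<Omega>1 \<times> \<Omega>2) \<Gamma>" for p
    using that unfolding normal_seminorms_def
  proof (elim UnE CollectE exE conjE)
    fix B assume p: "p = (\<lambda>u. SUP \<phi>\<in>B. ennreal (cmod (u \<phi>)))" and B: "tvs_bounded (test_topology (\<Omega>1 \<times> \<Omega>2)) B"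
    show ?thesis unfolding p
      by (rule hypo_small_test[OF \<Omega> tvs_bounded_test_bounded[OF open_Times[OF \<Omega>] B]])
  next
    fix N V \<theta> assume p: "p = fourier_seminorm N V \<theta>" and adm: "fourier_admissible (\<Omega>1 \<times> \<Omega>2) \<Gamma> V \<theta>"
    show ?thesis unfolding p by (rule hypo_small_fourier[OF \<Omega> assms(3,4) adm[unfolded \<Gamma>]])
  qed
  have z: "(\<lambda>s. 0) \<in> topspace ?E" "(\<lambda>s. 0) \<in> topspace ?F"
    using zero_in_distributions_WF \<Omega> by auto
  have TW: "?T u v \<in> distributions_WF (\<Omega>1 \<times> \<Omega>2) \<Gamma>" if "u \<in> topspace ?E" "v \<in> topspace ?F" for u v
    unfolding \<Gamma> using that by (intro tensor_distribution_WF[OF \<Omega>]) auto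
  have main: "(\<forall>A. tvs_bounded ?E A \<longrightarrow> (\<exists>V. zero_neighborhood ?F V \<and> (\<forall>u\<in>A. \<forall>v\<in>V. ?T u v \<in> W))) \<and>
      (\<forall>B. tvs_bounded ?F B \<longrightarrow> (\<exists>U. zero_neighborhood ?E U \<and> (\<forall>u\<in>U. \<forall>v\<in>B. ?T u v \<in> W)))"
    if W: "zero_neighborhood (normal_topology (\<Omega>1 \<times> \<Omega>2) \<Gamma>) W" for W
  proof -
    obtain F \<epsilon> where F: "finite F" "F \<subseteq> normal_seminorms (\<Omega>1 \<times> \<Omega>2) \<Gamma>" "0 < \<epsilon>"
      "{g \<in> distributions_WF (\<Omega>1 \<times> \<Omega>2) \<Gamma>. \<forall>p\<in>F. p g < ennreal \<epsilon>} \<subseteq> W"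
      by (rule zero_neighborhood_seminormsD[OF W[unfolded normal_topology_alt]])
    \<comment> \<open>Adding the finitely many seminorms behind \<open>W\<close> reduces both
      conditions to one scalar quantity.\<close>
    have h: "hypo_small ?E ?F (\<lambda>u v. \<Sum>p\<in>F. p (?T u v))"
      using F(2) small by (intro hypo_small_sum F(1) z) blast
    \<comment> \<open>\<open>hypo_small\<close> yields \<open>\<le>\<close>, whereas the basic
      neighbourhood inside \<open>W\<close> asks for \<open><\<close>.\<close>
    have e: "\<epsilon> / 2 > 0" "ennreal (\<epsilon> / 2) < ennreal \<epsilon>" using F(3) by (simp_all add: ennreal_lessI)
    have mem: "?T u v \<in> W"
      if "u \<in> topspace ?E" "v \<in> topspace ?F" "(\<Sum>p\<in>F. p (?T u v)) \<le> ennreal (\<epsilon> / 2)" for u v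
    proof -
      have "p (?T u v) < ennreal \<epsilon>" if p: "p \<in> F" for p
      proof -
        have "p (?T u v) \<le> (\<Sum>p\<in>F. p (?T u v))" using F(1) p by (intro member_le_sum) auto
        also note \<open>(\<Sum>p\<in>F. p (?T u v)) \<le> ennreal (\<epsilon> / 2)\<close>
        also note e(2)
        finally show ?thesis .
      qed
      thus ?thesis using F(4) TW[OF that(1,2)] by blast
    qed
    show ?thesis
    proof (intro conjI allI impI)
      fix A assume A: "tvs_bounded ?E A"
      obtain V where V: "zero_neighborhood ?F V" "\<forall>u\<in>A. \<forall>v\<in>V. (\<Sum>p\<in>F. p (?T u v)) \<le> ennreal (\<epsilon> / 2)"
        using hypo_smallD(1)[OF h e(1) A] by blast
      have "?T u v \<in> W" if "u \<in> A" "v \<in> V" for u v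
        using that V(2) tvs_bounded_subset_topspace[OF A] zero_neighborhood_subset_topspace[OF V(1)]
        by (intro mem) auto
      thus "\<exists>V. zero_neighborhood ?F V \<and> (\<forall>u\<in>A. \<forall>v\<in>V. ?T u v \<in> W)" using V(1) by blast
    next
      fix B assume B: "tvs_bounded ?F B"
      obtain U where U: "zero_neighborhood ?E U" "\<forall>u\<in>U. \<forall>v\<in>B. (\<Sum>p\<in>F. p (?T u v)) \<le> ennreal (\<epsilon> / 2)"
        using hypo_smallD(2)[OF h e(1) B] by blast
      have "?T u v \<in> W" if "u \<in> U" "v \<in> B" for u v
        using that U(2) tvs_bounded_subset_topspace[OF B] zero_neighborhood_subset_topspace[OF U(1)]
        by (intro mem) auto
      thus "\<exists>U. zero_neighborhood ?E U \<and> (\<forall>u\<in>U. \<forall>v\<in>B. ?T u v \<in> W)" using U(1) by blast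
    qed
  qed
  show ?thesis
    unfolding hypocontinuous_def topspace_normal_topology
    using bilinear_tensor_distribution[OF \<Omega>, of \<Gamma>1 \<Gamma>2] main unfolding \<Gamma> by blast
qed

end
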